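(* Let $(u_\varepsilon,v_\varepsilon)$ be a family of critical points of the functionals $\mathcal{F}_\varepsilon$ with boundary values $a_\varepsilon\to a>0$ as $\varepsilon\to0$, and such that $\sup_\varepsilon\mathcal{F}_\varepsilon(u_\varepsilon,v_\varepsilon)<+\infty$. Then there exists a subsequence $\varepsilon_k\to0$ such that $(u_{\varepsilon_k},v_{\varepsilon_k})\to(u,1)$ in $(L^1(0,L))^2$, for some $u\in \mathrm{SBV}(0,L)$ such that $|Du|(0,L)=a$. Moreover, letting $m_0:=\lim_{k\to\infty}\min_{[0,L]}v_{\varepsilon_k}$, the following hold: (i) If $m_0=1$, then $u(x)=\frac{a}{L}x$. (ii) If $m_0\in(0,1)$, then $u(x)=c_0x+(a-c_0L)\chi_{(\frac L2,L)}(x)$ with $c_0=\frac12 f(m_0)(1-m_0)\in(0,\frac{\sigma_{\mathrm c}}{2})$, $a-c_0L=[u](\frac L2)\in(0,s_{\mathrm{frac}})$, and $g'([u](\frac L2))=2c_0$. (iii) If $m_0=0$, then $s_{\mathrm{frac}}\in\mathbb{R}$ and $u(x)=a\chi_{(\frac L2,L)}(x)$ with $a=[u](\frac L2)=s_{\mathrm{frac}}$. Finally, if $m_0<1$, or if $m_0=1$ and $\frac aL\leq\frac{\sigma_{\mathrm c}}{2}$, the convergence of the energies holds: $$\mathcal{F}_{\varepsilon_k}(u_{\varepsilon_k},v_{\varepsilon_k})\to\mathcal{F}(u,1)\quad\text{as }k\to\infty.$$ If instead $m_0=1$ and $\frac aL>\frac{\sigma_{\mathrm c}}{2}$, this convergence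 of the energies does not hold.
   Context: Let $L>0$, $\sigma_{\mathrm c}\in(0,+\infty)$, and let $f$ satisfy: (f1) $f\in C^2([0,1);[0,+\infty))$ and $f^{-1}(0)=\{0\}$; (f2) $\lim_{s\to1^-}(1-s)f(s)=\sigma_{\mathrm c}$; (f3) $\frac{d}{ds}[(1-s)f(s)]>0$ for all $s\in(0,1)$; (f4) $\frac{d}{ds}\left[\frac{(1-s)f'(s)}{f(s)}\right]<0$ for all $s\in(0,1)$; (f5) $\lim_{s\to1^-}\frac{1}{(1-s)^3}\frac{d}{ds}[(1-s)f(s)]=+\infty$; (f6) the map $s\mapsto\sqrt{s}\,f(1-\sqrt{s})$ is convex. Truncation. For $\varepsilon>0$ fix $s_\varepsilon\in(0,1)$ with $s_\varepsilon\uparrow1$ and $\sqrt\varepsilon f(s_\varepsilon)\to1$ as $\varepsilon\to0$. Let $f_\varepsilon(s)=\sqrt\varepsilon f(s)$ for $0\le s\le s_\varepsilon$ and $f_\varepsilon(s)=\psi_\varepsilon(s)$ for $s_\varepsilon<s\le1$, where $\psi_\varepsilon:[0,1]\to[0,1]$ is any function such that: $\psi_\varepsilon\in C^2([0,1])$ is monotone nondecreasing with $\psi_\varepsilon(1)=1$; $\psi_\varepsilon(s_\varepsilon)=\sqrt\varepsilon f(s_\varepsilon)$ and $\psi_\varepsilon'(s_\varepsilon)=\sqrt\varepsilon f'(s_\varepsilon)$; the map $s\mapsto\frac{\psi_\varepsilon'(s)}{1-s}$ is monotone nonincreasing. Extend $f_\varepsilon$ to a $C^1$ function on $\mathbb{R}$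 by $f_\varepsilon(s)=\sqrt\varepsilon f'(0)s$ for $s<0$ and $f_\varepsilon(s)=1$ for $s>1$. Write $f^2(s):=(f(s))^2$, $f_\varepsilon^2(s):=(f_\varepsilon(s))^2$. Phase-field functionals. For $u,v\in H^1(0,L)$ with $0\le v\le1$ a.e., $$\mathcal{F}_\varepsilon(u,v)=\int_0^L\Bigl(f_\varepsilon^2(v)|u'|^2+\frac{(1-v)^2}{4\varepsilon}+\varepsilon|v'|^2\Bigr)dx,$$ and $\mathcal{F}_\varepsilon(u,v)=+\infty$ for all other $(u,v)\in L^1(0,L)^2$. Critical points. A critical point of $\mathcal{F}_\varepsilon$ (with boundary value $a_\varepsilon\in\mathbb{R}$) is a pair $u_\varepsilon,v_\varepsilon\in H^1(0,L)$ solving in the weak sense $$-\varepsilon v_\varepsilon''+f_\varepsilon(v_\varepsilon)f_\varepsilon'(v_\varepsilon)(u_\varepsilon')^2+\tfrac{v_\varepsilon-1}{4\varepsilon}=0,\qquad \bigl(f_\varepsilon^2(v_\varepsilon)u_\varepsilon'\bigr)'=0\quad\text{in }(0,L),$$ with $u_\varepsilon(0)=0$, $u_\varepsilon(L)=a_\varepsilon$, $v_\varepsilon(0)=v_\varepsilon(L)=1$. Cohesive density. For $s\ge0$, $g(s):=\inf_{(\alpha,\beta)\in\mathcal{U}_s}\mathcal{G}(\alpha,\beta)$ with $$\mathcal{G}(\alpha,\beta)=\int_{-\infty}^{+\infty}\Bigl(f^2(\beta)|\alpha'|^2+\frac{(1-\beta)^2}{4}+|\beta'|^2\Bigr)dt,$$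 $\mathcal{U}_s$ being the set of $(\alpha,\beta)\in H^1_{\mathrm{loc}}(\mathbb{R})^2$ with $\alpha'\in L^1(\mathbb{R})$, $\left|\int_{\mathbb{R}}\alpha'dt\right|=s$, $0\le\beta\le1$, $\lim_{|t|\to\infty}\beta(t)=1$ (convention: $f(\beta)|\alpha'|=0$ where $\beta=1$ and $\alpha'=0$). Set $s_{\mathrm{frac}}:=\sup\{s: g(s)<1\}\in(0,+\infty]$. The function $g$ is of class $C^1$ on $[0,+\infty)$. Limit functional. Let $\phi(\xi)=\xi^2$ if $|\xi|\le\frac{\sigma_{\mathrm c}}2$ and $\phi(\xi)=\sigma_{\mathrm c}|\xi|-\frac{\sigma_{\mathrm c}^2}4$ otherwise. For $u\in \mathrm{BV}(0,L)$ write $Du=u'dx+D^cu+\sum_{x\in J_u}[u](x)\delta_x$, with $[u](x)=u(x^+)-u(x^-)$ ($D^cu$ the Cantor part, $J_u$ the jump set); with the conventions $u(0^-)=0$, $u(L^+)=a$, extend $[u]$ to $x=0,L$ and let $J_u^a=\{x\in[0,L]:[u](x)\ne0\}$. Then $$\Phi(u)=\int_0^L\phi(u')dx+\sum_{x\in J_u^a}g(|[u](x)|)+\sigma_{\mathrm c}|D^cu|(0,L),$$ and $\mathcal{F}(u,v)=\Phi(u)$ if $u\in \mathrm{BV}(0,L)$ and $v=1$ a.e., $\mathcal{F}(u,v)=+\infty$ otherwise. $\chi_E$ denotes the characteristic function of $E$; the index $\varepsilon$ ranges over small positive numbers. *)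

theory Defs
  imports "HOL-Analysis.Analysis"
begin

section \<open>Differentiability classes and Sobolev functions on a set of reals\<close>

text \<open>Derivatives of functions given on an interval \<open>S\<close> are taken within \<open>S\<close>, so they are
  one-sided at the endpoints belonging to \<open>S\<close>.\<close>

abbreviation deriv_in :: "real set \<Rightarrow> (real \<Rightarrow> real) \<Rightarrow> real \<Rightarrow> real" where
  "deriv_in S h x \<equiv> vector_derivative h (at x within S)"

definition C2_on :: "real set \<Rightarrow> (real \<Rightarrow> real) \<Rightarrow> bool" where
  "C2_on S h \<longleftrightarrow> (\<exists>h1 h2. (\<forall>x\<in>S. (h has_real_derivative h1 x) (at x within S)) \<and>
                        (\<forall>x\<in>S. (h1 has_real_derivative h2 x) (at x within S)) \<and>
                        continuous_on S h2)"

definition test_fun :: "real set \<Rightarrow> (real \<Rightarrow> real) \<Rightarrow> bool" where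
  "test_fun S \<eta> \<longleftrightarrow> (\<forall>n x. (deriv ^^ n) \<eta> differentiable (at x)) \<and>
                  (\<exists>K. compact K \<and> K \<subseteq> S \<and> (\<forall>x. x \<notin> K \<longrightarrow> \<eta> x = 0))"

text \<open>Elements of Lebesgue and Sobolev spaces are represented by functions; the notions below depend
  only on the class modulo equality a.e. on \<open>S\<close>.\<close>

definition L2 :: "real set \<Rightarrow> (real \<Rightarrow> real) \<Rightarrow> bool" where
  "L2 S h \<longleftrightarrow> h \<in> borel_measurable (lebesgue_on S) \<and> integrable (lebesgue_on S) (\<lambda>x. (h x)\<^sup>2)"

definition L1_loc :: "real set \<Rightarrow> (real \<Rightarrow> real) \<Rightarrow> bool" where
  "L1_loc S h \<longleftrightarrow> h \<in> borel_measurable (lebesgue_on S) \<and>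
                 (\<forall>K. compact K \<and> K \<subseteq> S \<longrightarrow> integrable (lebesgue_on K) h)"

definition weak_deriv :: "real set \<Rightarrow> (real \<Rightarrow> real) \<Rightarrow> (real \<Rightarrow> real) \<Rightarrow> bool" where
  "weak_deriv S h w \<longleftrightarrow> L1_loc S h \<and> L1_loc S w \<and>
     (\<forall>\<eta>. test_fun S \<eta> \<longrightarrow>
        (\<integral>x. h x * deriv \<eta> x \<partial>lebesgue_on S) = - (\<integral>x. w x * \<eta> x \<partial>lebesgue_on S))"

definition wderiv :: "real set \<Rightarrow> (real \<Rightarrow> real) \<Rightarrow> real \<Rightarrow> real" where
  "wderiv S h = (SOME w. weak_deriv S h w)"

definition H1 :: "real set \<Rightarrow> (real \<Rightarrow> real) \<Rightarrow> bool" where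
  "H1 S h \<longleftrightarrow> L2 S h \<and> (\<exists>w. L2 S w \<and> weak_deriv S h w)"

definition H1_loc :: "real set \<Rightarrow> (real \<Rightarrow> real) \<Rightarrow> bool" where
  "H1_loc S h \<longleftrightarrow> (\<forall>K. compact K \<and> K \<subseteq> S \<longrightarrow> L2 K h) \<and>
                 (\<exists>w. (\<forall>K. compact K \<and> K \<subseteq> S \<longrightarrow> L2 K w) \<and> weak_deriv S h w)"

section \<open>Functions of bounded variation on an interval\<close>

text \<open>\<open>P\<close> and \<open>N\<close> are the positive and the negative part (Jordan decomposition) of the finite signed
  measure on \<open>(0,L)\<close> representing the distributional derivative \<open>Du\<close>; this pair is unique.\<close>

definition Jordan_deriv :: "real \<Rightarrow> (real \<Rightarrow> real) \<Rightarrow> real measure \<Rightarrow> real measure \<Rightarrow> bool" where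
  "Jordan_deriv L u P N \<longleftrightarrow>
     finite_measure P \<and> sets P = sets borel \<and> emeasure P (- {0<..<L}) = 0 \<and>
     finite_measure N \<and> sets N = sets borel \<and> emeasure N (- {0<..<L}) = 0 \<and>
     (\<exists>A\<in>sets borel. emeasure P A = 0 \<and> emeasure N (- A) = 0) \<and>
     (\<forall>\<eta>. test_fun {0<..<L} \<eta> \<longrightarrow>
        (\<integral>x. u x * deriv \<eta> x \<partial>lebesgue_on {0<..<L}) = - ((\<integral>x. \<eta> x \<partial>P) - (\<integral>x. \<eta> x \<partial>N)))"

definition BV :: "real \<Rightarrow> (real \<Rightarrow> real) \<Rightarrow> bool" where
  "BV L u \<longleftrightarrow> integrable (lebesgue_on {0<..<L}) u \<and> (\<exists>P N. Jordan_deriv L u P N)"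

definition Jordan_pair :: "real \<Rightarrow> (real \<Rightarrow> real) \<Rightarrow> real measure \<times> real measure" where
  "Jordan_pair L u = (SOME (P, N). Jordan_deriv L u P N)"

definition D_meas :: "real \<Rightarrow> (real \<Rightarrow> real) \<Rightarrow> real set \<Rightarrow> real" where
  "D_meas L u A = measure (fst (Jordan_pair L u)) A - measure (snd (Jordan_pair L u)) A"

definition D_var :: "real \<Rightarrow> (real \<Rightarrow> real) \<Rightarrow> real set \<Rightarrow> real" where
  "D_var L u A = measure (fst (Jordan_pair L u)) A + measure (snd (Jordan_pair L u)) A"

text \<open>Lebesgue decomposition of \<open>Du\<close>: it has density \<open>w\<close> outside the Lebesgue-null set \<open>S\<close>, which
  carries the singular part. The choice of \<open>w\<close> is unique a.e., the choice of \<open>S\<close> up to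
  \<open>|Du|\<close>-null sets.\<close>

definition Lebesgue_decomp :: "real \<Rightarrow> (real \<Rightarrow> real) \<Rightarrow> (real \<Rightarrow> real) \<Rightarrow> real set \<Rightarrow> bool" where
  "Lebesgue_decomp L u w S \<longleftrightarrow>
     integrable (lebesgue_on {0<..<L}) w \<and>
     S \<in> sets borel \<and> S \<subseteq> {0<..<L} \<and> emeasure lborel S = 0 \<and>
     (\<forall>A\<in>sets borel. A \<subseteq> {0<..<L} - S \<longrightarrow> D_meas L u A = (\<integral>x. w x \<partial>lebesgue_on A))"

definition ac_density :: "real \<Rightarrow> (real \<Rightarrow> real) \<Rightarrow> real \<Rightarrow> real" where
  "ac_density L u = (SOME w. \<exists>S. Lebesgue_decomp L u w S)"

definition sing_set :: "real \<Rightarrow> (real \<Rightarrow> real) \<Rightarrow> real set" where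
  "sing_set L u = (SOME S. \<exists>w. Lebesgue_decomp L u w S)"

text \<open>One-sided limits \<open>u(x\<^sup>+)\<close>, \<open>u(x\<^sup>-)\<close> up to null sets, i.e. the one-sided limits of a good
  representative of the class of \<open>u\<close>.\<close>

definition rlim :: "(real \<Rightarrow> real) \<Rightarrow> real \<Rightarrow> real" where
  "rlim u x = (THE l. \<forall>e>0. \<exists>d>0. AE y in lebesgue_on {x<..<x + d}. \<bar>u y - l\<bar> < e)"

definition llim :: "(real \<Rightarrow> real) \<Rightarrow> real \<Rightarrow> real" where
  "llim u x = (THE l. \<forall>e>0. \<exists>d>0. AE y in lebesgue_on {x - d<..<x}. \<bar>u y - l\<bar> < e)"

text \<open>The jump, with the conventions \<open>u(0\<^sup>-) = 0\<close> and \<open>u(L\<^sup>+) = a\<close>; on \<open>(0,L)\<close> it does not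
  depend on \<open>a\<close>.\<close>

definition jump :: "real \<Rightarrow> real \<Rightarrow> (real \<Rightarrow> real) \<Rightarrow> real \<Rightarrow> real" where
  "jump L a u x = (if x = L then a else rlim u x) - (if x = 0 then 0 else llim u x)"

definition J_inner :: "real \<Rightarrow> (real \<Rightarrow> real) \<Rightarrow> real set" where
  "J_inner L u = {x \<in> {0<..<L}. rlim u x - llim u x \<noteq> 0}"

definition J_bdry :: "real \<Rightarrow> real \<Rightarrow> (real \<Rightarrow> real) \<Rightarrow> real set" where
  "J_bdry L a u = {x \<in> {0..L}. jump L a u x \<noteq> 0}"

text \<open>\<open>|D\<^sup>cu|(0,L)\<close>: the Cantor part is the singular part of \<open>Du\<close> restricted to the complement
  of the jump set.\<close>

definition Cantor_var :: "real \<Rightarrow> (real \<Rightarrow> real) \<Rightarrow> real" where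
  "Cantor_var L u = D_var L u (sing_set L u - J_inner L u)"

definition SBV :: "real \<Rightarrow> (real \<Rightarrow> real) \<Rightarrow> bool" where
  "SBV L u \<longleftrightarrow> BV L u \<and> Cantor_var L u = 0"

section \<open>The degradation function and its truncations\<close>

text \<open>Only the values of \<open>f\<close> on \<open>[0,1)\<close> are used anywhere.\<close>

definition degradation :: "real \<Rightarrow> (real \<Rightarrow> real) \<Rightarrow> bool" where
  "degradation \<sigma> f \<longleftrightarrow>
     C2_on {0..<1} f \<and> (\<forall>s\<in>{0..<1}. 0 \<le> f s) \<and> {s\<in>{0..<1}. f s = 0} = {0} \<and>
     ((\<lambda>s. (1 - s) * f s) \<longlongrightarrow> \<sigma>) (at_left 1) \<and>
     (\<forall>s\<in>{0<..<1}. deriv (\<lambda>t. (1 - t) * f t) s > 0) \<and>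
     (\<forall>s\<in>{0<..<1}. deriv (\<lambda>t. (1 - t) * deriv f t / f t) s < 0) \<and>
     filterlim (\<lambda>s. 1 / (1 - s) ^ 3 * deriv (\<lambda>t. (1 - t) * f t) s) at_top (at_left 1) \<and>
     convex_on {0<..1} (\<lambda>s. sqrt s * f (1 - sqrt s))"

text \<open>The monotonicity of \<open>\<psi>'(s)/(1-s)\<close> is required on \<open>[s\<^sub>\<epsilon>,1)\<close>, the only place where \<open>\<psi>\<close>
  enters \<open>f\<^sub>\<epsilon>\<close>. On all of \<open>[0,1)\<close> it could not hold for small \<open>\<epsilon>\<close>: the slope of \<open>\<psi>\<close> at \<open>s\<^sub>\<epsilon>\<close>
  is of order \<open>1/(1-s\<^sub>\<epsilon>)\<close>, which would force \<open>\<psi>(s\<^sub>\<epsilon>) - \<psi>(0) > 1\<close>.\<close>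

definition trunc_profile :: "(real \<Rightarrow> real) \<Rightarrow> real \<Rightarrow> real \<Rightarrow> (real \<Rightarrow> real) \<Rightarrow> bool" where
  "trunc_profile f \<epsilon> s\<epsilon> \<psi> \<longleftrightarrow>
     \<psi> ` {0..1} \<subseteq> {0..1} \<and> C2_on {0..1} \<psi> \<and> mono_on {0..1} \<psi> \<and> \<psi> 1 = 1 \<and>
     \<psi> s\<epsilon> = sqrt \<epsilon> * f s\<epsilon> \<and>
     deriv_in {0..1} \<psi> s\<epsilon> = sqrt \<epsilon> * deriv_in {0..<1} f s\<epsilon> \<and>
     antimono_on {s\<epsilon>..<1} (\<lambda>s. deriv_in {0..1} \<psi> s / (1 - s))"

definition f_trunc :: "(real \<Rightarrow> real) \<Rightarrow> real \<Rightarrow> real \<Rightarrow> (real \<Rightarrow> real) \<Rightarrow> real \<Rightarrow> real" where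
  "f_trunc f \<epsilon> s\<epsilon> \<psi> x =
     (if x < 0 then sqrt \<epsilon> * deriv_in {0..<1} f 0 * x
      else if x \<le> s\<epsilon> then sqrt \<epsilon> * f x
      else if x \<le> 1 then \<psi> x
      else 1)"

section \<open>Phase-field functionals and critical points\<close>

text \<open>Here \<open>fe\<close> stands for the truncated function \<open>f\<^sub>\<epsilon>\<close>.\<close>

definition F_eps ::
  "real \<Rightarrow> (real \<Rightarrow> real) \<Rightarrow> real \<Rightarrow> (real \<Rightarrow> real) \<Rightarrow> (real \<Rightarrow> real) \<Rightarrow> ennreal" where
  "F_eps L fe \<epsilon> u v =
     (if H1 {0<..<L} u \<and> H1 {0<..<L} v \<and> (AE x in lebesgue_on {0<..<L}. 0 \<le> v x \<and> v x \<le> 1)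
      then \<integral>\<^sup>+x. ennreal ((fe (v x))\<^sup>2 * \<bar>wderiv {0<..<L} u x\<bar>\<^sup>2
                         + (1 - v x)\<^sup>2 / (4 * \<epsilon>)
                         + \<epsilon> * \<bar>wderiv {0<..<L} v x\<bar>\<^sup>2) \<partial>lebesgue_on {0<..<L}
      else \<infinity>)"

text \<open>As usual, functions in \<open>H\<^sup>1(0,L)\<close> are identified with their continuous representative on
  \<open>[0,L]\<close>, which gives a meaning to boundary values.\<close>

definition critical_point ::
  "real \<Rightarrow> (real \<Rightarrow> real) \<Rightarrow> real \<Rightarrow> real \<Rightarrow> (real \<Rightarrow> real) \<Rightarrow> (real \<Rightarrow> real) \<Rightarrow> bool" where
  "critical_point L fe \<epsilon> a u v \<longleftrightarrow>
     H1 {0<..<L} u \<and> continuous_on {0..L} u \<and>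
     H1 {0<..<L} v \<and> continuous_on {0..L} v \<and>
     (\<forall>\<eta>. test_fun {0<..<L} \<eta> \<longrightarrow>
        (\<integral>x. \<epsilon> * wderiv {0<..<L} v x * deriv \<eta> x
            + fe (v x) * deriv fe (v x) * (wderiv {0<..<L} u x)\<^sup>2 * \<eta> x
            + (v x - 1) / (4 * \<epsilon>) * \<eta> x \<partial>lebesgue_on {0<..<L}) = 0) \<and>
     (\<forall>\<eta>. test_fun {0<..<L} \<eta> \<longrightarrow>
        (\<integral>x. (fe (v x))\<^sup>2 * wderiv {0<..<L} u x * deriv \<eta> x \<partial>lebesgue_on {0<..<L}) = 0) \<and>
     u 0 = 0 \<and> u L = a \<and> v 0 = 1 \<and> v L = 1"

section \<open>Cohesive density and limit functional\<close>

text \<open>In the first term \<open>f(1) = +\<infinity>\<close>, in accordance with the behaviour of \<open>f\<close> at \<open>1\<close>, with the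
  convention that the term vanishes where \<open>\<beta> = 1\<close> and \<open>\<alpha>' = 0\<close>.\<close>

definition G_energy :: "(real \<Rightarrow> real) \<Rightarrow> (real \<Rightarrow> real) \<Rightarrow> (real \<Rightarrow> real) \<Rightarrow> ennreal" where
  "G_energy f \<alpha> \<beta> =
     (\<integral>\<^sup>+t. (if \<beta> t < 1 then ennreal ((f (\<beta> t))\<^sup>2 * \<bar>wderiv UNIV \<alpha> t\<bar>\<^sup>2)
            else if wderiv UNIV \<alpha> t = 0 then 0 else \<infinity>)
           + ennreal ((1 - \<beta> t)\<^sup>2 / 4 + \<bar>wderiv UNIV \<beta> t\<bar>\<^sup>2) \<partial>lebesgue)"

text \<open>\<open>\<beta>\<close> is again taken to be its continuous representative, so that its limits at infinity make
  sense.\<close>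

definition U_adm :: "real \<Rightarrow> ((real \<Rightarrow> real) \<times> (real \<Rightarrow> real)) set" where
  "U_adm s = {(\<alpha>, \<beta>). H1_loc UNIV \<alpha> \<and> H1_loc UNIV \<beta> \<and> continuous_on UNIV \<beta> \<and>
                integrable lebesgue (wderiv UNIV \<alpha>) \<and>
                \<bar>\<integral>t. wderiv UNIV \<alpha> t \<partial>lebesgue\<bar> = s \<and>
                (\<forall>t. 0 \<le> \<beta> t \<and> \<beta> t \<le> 1) \<and>
                (\<beta> \<longlongrightarrow> 1) at_top \<and> (\<beta> \<longlongrightarrow> 1) at_bot}"

text \<open>The infimum is finite for \<open>s \<ge> 0\<close> (let \<open>\<alpha>\<close> vary only where \<open>\<beta> = 0\<close>), so the conversion to
  \<^typ>\<open>real\<close> loses nothing.\<close>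

definition g_coh :: "(real \<Rightarrow> real) \<Rightarrow> real \<Rightarrow> real" where
  "g_coh f s = enn2real (INF (\<alpha>, \<beta>)\<in>U_adm s. G_energy f \<alpha> \<beta>)"

definition s_frac :: "(real \<Rightarrow> real) \<Rightarrow> ereal" where
  "s_frac f = (SUP s\<in>{s. 0 \<le> s \<and> g_coh f s < 1}. ereal s)"

definition phi_bulk :: "real \<Rightarrow> real \<Rightarrow> real" where
  "phi_bulk \<sigma> \<xi> = (if \<bar>\<xi>\<bar> \<le> \<sigma> / 2 then \<xi>\<^sup>2 else \<sigma> * \<bar>\<xi>\<bar> - \<sigma>\<^sup>2 / 4)"

definition Phi_lim :: "real \<Rightarrow> real \<Rightarrow> (real \<Rightarrow> real) \<Rightarrow> real \<Rightarrow> (real \<Rightarrow> real) \<Rightarrow> ennreal" where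
  "Phi_lim L \<sigma> f a u =
     (\<integral>\<^sup>+x. ennreal (phi_bulk \<sigma> (ac_density L u x)) \<partial>lebesgue_on {0<..<L})
     + (\<Sum>\<^sub>\<infinity>x\<in>J_bdry L a u. ennreal (g_coh f \<bar>jump L a u x\<bar>))
     + ennreal (\<sigma> * Cantor_var L u)"

definition F_lim ::
  "real \<Rightarrow> real \<Rightarrow> (real \<Rightarrow> real) \<Rightarrow> real \<Rightarrow> (real \<Rightarrow> real) \<Rightarrow> (real \<Rightarrow> real) \<Rightarrow> ennreal" where
  "F_lim L \<sigma> f a u v =
     (if BV L u \<and> (AE x in lebesgue_on {0<..<L}. v x = 1) then Phi_lim L \<sigma> f a u else \<infinity>)"

definition L1_tendsto :: "real \<Rightarrow> (nat \<Rightarrow> real \<Rightarrow> real) \<Rightarrow> (real \<Rightarrow> real) \<Rightarrow> bool" where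
  "L1_tendsto L h h0 \<longleftrightarrow>
     (\<lambda>k. \<integral>\<^sup>+x. ennreal \<bar>h k x - h0 x\<bar> \<partial>lebesgue_on {0<..<L}) \<longlonglongrightarrow> 0"

end

theory Submission
 imports Defs
begin

text \<open>A critical point of the phase-field energy is an orbit of a one-dimensional Hamiltonian
system, and the theorem follows from the analysis of its phase portrait as \<open>\<epsilon> \<rightarrow> 0\<close>.

The flux \<open>c = f\<^sub>\<epsilon>\<^sup>2(v) u'\<close> is constant and positive, so \<open>v\<close> stays away from zero (otherwise \<open>u'\<close>
would grow like an inverse square) and both functions are classical solutions
(\<open>classical_solution\<close>). Multiplying the equation of \<open>v\<close> by \<open>v'\<close> gives the first integral \<open>\<epsilon> v'\<^sup>2
= H(v)\<close> with \<open>H(t) = (1 - t)\<^sup>2/(4\<epsilon>) - c\<^sup>2/f\<^sub>\<epsilon>\<^sup>2(t) + d\<close>. The hypotheses on \<open>f\<close> and on the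
truncation make \<open>f\<^sub>\<epsilon>'/(f\<^sub>\<epsilon>\<^sup>3(1 - t))\<close> nonincreasing, so \<open>H\<close> first increases and then decreases.
Hence \<open>v\<close> is either constant or has a single well, which by reversal of the orbit lies at \<open>L/2\<close>
and is symmetric. The critical point is then governed by three numbers, the flux \<open>c\<close>, the level
\<open>d\<close> and the minimum \<open>m\<close> of \<open>v\<close>, and its energy is \<open>2ca - dL + 4 \<integral>\<^sub>m\<^sup>1 sqrt (\<epsilon> H)\<close>.

The cohesive density has the same structure. Put \<open>k(t) = (1 - t) f(t)\<close>, which increases from \<open>0\<close>
to \<open>\<sigma>\<close>, and \<open>z = (1 - t)\<^sup>2/2\<close>. By Young's inequality the energy of a path is at least its length
for the metric \<open>k\<^sup>2 d\<alpha>\<^sup>2 + dz\<^sup>2\<close>. The geodesics of this metric conserve \<open>C = k cos \<theta>\<close>; the one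
with constant \<open>C\<close> and end points on \<open>z = 0\<close> has opening \<open>S(C)\<close> and length \<open>C S(C) + KK(C)\<close>. The
convexity hypothesis says that \<open>k\<close> is convex in \<open>z\<close>: this makes \<open>S\<close> strictly decreasing and
allows a calibration (\<open>calibration_along_path\<close>, \<open>G_lower_bound\<close>), while a rescaled geodesic is a
competitor (\<open>competitor\<close>). Therefore \<open>g(S(C)) = C S(C) + KK(C)\<close>, and the envelope argument of
\<open>g_derivative\<close> gives \<open>g'(S(C)) = C\<close>. Moreover \<open>g(S(C)) < 1\<close>, and \<open>g \<ge> 1\<close> from the supremum of
\<open>S\<close> on, so that this supremum is \<open>s_frac\<close>.

Below the truncation threshold an orbit is such a geodesic up to an error of order \<open>\<epsilon> d\<close>.
Bounded energy allows to extract limits \<open>c0\<close>, \<open>d0\<close>, \<open>m0\<close> of \<open>c\<close>, \<open>d\<close>, \<open>m\<close>. Away from \<open>L/2\<close> one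
finds \<open>v \<rightarrow> 1\<close> and \<open>u - c x \<rightarrow> 0\<close> on the left, so that the limit of \<open>u\<close> is affine with one jump \<open>j
= a - c0 L\<close> at the midpoint. If \<open>m0 < 1\<close> then \<open>2 c0 = k(m0)\<close> and comparison with geodesics of
nearby constants gives \<open>j = S(2 c0)\<close> for \<open>m0 > 0\<close> and \<open>j = sup S = s_frac\<close> for \<open>m0 = 0\<close>; if \<open>m0
= 1\<close> then \<open>j = 0\<close>. Finally \<open>d0 = c0\<^sup>2\<close>, and the energies converge to \<open>2 c0 a - c0\<^sup>2 L\<close> plus the
limit of the last integral (\<open>energy_limit\<close>). For \<open>m0 < 1\<close> this is \<open>c0\<^sup>2 L + g(j)\<close> with \<open>c0 <
\<sigma>/2\<close>, the value of the limit functional. For \<open>m0 = 1\<close> it is \<open>(a/L)\<^sup>2 L\<close>, which equals \<open>\<phi>(a/L) L\<close>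
precisely when \<open>a/L \<le> \<sigma>/2\<close>.\<close>

abbreviation (input) seq_tendsto :: "(nat => 'a :: topological_space) => 'a => bool" ("((_)/ ----> (_))" [60, 60] 60) where
 "X ----> l \<equiv> X \<longlonglongrightarrow> l"

section \<open>Absolutely continuous functions\<close>

text \<open>Absolute continuity is encoded by the derivative: \<open>A\<close> is the integral of a given absolutely
integrable \<open>A'\<close>. This is the form in which weak derivatives produce it.\<close>

definition ac_on :: "real => real => (real => real) => (real => real) => bool" where
 "ac_on a b A A' \<longleftrightarrow> A' absolutely_integrable_on {a..b} &
   (\<forall>x\<in>{a..b}. A x = A a + integral {a..x} A')"

lemma ac_on_abs_integrable: "ac_on a b A A' ==> A' absolutely_integrable_on {a..b}"
 by (simp add: ac_on_def)

lemma abs_integrable_sub: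
 fixes h :: "real => real"
 assumes "h absolutely_integrable_on {a..b}" "a <= x" "y <= b"
 shows "h absolutely_integrable_on {x..y}"
 using absolutely_integrable_on_subinterval[OF assms(1), of x y] assms by auto

lemma ac_onD:
 assumes "ac_on a b A A'" "x \<in> {a..b}"
 shows "A x = A a + integral {a..x} A'"
 using assms unfolding ac_on_def by blast

lemma ac_on_increment:
 assumes "ac_on a b A A'" "a <= x" "x <= y" "y <= b"
 shows "A y - A x = integral {x..y} A'"
proof -
 have i: "A' integrable_on {a..y}"
  using abs_integrable_sub[OF ac_on_abs_integrable[OF assms(1)], of a y] assms
  by (simp add: absolutely_integrable_on_def)
 have "integral {a..x} A' + integral {x..y} A' = integral {a..y} A'"
  using Henstock_Kurzweil_Integration.integral_combine[OF assms(2,3) i] .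
 moreover have "A y = A a + integral {a..y} A'" "A x = A a + integral {a..x} A'"
  using assms(2-4) by (auto intro!: ac_onD[OF assms(1)])
 ultimately show ?thesis by linarith
qed

lemma ac_on_continuous:
 assumes "ac_on a b A A'"
 shows "continuous_on {a..b} A"
proof -
 have "A' integrable_on {a..b}"
  using assms by (auto simp: ac_on_def absolutely_integrable_on_def)
 hence "continuous_on {a..b} (%x. A a + integral {a..x} A')"
  by (intro continuous_intros indefinite_integral_continuous_1)
 moreover have "A a + integral {a..x} A' = A x" if "x \<in> {a..b}" for x
  using ac_onD[OF assms that] by (rule sym)
 ultimately show ?thesis by (rule continuous_on_eq)
qed

text \<open>Local-to-global principle: the error bound is additive over adjacent intervals, so bisection extends
it to the whole interval, for every \<open>e\<close>.\<close>

lemma increment_from_local_estimate: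
 fixes F r M :: "real => real"
 assumes ab: "a <= b" and r: "r integrable_on {a..b}" and M: "M integrable_on {a..b}"
  and loc: "!!e. e > 0 ==> \<exists>\<delta>>0. \<forall>x y. a <= x --> x <= y --> y <= b --> y - x < \<delta> -->
   \<bar>F y - F x - integral {x..y} r\<bar> <= e * integral {x..y} M"
 shows "F b - F a = integral {a..b} r"
proof -
 have ir: "integral {x..y} r + integral {y..z} r = integral {x..z} r"
  and iM: "integral {x..y} M + integral {y..z} M = integral {x..z} M"
  if "a <= x" "x <= y" "y <= z" "z <= b" for x y z
  using that r M by (auto intro!: Henstock_Kurzweil_Integration.integral_combine
    intro: integrable_subinterval_real)
 have est: "\<bar>F b - F a - integral {a..b} r\<bar> <= e * integral {a..b} M" if "e > 0" for e
 proof -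
  from loc[OF that] obtain \<delta> where \<delta>: "\<delta> > 0"
   "!!x y. a <= x ==> x <= y ==> y <= b ==> y - x < \<delta> ==>
    \<bar>F y - F x - integral {x..y} r\<bar> <= e * integral {x..y} M" by blast
  have "a <= a & b <= b --> \<bar>F b - F a - integral {a..b} r\<bar> <= e * integral {a..b} M"
  proof (rule Bolzano[where P = "%x y. a <= x & y <= b -->
     \<bar>F y - F x - integral {x..y} r\<bar> <= e * integral {x..y} M", OF ab])
   fix x y z assume 1: "a <= x & y <= b --> \<bar>F y - F x - integral {x..y} r\<bar> <= e * integral {x..y} M"
    and 2: "a <= y & z <= b --> \<bar>F z - F y - integral {y..z} r\<bar> <= e * integral {y..z} M"
    and 3: "x <= y" "y <= z"
   show "a <= x & z <= b --> \<bar>F z - F x - integral {x..z} r\<bar> <= e * integral {x..z} M"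
   proof
    assume 4: "a <= x & z <= b"
    have "integral {x..z} r = integral {x..y} r + integral {y..z} r"
     "integral {x..z} M = integral {x..y} M + integral {y..z} M"
     using ir[of x y z] iM[of x y z] 3 4 by auto
    moreover have "\<bar>F y - F x - integral {x..y} r\<bar> <= e * integral {x..y} M"
     "\<bar>F z - F y - integral {y..z} r\<bar> <= e * integral {y..z} M" using 1 2 3 4 by auto
    ultimately show "\<bar>F z - F x - integral {x..z} r\<bar> <= e * integral {x..z} M"
     by (simp add: distrib_left abs_le_iff)
   qed
  next
   fix x show "\<exists>d>0. \<forall>p q. p <= x & x <= q & q - p < d --> a <= p & q <= b -->
    \<bar>F q - F p - integral {p..q} r\<bar> <= e * integral {p..q} M"
    using \<delta> by (intro exI[of _ \<delta>]) auto
  qed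
  thus ?thesis by simp
 qed
 have "\<bar>F b - F a - integral {a..b} r\<bar> <= e" if "e > 0" for e
 proof -
  define e' where "e' = e / (1 + \<bar>integral {a..b} M\<bar>)"
  have e': "e' > 0" using that by (simp add: e'_def add_pos_nonneg)
  have "e' * integral {a..b} M <= e' * (1 + \<bar>integral {a..b} M\<bar>)" using e' by auto
  also have "\<dots> = e"
  proof -
   have "1 + \<bar>integral {a..b} M\<bar> ~= 0" using abs_ge_zero[of "integral {a..b} M"] by linarith
   thus ?thesis by (simp add: e'_def)
  qed
  finally show ?thesis using est[OF e'] by linarith
 qed
 hence "\<bar>F b - F a - integral {a..b} r\<bar> <= 0" by (rule field_le_epsilon) simp
 thus ?thesis by simp
qed

lemma abs_integrable_mult_continuous:
 fixes g h :: "real => real"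
 assumes "continuous_on {a..b} g" "h absolutely_integrable_on {a..b}"
 shows "(%x. g x * h x) absolutely_integrable_on {a..b}"
proof -
 have "bounded (g ` {a..b})" using assms(1) by (intro compact_imp_bounded compact_continuous_image) auto
 moreover have "g \<in> borel_measurable (lebesgue_on {a..b})"
  using assms(1) by (intro continuous_imp_measurable_on_sets_lebesgue) auto
 ultimately show ?thesis
  using absolutely_integrable_bounded_measurable_product_real[of g "{a..b}" h] assms(2) by auto
qed

lemma integral_abs_le_mult:
 fixes p M :: "real => real"
 assumes "p integrable_on S" "M integrable_on S" "!!x. x \<in> S ==> \<bar>p x\<bar> <= e * M x"
 shows "\<bar>integral S p\<bar> <= e * integral S M"
proof -
 have "norm (integral S p) <= integral S (%x. e * M x)"
  using assms by (intro integral_norm_bound_integral) (auto intro: integrable_on_mult_right)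
 thus ?thesis by simp
qed

lemma ac_onI:
 fixes F r M :: "real => real"
 assumes r: "r absolutely_integrable_on {a..b}" and M: "M integrable_on {a..b}"
  and loc: "!!e. e > 0 ==> \<exists>\<delta>>0. \<forall>x y. a <= x --> x <= y --> y <= b --> y - x < \<delta> -->
   \<bar>F y - F x - integral {x..y} r\<bar> <= e * integral {x..y} M"
 shows "ac_on a b F r"
 unfolding ac_on_def
proof (intro conjI ballI r)
 fix x assume x: "x \<in> {a..b}"
 have "F x - F a = integral {a..x} r"
 proof (rule increment_from_local_estimate)
  show "a <= x" using x by auto
  show "r integrable_on {a..x}" "M integrable_on {a..x}"
   using x r M by (auto simp: absolutely_integrable_on_def intro: integrable_subinterval_real)
  fix e :: real assume "e > 0"
  from loc[OF this] x show "\<exists>\<delta>>0. \<forall>xa y. a <= xa --> xa <= y --> y <= x --> y - xa < \<delta> -->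
    \<bar>F y - F xa - integral {xa..y} r\<bar> <= e * integral {xa..y} M"
   by (meson atLeastAtMost_iff order_trans)
 qed
 thus "F x = F a + integral {a..x} r" by simp
qed

lemma uniform_osc:
 fixes h :: "real => real"
 assumes "continuous_on {a..b} h" "e > 0"
 obtains \<delta> where "\<delta> > 0"
  "!!x y s t. a <= x ==> y <= b ==> y - x < \<delta> ==> s \<in> {x..y} ==> t \<in> {x..y} ==> \<bar>h s - h t\<bar> < e"
proof -
 have "uniformly_continuous_on {a..b} h"
  using assms(1) by (intro compact_uniformly_continuous) auto
 then obtain \<delta> where d: "\<delta> > 0" "!!s t. s \<in> {a..b} ==> t \<in> {a..b} ==> dist t s < \<delta> ==> dist (h t) (h s) < e"
  using assms(2) unfolding uniformly_continuous_on_def by metis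
 show ?thesis
 proof (rule that[OF d(1)])
  fix x y s t assume "a <= x" "y <= b" "y - x < \<delta>" "s \<in> {x..y}" "t \<in> {x..y}"
  thus "\<bar>h s - h t\<bar> < e" using d(2)[of t s] by (auto simp: dist_real_def)
 qed
qed

text \<open>The increments of \<open>\<Phi> \<circ> A\<close> over a short interval differ from those of the linearisation of \<open>\<Phi>\<close> by
the oscillation of \<open>\<Phi>'\<close> times \<open>\<integral> \<bar>A'\<bar>\<close>; uniform continuity of \<open>\<Phi>' \<circ> A\<close> makes this small, and the
local-to-global principle applies.\<close>

lemma ac_on_compose:
 assumes A: "ac_on a b A A'" and rng: "A ` {a..b} \<subseteq> T"
  and der: "!!t. t \<in> T ==> (\<Phi> has_real_derivative \<phi> t) (at t within T)"
  and cont: "continuous_on T \<phi>"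
 shows "ac_on a b (%x. \<Phi> (A x)) (%x. \<phi> (A x) * A' x)"
proof (rule ac_onI[where M = "%x. \<bar>A' x\<bar>"])
 have cA: "continuous_on {a..b} A" by (rule ac_on_continuous[OF A])
 have cp: "continuous_on {a..b} (%x. \<phi> (A x))" by (rule continuous_on_compose2[OF cont cA rng])
 have iA: "A' absolutely_integrable_on {a..b}" by (rule ac_on_abs_integrable[OF A])
 show ip: "(%x. \<phi> (A x) * A' x) absolutely_integrable_on {a..b}"
  by (rule abs_integrable_mult_continuous[OF cp iA])
 show iM: "(%x. \<bar>A' x\<bar>) integrable_on {a..b}" using iA by (simp add: absolutely_integrable_on_def)
 fix e :: real assume "e > 0"
 hence "e / 2 > 0" by simp
 from uniform_osc[OF cp this] obtain \<delta> where d: "\<delta> > 0"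
  "!!x y s t. a <= x ==> y <= b ==> y - x < \<delta> ==> s \<in> {x..y} ==> t \<in> {x..y} ==> \<bar>\<phi> (A s) - \<phi> (A t)\<bar> < e / 2" by metis
 show "\<exists>\<delta>>0. \<forall>x y. a <= x --> x <= y --> y <= b --> y - x < \<delta> -->
   \<bar>\<Phi> (A y) - \<Phi> (A x) - integral {x..y} (%x. \<phi> (A x) * A' x)\<bar> <= e * integral {x..y} (%x. \<bar>A' x\<bar>)"
 proof (intro exI[of _ \<delta>] conjI allI impI d(1))
  fix x y assume xy: "a <= x" "x <= y" "y <= b" "y - x < \<delta>"
  have osc: "\<bar>\<phi> (A x) - \<phi> (A t)\<bar> <= e / 2" "\<bar>\<phi> (A t) - \<phi> (A x)\<bar> <= e / 2" if "t \<in> {x..y}" for t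
   using d(2)[OF xy(1,3,4) _ that, of x] xy(2) by (auto simp: abs_minus_commute)
  have sub: "{x..y} \<subseteq> {a..b}" using xy by auto
  have "connected (A ` {x..y})" by (intro connected_continuous_image continuous_on_subset[OF cA sub]) simp
  hence S: "convex (A ` {x..y})" "A ` {x..y} \<subseteq> T" using rng sub by (auto simp: connected_convex_1)
  have i1: "A' integrable_on {x..y}" "(%x. \<bar>A' x\<bar>) integrable_on {x..y}" "(%x. \<phi> (A x) * A' x) integrable_on {x..y}"
   using abs_integrable_sub[OF iA xy(1,3)] abs_integrable_sub[OF ip xy(1,3)] by (auto simp: absolutely_integrable_on_def)
  have 1: "norm ((\<Phi> (A y) - \<phi> (A x) * A y) - (\<Phi> (A x) - \<phi> (A x) * A x)) <= e / 2 * norm (A y - A x)"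
   by (rule field_differentiable_bound[OF S(1), where f = "%t. \<Phi> t - \<phi> (A x) * t" and f' = "%t. \<phi> t - \<phi> (A x)"])
    (use xy S(2) osc in \<open>auto intro!: DERIV_diff DERIV_subset[OF der S(2)] DERIV_cmult_Id\<close>)
  have "\<bar>integral {x..y} A'\<bar> <= 1 * integral {x..y} (%x. \<bar>A' x\<bar>)"
   by (rule integral_abs_le_mult[OF i1(1,2)]) simp
  hence 2: "e / 2 * norm (A y - A x) <= e / 2 * integral {x..y} (%x. \<bar>A' x\<bar>)"
   using ac_on_increment[OF A xy(1-3)] \<open>e > 0\<close> by simp
  have 3: "\<bar>integral {x..y} (%r. \<phi> (A x) * A' r - \<phi> (A r) * A' r)\<bar> <= e / 2 * integral {x..y} (%x. \<bar>A' x\<bar>)"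
  proof (rule integral_abs_le_mult[OF _ i1(2)])
   show "(%r. \<phi> (A x) * A' r - \<phi> (A r) * A' r) integrable_on {x..y}"
    using i1 by (intro integrable_diff integrable_on_mult_right)
   fix r assume "r \<in> {x..y}"
   hence "\<bar>\<phi> (A x) - \<phi> (A r)\<bar> * \<bar>A' r\<bar> <= e / 2 * \<bar>A' r\<bar>" by (intro mult_right_mono osc) auto
   thus "\<bar>\<phi> (A x) * A' r - \<phi> (A r) * A' r\<bar> <= e / 2 * \<bar>A' r\<bar>" by (simp add: abs_mult[symmetric] left_diff_distrib)
  qed
  have "integral {x..y} (%r. \<phi> (A x) * A' r - \<phi> (A r) * A' r)
    = \<phi> (A x) * (A y - A x) - integral {x..y} (%x. \<phi> (A x) * A' x)"
   using i1 ac_on_increment[OF A xy(1-3)]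
   by (simp add: Henstock_Kurzweil_Integration.integral_diff integrable_on_mult_right)
  hence "\<Phi> (A y) - \<Phi> (A x) - integral {x..y} (%x. \<phi> (A x) * A' x) = (\<Phi> (A y) - \<phi> (A x) * A y - (\<Phi> (A x) - \<phi> (A x) * A x))
    + integral {x..y} (%r. \<phi> (A x) * A' r - \<phi> (A r) * A' r)" by (simp add: right_diff_distrib)
  thus "\<bar>\<Phi> (A y) - \<Phi> (A x) - integral {x..y} (%x. \<phi> (A x) * A' x)\<bar> <= e * integral {x..y} (%x. \<bar>A' x\<bar>)"
   using order_trans[OF abs_triangle_ineq add_mono[OF order_trans[OF 1[unfolded real_norm_def] 2[unfolded real_norm_def]] 3]] by simp
 qed
qed

lemma ac_on_add:
 assumes A: "ac_on a b A A'" and B: "ac_on a b B B'"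
 shows "ac_on a b (%x. A x + B x) (%x. A' x + B' x)"
 unfolding ac_on_def
proof (intro conjI ballI)
 have iA: "A' absolutely_integrable_on {a..b}" and iB: "B' absolutely_integrable_on {a..b}"
  using A B ac_on_abs_integrable by auto
 thus "(%x. A' x + B' x) absolutely_integrable_on {a..b}" by (rule set_integral_add(1))
 fix x assume x: "x \<in> {a..b}"
 have "A' integrable_on {a..x}" "B' integrable_on {a..x}"
  using abs_integrable_sub[OF iA, of a x] abs_integrable_sub[OF iB, of a x] x
  by (auto simp: absolutely_integrable_on_def)
 hence "integral {a..x} (%x. A' x + B' x) = integral {a..x} A' + integral {a..x} B'"
  by (rule Henstock_Kurzweil_Integration.integral_add)
 thus "A x + B x = A a + B a + integral {a..x} (%x. A' x + B' x)"
  using ac_onD[OF A x] ac_onD[OF B x] by linarith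
qed

lemma ac_on_cmult:
 assumes A: "ac_on a b A A'" shows "ac_on a b (%x. c * A x) (%x. c * A' x)"
proof -
 have "(%x. c * A' x) absolutely_integrable_on {a..b}"
  by (cases "c = 0") (simp_all add: set_integrable_mult_right ac_on_abs_integrable[OF A])
 moreover have "c * A x = c * A a + integral {a..x} (%x. c * A' x)" if "x \<in> {a..b}" for x
  by (subst ac_onD[OF A that]) (simp add: distrib_left)
 ultimately show ?thesis unfolding ac_on_def by blast
qed

lemma ac_on_cong_AE:
 assumes "ac_on a b A A'" "negligible N" "!!x. x \<in> {a..b} - N ==> B' x = A' x"
  "!!x. x \<in> {a..b} ==> B x = A x"
 shows "ac_on a b B B'"
 unfolding ac_on_def
proof (intro conjI ballI)
 show "B' absolutely_integrable_on {a..b}"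
  using absolutely_integrable_spike[OF ac_on_abs_integrable[OF assms(1)] assms(2)] assms(3) by auto
 fix x assume x: "x \<in> {a..b}"
 have "integral {a..x} B' = integral {a..x} A'"
  using assms x by (intro integral_spike[OF assms(2)]) auto
 moreover have "B x = A x" "B a = A a" using assms(4) x by simp_all
 ultimately show "B x = B a + integral {a..x} B'" using ac_onD[OF assms(1) x] by linarith
qed


lemma ac_on_mult:
 assumes A: "ac_on a b A A'" and B: "ac_on a b B B'"
 shows "ac_on a b (%x. A x * B x) (%x. B x * A' x + A x * B' x)"
proof -
 have sq: "ac_on a b (%x. (h x)\<^sup>2) (%x. 2 * h x * h' x)" if "ac_on a b h h'" for h h'
  by (rule ac_on_compose[OF that subset_UNIV]) (auto intro!: derivative_eq_intros continuous_intros)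
 \<comment> \<open>Polarisation reduces products to squares.\<close>
 have "ac_on a b (%x. 1 / 4 * ((A x + B x)\<^sup>2 + - 1 * (A x + - 1 * B x)\<^sup>2))
  (%x. 1 / 4 * (2 * (A x + B x) * (A' x + B' x) + - 1 * (2 * (A x + - 1 * B x) * (A' x + - 1 * B' x))))"
  by (intro ac_on_cmult ac_on_add sq A B)
 thus ?thesis
  by (rule ac_on_cong_AE[OF _ negligible_empty]) (simp_all add: power2_eq_square algebra_simps)
qed

lemma ac_on_C1:
 assumes "!!x. x \<in> {a..b} ==> (A has_real_derivative A' x) (at x within {a..b})"
  "continuous_on {a..b} A'"
 shows "ac_on a b A A'"
 unfolding ac_on_def
proof (intro conjI ballI)
 show "A' absolutely_integrable_on {a..b}" using assms(2) by (rule absolutely_integrable_continuous_real)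
 fix x assume x: "x \<in> {a..b}"
 have "(A' has_integral (A x - A a)) {a..x}"
 proof (rule fundamental_theorem_of_calculus)
  show "a <= x" using x by auto
  fix y assume "y \<in> {a..x}"
  thus "(A has_vector_derivative A' y) (at y within {a..x})"
   using assms(1)[of y] x DERIV_subset[of A "A' y" y "{a..b}" "{a..x}"]
   by (auto simp: has_real_derivative_iff_has_vector_derivative)
 qed
 thus "A x = A a + integral {a..x} A'" by (simp add: integral_unique)
qed

section \<open>Smooth functions and test functions\<close>

definition smooth :: "(real => real) => bool" where
 "smooth f \<longleftrightarrow> (\<forall>n x. (deriv ^^ n) f differentiable (at x))"

text \<open>Smoothness is proved by exhibiting a class of functions closed under differentiation.\<close>

lemma smooth_coinduct:
 assumes "P f" and "!!h. P h ==> \<exists>h'. (\<forall>x. (h has_real_derivative h' x) (at x)) & P h'"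
 shows "smooth f"
proof -
 have "P ((deriv ^^ n) f)" for n
 proof (induction n)
  case (Suc n)
  from assms(2)[OF this] obtain h' where
   h': "!!x. ((deriv ^^ n) f has_real_derivative h' x) (at x)" "P h'" by blast
  have "deriv ((deriv ^^ n) f) = h'" using h'(1) by (auto intro!: ext DERIV_imp_deriv)
  thus ?case using h'(2) by simp
 qed (use assms(1) in simp)
 thus ?thesis
  unfolding smooth_def using assms(2) real_differentiable_def by blast
qed

lemma smooth_has_derivative: "smooth f ==> (f has_real_derivative deriv f x) (at x)"
 unfolding smooth_def
 by (metis DERIV_deriv_iff_real_differentiable funpow_0)

lemma smooth_deriv: "smooth f ==> smooth (deriv f)"
 unfolding smooth_def by (metis comp_apply funpow_Suc_right)

lemma smooth_continuous: "smooth f ==> continuous_on A f"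
 by (meson DERIV_continuous_on has_field_derivative_at_within smooth_has_derivative)

lemma smooth_primitive_smooth:
 assumes "!!x. (G has_real_derivative g x) (at x)" "smooth g"
 shows "smooth G"
proof (rule smooth_coinduct[where P = "%h. h = G \<or> smooth h"])
 fix h assume "h = G \<or> smooth h"
 thus "\<exists>h'. (\<forall>x. (h has_real_derivative h' x) (at x)) & (h' = G \<or> smooth h')"
  using assms smooth_has_derivative smooth_deriv by blast
qed simp

inductive smooth_alg :: "(real => real) => bool" where
 prod: "smooth f ==> smooth g ==> smooth_alg (%x. f x * g x)"
| sum: "smooth_alg f ==> smooth_alg g ==> smooth_alg (%x. f x + g x)"

lemma smooth_alg_derivative:
 "smooth_alg h ==> \<exists>h'. (\<forall>x. (h has_real_derivative h' x) (at x)) & smooth_alg h'"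
proof (induction rule: smooth_alg.induct)
 case (prod f g)
 have "\<forall>x. ((%x. f x * g x) has_real_derivative (deriv f x * g x + deriv g x * f x)) (at x)"
  using prod smooth_has_derivative by (auto intro!: DERIV_mult)
 moreover have "smooth_alg (%x. deriv f x * g x + deriv g x * f x)"
  using prod by (auto intro!: smooth_alg.intros smooth_deriv)
 ultimately show ?case by (intro exI[of _ "%x. deriv f x * g x + deriv g x * f x"]) simp
next
 case (sum f g)
 then obtain f' g' where 1: "!!x. (f has_real_derivative f' x) (at x)" "smooth_alg f'"
  "!!x. (g has_real_derivative g' x) (at x)" "smooth_alg g'" by blast
 have "\<forall>x. ((%x. f x + g x) has_real_derivative (f' x + g' x)) (at x)"
  using 1 by (auto intro!: DERIV_add)
 thus ?case using smooth_alg.sum[OF 1(2,4)] by (intro exI[of _ "%x. f' x + g' x"]) simp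
qed

lemma smooth_mult: "smooth f ==> smooth g ==> smooth (%x. f x * g x)"
 by (rule smooth_coinduct[where P = smooth_alg, OF smooth_alg.prod]) (auto dest: smooth_alg_derivative)

lemma smooth_const [simp]: "smooth (%x. c)"
 by (rule smooth_coinduct[where P = "%h. \<exists>c. h = (%x. c)"]) (auto intro!: exI[of _ "%x. 0::real"])

lemma smooth_add:
 assumes "smooth f" "smooth g" shows "smooth (%x. f x + g x)"
proof -
 have "smooth_alg (%x. f x * 1 + g x * 1)" by (intro smooth_alg.intros assms smooth_const)
 hence "smooth (%x. f x * 1 + g x * 1)"
  by (rule smooth_coinduct[where P = smooth_alg]) (auto dest: smooth_alg_derivative)
 thus ?thesis by simp
qed

lemma smooth_cmult: "smooth f ==> smooth (%x. c * f x)"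
 by (rule smooth_mult) simp_all

lemma smooth_diff:
 assumes "smooth f" "smooth g" shows "smooth (%x. f x - g x)"
 using smooth_add[OF assms(1) smooth_cmult[OF assms(2), of "-1"]] by simp

lemma smooth_affine:
 assumes "smooth f" shows "smooth (%x. f (c * x + d))"
proof (rule smooth_coinduct[where P = "%h. \<exists>g k. smooth g & h = (%x. k * g (c * x + d))"])
 show "\<exists>g k. smooth g & (%x. f (c * x + d)) = (%x. k * g (c * x + d))"
  by (intro exI[of _ f] exI[of _ 1]) (use assms in auto)
 fix h assume "\<exists>g k. smooth g & h = (%x. k * g (c * x + d))"
 then obtain g k where g: "smooth g" "h = (%x. k * g (c * x + d))" by blast
 have "(h has_real_derivative k * c * deriv g (c * x + d)) (at x)" for x
  unfolding g(2) by (rule derivative_eq_intros DERIV_chain2[OF smooth_has_derivative[OF g(1)]] refl | simp)+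
 thus "\<exists>h'. (\<forall>x. (h has_real_derivative h' x) (at x)) & (\<exists>g k. smooth g & h' = (%x. k * g (c * x + d)))"
  using smooth_deriv[OF g(1)] by (intro exI[of _ "%x. k * c * deriv g (c * x + d)"] conjI allI exI[of _ "deriv g"] exI[of _ "k * c"]) auto
qed

lemma poly_times_exp_tendsto_0: "((%y::real. poly p y * exp (- y)) \<longlongrightarrow> 0) at_top"
proof -
 have "((%y::real. coeff p i * (y ^ i / exp y)) \<longlongrightarrow> coeff p i * 0) at_top" for i
  by (intro tendsto_mult tendsto_const tendsto_power_div_exp_0)
 hence "((%y::real. \<Sum>i\<le>degree p. coeff p i * (y ^ i / exp y)) \<longlongrightarrow> (\<Sum>i\<le>degree p. coeff p i * 0)) at_top"
  by (intro tendsto_sum)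
 moreover have "(%y::real. \<Sum>i\<le>degree p. coeff p i * (y ^ i / exp y)) = (%y. poly p y * exp (- y))"
  by (simp add: poly_altdef exp_minus sum_divide_distrib divide_inverse sum_distrib_right mult.assoc)
 ultimately show ?thesis by simp
qed

text \<open>The classical flat function: each derivative is a polynomial in \<open>1/x\<close> times
 \<open>exp (-1/x)\<close>, hence tends to zero at the origin.\<close>

lemma smooth_flat: "smooth (%x. if x > 0 then exp (- (1 / x)) else 0)"
proof (rule smooth_coinduct[where P = "%h. \<exists>p. h = (%x. if x > 0 then poly p (1 / x) * exp (- (1 / x)) else 0)"])
 show "\<exists>p. (%x::real. if x > 0 then exp (- (1 / x)) else 0) = (%x. if x > 0 then poly p (1 / x) * exp (- (1 / x)) else 0)"
  by (intro exI[of _ 1]) auto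
 fix h :: "real => real"
 assume "\<exists>p. h = (%x. if x > 0 then poly p (1 / x) * exp (- (1 / x)) else 0)"
 then obtain p where h: "h = (%x. if x > 0 then poly p (1 / x) * exp (- (1 / x)) else 0)" by blast
 define q where "q = [:0, 0, 1:] * (p - pderiv p)"
 have "(h has_real_derivative (if x > 0 then poly q (1 / x) * exp (- (1 / x)) else 0)) (at x)" for x
 proof -
  consider "x > 0" | "x < 0" | "x = 0" by linarith
  thus ?thesis
  proof cases
   case 1
   have "((%x. poly p (1 / x) * exp (- (1 / x))) has_real_derivative poly q (1 / x) * exp (- (1 / x))) (at x)"
    using 1 by (auto intro!: derivative_eq_intros DERIV_chain2[OF poly_DERIV] simp: q_def field_simps power2_eq_square)
   moreover have "\<forall>\<^sub>F y in nhds x. y > 0" using 1 by (auto simp: eventually_nhds intro!: exI[of _ "{0<..}"])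
   hence "\<forall>\<^sub>F y in nhds x. h y = poly p (1 / y) * exp (- (1 / y))"
    by eventually_elim (simp add: h)
   ultimately show ?thesis using 1 by (simp add: DERIV_cong_ev)
  next
   case 2
   have "\<forall>\<^sub>F y in nhds x. y < 0" using 2 by (auto simp: eventually_nhds intro!: exI[of _ "{..<0}"])
   hence "\<forall>\<^sub>F y in nhds x. h y = (%y. 0) y" by eventually_elim (simp add: h)
   hence "(h has_real_derivative 0) (at x)" by (subst DERIV_cong_ev[OF refl _ refl]) auto
   thus ?thesis using 2 by simp
  next
   case 3
   have "((%y. poly (pCons 0 p) (inverse y) * exp (- inverse y)) \<longlongrightarrow> 0) (at_right 0)"
    using filterlim_compose[OF poly_times_exp_tendsto_0 filterlim_inverse_at_top_right] .
   moreover have "\<forall>\<^sub>F y in at_right 0. poly (pCons 0 p) (inverse y) * exp (- inverse y) = (h y - h 0) / (y - 0)"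
    unfolding eventually_at_right_field by (intro exI[of _ 1]) (auto simp: h field_simps)
   ultimately have r: "((%y. (h y - h 0) / (y - 0)) \<longlongrightarrow> 0) (at_right 0)"
    by (rule Lim_transform_eventually)
   have "\<forall>\<^sub>F y in at_left 0. 0 = (h y - h 0) / (y - 0)"
    unfolding eventually_at_left_field by (intro exI[of _ "-1"]) (auto simp: h)
   hence l: "((%y. (h y - h 0) / (y - 0)) \<longlongrightarrow> 0) (at_left 0)"
    by (rule Lim_transform_eventually[OF tendsto_const])
   have "((%y. (h y - h 0) / (y - 0)) \<longlongrightarrow> 0) (at 0)" using l r by (simp add: filterlim_at_split)
   hence "(h has_real_derivative 0) (at 0)" by (simp add: has_field_derivative_iff)
   thus ?thesis using 3 by simp
  qed
 qed
 thus "\<exists>h'. (\<forall>x. (h has_real_derivative h' x) (at x)) &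
   (\<exists>p. h' = (%x. if x > 0 then poly p (1 / x) * exp (- (1 / x)) else 0))"
  by (intro exI[of _ "%x. if x > 0 then poly q (1 / x) * exp (- (1 / x)) else 0"]) blast
qed

lemma integral_support:
 fixes f :: "real => real"
 assumes "!!x. x \<notin> {p..q} ==> f x = 0" "A <= p" "q <= B"
 shows "integral {A..B} f = integral {p..q} f"
proof -
 have "integral {A..B} f = integral {A..B} (%x. if x \<in> {p..q} then f x else 0)"
  by (rule integral_cong) (use assms(1) in auto)
 also have "\<dots> = integral ({p..q} \<inter> {A..B}) f" by (rule integral_restrict_Int)
 also have "{p..q} \<inter> {A..B} = {p..q}" using assms by auto
 finally show ?thesis .
qed

lemma smooth_primitive:
 assumes g: "smooth g" and supp: "!!x. x \<notin> {p..q} ==> g x = 0" and pq: "p <= q"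
 obtains G where "smooth G" "!!x. (G has_real_derivative g x) (at x)"
  "!!x. x <= p ==> G x = 0" "!!x. q <= x ==> G x = integral {p..q} g"
proof -
 define G where "G x = integral {p - 1..x} g" for x
 have gi: "g integrable_on {a..b}" for a b
  by (rule integrable_continuous_real[OF smooth_continuous[OF g]])
 have g0: "g x = 0" if "x <= p" for x
 proof -
  have "continuous_on {p - 1..p} g" using smooth_continuous[OF g] .
  hence "g p = 0"
  proof -
   have "(g \<longlongrightarrow> g p) (at_left p)"
    using smooth_has_derivative[OF g, of p] DERIV_isCont isCont_def filterlim_at_split by blast
   moreover have "(g \<longlongrightarrow> 0) (at_left p)"
    by (rule tendsto_eventually) (auto simp: eventually_at_left_field supp intro!: exI[of _ "p - 1"])
   ultimately show ?thesis using tendsto_unique trivial_limit_at_left_real by blast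
  qed
  thus ?thesis using that supp[of x] by (cases "x = p") auto
 qed
 have G0: "G x = 0" if "x <= p" for x
  unfolding G_def using g0 that by (subst integral_cong[where g = "%x. 0"]) auto
 have D: "(G has_real_derivative g x) (at x)" for x
 proof (cases "x < p")
  case True
  hence "\<forall>\<^sub>F y in nhds x. G y = (%y. 0) y"
   using G0 by (auto simp: eventually_nhds intro!: exI[of _ "{..<p}"])
  hence "(G has_real_derivative 0) (at x)" by (subst DERIV_cong_ev[OF refl _ refl]) auto
  thus ?thesis using g0 True by simp
 next
  case False
  have "(G has_real_derivative g x) (at x within {p - 1..x + 1})"
   unfolding G_def by (rule integral_has_real_derivative[OF smooth_continuous[OF g]]) (use False in auto)
  moreover have "x \<in> interior {p - 1..x + 1}" using False by simp
  ultimately show ?thesis using at_within_interior by metis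
 qed
 have Gq: "G x = integral {p..q} g" if "q <= x" for x
  unfolding G_def by (rule integral_support[OF supp]) (use that in auto)
 show ?thesis using that[OF smooth_primitive_smooth[OF D g] D G0 Gq] .
qed

text \<open>Each approximation is a product of two rescaled flat functions, one for each end point.
Convergence holds at every point, which allows to pass to the limit under any finite measure,
atoms included.\<close>

lemma smooth_indicator_approx:
 fixes p q :: real
 obtains \<zeta> :: "nat => real => real" where "!!n. smooth (\<zeta> n)" "!!n x. 0 <= \<zeta> n x" "!!n x. \<zeta> n x <= 1"
  "!!n x. x \<notin> {p<..<q} ==> \<zeta> n x = 0" "!!x. (%n. \<zeta> n x) ----> indicator {p<..<q} x"
  "!!n. \<exists>r s. p < r & s < q & (\<forall>x. x \<notin> {r..s} --> \<zeta> n x = 0)"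
proof -
 define E :: "real => real" where "E x = (if x > 0 then exp (- (1 / x)) else 0)" for x
 define \<zeta> where "\<zeta> n x = E (real n * x + (- 1 - real n * p)) * E (- real n * x + (real n * q - 1))" for n x
 have E: "0 <= E x" "E x <= 1" for x by (auto simp: E_def)
 have z: "\<zeta> n x = 0" if "n = 0 \<or> x < p + 1 / real n \<or> q - 1 / real n < x" for n x
 proof (cases "n = 0")
  case False
  hence "real n * x < real n * (p + 1 / real n) \<or> real n * (q - 1 / real n) < real n * x" using that by simp
  thus ?thesis using False by (auto simp: \<zeta>_def E_def algebra_simps)
 qed (simp add: \<zeta>_def E_def)
 have out: "\<zeta> n x = 0" if "x \<notin> {p<..<q}" for n x
 proof (rule z)
  have "n ~= 0 ==> 0 < 1 / real n" by simp
  moreover have "x <= p \<or> q <= x" using that by auto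
  ultimately show "n = 0 \<or> x < p + 1 / real n \<or> q - 1 / real n < x" by linarith
 qed
 have lim: "(%n. E (c * real n - 1)) ----> 1" if "0 < c" for c
 proof -
  have top: "filterlim (%n. c * real n - 1) at_top sequentially" using that by real_asymp
  hence "(%n. exp (- (1 / (c * real n - 1)))) ----> 1" using that by real_asymp
  moreover have "\<forall>\<^sub>F n in sequentially. 0 < c * real n - 1" using top unfolding filterlim_at_top_dense by blast
  hence "\<forall>\<^sub>F n in sequentially. exp (- (1 / (c * real n - 1))) = E (c * real n - 1)"
   by eventually_elim (simp add: E_def)
  ultimately show ?thesis by (rule Lim_transform_eventually)
 qed
 have conv: "(%n. \<zeta> n x) ----> indicator {p<..<q} x" for x
 proof (cases "x \<in> {p<..<q}")
  case True
  hence "(%n. E ((x - p) * real n - 1) * E ((q - x) * real n - 1)) ----> 1 * 1" by (intro tendsto_mult lim) auto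
  thus ?thesis using True by (simp add: \<zeta>_def algebra_simps)
 qed (simp add: out)
 have "\<exists>r s. p < r & s < q & (\<forall>x. x \<notin> {r..s} --> \<zeta> n x = 0)" for n
  by (rule exI[of _ "if n = 0 then p + 1 else p + 1 / real n"], rule exI[of _ "if n = 0 then q - 1 else q - 1 / real n"])
   (auto intro!: z)
 moreover have "smooth (\<zeta> n)" for n
  unfolding \<zeta>_def by (intro smooth_mult smooth_affine) (simp_all add: E_def[abs_def] smooth_flat)
 ultimately show ?thesis using E out conv by (intro that[of \<zeta>]) (auto simp: \<zeta>_def intro: mult_le_one)
qed

section \<open>Weak derivatives\<close>

lemma AE_lebesgue_on_iff_negligible:
 assumes "S \<in> sets lebesgue"
 shows "(AE x in lebesgue_on S. P x) \<longleftrightarrow> negligible {x \<in> S. \<not> P x}"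
proof -
 have "(AE x in lebesgue_on S. P x) \<longleftrightarrow> (AE x in lebesgue. x \<in> S --> P x)"
  using assms by (subst AE_restrict_space_iff) auto
 also have "\<dots> \<longleftrightarrow> negligible {x \<in> S. \<not> P x}"
  unfolding eventually_ae_filter_negligible by (auto intro: negligible_subset)
 finally show ?thesis .
qed

lemma negligible_if_on_compact_intervals:
 fixes S :: "real set"
 assumes "open S" and "!!p q. p <= q ==> {p..q} \<subseteq> S ==> negligible {x \<in> {p..q}. P x}"
 shows "negligible {x \<in> S. P x}"
proof -
 define I where "I = {(r, s). r \<in> \<rat> & s \<in> \<rat> & r <= s & {r..s} \<subseteq> S}"
 have "countable I"
  by (rule countable_subset[of _ "\<rat> \<times> \<rat>"]) (auto simp: I_def countable_rat)
 hence "negligible (\<Union>((%(r, s). {x \<in> {r..s}. P x}) ` I))"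
 proof (intro negligible_countable_Union countable_image)
  fix T assume "T \<in> (%(r, s). {x \<in> {r..s}. P x}) ` I"
  then obtain r s where "(r, s) \<in> I" "T = {x \<in> {r..s}. P x}" by auto
  thus "negligible T" using assms(2)[of r s] by (simp add: I_def)
 qed
 moreover have "{x \<in> S. P x} \<subseteq> (\<Union>((%(r, s). {x \<in> {r..s}. P x}) ` I))"
 proof
  fix x assume x: "x \<in> {x \<in> S. P x}"
  then obtain e where e: "e > 0" "cball x e \<subseteq> S" using assms(1) open_contains_cball by blast
  obtain r where r: "r \<in> \<rat>" "x - e < r" "r < x" using Rats_dense_in_real[of "x - e" x] e by auto
  obtain s where s: "s \<in> \<rat>" "x < s" "s < x + e" using Rats_dense_in_real[of x "x + e"] e by auto
  have "{r..s} \<subseteq> S" using r s e(2) by (auto simp: dist_real_def subset_iff)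
  thus "x \<in> (\<Union>((%(r, s). {x \<in> {r..s}. P x}) ` I))"
   using r s x by (intro UN_I[of "(r, s)"]) (auto simp: I_def)
 qed
 ultimately show ?thesis by (rule negligible_subset)
qed

text \<open>The positive and the negative part of \<open>h\<close> have densities that agree on all intervals, hence
define the same measure.\<close>

lemma zero_on_intervals_imp_zero_ae:
 fixes h :: "real => real"
 assumes h: "h absolutely_integrable_on {A..B}"
  and z: "!!p q. A <= p ==> p <= q ==> q <= B ==> integral {p..q} h = 0"
 shows "negligible {x \<in> {A..B}. h x ~= 0}"
proof -
 define f where "f x = indicator {A..B} x * h x" for x
 have fi: "integrable lebesgue f" using h by (simp add: f_def[abs_def] set_integrable_def)
 hence "f \<in> borel_measurable (completion lborel)" by auto
 then obtain g where g: "g \<in> borel_measurable lborel" "AE x in lborel. f x = g x"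
  using completion_ex_borel_measurable_real by blast
 have gae: "AE x in lebesgue. g x = f x"
  using AE_completion[OF g(2)] by eventually_elim simp
 have gi: "integrable lborel g"
 proof -
  have "integrable lebesgue g"
   using fi gae g(1) by (intro Bochner_Integration.integrable_cong_AE[THEN iffD1, OF _ _ _ fi])
    (auto intro: measurable_completion elim: AE_mp)
  thus ?thesis using g(1) integrable_completion by blast
 qed
 have gb[measurable]: "g \<in> borel_measurable borel" using g(1) by simp
 have half: "(\<integral>t. indicator {x<..} t * g t \<partial>lborel) = 0" for x
 proof -
  have fx: "integrable lebesgue (%t. indicator {x<..} t *\<^sub>R f t)" by (rule integrable_mult_indicator[OF _ fi]) simp
  have "(\<integral>t. indicator {x<..} t * g t \<partial>lborel) = (\<integral>t. indicator {x<..} t * g t \<partial>lebesgue)"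
   by (simp add: integral_completion)
  also have "\<dots> = (\<integral>t. indicator {x<..} t *\<^sub>R f t \<partial>lebesgue)"
  proof (rule integral_cong_AE)
   show "(%t. indicator {x<..} t * g t) \<in> borel_measurable lebesgue" by (intro measurable_completion) measurable
   show "AE t in lebesgue. indicator {x<..} t * g t = indicator {x<..} t *\<^sub>R f t" using gae by eventually_elim simp
  qed (use fx in auto)
  also have "\<dots> = set_lebesgue_integral lebesgue {A..B} (%t. indicator {x<..} t * h t)"
   by (simp add: set_lebesgue_integral_def f_def mult_ac)
  also have "\<dots> = integral {A..B} (%t. indicator {x<..} t * h t)"
   by (rule set_lebesgue_integral_eq_integral(2)) (use fx in \<open>simp add: set_integrable_def f_def mult_ac\<close>)
  also have "\<dots> = integral {A..B} (%t. if t \<in> {max A x..B} then h t else 0)"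
   by (rule integral_spike[of "{x}"]) (auto simp: indicator_def)
  also have "\<dots> = integral ({max A x..B} \<inter> {A..B}) h" by (rule integral_restrict_Int)
  also have "{max A x..B} \<inter> {A..B} = {max A x..B}" by auto
  also have "integral {max A x..B} h = 0" using z[of "max A x" B] by (cases "max A x <= B") auto
  finally show ?thesis .
 qed
 have "density lborel (%x. ennreal (g x)) = density lborel (%x. ennreal (- g x))"
 proof (rule measure_eqI_lessThan)
  fix x :: real
  have si: "integrable lborel (%t. indicator {x<..} t * g t)"
   using integrable_mult_indicator[OF _ gi, of "{x<..}"] by simp
  have e: "emeasure (density lborel (%x. ennreal (s * g x))) {x<..} = (\<integral>\<^sup>+t. ennreal (s * (indicator {x<..} t * g t)) \<partial>lborel)" for s
   by (subst emeasure_density) (auto intro!: nn_integral_cong simp: indicator_def)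
  have fin: "(\<integral>\<^sup>+t. ennreal (indicator {x<..} t * g t) \<partial>lborel) < \<infinity>"
   "(\<integral>\<^sup>+t. ennreal (- (indicator {x<..} t * g t)) \<partial>lborel) < \<infinity>"
   using si real_integrable_def[of lborel "%t. indicator {x<..} t * g t"] by (auto simp: less_top)
  show "emeasure (density lborel (%x. ennreal (g x))) {x<..} < \<infinity>" using e[of 1] fin by simp
  show "emeasure (density lborel (%x. ennreal (g x))) {x<..} = emeasure (density lborel (%x. ennreal (- g x))) {x<..}"
   using real_lebesgue_integral_def[OF si, unfolded half] fin
   unfolding e[of 1, unfolded mult_1] e[of "- 1", unfolded mult_minus1]
   by (metis ennreal_enn2real infinity_ennreal_def right_minus_eq)
 qed simp_all
 hence "AE x in lborel. ennreal (g x) = ennreal (- g x)" by (intro sigma_finite_measure.density_unique[OF sigma_finite_lborel]) simp_all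
 hence "AE x in lborel. f x = 0" using g(2)
 proof eventually_elim
  case (elim x) thus ?case by (cases "0 <= g x") (auto simp: ennreal_neg)
 qed
 hence "AE x in lebesgue. f x = 0" by (rule AE_completion)
 thus ?thesis
  unfolding eventually_ae_filter_negligible
  by (auto simp: f_def indicator_def intro: negligible_subset)
qed

lemma test_fun_iff: "test_fun S \<eta> \<longleftrightarrow> smooth \<eta> & (\<exists>K. compact K & K \<subseteq> S & (\<forall>x. x \<notin> K --> \<eta> x = 0))"
 by (simp add: test_fun_def smooth_def)

lemma test_funI: "smooth \<eta> ==> {p..q} \<subseteq> S ==> (!!x. x \<notin> {p..q} ==> \<eta> x = 0) ==> test_fun S \<eta>"
 unfolding test_fun_iff by (blast intro: compact_Icc)

lemma compact_subset_interval:
 fixes S :: "real set"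
 assumes "compact K" "K \<subseteq> S" "convex S" "S ~= {}"
 obtains p q where "p <= q" "{p..q} \<subseteq> S" "K \<subseteq> {p..q}"
proof (cases "K = {}")
 case True
 obtain x where "x \<in> S" using assms(4) by blast
 thus ?thesis using that[of x x] True by auto
next
 case False
 obtain p where p: "p \<in> K" "!!x. x \<in> K ==> p <= x" using compact_attains_inf[OF assms(1) False] by blast
 obtain q where q: "q \<in> K" "!!x. x \<in> K ==> x <= q" using compact_attains_sup[OF assms(1) False] by blast
 have "closed_segment p q \<subseteq> S" using p(1) q(1) assms(2,3) by (intro closed_segment_subset) auto
 moreover have pq: "p <= q" using p(1) q(2) by blast
 ultimately have "{p..q} \<subseteq> S" by (simp add: closed_segment_eq_real_ivl)
 moreover have "K \<subseteq> {p..q}" using p(2) q(2) by auto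
 ultimately show ?thesis using that[of p q] pq by blast
qed

lemma test_fun_support:
 assumes "test_fun S \<eta>" "convex S" "S ~= {}"
 obtains p q where "p <= q" "{p..q} \<subseteq> S" "smooth \<eta>" "!!x. x \<notin> {p..q} ==> \<eta> x = 0"
proof -
 obtain K where K: "compact K" "K \<subseteq> S" "!!x. x \<notin> K ==> \<eta> x = 0" and s: "smooth \<eta>"
  using assms(1) unfolding test_fun_iff by blast
 obtain p q where "p <= q" "{p..q} \<subseteq> S" "K \<subseteq> {p..q}" using compact_subset_interval[OF K(1,2) assms(2,3)] .
 thus ?thesis using that[of p q] K(3) s by blast
qed

lemma zero_off_open_interval:
 fixes \<eta> :: "real => real"
 assumes "smooth \<eta>" "!!x. x \<notin> {p..q} ==> \<eta> x = 0" "x \<notin> {p<..<q}"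
 shows "\<eta> x = 0"
proof -
 have cl: "closed {x. \<eta> x = 0}"
  by (intro closed_Collect_eq smooth_continuous[OF assms(1)] continuous_on_const)
 have "{q<..} \<subseteq> {x. \<eta> x = 0}" "{..<p} \<subseteq> {x. \<eta> x = 0}" using assms(2) by auto
 hence "closure {q<..} \<subseteq> {x. \<eta> x = 0}" "closure {..<p} \<subseteq> {x. \<eta> x = 0}"
  using closure_minimal[OF _ cl] by blast+
 thus ?thesis using assms(3) by (auto simp: subset_iff)
qed

lemma deriv_zero_off_support:
 assumes "!!x. x \<notin> {p..q::real} ==> \<eta> x = (0::real)" "x \<notin> {p..q}"
 shows "deriv \<eta> x = 0"
proof -
 have "\<forall>\<^sub>F y in nhds x. \<eta> y = (%y. 0) y"
  using assms by (auto simp: eventually_nhds intro!: exI[of _ "- {p..q}"] open_Compl)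
 hence "(\<eta> has_real_derivative 0) (at x)" by (subst DERIV_cong_ev[OF refl _ refl]) auto
 thus ?thesis by (rule DERIV_imp_deriv)
qed

lemma integrable_lebesgue_on_iff:
 fixes F :: "real => real"
 assumes "S \<in> sets lebesgue"
 shows "integrable (lebesgue_on S) F \<longleftrightarrow> F absolutely_integrable_on S"
 using assms by (simp add: integrable_restrict_space set_integrable_def)

lemma L1_loc_abs_integrable: "L1_loc S h ==> {p..q} \<subseteq> S ==> h absolutely_integrable_on {p..q}"
 unfolding L1_loc_def using integrable_lebesgue_on_iff[of "{p..q}" h] by auto

lemma LINT_support:
 fixes F :: "real => real"
 assumes "{p..q} \<subseteq> S" "S \<in> sets lebesgue" "!!x. x \<notin> {p..q} ==> F x = 0" "F absolutely_integrable_on {p..q}"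
 shows "(\<integral>x. F x \<partial>lebesgue_on S) = integral {p..q} F" "integrable (lebesgue_on S) F"
proof -
 have eq: "indicator S x * F x = indicator {p..q} x * F x" for x
  using assms(1,3) by (auto simp: indicator_def)
 show "integrable (lebesgue_on S) F"
  using assms(2,4) by (simp add: integrable_restrict_space set_integrable_def eq)
 have "(\<integral>x. F x \<partial>lebesgue_on S) = (\<integral>x. indicator {p..q} x *\<^sub>R F x \<partial>lebesgue)"
  using assms(2) by (simp add: integral_restrict_space eq)
 also have "\<dots> = integral {p..q} F"
  using set_lebesgue_integral_eq_integral(2)[OF assms(4)] by (simp add: set_lebesgue_integral_def)
 finally show "(\<integral>x. F x \<partial>lebesgue_on S) = integral {p..q} F" .
qed

lemma smooth_times_abs_integrable:
 assumes "smooth \<zeta>" "h absolutely_integrable_on {p..q}"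
 shows "(%x. h x * \<zeta> x) absolutely_integrable_on {p..q}"
 using abs_integrable_mult_continuous[OF smooth_continuous[OF assms(1)] assms(2)] by (simp add: mult.commute)

lemma indicator_approx_integral:
 fixes h :: "real => real"
 assumes h: "h absolutely_integrable_on {p..q}"
  and \<zeta>: "!!n. smooth (\<zeta> n)" "!!n x. 0 <= \<zeta> n x" "!!n x. \<zeta> n x <= 1"
   "!!x. (%n. \<zeta> n x) ----> indicator {p<..<q} x"
 shows "(%n. integral {p..q} (%x. h x * \<zeta> n x)) ----> integral {p..q} h"
proof -
 have "(%n. integral {p..q} (%x. h x * \<zeta> n x)) ----> integral {p..q} (%x. h x * indicator {p<..<q} x)"
 proof (rule dominated_convergence(2)[where h = "%x. \<bar>h x\<bar>"])
  show "(%x. h x * \<zeta> n x) integrable_on {p..q}" for n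
   using smooth_times_abs_integrable[OF \<zeta>(1) h] by (simp add: absolutely_integrable_on_def)
  show "(%x. \<bar>h x\<bar>) integrable_on {p..q}" using h by (simp add: absolutely_integrable_on_def)
  show "norm (h x * \<zeta> n x) <= \<bar>h x\<bar>" for n x
   using \<zeta>(2,3)[of n x] by (simp add: abs_mult mult_left_le)
  show "(%n. h x * \<zeta> n x) ----> h x * indicator {p<..<q} x" for x
   by (intro tendsto_mult tendsto_const \<zeta>(4))
 qed
 moreover have "integral {p..q} (%x. h x * indicator {p<..<q} x) = integral {p..q} h"
  by (rule integral_spike[of "{p, q}"]) (auto simp: indicator_def)
 ultimately show ?thesis by simp
qed

lemma fundamental_lemma:
 fixes d :: "real => real"
 assumes S: "open S" and d: "!!p q. {p..q} \<subseteq> S ==> d absolutely_integrable_on {p..q}"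
  and z: "!!\<eta>. test_fun S \<eta> ==> (\<integral>x. d x * \<eta> x \<partial>lebesgue_on S) = 0"
 shows "negligible {x \<in> S. d x ~= 0}"
proof (rule negligible_if_on_compact_intervals[OF S])
 have Sl: "S \<in> sets lebesgue" using borel_open[OF S] by simp
 fix A B :: real assume AB: "A <= B" "{A..B} \<subseteq> S"
 show "negligible {x \<in> {A..B}. d x ~= 0}"
 proof (rule zero_on_intervals_imp_zero_ae[OF d[OF AB(2)]])
  fix p q assume pq: "A <= p" "p <= q" "q <= B"
  show "integral {p..q} d = 0"
  proof (cases "p = q")
   case False
   hence "p < q" using pq by simp
   obtain \<zeta> :: "nat => real => real" where \<zeta>: "!!n. smooth (\<zeta> n)" "!!n x. 0 <= \<zeta> n x" "!!n x. \<zeta> n x <= 1"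
    "!!n x. x \<notin> {p<..<q} ==> \<zeta> n x = 0" "!!x. (%n. \<zeta> n x) ----> indicator {p<..<q} x"
    by (rule smooth_indicator_approx) (rule that)
   have sub: "{p..q} \<subseteq> S" using pq AB by auto
   have "integral {p..q} (%x. d x * \<zeta> n x) = 0" for n
   proof -
    have 0: "\<zeta> n x = 0" if "x \<notin> {p..q}" for x using that by (intro \<zeta>(4)) auto
    have "test_fun S (\<zeta> n)" by (rule test_funI[OF \<zeta>(1) sub 0])
    hence "(\<integral>x. d x * \<zeta> n x \<partial>lebesgue_on S) = 0" by (rule z)
    moreover have "(\<integral>x. d x * \<zeta> n x \<partial>lebesgue_on S) = integral {p..q} (%x. d x * \<zeta> n x)"
     using 0 by (intro LINT_support(1)[OF sub Sl]) (auto intro: smooth_times_abs_integrable[OF \<zeta>(1) d[OF sub]])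
    ultimately show ?thesis by simp
   qed
   hence "(%n. 0) ----> integral {p..q} d"
    using indicator_approx_integral[OF d[OF sub] \<zeta>(1-3,5)] by simp
   thus ?thesis using LIMSEQ_unique[OF tendsto_const] by metis
  qed simp
 qed
qed

text \<open>Every test function \<open>\<eta>\<close> becomes the derivative of a test function after subtracting a multiple
of a fixed test function of integral one, so the fundamental lemma applies to \<open>h\<close> minus a
constant.\<close>

lemma du_Bois_Reymond:
 fixes h :: "real => real"
 assumes S: "open S" "convex S" "S ~= {}" and h: "!!p q. {p..q} \<subseteq> S ==> h absolutely_integrable_on {p..q}"
  and z: "!!\<eta>. test_fun S \<eta> ==> (\<integral>x. h x * deriv \<eta> x \<partial>lebesgue_on S) = 0"
 obtains c where "negligible {x \<in> S. h x ~= c}"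
proof -
 obtain x0 where "x0 \<in> S" using S by blast
 then obtain e where e: "e > 0" "cball x0 e \<subseteq> S" using S(1) open_contains_cball by blast
 define p where "p = x0 - e"
 define q where "q = x0 + e"
 have pq: "p < q" "{p..q} \<subseteq> S" using e by (auto simp: p_def q_def dist_real_def subset_iff)
 obtain \<zeta> :: "nat => real => real" where \<zeta>: "!!n. smooth (\<zeta> n)" "!!n x. 0 <= \<zeta> n x" "!!n x. \<zeta> n x <= 1"
   "!!n x. x \<notin> {p<..<q} ==> \<zeta> n x = 0" "!!x. (%n. \<zeta> n x) ----> indicator {p<..<q} x"
  by (rule smooth_indicator_approx) (rule that)
 have "(%n. integral {p..q} (\<zeta> n)) ----> q - p"
  using indicator_approx_integral[where h = "%x. 1" and p = p and q = q, OF _ \<zeta>(1-3,5)] pq(1) by simp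
 hence "\<forall>\<^sub>F n in sequentially. 0 < integral {p..q} (\<zeta> n)" using pq(1) by (intro order_tendstoD) auto
 then obtain n where "0 < integral {p..q} (\<zeta> n)" using eventually_happens by force
 moreover have "\<zeta> n x = 0" if "x \<notin> {p..q}" for x using that by (intro \<zeta>(4)) auto
 ultimately obtain \<psi> I where \<psi>: "smooth \<psi>" "!!x. x \<notin> {p..q} ==> \<psi> x = 0" and I: "I = integral {p..q} \<psi>" "0 < I"
  using \<zeta>(1)[of n] by blast
 define c where "c = integral {p..q} (%x. h x * \<psi> x) / I"
 have "negligible {x \<in> S. h x - c ~= 0}"
 proof (rule fundamental_lemma[OF S(1)])
  show "(%x. h x - c) absolutely_integrable_on {p..q}" if "{p..q} \<subseteq> S" for p q
   by (intro set_integral_diff h that) simp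
  fix \<eta> assume \<eta>: "test_fun S \<eta>"
  obtain r s where rs: "r <= s" "{r..s} \<subseteq> S" "smooth \<eta>" "!!x. x \<notin> {r..s} ==> \<eta> x = 0"
   by (rule test_fun_support[OF \<eta> S(2,3)]) (rule that)
  define A where "A = min p r"
  define B where "B = max q s"
  have AB: "A <= B" "A <= p" "A <= r" "q <= B" "s <= B" using pq rs(1) by (auto simp: A_def B_def)
  have "A \<in> S" "B \<in> S" using pq rs(1,2) by (auto simp: A_def B_def min_def max_def)
  hence "closed_segment A B \<subseteq> S" using S(2) by (rule closed_segment_subset)
  hence ABS: "{A..B} \<subseteq> S" using AB(1) by (simp add: closed_segment_eq_real_ivl)
  have \<eta>0: "\<eta> x = 0" if "x \<notin> {A..B}" for x using rs(4)[of x] that AB by auto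
  have \<psi>0: "\<psi> x = 0" if "x \<notin> {A..B}" for x using \<psi>(2)[of x] that AB by auto
  define J where "J = integral {A..B} \<eta>"
  \<comment> \<open>Subtracting a multiple of \<open>\<psi>\<close> makes \<open>\<eta>\<close> the derivative of a test function.\<close>
  define g where "g x = \<eta> x - J / I * \<psi> x" for x
  have sg: "smooth g" unfolding g_def by (intro smooth_diff smooth_cmult rs(3) \<psi>(1))
  have g0: "g x = 0" if "x \<notin> {A..B}" for x using that by (simp add: g_def \<eta>0 \<psi>0)
  have lin: "integral {A..B} (%x. w x * g x) = integral {A..B} (%x. w x * \<eta> x) - J / I * integral {p..q} (%x. w x * \<psi> x)"
   if w: "w absolutely_integrable_on {A..B}" for w
  proof -
   have i: "(%x. w x * \<eta> x) integrable_on {A..B}" "(%x. w x * \<psi> x) integrable_on {A..B}"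
    using smooth_times_abs_integrable[OF rs(3) w] smooth_times_abs_integrable[OF \<psi>(1) w]
    by (auto simp: absolutely_integrable_on_def)
   have "integral {A..B} (%x. w x * g x) = integral {A..B} (%x. w x * \<eta> x - J / I * (w x * \<psi> x))"
    by (simp add: g_def algebra_simps)
   also have "\<dots> = integral {A..B} (%x. w x * \<eta> x) - J / I * integral {A..B} (%x. w x * \<psi> x)"
    using i by (subst Henstock_Kurzweil_Integration.integral_diff[OF _ integrable_on_mult_right]) auto
   also have "integral {A..B} (%x. w x * \<psi> x) = integral {p..q} (%x. w x * \<psi> x)"
    by (rule integral_support) (use \<psi>(2) AB in auto)
   finally show ?thesis .
  qed
  have Ig: "integral {A..B} g = 0" using lin[of "%x. 1"] I by (simp add: J_def)
  obtain G where G: "smooth G" "!!x. (G has_real_derivative g x) (at x)"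
   "!!x. x <= A ==> G x = 0" "!!x. B <= x ==> G x = integral {A..B} g"
   by (rule smooth_primitive[OF sg g0 AB(1)]) (assumption, rule that)
  have dG: "deriv G = g" using G(2) by (auto intro!: ext DERIV_imp_deriv)
  have "test_fun S G" by (rule test_funI[OF G(1) ABS]) (use G(3,4) Ig in auto)
  hence "(\<integral>x. h x * g x \<partial>lebesgue_on S) = 0" using z[of G] by (simp add: dG)
  moreover have "(\<integral>x. h x * g x \<partial>lebesgue_on S) = integral {A..B} (%x. h x * g x)"
   by (rule LINT_support(1)[OF ABS]) (use g0 S in \<open>auto intro: smooth_times_abs_integrable[OF sg h[OF ABS]]\<close>)
  ultimately have "integral {A..B} (%x. h x * \<eta> x) = c * J" using lin[OF h[OF ABS]] I by (simp add: c_def)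
  moreover have "(%x. h x * \<eta> x) integrable_on {A..B}" "\<eta> integrable_on {A..B}"
   using smooth_times_abs_integrable[OF rs(3) h[OF ABS]] integrable_continuous_real[OF smooth_continuous[OF rs(3)]]
   by (auto simp: absolutely_integrable_on_def)
  ultimately have "integral {A..B} (%x. (h x - c) * \<eta> x) = 0"
   by (simp add: left_diff_distrib Henstock_Kurzweil_Integration.integral_diff integrable_on_mult_right J_def)
  moreover have "(%x. h x - c) absolutely_integrable_on {A..B}" by (intro set_integral_diff h ABS) simp
  hence "(\<integral>x. (h x - c) * \<eta> x \<partial>lebesgue_on S) = integral {A..B} (%x. (h x - c) * \<eta> x)"
   by (intro LINT_support(1)[OF ABS]) (use \<eta>0 S in \<open>auto intro: smooth_times_abs_integrable[OF rs(3)]\<close>)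
  ultimately show "(\<integral>x. (h x - c) * \<eta> x \<partial>lebesgue_on S) = 0" by simp
 qed
 thus ?thesis using that[of c] by simp
qed

lemma weak_deriv_unique:
 assumes S: "open S" and w: "weak_deriv S h w1" "weak_deriv S h w2" and ne: "convex S" "S ~= {}"
 shows "negligible {x \<in> S. w1 x ~= w2 x}"
proof -
 have Sl: "S \<in> sets lebesgue" using borel_open[OF S] by simp
 have L: "L1_loc S w1" "L1_loc S w2" using w by (auto simp: weak_deriv_def)
 have "negligible {x \<in> S. w1 x - w2 x ~= 0}"
 proof (rule fundamental_lemma[OF S])
  show "(%x. w1 x - w2 x) absolutely_integrable_on {p..q}" if "{p..q} \<subseteq> S" for p q
   using L1_loc_abs_integrable[OF L(1) that] L1_loc_abs_integrable[OF L(2) that] by (rule set_integral_diff(1))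
  fix \<eta> assume \<eta>: "test_fun S \<eta>"
  then obtain p q where pq: "p <= q" "{p..q} \<subseteq> S" "smooth \<eta>" "!!x. x \<notin> {p..q} ==> \<eta> x = 0"
   using test_fun_support ne by blast
  have i: "integrable (lebesgue_on S) (%x. w1 x * \<eta> x)" "integrable (lebesgue_on S) (%x. w2 x * \<eta> x)"
   by (rule LINT_support(2)[OF pq(2) Sl], simp add: pq(4),
     rule smooth_times_abs_integrable[OF pq(3) L1_loc_abs_integrable[OF _ pq(2)]], rule L)+
  have "(\<integral>x. (w1 x - w2 x) * \<eta> x \<partial>lebesgue_on S) = (\<integral>x. w1 x * \<eta> x \<partial>lebesgue_on S) - (\<integral>x. w2 x * \<eta> x \<partial>lebesgue_on S)"
   using Bochner_Integration.integral_diff[OF i] by (simp add: left_diff_distrib)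
  also have "\<dots> = 0" using w \<eta> by (simp add: weak_deriv_def)
  finally show "(\<integral>x. (w1 x - w2 x) * \<eta> x \<partial>lebesgue_on S) = 0" .
 qed
 thus ?thesis by simp
qed

lemma wderiv_weak_deriv: "weak_deriv S h w ==> weak_deriv S h (wderiv S h)"
 unfolding wderiv_def by (rule someI[where P = "weak_deriv S h"])

lemma wderiv_ae:
 assumes "open S" "convex S" "S ~= {}" "weak_deriv S h w"
 shows "negligible {x \<in> S. wderiv S h x ~= w x}"
 using weak_deriv_unique[OF assms(1) wderiv_weak_deriv[OF assms(4)] assms(4) assms(2,3)] .

lemma ac_on_test_fun_by_parts:
 assumes ac: "ac_on p q h w" and pq: "p <= q" and \<eta>: "smooth \<eta>" "!!x. x \<notin> {p..q} ==> \<eta> x = 0"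
 shows "integral {p..q} (%x. h x * deriv \<eta> x) = - integral {p..q} (%x. w x * \<eta> x)"
proof -
 have "ac_on p q \<eta> (deriv \<eta>)"
  by (rule ac_on_C1[OF _ smooth_continuous[OF smooth_deriv[OF \<eta>(1)]]])
   (use smooth_has_derivative[OF \<eta>(1)] has_field_derivative_at_within in blast)
 hence a: "ac_on p q (%x. h x * \<eta> x) (%x. \<eta> x * w x + h x * deriv \<eta> x)" by (rule ac_on_mult[OF ac])
 have "\<eta> p = 0" "\<eta> q = 0" using zero_off_open_interval[OF \<eta>] by auto
 hence "integral {p..q} (%x. \<eta> x * w x + h x * deriv \<eta> x) = 0"
  using ac_on_increment[OF a, of p q] pq by simp
 moreover have "(%x. w x * \<eta> x) integrable_on {p..q}" "(%x. h x * deriv \<eta> x) integrable_on {p..q}"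
  using smooth_times_abs_integrable[OF \<eta>(1) ac_on_abs_integrable[OF ac]]
   smooth_times_abs_integrable[OF smooth_deriv[OF \<eta>(1)] absolutely_integrable_continuous_real[OF ac_on_continuous[OF ac]]]
  by (auto simp: absolutely_integrable_on_def)
 ultimately show ?thesis
  by (simp add: Henstock_Kurzweil_Integration.integral_add mult.commute)
qed

lemma L1_locI:
 fixes h :: "real => real"
 assumes "convex S" "S ~= {}" "h \<in> borel_measurable (lebesgue_on S)"
  "!!p q. p <= q ==> {p..q} \<subseteq> S ==> h absolutely_integrable_on {p..q}"
 shows "L1_loc S h"
 unfolding L1_loc_def
proof (intro conjI allI impI assms(3))
 fix K assume K: "compact K & K \<subseteq> S"
 then obtain p q where pq: "p <= q" "{p..q} \<subseteq> S" "K \<subseteq> {p..q}"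
  using compact_subset_interval assms(1,2) by metis
 have "K \<in> sets lebesgue" using K by (simp add: borel_compact)
 moreover have "h absolutely_integrable_on K"
  using set_integrable_subset[OF assms(4)[OF pq(1,2)] _ pq(3)] \<open>K \<in> sets lebesgue\<close> by simp
 ultimately show "integrable (lebesgue_on K) h" by (simp add: integrable_lebesgue_on_iff)
qed

lemma test_fun_ac_by_parts:
 assumes S: "open S" "convex S" "S ~= {}"
  and ac: "!!p q. p <= q ==> {p..q} \<subseteq> S ==> ac_on p q h w" and \<eta>: "test_fun S \<eta>"
 shows "(\<integral>x. h x * deriv \<eta> x \<partial>lebesgue_on S) = - (\<integral>x. w x * \<eta> x \<partial>lebesgue_on S)"
  "integrable (lebesgue_on S) (%x. h x * deriv \<eta> x)" "integrable (lebesgue_on S) (%x. w x * \<eta> x)"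
proof -
 have Sl: "S \<in> sets lebesgue" using borel_open[OF S(1)] by simp
 from \<eta> obtain p q where pq: "p <= q" "{p..q} \<subseteq> S" "smooth \<eta>" "!!x. x \<notin> {p..q} ==> \<eta> x = 0"
  using test_fun_support S by blast
 have d0: "deriv \<eta> x = 0" if "x \<notin> {p..q}" for x using deriv_zero_off_support[OF pq(4) that] .
 note a = ac[OF pq(1,2)]
 note 1 = smooth_times_abs_integrable[OF smooth_deriv[OF pq(3)] absolutely_integrable_continuous_real[OF ac_on_continuous[OF a]]]
 note 2 = smooth_times_abs_integrable[OF pq(3) ac_on_abs_integrable[OF a]]
 show "integrable (lebesgue_on S) (%x. h x * deriv \<eta> x)"
  by (rule LINT_support(2)[OF pq(2) Sl _ 1]) (use d0 in auto)
 show "integrable (lebesgue_on S) (%x. w x * \<eta> x)"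
  by (rule LINT_support(2)[OF pq(2) Sl _ 2]) (use pq(4) in auto)
 have "(\<integral>x. h x * deriv \<eta> x \<partial>lebesgue_on S) = integral {p..q} (%x. h x * deriv \<eta> x)"
  by (rule LINT_support(1)[OF pq(2) Sl _ 1]) (use d0 in auto)
 also have "\<dots> = - integral {p..q} (%x. w x * \<eta> x)" by (rule ac_on_test_fun_by_parts[OF a pq(1,3,4)])
 also have "integral {p..q} (%x. w x * \<eta> x) = (\<integral>x. w x * \<eta> x \<partial>lebesgue_on S)"
  by (rule LINT_support(1)[OF pq(2) Sl _ 2, symmetric]) (use pq(4) in auto)
 finally show "(\<integral>x. h x * deriv \<eta> x \<partial>lebesgue_on S) = - (\<integral>x. w x * \<eta> x \<partial>lebesgue_on S)" .
qed

lemma weak_deriv_if_ac: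
 assumes S: "open S" "convex S" "S ~= {}"
  and m: "h \<in> borel_measurable (lebesgue_on S)" "w \<in> borel_measurable (lebesgue_on S)"
  and ac: "!!p q. p <= q ==> {p..q} \<subseteq> S ==> ac_on p q h w"
 shows "weak_deriv S h w"
 unfolding weak_deriv_def
proof (intro conjI allI impI)
 show "L1_loc S h"
  by (rule L1_locI[OF S(2,3) m(1)]) (intro absolutely_integrable_continuous_real ac_on_continuous[OF ac])
 show "L1_loc S w" by (rule L1_locI[OF S(2,3) m(2)]) (intro ac_on_abs_integrable[OF ac])
qed (rule test_fun_ac_by_parts(1)[OF S ac])

definition primitive :: "real => (real => real) => real => real" where
 "primitive x0 w x = (if x0 <= x then integral {x0..x} w else - integral {x..x0} w)"

lemma primitive_ac_on:
 assumes w: "!!p q. p <= q ==> {p..q} \<subseteq> S ==> w absolutely_integrable_on {p..q}"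
  and S: "convex S" "x0 \<in> S" and pq: "p <= q" "{p..q} \<subseteq> S"
 shows "ac_on p q (primitive x0 w) w"
 unfolding ac_on_def
proof (intro conjI ballI w[OF pq])
 fix x assume x: "x \<in> {p..q}"
 have mem: "p \<in> S" "x \<in> S" using pq x by auto
 have iv: "{a..b} \<subseteq> S" if "a \<in> S" "b \<in> S" for a b
  using closed_segment_subset[OF that S(1)] by (auto simp: closed_segment_eq_real_ivl split: if_splits)
 have comb: "integral {a..b} w + integral {b..c} w = integral {a..c} w"
  if "a <= b" "b <= c" "{a..c} \<subseteq> S" for a b c
  using Henstock_Kurzweil_Integration.integral_combine[OF that(1,2)] w[of a c] that
  by (auto simp: absolutely_integrable_on_def)
 consider "x0 <= p" | "p < x0" "x0 <= x" | "x < x0" by linarith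
 thus "primitive x0 w x = primitive x0 w p + integral {p..x} w"
 proof cases
  case 1 thus ?thesis using x comb[of x0 p x] iv[OF S(2) mem(2)] by (simp add: primitive_def)
 next
  case 2 thus ?thesis using x comb[of p x0 x] iv[OF mem] by (simp add: primitive_def)
 next
  case 3 thus ?thesis using x comb[of p x x0] iv[OF mem(1) S(2)] by (simp add: primitive_def)
 qed
qed

text \<open>The difference of \<open>h\<close> and a primitive of \<open>w\<close> is orthogonal to all derivatives of test functions, so
the lemma of du Bois-Reymond applies to it.\<close>

lemma weak_primitive:
 fixes h w :: "real => real"
 assumes S: "open S" "convex S" "x0 \<in> S"
  and h: "!!p q. p <= q ==> {p..q} \<subseteq> S ==> h absolutely_integrable_on {p..q}"
  and w: "!!p q. p <= q ==> {p..q} \<subseteq> S ==> w absolutely_integrable_on {p..q}"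
  and eq: "!!\<eta>. test_fun S \<eta> ==>
   (\<integral>x. h x * deriv \<eta> x \<partial>lebesgue_on S) = - (\<integral>x. w x * \<eta> x \<partial>lebesgue_on S)"
 obtains c where "negligible {x \<in> S. h x ~= primitive x0 w x + c}"
proof -
 have ne: "S ~= {}" using S by auto
 have Sl: "S \<in> sets lebesgue" using borel_open[OF S(1)] by simp
 have ac: "ac_on p q (primitive x0 w) w" if "p <= q" "{p..q} \<subseteq> S" for p q
  by (rule primitive_ac_on[OF w S(2,3) that])
 define d where "d x = h x - primitive x0 w x" for x
 have di: "d absolutely_integrable_on {p..q}" if "{p..q} \<subseteq> S" for p q
 proof (cases "p <= q")
  case True
  show ?thesis unfolding d_def
   by (rule set_integral_diff(1)[OF h[OF True that]
      absolutely_integrable_continuous_real[OF ac_on_continuous[OF ac[OF True that]]]])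
 qed simp
 have "(\<integral>x. d x * deriv \<eta> x \<partial>lebesgue_on S) = 0" if \<eta>: "test_fun S \<eta>" for \<eta>
 proof -
  obtain p q where pq: "p <= q" "{p..q} \<subseteq> S" "smooth \<eta>" "!!x. x \<notin> {p..q} ==> \<eta> x = 0"
   using test_fun_support[OF \<eta> S(2) ne] by blast
  have d0: "deriv \<eta> x = 0" if "x \<notin> {p..q}" for x using deriv_zero_off_support[OF pq(4) that] .
  have i: "integrable (lebesgue_on S) (%x. h x * deriv \<eta> x)"
   by (rule LINT_support(2)[OF pq(2) Sl])
    (use d0 in \<open>auto intro: smooth_times_abs_integrable[OF smooth_deriv[OF pq(3)] h[OF pq(1,2)]]\<close>)
  show ?thesis
   using Bochner_Integration.integral_diff[OF i test_fun_ac_by_parts(2)[OF S(1,2) ne ac \<eta>]]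
    test_fun_ac_by_parts(1)[OF S(1,2) ne ac \<eta>] eq[OF \<eta>]
   by (simp add: d_def left_diff_distrib)
 qed
 then obtain c where "negligible {x \<in> S. d x ~= c}"
  using du_Bois_Reymond[OF S(1,2) ne di] by metis
 moreover have "{x \<in> S. d x ~= c} = {x \<in> S. h x ~= primitive x0 w x + c}" by (auto simp: d_def)
 ultimately show ?thesis using that[of c] by simp
qed

lemma continuous_ae_eq_imp_eq:
 fixes f g :: "real => real"
 assumes S: "open S" and f: "continuous_on S f" and g: "continuous_on S g"
  and ae: "negligible {x \<in> S. f x ~= g x}" and x: "x \<in> S"
 shows "f x = g x"
proof (rule ccontr)
 assume "f x ~= g x"
 have "open {x \<in> S. f x - g x ~= 0}"
 proof -
  have "continuous_on S (%x. f x - g x)" by (intro continuous_intros f g)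
  hence "open ((%x. f x - g x) -` (- {0}) \<inter> S)"
   using S by (simp add: continuous_on_open_vimage open_Compl)
  moreover have "(%x. f x - g x) -` (- {0}) \<inter> S = {x \<in> S. f x - g x ~= 0}" by auto
  ultimately show ?thesis by simp
 qed
 hence "open {x \<in> S. f x ~= g x}" by simp
 hence "{x \<in> S. f x ~= g x} = {}" using open_not_negligible ae by blast
 thus False using x \<open>f x ~= g x\<close> by auto
qed

lemma primitive_continuous_on:
 assumes S: "open S" "convex S" "x0 \<in> S"
  and w: "!!p q. p <= q ==> {p..q} \<subseteq> S ==> w absolutely_integrable_on {p..q}"
 shows "continuous_on S (primitive x0 w)"
proof (rule continuous_at_imp_continuous_on, rule ballI)
 fix x assume x: "x \<in> S"
 then obtain e where e: "e > 0" "cball x e \<subseteq> S" using S(1) open_contains_cball by blast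
 hence sub: "{x - e..x + e} \<subseteq> S" by (auto simp: dist_real_def subset_iff)
 have "continuous_on {x - e..x + e} (primitive x0 w)"
  using ac_on_continuous[OF primitive_ac_on[OF w S(2,3) _ sub]] e by simp
 thus "isCont (primitive x0 w) x"
  by (rule continuous_on_interior) (use e in simp)
qed

text \<open>The continuous representative of a function with a weak derivative is itself a primitive: two
continuous functions that agree almost everywhere are equal.\<close>

lemma weak_deriv_continuous_imp_ac:
 assumes S: "open S" "convex S" and wd: "weak_deriv S h w" and h: "continuous_on S h"
  and pq: "p <= q" "{p..q} \<subseteq> S"
 shows "ac_on p q h w"
proof -
 have x0: "p \<in> S" using pq by auto
 have L: "L1_loc S h" "L1_loc S w" using wd by (auto simp: weak_deriv_def)
 note w = L1_loc_abs_integrable[OF L(2)]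
 obtain c where c: "negligible {x \<in> S. h x ~= primitive p w x + c}"
 proof (rule weak_primitive[OF S x0])
  show "h absolutely_integrable_on {p..q}" if "p <= q" "{p..q} \<subseteq> S" for p q
   using L1_loc_abs_integrable[OF L(1) that(2)] .
  show "w absolutely_integrable_on {p..q}" if "p <= q" "{p..q} \<subseteq> S" for p q
   using w[OF that(2)] .
  show "(\<integral>x. h x * deriv \<eta> x \<partial>lebesgue_on S) = - (\<integral>x. w x * \<eta> x \<partial>lebesgue_on S)"
   if "test_fun S \<eta>" for \<eta> using wd that by (simp add: weak_deriv_def)
 qed blast
 have cp: "continuous_on S (%x. primitive p w x + c)"
  using primitive_continuous_on[OF S x0 w] by (intro continuous_on_add continuous_on_const)
 have "h x = primitive p w x + c" if "x \<in> S" for x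
  by (rule continuous_ae_eq_imp_eq[OF S(1) h cp c that])
 moreover have ac: "ac_on p q (%x. primitive p w x + c) (%x. w x + 0)"
  by (rule ac_on_add[OF primitive_ac_on[OF w S(2) x0 pq] ac_on_C1]) auto
 ultimately show ?thesis
  using pq(2) by (intro ac_on_cong_AE[OF ac negligible_empty]) (simp, blast)
qed

section \<open>Piecewise affine functions with one jump as functions of bounded variation\<close>

definition sum_measure :: "'a measure => 'a measure => 'a measure" where
 "sum_measure M N = measure_of (space M) (sets M) (%A. emeasure M A + emeasure N A)"

lemma sets_sum_measure [simp]: "sets (sum_measure M N) = sets M"
 by (simp add: sum_measure_def)

lemma space_sum_measure [simp]: "space (sum_measure M N) = space M"
 by (simp add: sum_measure_def)

lemma emeasure_sum_measure:
 assumes "sets N = sets M" "A \<in> sets M"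
 shows "emeasure (sum_measure M N) A = emeasure M A + emeasure N A"
 unfolding sum_measure_def
proof (rule emeasure_measure_of_sigma)
 show "sigma_algebra (space M) (sets M)" ..
 show "positive (sets M) (%A. emeasure M A + emeasure N A)" by (simp add: positive_def)
 show "countably_additive (sets M) (%A. emeasure M A + emeasure N A)"
 proof (rule countably_additiveI)
  fix F :: "nat => 'a set" assume F: "range F \<subseteq> sets M" "disjoint_family F" "\<Union>(range F) \<in> sets M"
  have "(\<Sum>i. emeasure M (F i) + emeasure N (F i)) = (\<Sum>i. emeasure M (F i)) + (\<Sum>i. emeasure N (F i))"
   by (rule suminf_add[symmetric]) auto
  thus "(\<Sum>i. emeasure M (F i) + emeasure N (F i)) = emeasure M (\<Union>(range F)) + emeasure N (\<Union>(range F))"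
   using F assms(1) by (simp add: suminf_emeasure)
 qed
qed (use assms in simp)

lemma nn_integral_sum_measure:
 assumes s: "sets N = sets M" and f: "f \<in> borel_measurable M"
 shows "(\<integral>\<^sup>+x. f x \<partial>sum_measure M N) = (\<integral>\<^sup>+x. f x \<partial>M) + (\<integral>\<^sup>+x. f x \<partial>N)"
 using f
proof (induction rule: borel_measurable_induct)
 case (cong f g)
 have sp: "space N = space M" using sets_eq_imp_space_eq[OF s] .
 have "integral\<^sup>N K f = integral\<^sup>N K g" if "space K = space M" for K
  by (rule nn_integral_cong) (use that cong in auto)
 from this[of M] this[of N] this[of "sum_measure M N"] show ?case using cong(4) sp by simp
next
 case (set A)
 thus ?case using s by (simp add: emeasure_sum_measure)
next
 case (mult u c)
 have "u \<in> borel_measurable N" using mult(2) s by (simp cong: measurable_cong_sets)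
 moreover have "u \<in> borel_measurable (sum_measure M N)" using mult(2) by (simp cong: measurable_cong_sets)
 ultimately show ?case using mult by (simp add: nn_integral_cmult distrib_left)
next
 case (add u v)
 have uv: "u \<in> borel_measurable M" "v \<in> borel_measurable M" by fact+
 hence "u \<in> borel_measurable N" "v \<in> borel_measurable N" using s by (simp_all cong: measurable_cong_sets)
 moreover have "u \<in> borel_measurable (sum_measure M N)" "v \<in> borel_measurable (sum_measure M N)"
  using uv by (simp_all cong: measurable_cong_sets)
 ultimately show ?case using add by (simp add: nn_integral_add ac_simps)
next
 case (seq U)
 have mN: "!!i. U i \<in> borel_measurable N" using seq(1) s by (simp cong: measurable_cong_sets)
 have mS: "!!i. U i \<in> borel_measurable (sum_measure M N)" using seq(1) by (simp cong: measurable_cong_sets)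
 have inc: "incseq U" by fact
 have *: "(\<integral>\<^sup>+x. (SUP i. U i x) \<partial>K) = (SUP i. \<integral>\<^sup>+x. U i x \<partial>K)" if "!!i. U i \<in> borel_measurable K" for K
  by (rule nn_integral_monotone_convergence_SUP[OF inc that])
 have "(SUP i. (\<integral>\<^sup>+x. U i x \<partial>M) + (\<integral>\<^sup>+x. U i x \<partial>N)) = (SUP i. \<integral>\<^sup>+x. U i x \<partial>M) + (SUP i. \<integral>\<^sup>+x. U i x \<partial>N)"
  by (rule ennreal_SUP_add) (use inc in \<open>auto simp: incseq_def le_fun_def intro!: nn_integral_mono\<close>)
 thus ?case using *[OF seq(1)] *[OF mN] *[OF mS] seq by (simp add: SUP_apply image_comp)
qed

lemma integral_sum_measure:
 fixes f :: "'a => real"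
 assumes s: "sets N = sets M" and f: "integrable M f" "integrable N f"
 shows "integrable (sum_measure M N) f" "(\<integral>x. f x \<partial>sum_measure M N) = (\<integral>x. f x \<partial>M) + (\<integral>x. f x \<partial>N)"
proof -
 have m: "f \<in> borel_measurable M" using f by auto
 have mS: "f \<in> borel_measurable (sum_measure M N)" using m by (simp cong: measurable_cong_sets)
 have p: "(\<integral>\<^sup>+x. ennreal (f x) \<partial>sum_measure M N) = (\<integral>\<^sup>+x. ennreal (f x) \<partial>M) + (\<integral>\<^sup>+x. ennreal (f x) \<partial>N)"
  and n: "(\<integral>\<^sup>+x. ennreal (- f x) \<partial>sum_measure M N) = (\<integral>\<^sup>+x. ennreal (- f x) \<partial>M) + (\<integral>\<^sup>+x. ennreal (- f x) \<partial>N)"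
  using m by (simp_all add: nn_integral_sum_measure[OF s])
 have fin: "(\<integral>\<^sup>+x. ennreal (f x) \<partial>M) ~= \<infinity>" "(\<integral>\<^sup>+x. ennreal (f x) \<partial>N) ~= \<infinity>"
  "(\<integral>\<^sup>+x. ennreal (- f x) \<partial>M) ~= \<infinity>" "(\<integral>\<^sup>+x. ennreal (- f x) \<partial>N) ~= \<infinity>"
  using f by (auto simp: real_integrable_def)
 show i: "integrable (sum_measure M N) f" using mS p n fin by (simp add: real_integrable_def)
 show "(\<integral>x. f x \<partial>sum_measure M N) = (\<integral>x. f x \<partial>M) + (\<integral>x. f x \<partial>N)"
  using p n fin by (simp add: real_lebesgue_integral_def f i enn2real_plus less_top)
qed

definition affine_jump :: "real => real => real => real => real" where
 "affine_jump L c j x = c * x + j * indicator {L / 2<..<L} x"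

text \<open>The derivative of \<open>affine_jump\<close>: \<open>c\<close> times Lebesgue measure plus a point mass \<open>j\<close> at the
 midpoint.\<close>

definition affine_jump_measure :: "real => real => real => real measure" where
 "affine_jump_measure L c j = sum_measure
   (density lborel (%x. ennreal c * indicator {0<..<L} x))
   (scale_measure (ennreal j) (distr (count_space (UNIV :: unit set)) borel (%_. L / 2)))"

locale one_jump =
 fixes L c j :: real
 assumes L: "0 < L" and c0: "0 <= c" and j0: "0 <= j"
begin

abbreviation "Q \<equiv> affine_jump_measure L c j"
abbreviation "u0 \<equiv> affine_jump L c j"

lemma sets_Q [simp]: "sets Q = sets borel"
 by (simp add: affine_jump_measure_def)

lemma emeasure_Q:
 assumes "A \<in> sets borel"
 shows "emeasure Q A = ennreal c * emeasure lborel (A \<inter> {0<..<L}) + ennreal j * indicator A (L / 2)"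
proof -
 have 1: "emeasure (density lborel (%x. ennreal c * indicator {0<..<L} x)) A = ennreal c * emeasure lborel (A \<inter> {0<..<L})"
 proof -
  have "emeasure (density lborel (%x. ennreal c * indicator {0<..<L} x)) A
    = (\<integral>\<^sup>+x. ennreal c * indicator (A \<inter> {0<..<L}) x \<partial>lborel)"
   using assms by (subst emeasure_density) (auto intro!: nn_integral_cong simp: indicator_def)
  also have "\<dots> = ennreal c * emeasure lborel (A \<inter> {0<..<L})"
   using assms by (subst nn_integral_cmult_indicator) auto
  finally show ?thesis .
 qed
 have 2: "emeasure (distr (count_space (UNIV :: unit set)) borel (%_. L / 2)) A = indicator A (L / 2)"
 proof -
  have "emeasure (distr (count_space (UNIV :: unit set)) borel (%_. L / 2)) A
    = emeasure (count_space (UNIV :: unit set)) ((%_. L / 2) -` A)"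
   using assms by (subst emeasure_distr) auto
  thus ?thesis by (cases "L / 2 \<in> A") (auto simp: emeasure_count_space UNIV_unit)
 qed
 show ?thesis unfolding affine_jump_measure_def
  using assms by (subst emeasure_sum_measure) (auto simp: 1 2)
qed

lemma measure_Q:
 assumes "A \<in> sets borel"
 shows "measure Q A = c * measure lborel (A \<inter> {0<..<L}) + j * indicator A (L / 2)"
proof -
 have "emeasure lborel (A \<inter> {0<..<L}) <= emeasure lborel {0<..<L}" using assms by (intro emeasure_mono) auto
 hence "emeasure lborel (A \<inter> {0<..<L}) ~= \<infinity>" using L by (auto simp: top_unique)
 hence "emeasure lborel (A \<inter> {0<..<L}) = ennreal (measure lborel (A \<inter> {0<..<L}))"
  by (rule emeasure_eq_ennreal_measure[unfolded infinity_ennreal_def[symmetric]])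
 thus ?thesis unfolding measure_def[of Q] emeasure_Q[OF assms]
  using c0 j0 by (auto simp: indicator_def ennreal_mult[symmetric] ennreal_plus[symmetric] simp del: ennreal_plus)
qed

lemma finite_Q: "finite_measure Q"
proof (rule finite_measureI)
 have "emeasure Q (space Q) = emeasure Q UNIV" by (simp add: affine_jump_measure_def)
 also have "\<dots> ~= \<infinity>" using L by (simp add: emeasure_Q ennreal_mult_eq_top_iff)
 finally show "emeasure Q (space Q) ~= \<infinity>" .
qed

lemma integral_Q:
 assumes \<eta>: "test_fun {0<..<L} \<eta>"
 shows "(\<integral>x. \<eta> x \<partial>Q) = c * (\<integral>x. \<eta> x \<partial>lebesgue_on {0<..<L}) + j * \<eta> (L / 2)"
proof -
 obtain p q where pq: "p <= q" "{p..q} \<subseteq> {0<..<L}" "smooth \<eta>" "!!x. x \<notin> {p..q} ==> \<eta> x = 0"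
  using test_fun_support[OF \<eta>] L by auto
 have mb[measurable]: "\<eta> \<in> borel_measurable borel"
  by (intro borel_measurable_continuous_onI smooth_continuous pq)
 have il: "integrable lborel (%x. indicator {0<..<L} x * \<eta> x)"
 proof -
  have "integrable lborel (%x. indicator {p..q} x *\<^sub>R \<eta> x)"
   using borel_integrable_atLeastAtMost'[OF smooth_continuous[OF pq(3)]] by (simp add: set_integrable_def)
  moreover have "(%x. indicator {p..q} x *\<^sub>R \<eta> x) = (%x. indicator {0<..<L} x * \<eta> x)"
  proof
   fix x show "indicator {p..q} x *\<^sub>R \<eta> x = indicator {0<..<L} x * \<eta> x"
    using pq(2) pq(4)[of x] by (cases "x \<in> {p..q}") auto
  qed
  ultimately show ?thesis by (simp only:)
 qed
 let ?D = "density lborel (%x. ennreal c * indicator {0<..<L} x)"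
 let ?P = "scale_measure (ennreal j) (distr (count_space (UNIV :: unit set)) borel (%_. L / 2))"
 have Deq: "?D = density lborel (%x. ennreal (c * indicator {0<..<L} x))"
  by (rule density_cong) (use c0 in \<open>auto simp: indicator_def\<close>)
 have D: "integrable ?D \<eta>" "(\<integral>x. \<eta> x \<partial>?D) = c * (\<integral>x. indicator {0<..<L} x * \<eta> x \<partial>lborel)"
 proof -
  have i: "integrable lborel (%x. c * indicator {0<..<L} x * \<eta> x)"
   using integrable_mult_right[OF il, of c] by (simp add: mult.assoc)
  thus "integrable ?D \<eta>" unfolding Deq by (subst integrable_density) (use c0 in auto)
  show "(\<integral>x. \<eta> x \<partial>?D) = c * (\<integral>x. indicator {0<..<L} x * \<eta> x \<partial>lborel)"
   unfolding Deq by (subst integral_density) (use c0 in \<open>auto simp: mult.assoc\<close>)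
 qed
 have P: "integrable ?P \<eta>" "(\<integral>x. \<eta> x \<partial>?P) = j * \<eta> (L / 2)"
 proof -
  have n: "(\<integral>\<^sup>+x. f x \<partial>?P) = ennreal j * f (L / 2)" if "f \<in> borel_measurable borel" for f
   using that by (subst nn_integral_scale_measure) (auto simp: nn_integral_distr nn_integral_count_space_finite UNIV_unit)
  have m: "\<eta> \<in> borel_measurable ?P" by measurable
  show i: "integrable ?P \<eta>"
   using m by (simp add: real_integrable_def n ennreal_mult_eq_top_iff)
  show "(\<integral>x. \<eta> x \<partial>?P) = j * \<eta> (L / 2)"
   using j0 by (simp add: real_lebesgue_integral_def[OF i] n)
    (cases "\<eta> (L / 2) \<ge> 0"; simp add: ennreal_mult'[symmetric] ennreal_neg mult_nonneg_nonpos)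
 qed
 have "(\<integral>x. \<eta> x \<partial>Q) = c * (\<integral>x. indicator {0<..<L} x * \<eta> x \<partial>lborel) + j * \<eta> (L / 2)"
  unfolding affine_jump_measure_def using integral_sum_measure(2)[of ?P ?D \<eta>] D P by simp
 also have "(\<integral>x. indicator {0<..<L} x * \<eta> x \<partial>lborel) = (\<integral>x. \<eta> x \<partial>lebesgue_on {0<..<L})"
  by (subst integral_restrict_space) (auto simp: integral_completion)
 finally show ?thesis .
qed

lemma u0_integrable: "integrable (lebesgue_on {0<..<L}) u0"
proof -
 have 1: "(%x. c * x) absolutely_integrable_on {0<..<L}"
  using absolutely_integrable_continuous_real[of 0 L "%x. c * x"]
  by (auto intro!: continuous_intros simp: absolutely_integrable_on_Icc_iff_Ioo)
 have 2: "(%x. j * indicator {L / 2<..<L} x) absolutely_integrable_on {0<..<L}"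
 proof -
  have "integrable lebesgue (%x. indicator {L / 2<..<L} x :: real)" by (rule integrable_real_indicator) (use L in auto)
  hence "integrable lebesgue (%x. j * indicator {L / 2<..<L} x)" by (rule integrable_mult_right)
  moreover have "(%x. j * indicator {L / 2<..<L} x) = (%x. indicator {0<..<L} x *\<^sub>R (j * indicator {L / 2<..<L} x))"
   using L by (auto simp: indicator_def fun_eq_iff)
  ultimately show ?thesis unfolding set_integrable_def by (simp only:)
 qed
 have "u0 absolutely_integrable_on {0<..<L}"
  using set_integral_add(1)[OF 1 2] by (simp add: affine_jump_def[abs_def])
 thus ?thesis by (simp add: integrable_lebesgue_on_iff)
qed

lemma u0_by_parts:
 assumes \<eta>: "test_fun {0<..<L} \<eta>"
 shows "(\<integral>x. u0 x * deriv \<eta> x \<partial>lebesgue_on {0<..<L}) = - (c * (\<integral>x. \<eta> x \<partial>lebesgue_on {0<..<L}) + j * \<eta> (L / 2))"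
proof -
 have S: "open {0<..<L}" "convex {0<..<L}" "{0<..<L} ~= {}" using L by auto
 obtain p q where pq: "p <= q" "{p..q} \<subseteq> {0<..<L}" "smooth \<eta>" "!!x. x \<notin> {p..q} ==> \<eta> x = 0"
  using test_fun_support[OF \<eta>] L by auto
 have ac: "ac_on p q (%x. c * x) (%x. c)" for p q
  by (rule ac_on_C1) (auto intro!: derivative_eq_intros)
 note 1 = test_fun_ac_by_parts[OF S ac \<eta>]
 have d0: "deriv \<eta> x = 0" if "x \<notin> {p..q}" for x using deriv_zero_off_support[OF pq(4) that] .
 have cd: "continuous_on A (deriv \<eta>)" for A by (rule smooth_continuous[OF smooth_deriv[OF pq(3)]])
 have ai: "deriv \<eta> absolutely_integrable_on {L/2..L}" by (rule absolutely_integrable_continuous_real[OF cd])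
 have e: "indicator {0<..<L} x * (indicator {L / 2<..<L} x * deriv \<eta> x) = indicator {L/2<..<L} x * deriv \<eta> x" for x
  using L by (auto simp: indicator_def)
 have iL: "integrable lebesgue (%x. indicator {L/2<..<L} x * deriv \<eta> x)"
  using ai unfolding absolutely_integrable_on_Icc_iff_Ioo by (simp add: set_integrable_def)
 have i2: "integrable (lebesgue_on {0<..<L}) (%x. indicator {L / 2<..<L} x * deriv \<eta> x)"
  by (subst integrable_restrict_space) (simp_all add: e iL)
 have "(\<integral>x. indicator {L / 2<..<L} x * deriv \<eta> x \<partial>lebesgue_on {0<..<L}) = (\<integral>x. indicator {L/2<..<L} x * deriv \<eta> x \<partial>lebesgue)"
  by (subst integral_restrict_space) (simp_all add: e)
 also have "\<dots> = integral {L/2<..<L} (deriv \<eta>)"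
  using set_lebesgue_integral_eq_integral(2)[of "{L/2<..<L}" "deriv \<eta>"] iL
  by (simp add: set_integrable_def set_lebesgue_integral_def)
 also have "\<dots> = integral {L/2..L} (deriv \<eta>)" by (simp add: integral_open_interval_real)
 also have "\<dots> = \<eta> L - \<eta> (L/2)"
 proof (rule integral_unique, rule fundamental_theorem_of_calculus)
  show "L / 2 <= L" using L by simp
  show "(\<eta> has_vector_derivative deriv \<eta> x) (at x within {L / 2..L})" for x
   using smooth_has_derivative[OF pq(3), of x]
   by (simp add: has_real_derivative_iff_has_vector_derivative has_vector_derivative_at_within)
 qed
 also have "\<eta> L = 0" using pq(2,4) by fastforce
 finally have 2: "(\<integral>x. indicator {L / 2<..<L} x * deriv \<eta> x \<partial>lebesgue_on {0<..<L}) = - \<eta> (L/2)" by simp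
 have "(\<integral>x. u0 x * deriv \<eta> x \<partial>lebesgue_on {0<..<L})
   = (\<integral>x. c * x * deriv \<eta> x + j * (indicator {L / 2<..<L} x * deriv \<eta> x) \<partial>lebesgue_on {0<..<L})"
  by (simp add: affine_jump_def distrib_right mult.assoc)
 also have "\<dots> = (\<integral>x. c * x * deriv \<eta> x \<partial>lebesgue_on {0<..<L}) + j * (\<integral>x. indicator {L / 2<..<L} x * deriv \<eta> x \<partial>lebesgue_on {0<..<L})"
  using 1(2) i2 by (subst Bochner_Integration.integral_add) auto
 finally show ?thesis using 1(1) 2 by simp
qed

lemma Jordan_Q: "Jordan_deriv L u0 Q (null_measure borel)"
 unfolding Jordan_deriv_def
proof (intro conjI allI impI)
 show "finite_measure Q" by (rule finite_Q)
 show "emeasure Q (- {0<..<L}) = 0" using L by (simp add: emeasure_Q)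
 show "\<exists>A\<in>sets borel. emeasure Q A = 0 & emeasure (null_measure borel) (- A) = 0"
  by (rule bexI[of _ "{}"]) auto
 fix \<eta> assume \<eta>: "test_fun {0<..<L} \<eta>"
 have "(\<integral>x. \<eta> x \<partial>null_measure borel) = 0"
  by (rule integral_eq_zero_AE) (auto simp: eventually_ae_filter null_sets_def intro!: bexI[of _ UNIV])
 thus "(\<integral>x. u0 x * deriv \<eta> x \<partial>lebesgue_on {0<..<L}) = - ((\<integral>x. \<eta> x \<partial>Q) - (\<integral>x. \<eta> x \<partial>null_measure borel))"
  using u0_by_parts[OF \<eta>] integral_Q[OF \<eta>] by simp
qed (auto intro: finite_measureI)

text \<open>Both \<open>P - N\<close> and \<open>Q\<close> represent the distributional derivative, so \<open>P = N + Q\<close> on intervals and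
hence everywhere. The two members of a Jordan pair are carried by disjoint sets, and \<open>Q\<close> is
nonnegative: this forces \<open>N = 0\<close>.\<close>

lemma Jordan_unique:
 assumes J: "Jordan_deriv L u0 P N"
 shows "P = Q" "!!A. emeasure N A = 0"
proof -
 have fP: "finite_measure P" and sP: "sets P = sets borel" and oP: "emeasure P (- {0<..<L}) = 0"
  and fN: "finite_measure N" and sN: "sets N = sets borel" and oN: "emeasure N (- {0<..<L}) = 0"
  using J by (auto simp: Jordan_deriv_def)
 interpret P: finite_measure P by (rule fP)
 interpret N: finite_measure N by (rule fN)
 interpret Qf: finite_measure Q by (rule finite_Q)
 have open_eq: "measure P {p<..<q} = measure N {p<..<q} + measure Q {p<..<q}"
  if pq: "p < q" "0 <= p" "q <= L" for p q
 proof -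
  obtain \<zeta> :: "nat => real => real" where \<zeta>: "!!n. smooth (\<zeta> n)" "!!n x. 0 <= \<zeta> n x" "!!n x. \<zeta> n x <= 1"
    "!!x. (%n. \<zeta> n x) ----> indicator {p<..<q} x"
    "!!n. \<exists>r s. p < r & s < q & (\<forall>x. x \<notin> {r..s} --> \<zeta> n x = 0)"
   by (rule smooth_indicator_approx) (rule that)
  have t: "test_fun {0<..<L} (\<zeta> n)" for n
  proof -
   obtain r s where "p < r" "s < q" "\<forall>x. x \<notin> {r..s} --> \<zeta> n x = 0" using \<zeta>(5) by blast
   thus ?thesis using pq by (intro test_funI[OF \<zeta>(1), of r s]) auto
  qed
  have lim: "(%n. \<integral>x. \<zeta> n x \<partial>M) ----> measure M {p<..<q}" if "finite_measure M" "sets M = sets borel" for M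
  proof -
   interpret finite_measure M by fact
   have m: "\<zeta> n \<in> borel_measurable M" for n
    using borel_measurable_continuous_onI[OF smooth_continuous[OF \<zeta>(1)]] that(2)
    by (simp cong: measurable_cong_sets)
   have "(%n. \<integral>x. \<zeta> n x \<partial>M) ----> (\<integral>x. indicator {p<..<q} x \<partial>M)"
   proof (rule integral_dominated_convergence[where w = "%x. 1"])
    show "indicat_real {p<..<q} \<in> borel_measurable M" using that(2) by auto
    show "AE x in M. (%n. \<zeta> n x) ----> indicat_real {p<..<q} x" using \<zeta>(4) by simp
    show "AE x in M. norm (\<zeta> n x) <= 1" for n using \<zeta>(2,3) by simp
   qed (use m in auto)
   moreover have "{p<..<q} \<in> sets M" using that(2) by simp
   moreover have "space M = UNIV" using sets_eq_imp_space_eq[OF that(2)] by simp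
   ultimately show ?thesis by simp
  qed
  have eq: "(\<integral>x. \<zeta> n x \<partial>P) = (\<integral>x. \<zeta> n x \<partial>N) + (\<integral>x. \<zeta> n x \<partial>Q)" for n
  proof -
   have "(\<integral>x. u0 x * deriv (\<zeta> n) x \<partial>lebesgue_on {0<..<L}) = - ((\<integral>x. \<zeta> n x \<partial>P) - (\<integral>x. \<zeta> n x \<partial>N))"
    using J t by (simp add: Jordan_deriv_def)
   thus ?thesis using u0_by_parts[OF t] integral_Q[OF t] by simp
  qed
  have "(%n. (\<integral>x. \<zeta> n x \<partial>N) + (\<integral>x. \<zeta> n x \<partial>Q)) ----> measure N {p<..<q} + measure Q {p<..<q}"
   by (intro tendsto_add lim fN finite_Q sN sets_Q)
  thus ?thesis by (rule LIMSEQ_unique[OF lim[OF fP sP, unfolded eq]])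
 qed
 have "P = sum_measure N Q"
 proof (rule measure_eqI_lessThan)
  show "sets P = sets borel" "sets (sum_measure N Q) = sets borel" using sP sN by auto
  fix x :: real
  show "emeasure P {x<..} < \<infinity>" by (simp add: P.emeasure_eq_measure)
  have dec: "measure M {x<..} = measure M ({x<..} \<inter> {0<..<L})"
   if "finite_measure M" "sets M = sets borel" "emeasure M (- {0<..<L}) = 0" for M
   using emeasure_Diff_null_set[of "- {0<..<L}" M "{x<..}"] that by (simp add: measure_def null_sets_def Diff_Compl)
  have oQ: "emeasure Q (- {0<..<L}) = 0" using L by (simp add: emeasure_Q)
  have "measure P {x<..} = measure N {x<..} + measure Q {x<..}"
  proof (cases "max 0 x < L")
   case True
   have "{x<..} \<inter> {0<..<L} = {max 0 x<..<L}" by auto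
   thus ?thesis
    using open_eq[of "max 0 x" L] True dec[OF fP sP oP] dec[OF fN sN oN] dec[OF finite_Q sets_Q oQ] by simp
  next
   case False
   hence "{x<..} \<inter> {0<..<L} = {}" using L by (auto simp: max_def split: if_splits)
   thus ?thesis
    using dec[OF fP sP oP] dec[OF fN sN oN] dec[OF finite_Q sets_Q oQ] by simp
  qed
  thus "emeasure P {x<..} = emeasure (sum_measure N Q) {x<..}"
   using sN by (subst emeasure_sum_measure)
    (simp_all add: P.emeasure_eq_measure N.emeasure_eq_measure Qf.emeasure_eq_measure)
 qed
 hence PNQ: "emeasure P A = emeasure N A + emeasure Q A" if "A \<in> sets borel" for A
  using that sN emeasure_sum_measure[of Q N A] by simp
 obtain A where A: "A \<in> sets borel" "emeasure P A = 0" "emeasure N (- A) = 0"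
  using J by (auto simp: Jordan_deriv_def)
 have NA: "emeasure N A = 0" using PNQ[OF A(1)] A(2) by simp
 have "emeasure N UNIV <= emeasure N A + emeasure N (- A)"
  using emeasure_subadditive[of A N "- A"] A(1) sN by (simp add: Un_commute)
 hence NU: "emeasure N UNIV = 0" using NA A(3) by simp
 show N0: "emeasure N A = 0" for A
 proof (cases "A \<in> sets N")
  case True
  hence "emeasure N A <= emeasure N UNIV" using sN by (intro emeasure_mono) auto
  thus ?thesis using NU by simp
 qed (simp add: emeasure_notin_sets)
 show "P = Q"
  by (rule measure_eqI) (use sP PNQ N0 in auto)
qed

lemma Jordan_pair_u0: "fst (Jordan_pair L u0) = Q" "emeasure (snd (Jordan_pair L u0)) A = 0"
proof -
 have "\<exists>x. (case x of (P, N) => Jordan_deriv L u0 P N)" using Jordan_Q by (intro exI[of _ "(Q, null_measure borel)"]) simp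
 hence "case Jordan_pair L u0 of (P, N) => Jordan_deriv L u0 P N"
  unfolding Jordan_pair_def by (rule someI_ex)
 hence "Jordan_deriv L u0 (fst (Jordan_pair L u0)) (snd (Jordan_pair L u0))"
  by (simp add: case_prod_beta)
 from Jordan_unique[OF this] show "fst (Jordan_pair L u0) = Q" "emeasure (snd (Jordan_pair L u0)) A = 0" by auto
qed

lemma D_u0:
 assumes "A \<in> sets borel"
 shows "D_meas L u0 A = c * measure lborel (A \<inter> {0<..<L}) + j * indicator A (L / 2)"
  "D_var L u0 A = c * measure lborel (A \<inter> {0<..<L}) + j * indicator A (L / 2)"
 unfolding D_meas_def D_var_def
 by (simp_all add: Jordan_pair_u0 measure_Q[OF assms] measure_def[of "snd (Jordan_pair L u0)"])

lemma BV_u0: "BV L u0"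
 unfolding BV_def using u0_integrable Jordan_Q by blast

lemma D_var_u0: "D_var L u0 {0<..<L} = c * L + j"
 using L by (simp add: D_u0)

lemma Lebesgue_decomp_u0: "Lebesgue_decomp L u0 (%x. c) {L / 2}"
 unfolding Lebesgue_decomp_def
proof (intro conjI ballI impI)
 show "integrable (lebesgue_on {0<..<L}) (%x. c)"
  by (simp add: integrable_lebesgue_on_iff absolutely_integrable_on_def integrable_on_const)
 show "{L / 2} \<subseteq> {0<..<L}" using L by simp
 fix A :: "real set" assume A: "A \<in> sets borel" "A \<subseteq> {0<..<L} - {L / 2}"
 have "measure (lebesgue_on A) A = measure lborel A"
  using A(1) by (simp add: measure_restrict_space measure_completion)
 thus "D_meas L u0 A = (\<integral>x. c \<partial>lebesgue_on A)"
 proof -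
  have "A \<inter> {0<..<L} = A" "indicator A (L / 2) = (0::real)" using A(2) by (auto simp: indicator_def)
  thus ?thesis using A(1) \<open>measure (lebesgue_on A) A = measure lborel A\<close>
   by (simp add: D_u0 space_restrict_space)
 qed
qed auto

lemma sing_set_u0: "\<exists>w. Lebesgue_decomp L u0 w (sing_set L u0)"
 unfolding sing_set_def by (rule someI[where P = "%S. \<exists>w. Lebesgue_decomp L u0 w S"]) (use Lebesgue_decomp_u0 in blast)

lemma ac_density_u0: "AE x in lebesgue_on {0<..<L}. ac_density L u0 x = c"
proof -
 have "\<exists>S. Lebesgue_decomp L u0 (ac_density L u0) S"
  unfolding ac_density_def by (rule someI[where P = "%w. \<exists>S. Lebesgue_decomp L u0 w S"]) (use Lebesgue_decomp_u0 in blast)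
 then obtain S where S: "Lebesgue_decomp L u0 (ac_density L u0) S" ..
 define w where "w = ac_density L u0"
 have wi: "w absolutely_integrable_on {0<..<L}" and Sb: "S \<in> sets borel" "emeasure lborel S = 0"
  and Sd: "!!A. A \<in> sets borel ==> A \<subseteq> {0<..<L} - S ==> D_meas L u0 A = (\<integral>x. w x \<partial>lebesgue_on A)"
  using S unfolding Lebesgue_decomp_def w_def by (auto simp: integrable_lebesgue_on_iff)
 have wi': "w absolutely_integrable_on {0..L}" using wi by (simp add: absolutely_integrable_on_Icc_iff_Ioo)
 have Sn: "negligible S" using Sb by (auto simp: negligible_iff_null_sets null_sets_def)
 have "negligible {x \<in> {0..L}. w x - c ~= 0}"
 proof (rule zero_on_intervals_imp_zero_ae)
  show "(%x. w x - c) absolutely_integrable_on {0..L}" by (intro set_integral_diff wi') simp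
  fix p q assume pq: "0 <= p" "p <= q" "q <= L"
  define A where "A = {p<..<q} - (S \<union> {L / 2})"
  have Ab: "A \<in> sets borel" using Sb by (auto simp: A_def)
  have "D_meas L u0 A = c * (q - p)"
  proof -
   have "emeasure lborel A = emeasure lborel {p<..<q}"
    unfolding A_def by (rule emeasure_Diff_null_set) (rule null_sets.Un, use Sb in \<open>auto simp: null_sets_def\<close>)
   moreover have "A \<inter> {0<..<L} = A" using pq by (auto simp: A_def)
   ultimately show ?thesis using pq Ab by (simp add: D_u0 measure_def) (simp add: A_def)
  qed
  moreover have "D_meas L u0 A = (\<integral>x. w x \<partial>lebesgue_on A)" by (rule Sd[OF Ab]) (use pq in \<open>auto simp: A_def\<close>)
  moreover have "(\<integral>x. w x \<partial>lebesgue_on A) = integral A w"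
  proof (rule lebesgue_integral_eq_integral)
   show "A \<in> sets lebesgue" using Ab by simp
   thus "integrable (lebesgue_on A) w"
    using set_integrable_subset[OF wi' \<open>A \<in> sets lebesgue\<close>] pq by (fastforce simp: integrable_lebesgue_on_iff A_def)
  qed
  moreover have "integral A w = integral {p..q} w"
  proof (rule integral_spike_set)
   have "negligible (S \<union> {L / 2} \<union> {p, q})" using Sn by auto
   thus "negligible {x \<in> A - {p..q}. w x ~= 0}" "negligible {x \<in> {p..q} - A. w x ~= 0}"
    by (rule negligible_subset; force simp: A_def)+
  qed
  ultimately have "integral {p..q} w = c * (q - p)" by simp
  moreover have "w integrable_on {p..q}" using abs_integrable_sub[OF wi' pq(1,3)] by (simp add: absolutely_integrable_on_def)
  ultimately show "integral {p..q} (%x. w x - c) = 0"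
   using pq by (subst Henstock_Kurzweil_Integration.integral_diff) auto
 qed
 hence "negligible {x \<in> {0<..<L}. \<not> w x = c}" by (rule negligible_subset) auto
 thus ?thesis by (simp add: AE_lebesgue_on_iff_negligible w_def)
qed

end

lemma ae_limit_eqI:
 fixes I :: "real => real set" and u :: "real => real"
 assumes lim: "!!e. e > 0 ==> \<exists>d>0. \<forall>y\<in>I d. \<bar>u y - l\<bar> < e"
  and I: "!!d. d > 0 ==> open (I d) & I d ~= {}" "!!d d'. d <= d' ==> I d \<subseteq> I d'"
 shows "(THE l. \<forall>e>0. \<exists>d>0. AE y in lebesgue_on (I d). \<bar>u y - l\<bar> < e) = l"
proof (rule the_equality)
 show "\<forall>e>0. \<exists>d>0. AE y in lebesgue_on (I d). \<bar>u y - l\<bar> < e"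
 proof (intro allI impI)
  fix e :: real assume "e > 0"
  then obtain d where "d > 0" "\<forall>y\<in>I d. \<bar>u y - l\<bar> < e" using lim by blast
  thus "\<exists>d>0. AE y in lebesgue_on (I d). \<bar>u y - l\<bar> < e" by (intro exI[of _ d]) (auto intro!: AE_I2)
 qed
 fix l' assume l': "\<forall>e>0. \<exists>d>0. AE y in lebesgue_on (I d). \<bar>u y - l'\<bar> < e"
 show "l' = l"
 proof (rule ccontr)
  assume "l' ~= l"
  define e where "e = \<bar>l - l'\<bar> / 2"
  have e: "e > 0" using \<open>l' ~= l\<close> by (simp add: e_def)
  obtain d1 where d1: "d1 > 0" "\<forall>y\<in>I d1. \<bar>u y - l\<bar> < e" using lim[OF e] by blast
  obtain d2 where d2: "d2 > 0" "AE y in lebesgue_on (I d2). \<bar>u y - l'\<bar> < e" using l' e by blast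
  define d where "d = min d1 d2"
  have d: "d > 0" "d <= d1" "d <= d2" using d1(1) d2(1) by (auto simp: d_def)
  have "I d2 \<in> sets lebesgue" using I(1)[OF d2(1)] by simp
  hence n: "negligible {y \<in> I d2. \<not> \<bar>u y - l'\<bar> < e}" using d2(2) by (simp add: AE_lebesgue_on_iff_negligible)
  have "I d \<subseteq> {y \<in> I d2. \<not> \<bar>u y - l'\<bar> < e}"
  proof
   fix y assume "y \<in> I d"
   hence "y \<in> I d2" "\<bar>u y - l\<bar> < e" using I(2) d d1(2) by blast+
   moreover have "\<not> (\<bar>u y - l\<bar> < e & \<bar>u y - l'\<bar> < e)" unfolding e_def by argo
   ultimately show "y \<in> {y \<in> I d2. \<not> \<bar>u y - l'\<bar> < e}" by blast
  qed
  hence "negligible (I d)" by (rule negligible_subset[OF n])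
  thus False using I(1)[OF d(1)] open_not_negligible by blast
 qed
qed

lemma rlim_eqI:
 assumes "(u \<longlongrightarrow> l) (at_right x)"
 shows "rlim u x = l"
 unfolding rlim_def
proof (rule ae_limit_eqI[where I = "%d. {x<..<x + d}"])
 fix e :: real assume "e > 0"
 hence "\<forall>\<^sub>F y in at_right x. \<bar>u y - l\<bar> < e" using tendstoD[OF assms] by (simp add: dist_real_def)
 then obtain b where "b > x" "!!y. x < y ==> y < b ==> \<bar>u y - l\<bar> < e" by (auto simp: eventually_at_right_field)
 thus "\<exists>d>0. \<forall>y\<in>{x<..<x + d}. \<bar>u y - l\<bar> < e" by (intro exI[of _ "b - x"]) auto
qed auto

lemma llim_eqI:
 assumes "(u \<longlongrightarrow> l) (at_left x)"
 shows "llim u x = l"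
 unfolding llim_def
proof (rule ae_limit_eqI[where I = "%d. {x - d<..<x}"])
 fix e :: real assume "e > 0"
 hence "\<forall>\<^sub>F y in at_left x. \<bar>u y - l\<bar> < e" using tendstoD[OF assms] by (simp add: dist_real_def)
 then obtain b where "b < x" "!!y. b < y ==> y < x ==> \<bar>u y - l\<bar> < e" by (auto simp: eventually_at_left_field)
 thus "\<exists>d>0. \<forall>y\<in>{x - d<..<x}. \<bar>u y - l\<bar> < e" by (intro exI[of _ "x - b"]) auto
qed auto

context one_jump
begin

lemma rlim_u0:
 assumes "0 <= x" "x < L"
 shows "rlim u0 x = c * x + (if L / 2 <= x then j else 0)"
proof (rule rlim_eqI)
 have "((%y. c * y + (if L / 2 <= x then j else 0)) \<longlongrightarrow> c * x + (if L / 2 <= x then j else 0)) (at_right x)"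
  by (intro tendsto_intros)
 moreover have "\<forall>\<^sub>F y in at_right x. c * y + (if L / 2 <= x then j else 0) = u0 y"
  unfolding eventually_at_right_field
 proof (intro exI[of _ "if L / 2 <= x then L else L / 2"] conjI allI impI)
  show "x < (if L / 2 <= x then L else L / 2)" using assms by simp
  fix y assume "x < y" "y < (if L / 2 <= x then L else L / 2)"
  thus "c * y + (if L / 2 <= x then j else 0) = u0 y"
   by (auto simp: affine_jump_def indicator_def split: if_splits)
 qed
 ultimately show "(u0 \<longlongrightarrow> c * x + (if L / 2 <= x then j else 0)) (at_right x)" by (rule Lim_transform_eventually)
qed

lemma llim_u0:
 assumes "0 < x" "x <= L"
 shows "llim u0 x = c * x + (if L / 2 < x then j else 0)"
proof (rule llim_eqI)
 have "((%y. c * y + (if L / 2 < x then j else 0)) \<longlongrightarrow> c * x + (if L / 2 < x then j else 0)) (at_left x)"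
  by (intro tendsto_intros)
 moreover have "\<forall>\<^sub>F y in at_left x. c * y + (if L / 2 < x then j else 0) = u0 y"
  unfolding eventually_at_left_field
 proof (intro exI[of _ "if L / 2 < x then L / 2 else 0"] conjI allI impI)
  show "(if L / 2 < x then L / 2 else 0) < x" using assms by simp
  fix y assume "y < x" "(if L / 2 < x then L / 2 else 0) < y"
  thus "c * y + (if L / 2 < x then j else 0) = u0 y"
   using assms by (auto simp: affine_jump_def indicator_def split: if_splits)
 qed
 ultimately show "(u0 \<longlongrightarrow> c * x + (if L / 2 < x then j else 0)) (at_left x)" by (rule Lim_transform_eventually)
qed

lemma J_inner_u0: "J_inner L u0 = (if j = 0 then {} else {L / 2})"
proof -
 have eq: "rlim u0 x - llim u0 x = (if x = L / 2 then j else 0)" if "x \<in> {0<..<L}" for x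
  using that by (auto simp: rlim_u0 llim_u0)
 have iff: "(rlim u0 x - llim u0 x ~= 0) = (x = L / 2 & j ~= 0)" if "x \<in> {0<..<L}" for x
  unfolding eq[OF that] by simp
 have "J_inner L u0 = {x \<in> {0<..<L}. x = L / 2 & j ~= 0}"
  unfolding J_inner_def by (rule Collect_cong, rule conj_cong, rule refl, erule iff)
 moreover have "L / 2 \<in> {0<..<L}" using L by simp
 hence "{x \<in> {0<..<L}. x = L / 2 & j ~= 0} = (if j = 0 then {} else {L / 2})"
 proof (cases "j = 0")
  case False
  thus ?thesis using \<open>L / 2 \<in> {0<..<L}\<close> by auto
 qed simp
 ultimately show ?thesis by (rule trans)
qed

lemma jump_u0: "jump L a u0 (L / 2) = j"
 using L by (simp add: jump_def rlim_u0 llim_u0)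

lemma J_bdry_u0: "J_bdry L (c * L + j) u0 = (if j = 0 then {} else {L / 2})"
proof -
 have "jump L (c * L + j) u0 x = (if x = L / 2 then j else 0)" if "x \<in> {0..L}" for x
  using that L by (auto simp: jump_def rlim_u0 llim_u0)
 thus ?thesis using L unfolding J_bdry_def by (auto split: if_splits)
qed

lemma Cantor_var_u0: "Cantor_var L u0 = 0"
proof -
 obtain w where "Lebesgue_decomp L u0 w (sing_set L u0)" using sing_set_u0 by blast
 hence S: "sing_set L u0 \<in> sets borel" "emeasure lborel (sing_set L u0) = 0"
  by (auto simp: Lebesgue_decomp_def)
 have "emeasure lborel ((sing_set L u0 - J_inner L u0) \<inter> {0<..<L}) <= emeasure lborel (sing_set L u0)"
  using S by (intro emeasure_mono) (auto simp: J_inner_u0)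
 hence "measure lborel ((sing_set L u0 - J_inner L u0) \<inter> {0<..<L}) = 0" using S by (simp add: measure_def)
 thus ?thesis unfolding Cantor_var_def
  using S by (subst D_u0) (auto simp: J_inner_u0)
qed

lemma SBV_u0: "SBV L u0"
 using BV_u0 Cantor_var_u0 by (simp add: SBV_def)

lemma F_lim_u0:
 assumes s: "0 < \<sigma>"
 shows "F_lim L \<sigma> f (c * L + j) u0 (%_. 1)
  = ennreal (L * phi_bulk \<sigma> c) + (if j = 0 then 0 else ennreal (g_coh f j))"
proof -
 have "(\<integral>\<^sup>+x. ennreal (phi_bulk \<sigma> (ac_density L u0 x)) \<partial>lebesgue_on {0<..<L})
   = (\<integral>\<^sup>+x. ennreal (phi_bulk \<sigma> c) \<partial>lebesgue_on {0<..<L})"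
  by (rule nn_integral_cong_AE) (use ac_density_u0 in eventually_elim, simp)
 also have "\<dots> = ennreal (phi_bulk \<sigma> c) * emeasure lborel {0<..<L}"
  by (simp add: emeasure_restrict_space space_restrict_space)
 also have "\<dots> = ennreal (L * phi_bulk \<sigma> c)"
  using L by (simp add: ennreal_mult' mult.commute)
 finally have "(\<integral>\<^sup>+x. ennreal (phi_bulk \<sigma> (ac_density L u0 x)) \<partial>lebesgue_on {0<..<L}) = ennreal (L * phi_bulk \<sigma> c)" .
 moreover have "(\<Sum>\<^sub>\<infinity>x\<in>J_bdry L (c * L + j) u0. ennreal (g_coh f \<bar>jump L (c * L + j) u0 x\<bar>))
   = (if j = 0 then 0 else ennreal (g_coh f j))"
  using j0 by (simp add: J_bdry_u0 jump_u0)
 ultimately show ?thesis using BV_u0 Cantor_var_u0 by (simp add: F_lim_def Phi_lim_def)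
qed

end

section \<open>The degradation function\<close>

locale degr =
 fixes \<sigma> :: real and f :: "real => real"
 assumes \<sigma>_pos: "0 < \<sigma>" and deg: "degradation \<sigma> f"
begin

definition f1 :: "real => real" where "f1 = deriv_in {0..<1} f"

lemma within_not_bot: "t \<in> {0..<1::real} ==> at t within {0..<1} ~= bot"
proof -
 assume t: "t \<in> {0..<1::real}"
 hence "t islimpt {t<..<1}" by (intro islimpt_greaterThanLessThan1) auto
 hence "t islimpt {0..<1}" by (rule islimpt_subset) (use t in auto)
 thus ?thesis by (simp add: trivial_limit_within)
qed

lemma f_C2:
 obtains f2 where "!!t. t \<in> {0..<1} ==> (f has_real_derivative f1 t) (at t within {0..<1})"
  "!!t. t \<in> {0..<1} ==> (f1 has_real_derivative f2 t) (at t within {0..<1})" "continuous_on {0..<1} f2"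
proof -
 obtain h1 h2 where h: "\<forall>x\<in>{0..<1}. (f has_real_derivative h1 x) (at x within {0..<1})"
   "\<forall>x\<in>{0..<1}. (h1 has_real_derivative h2 x) (at x within {0..<1})" "continuous_on {0..<1} h2"
  using deg unfolding degradation_def C2_on_def by blast
 have eq: "f1 t = h1 t" if "t \<in> {0..<1}" for t
  unfolding f1_def
 proof (rule vector_derivative_within)
  show "at t within {0..<1} ~= bot" by (rule within_not_bot[OF that])
  show "(f has_vector_derivative h1 t) (at t within {0..<1})"
   using h(1) that by (simp add: has_real_derivative_iff_has_vector_derivative)
 qed
 have "(f1 has_real_derivative h2 t) (at t within {0..<1})" if "t \<in> {0..<1}" for t
  by (rule has_field_derivative_transform_within[of h1 _ _ _ 1]) (use h(2) that eq in auto)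
 thus ?thesis using that[of h2] h eq by auto
qed

lemma f_deriv_within: "t \<in> {0..<1} ==> (f has_real_derivative f1 t) (at t within {0..<1})"
 using f_C2 by blast

lemma f1_continuous: "continuous_on {0..<1} f1"
 using f_C2 by (metis DERIV_continuous_on)

lemma f_continuous: "continuous_on {0..<1} f"
 using f_deriv_within by (rule DERIV_continuous_on)

lemma at_within_inner: "t \<in> {0<..<1::real} ==> at t within {0..<1} = at t"
proof -
 assume "t \<in> {0<..<1}"
 thus ?thesis by (intro at_within_open_subset[of t "{0<..<1}"]) auto
qed

lemma f_deriv: "t \<in> {0<..<1} ==> (f has_real_derivative f1 t) (at t)"
 using f_deriv_within[of t] at_within_inner[of t] by auto

lemma f_zero: "f 0 = 0"
proof -
 have "{s \<in> {0..<1}. f s = 0} = {0}" using deg by (simp add: degradation_def)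
 thus ?thesis by blast
qed

lemma f_pos: "t \<in> {0<..<1} ==> 0 < f t"
proof -
 assume t: "t \<in> {0<..<1}"
 have "{s \<in> {0..<1}. f s = 0} = {0}" "\<forall>s\<in>{0..<1}. 0 <= f s" using deg by (simp_all add: degradation_def)
 thus ?thesis using t by (metis (mono_tags, lifting) atLeastLessThan_iff greaterThanLessThan_iff less_eq_real_def mem_Collect_eq singletonD)
qed

definition k :: "real => real" where "k t = (if t < 1 then (1 - t) * f t else \<sigma>)"

definition k1 :: "real => real" where "k1 t = (1 - t) * f1 t - f t"

lemma k_deriv_within: "t \<in> {0..<1} ==> (k has_real_derivative k1 t) (at t within {0..<1})"
proof -
 assume t: "t \<in> {0..<1}"
 have "((%t. (1 - t) * f t) has_real_derivative k1 t) (at t within {0..<1})"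
  using f_deriv_within[OF t] by (auto intro!: derivative_eq_intros simp: k1_def)
 thus ?thesis
  by (rule has_field_derivative_transform_within[of _ _ _ _ 1]) (use t in \<open>auto simp: k_def\<close>)
qed

lemma k_deriv: "t \<in> {0<..<1} ==> (k has_real_derivative k1 t) (at t)"
 using k_deriv_within[of t] at_within_inner[of t] by auto

lemma k1_continuous: "continuous_on {0..<1} k1"
 unfolding k1_def[abs_def] by (intro continuous_intros f1_continuous f_continuous)

lemma k1_pos: "t \<in> {0<..<1} ==> 0 < k1 t"
proof -
 assume t: "t \<in> {0<..<1}"
 have "((%t. (1 - t) * f t) has_real_derivative k1 t) (at t)"
  using f_deriv[OF t] by (auto intro!: derivative_eq_intros simp: k1_def)
 hence "deriv (%t. (1 - t) * f t) t = k1 t" by (rule DERIV_imp_deriv)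
 moreover have "\<forall>s\<in>{0<..<1}. deriv (%t. (1 - t) * f t) s > 0" using deg unfolding degradation_def by (elim conjE)
 ultimately show ?thesis using t by metis
qed

lemma f1_pos: "t \<in> {0<..<1} ==> 0 < f1 t"
proof -
 assume t: "t \<in> {0<..<1}"
 have "0 < (1 - t) * f1 t" using k1_pos[OF t] f_pos[OF t] by (simp add: k1_def)
 thus ?thesis using t by (simp add: zero_less_mult_iff)
qed

lemma k_0 [simp]: "k 0 = 0" by (simp add: k_def f_zero)
lemma k_1 [simp]: "k 1 = \<sigma>" by (simp add: k_def)

lemma k_continuous: "continuous_on {0..1} k"
proof -
 have "isCont k t" if "t \<in> {0<..<1}" for t using k_deriv[OF that] by (rule DERIV_isCont)
 moreover have "(k \<longlongrightarrow> k 1) (at_left 1)"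
 proof -
  have "((%s. (1 - s) * f s) \<longlongrightarrow> \<sigma>) (at_left 1)" using deg by (simp add: degradation_def)
  moreover have "\<forall>\<^sub>F s in at_left 1. (1 - s) * f s = k s"
   unfolding eventually_at_left_field by (intro exI[of _ 0]) (auto simp: k_def)
  ultimately show ?thesis by (simp add: Lim_transform_eventually)
 qed
 moreover have "(k \<longlongrightarrow> k 0) (at_right 0)"
 proof -
  have "continuous_on {0..<1} k" using k_deriv_within by (rule DERIV_continuous_on)
  hence "continuous_on {0..1/2} k" by (rule continuous_on_subset) auto
  thus ?thesis by (rule continuous_on_Icc_at_rightD) simp
 qed
 ultimately show ?thesis by (intro continuous_on_IccI) (auto simp: isCont_def)
qed

lemma k_strict_mono: "0 <= x ==> x < y ==> y <= 1 ==> k x < k y"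
proof -
 assume xy: "0 <= x" "x < y" "y <= 1"
 show ?thesis
 proof (rule DERIV_pos_imp_increasing_open[OF xy(2)])
  show "\<exists>l. (k has_real_derivative l) (at z) & 0 < l" if "x < z" "z < y" for z
   using k_deriv[of z] k1_pos[of z] that xy by auto
  show "continuous_on {x..y} k" by (rule continuous_on_subset[OF k_continuous]) (use xy in auto)
 qed
qed

lemma k_mono: "0 <= x ==> x <= y ==> y <= 1 ==> k x <= k y"
 using k_strict_mono[of x y] by (cases "x = y") auto

lemma k_pos: "0 < x ==> x <= 1 ==> 0 < k x"
 using k_strict_mono[of 0 x] by simp

lemma k_less_\<sigma>: "0 <= x ==> x < 1 ==> k x < \<sigma>"
 using k_strict_mono[of x 1] by simp

lemma k_nonneg: "0 <= x ==> x <= 1 ==> 0 <= k x"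
 using k_mono[of 0 x] by simp

text \<open>Differentiating \<open>k\<close> with respect to \<open>z = (1 - t)\<^sup>2/2\<close> gives \<open>- 1/\<rho>\<close>; along a geodesic of
constant \<open>C = k cos \<theta>\<close> the function \<open>\<rho>\<close> is the rate of change of the displacement with respect
to the angle \<open>\<theta>\<close>.\<close>

definition \<rho> :: "real => real" where "\<rho> t = (1 - t) / k1 t"

lemma \<rho>_pos: "t \<in> {0<..<1} ==> 0 < \<rho> t"
 using k1_pos[of t] by (simp add: \<rho>_def)

lemma \<rho>_continuous: "continuous_on {0<..<1} \<rho>"
proof -
 have "continuous_on {0<..<1} k1" by (rule continuous_on_subset[OF k1_continuous]) auto
 thus ?thesis unfolding \<rho>_def[abs_def] using k1_pos by (intro continuous_intros) force+
qed

text \<open>In the variable \<open>z = (1 - t)\<^sup>2 / 2\<close> the convexity hypothesis says that \<open>k\<close> is convex, with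
 slope \<open>- 1 / \<rho>\<close>. This is the tangent line inequality.\<close>

lemma k_tangent:
 assumes t: "t \<in> {0<..<1}" and x: "x \<in> {0..1}"
 shows "k t + ((1 - t)\<^sup>2 / 2 - (1 - x)\<^sup>2 / 2) / \<rho> t <= k x"
proof -
 define \<phi> where "\<phi> s = sqrt s * f (1 - sqrt s)" for s
 have conv: "convex_on {0<..1} \<phi>" using deg unfolding degradation_def \<phi>_def[abs_def] by blast
 have \<phi>k: "\<phi> s = k (1 - sqrt s)" if "0 < s" for s using that by (simp add: \<phi>_def k_def)
 define c where "c = (1 - t)\<^sup>2"
 have c: "0 < c" "c < 1" "sqrt c = 1 - t" using t by (auto simp: c_def power_less_one_iff)
 have D: "(\<phi> has_real_derivative - (k1 t / (2 * (1 - t)))) (at c)"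
 proof -
  have kd: "(k has_real_derivative k1 t) (at (1 - sqrt c))" using k_deriv[OF t] c(3) by simp
  have "((%s. 1 - sqrt s) has_real_derivative - (inverse (sqrt c) / 2)) (at c)"
   using c(1) by (auto intro!: derivative_eq_intros)
  note ch = DERIV_chain2[OF kd this]
  have "k1 t * - (inverse (sqrt c) / 2) = - (k1 t / (2 * (1 - t)))"
   unfolding c(3) by (simp add: field_simps)
  hence d: "((%s. k (1 - sqrt s)) has_real_derivative - (k1 t / (2 * (1 - t)))) (at c)"
   by (rule DERIV_cong[OF ch])
  have ev: "\<forall>\<^sub>F s in nhds c. \<phi> s = k (1 - sqrt s)"
   by (rule eventually_mono[OF eventually_nhds_in_open[of "{0<..}"]]) (use c(1) \<phi>k in auto)
  show ?thesis by (rule DERIV_cong_ev[OF refl ev refl, THEN iffD2, OF d])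
 qed
 have lt1: "k t + ((1 - t)\<^sup>2 / 2 - (1 - y)\<^sup>2 / 2) / \<rho> t <= k y" if y: "0 <= y" "y < 1" for y
 proof -
  have my: "(1 - y)\<^sup>2 \<in> {0<..1}" using y by (auto simp: power_le_one)
  have ci: "c \<in> interior {0<..1}" using c by (intro interiorI[of "{0<..<1}"]) auto
  have "\<phi> ((1 - y)\<^sup>2) - \<phi> c \<ge> - (k1 t / (2 * (1 - t))) * ((1 - y)\<^sup>2 - c)"
   by (rule convex_on_imp_above_tangent[OF conv _ ci my has_field_derivative_at_within[OF D]]) simp
  moreover have "\<phi> ((1 - y)\<^sup>2) = k y" using y by (subst \<phi>k) auto
  moreover have "\<phi> c = k t" using c by (subst \<phi>k) auto
  moreover have "- (k1 t / (2 * (1 - t))) * ((1 - y)\<^sup>2 - c) = ((1 - t)\<^sup>2 / 2 - (1 - y)\<^sup>2 / 2) / \<rho> t"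
   using t k1_pos[OF t] by (simp add: \<rho>_def c_def field_simps)
  ultimately show ?thesis by simp
 qed
 show ?thesis
 proof (cases "x < 1")
  case False
  hence "x = 1" using x by auto
  have k1lim: "(k \<longlongrightarrow> k 1) (at_left 1)" by (rule continuous_on_Icc_at_leftD[OF k_continuous]) simp
  have "((%y. k t + ((1 - t)\<^sup>2 / 2 - (1 - y)\<^sup>2 / 2) / \<rho> t) \<longlongrightarrow> k t + ((1 - t)\<^sup>2 / 2 - (1 - 1)\<^sup>2 / 2) / \<rho> t) (at_left 1)"
   by (intro tendsto_intros) (use \<rho>_pos[OF t] in auto)
  moreover have "\<forall>\<^sub>F y in at_left 1. k t + ((1 - t)\<^sup>2 / 2 - (1 - y)\<^sup>2 / 2) / \<rho> t <= k y"
   unfolding eventually_at_left_field using lt1 by (intro exI[of _ 0]) auto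
  ultimately show ?thesis using tendsto_le[OF trivial_limit_at_left_real k1lim] \<open>x = 1\<close> by blast
 qed (use lt1 x in auto)
qed

lemma \<rho>_antimono:
 assumes "0 < t" "t <= x" "x < 1"
 shows "\<rho> x <= \<rho> t"
proof (cases "t = x")
 case False
 define D where "D = (1 - t)\<^sup>2 / 2 - (1 - x)\<^sup>2 / 2"
 have "(1 - x)\<^sup>2 < (1 - t)\<^sup>2" using assms False by (intro power_strict_mono) auto
 hence D: "D > 0" by (simp add: D_def)
 have p: "\<rho> x > 0" "\<rho> t > 0" using \<rho>_pos assms by auto
 have "k t + D / \<rho> t <= k x" using k_tangent[of t x] assms by (simp add: D_def)
 moreover have "k x + (- D) / \<rho> x <= k t" using k_tangent[of x t] assms by (simp add: D_def)
 ultimately have "D / \<rho> t <= D / \<rho> x" by simp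
 thus ?thesis using D p by (simp add: field_simps)
qed simp

definition \<kappa> :: "real => real" where "\<kappa> = inv_into {0..1} k"

lemma k_inj: "inj_on k {0..1}"
proof (rule inj_onI)
 fix x y assume "x \<in> {0..1}" "y \<in> {0..1}" "k x = k y"
 thus "x = y" using k_strict_mono[of x y] k_strict_mono[of y x] by (cases x y rule: linorder_cases) auto
qed

lemma k_image: "k ` {0..1} = {0..\<sigma>}"
proof
 show "k ` {0..1} \<subseteq> {0..\<sigma>}" using k_nonneg k_mono[of _ 1] by auto
 show "{0..\<sigma>} \<subseteq> k ` {0..1}"
 proof
  fix y assume "y \<in> {0..\<sigma>}"
  hence "\<exists>x\<ge>0. x <= 1 & k x = y" by (intro IVT' k_continuous) auto
  thus "y \<in> k ` {0..1}" by auto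
 qed
qed

lemma k_\<kappa>: "y \<in> {0..\<sigma>} ==> k (\<kappa> y) = y"
 unfolding \<kappa>_def by (rule f_inv_into_f) (simp add: k_image)

lemma \<kappa>_range: "y \<in> {0..\<sigma>} ==> \<kappa> y \<in> {0..1}"
 unfolding \<kappa>_def by (rule inv_into_into) (simp add: k_image)

lemma \<kappa>_k: "t \<in> {0..1} ==> \<kappa> (k t) = t"
 unfolding \<kappa>_def by (rule inv_into_f_f[OF k_inj])

lemma \<kappa>_continuous: "continuous_on {0..\<sigma>} \<kappa>"
proof -
 have "continuous_on {0..\<sigma>} (the_inv_into {0..1} k)"
  using continuous_on_inv_into[OF k_continuous compact_Icc k_inj] by (simp add: k_image)
 moreover have "the_inv_into {0..1} k y = \<kappa> y" if "y \<in> {0..\<sigma>}" for y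
  by (rule the_inv_into_f_eq[OF k_inj k_\<kappa>[OF that] \<kappa>_range[OF that]])
 ultimately show ?thesis by (rule continuous_on_eq)
qed

lemma \<kappa>_mono: "0 <= y ==> y <= w ==> w <= \<sigma> ==> \<kappa> y <= \<kappa> w"
 using k_strict_mono[of "\<kappa> w" "\<kappa> y"] k_\<kappa>[of y] k_\<kappa>[of w] \<kappa>_range[of y] \<kappa>_range[of w]
 by (cases "\<kappa> w < \<kappa> y") auto

lemma \<kappa>_inner: "0 < y ==> y < \<sigma> ==> \<kappa> y \<in> {0<..<1}"
proof -
 assume y: "0 < y" "y < \<sigma>"
 hence "k (\<kappa> y) = y" "\<kappa> y \<in> {0..1}" using k_\<kappa>[of y] \<kappa>_range[of y] by auto
 thus ?thesis using y by (cases "\<kappa> y = 0 \<or> \<kappa> y = 1") auto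
qed

text \<open>The slope \<open>\<rho>\<close> as a function of \<open>y = k t\<close>; beyond \<open>\<sigma>\<close> it is extended by zero, which keeps it
 nonincreasing.\<close>

definition r :: "real => real" where "r y = (if y < \<sigma> then \<rho> (\<kappa> y) else 0)"

lemma r_pos: "0 < y ==> y < \<sigma> ==> 0 < r y"
 using \<rho>_pos[OF \<kappa>_inner] by (simp add: r_def)

lemma r_nonneg: "0 < y ==> 0 <= r y"
 using r_pos[of y] by (cases "y < \<sigma>") (auto simp: r_def)

lemma r_antimono: "0 < y ==> y <= w ==> r w <= r y"
proof (cases "w < \<sigma>")
 case True
 assume "0 < y" "y <= w"
 thus ?thesis using True \<kappa>_inner[of y] \<kappa>_inner[of w] \<kappa>_mono[of y w] \<rho>_antimono[of "\<kappa> y" "\<kappa> w"]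
  by (simp add: r_def)
next
 case False
 assume "0 < y" "y <= w"
 thus ?thesis using False r_nonneg[of y] by (simp add: r_def)
qed

lemma r_k: "t \<in> {0<..<1} ==> r (k t) = \<rho> t"
 using k_less_\<sigma>[of t] by (simp add: r_def \<kappa>_k)

lemma r_continuous: "continuous_on {0<..<\<sigma>} r"
proof -
 have "continuous_on {0<..<\<sigma>} (%y. \<rho> (\<kappa> y))"
 proof (rule continuous_on_compose2[OF \<rho>_continuous])
  show "continuous_on {0<..<\<sigma>} \<kappa>" by (rule continuous_on_subset[OF \<kappa>_continuous]) auto
  show "\<kappa> ` {0<..<\<sigma>} \<subseteq> {0<..<1}" using \<kappa>_inner by auto
 qed
 thus ?thesis by (rule continuous_on_eq) (simp add: r_def)
qed

text \<open>The quotient is the product of \<open>(1 - t) f'/f\<close>, decreasing by hypothesis, and of \<open>1/k\<^sup>2\<close>,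
decreasing because \<open>k\<close> increases.\<close>

lemma q_antimono:
 assumes "0 < s" "s <= t" "t < 1"
 shows "f1 t / (f t ^ 3 * (1 - t)) <= f1 s / (f s ^ 3 * (1 - s))"
proof (cases "s = t")
 case False
 obtain f2 where f2: "!!t. t \<in> {0..<1} ==> (f1 has_real_derivative f2 t) (at t within {0..<1})"
  by (rule f_C2) blast
 define A where "A t = (1 - t) * f1 t / f t" for t
 have dA: "\<exists>y. (A has_real_derivative y) (at x) & y < 0" if x: "x \<in> {0<..<1}" for x
 proof -
  have d1: "(f1 has_real_derivative f2 x) (at x)" using f2[of x] at_within_inner[OF x] x by auto
  have "\<exists>y. (A has_real_derivative y) (at x)"
   unfolding A_def using f_pos[OF x]
   by (intro exI) (rule DERIV_divide[OF DERIV_mult[OF DERIV_diff[OF DERIV_const DERIV_ident] d1] f_deriv[OF x]], simp)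
  then obtain y where y: "(A has_real_derivative y) (at x)" ..
  have ev: "\<forall>\<^sub>F t in nhds x. (1 - t) * deriv f t / f t = A t"
   by (rule eventually_mono[OF eventually_nhds_in_open[of "{0<..<1}"]])
    (use x DERIV_imp_deriv[OF f_deriv] in \<open>auto simp: A_def\<close>)
  have "((%t. (1 - t) * deriv f t / f t) has_real_derivative y) (at x)"
   using y DERIV_cong_ev[OF refl ev refl] by simp
  hence "deriv (%t. (1 - t) * deriv f t / f t) x = y" by (rule DERIV_imp_deriv)
  moreover have "\<forall>s\<in>{0<..<1}. deriv (%t. (1 - t) * deriv f t / f t) s < 0" using deg unfolding degradation_def by (elim conjE)
  ultimately show ?thesis using y x by metis
 qed
 have "A t < A s"
  by (rule DERIV_neg_imp_decreasing) (use assms False dA in auto)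
 moreover have "A t > 0" using f1_pos[of t] f_pos[of t] assms by (auto simp: A_def)
 moreover have kk: "k s <= k t" "0 < k s" using k_mono[of s t] k_pos[of s] assms by auto
 ultimately have "A t / (k t)\<^sup>2 <= A s / (k s)\<^sup>2"
  by (intro frac_le power_mono) auto
 moreover have "f1 x / (f x ^ 3 * (1 - x)) = A x / (k x)\<^sup>2" if "x \<in> {0<..<1}" for x
 proof -
  have "f x ~= 0" "1 - x ~= 0" using that f_pos[OF that] by auto
  thus ?thesis using that
   by (simp add: A_def k_def power2_eq_square power3_eq_cube divide_divide_eq_left mult_divide_mult_cancel_left_if mult.assoc mult.left_commute)
 qed
 ultimately show ?thesis using assms by simp
qed simp

end

lemma bounded_continuous_abs_integrable:
 fixes g :: "real => real"
 assumes "continuous_on {a<..<b} g" "!!x. x \<in> {a<..<b} ==> \<bar>g x\<bar> <= B"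
 shows "g absolutely_integrable_on {a..b}"
proof -
 have "g absolutely_integrable_on {a<..<b}"
 proof (rule measurable_bounded_by_integrable_imp_absolutely_integrable)
  show "g \<in> borel_measurable (lebesgue_on {a<..<b})"
   using assms(1) by (intro continuous_imp_measurable_on_sets_lebesgue) auto
  show "(%x. B) integrable_on {a<..<b}" by (rule integrable_on_const) simp
 qed (use assms(2) in auto)
 thus ?thesis by (simp add: absolutely_integrable_on_Icc_iff_Ioo)
qed

lemma integral_le_open:
 fixes f g :: "real => real"
 assumes "f integrable_on {a..b}" "g integrable_on {a..b}" "!!x. a < x ==> x < b ==> f x <= g x"
 shows "integral {a..b} f <= integral {a..b} g"
 unfolding integral_open_interval_real
 by (rule integral_le) (use assms in \<open>auto simp: integrable_on_open_interval_real\<close>)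

lemma primitive_has_derivative:
 assumes S: "open S" "convex S" "x0 \<in> S" "x \<in> S" and w: "continuous_on S w"
 shows "(primitive x0 w has_real_derivative w x) (at x)"
proof -
 obtain e where e: "e > 0" "cball x e \<subseteq> S" using S open_contains_cball by blast
 hence sub: "{x - e..x + e} \<subseteq> S" by (auto simp: dist_real_def subset_iff)
 have ac: "ac_on (x - e) (x + e) (primitive x0 w) w"
  by (rule primitive_ac_on[OF _ S(2,3) _ sub])
   (use e in \<open>auto intro: absolutely_integrable_continuous_real continuous_on_subset[OF w]\<close>)
 have "((%y. primitive x0 w (x - e) + integral {x - e..y} w) has_real_derivative 0 + w x) (at x within {x - e..x + e})"
  by (intro DERIV_add DERIV_const integral_has_real_derivative continuous_on_subset[OF w sub]) (use e in auto)
 hence d: "((%y. primitive x0 w (x - e) + integral {x - e..y} w) has_real_derivative w x) (at x within {x - e..x + e})"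
  by simp
 have eq: "primitive x0 w (x - e) + integral {x - e..y} w = primitive x0 w y" if "y \<in> {x - e..x + e}" for y
  by (rule ac_onD[OF ac that, symmetric])
 have "(primitive x0 w has_real_derivative w x) (at x within {x - e..x + e})"
  by (rule has_field_derivative_transform_within[OF d zero_less_one]) (use e eq in auto)
 moreover have "at x within {x - e..x + e} = at x" using e by (intro at_within_interior) simp
 ultimately show ?thesis by simp
qed

context degr
begin

section \<open>Geodesics of the degenerate metric\<close>

text \<open>A geodesic with \<open>k cos \<theta> = C\<close> is parametrised by its angle \<open>\<theta> \<in> [-\<Theta>(C), \<Theta>(C)]\<close>: at \<open>\<theta> = 0\<close> it is
deepest (\<open>k = C\<close>) and at \<open>\<theta> = \<plusminus>\<Theta>(C)\<close> it reaches \<open>k = \<sigma>\<close>, that is \<open>t = 1\<close>. Here \<open>gr\<close> is the speed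
of the displacement, \<open>RR\<close> the displacement, \<open>S\<close> the total opening and \<open>zs\<close> the coordinate \<open>z =
(1 - t)\<^sup>2/2\<close>; \<open>KK\<close> is the part of the length that is not \<open>C S\<close>. Since \<open>gr\<close> and \<open>zs\<close> vanish
beyond \<open>\<Theta>\<close>, all integrals run up to \<open>pi/2\<close>, which keeps the domain independent of \<open>C\<close>.\<close>

definition \<Theta> :: "real => real" where "\<Theta> C = arccos (C / \<sigma>)"

definition gr :: "real => real => real" where "gr C \<theta> = r (C / cos \<theta>)"

definition RR :: "real => real => real" where "RR C \<theta> = integral {0..\<theta>} (gr C)"

definition S :: "real => real" where "S C = 2 * RR C (pi / 2)"

definition zs :: "real => real => real" where "zs C \<theta> = (1 - \<kappa> (min (C / cos \<theta>) \<sigma>))\<^sup>2 / 2"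

definition KK :: "real => real" where "KK C = 2 * integral {0..pi / 2} (%\<theta>. cos \<theta> * zs C \<theta>)"

lemma neg_one_le_quot: "0 < (C::real) ==> 0 < K ==> - 1 <= C / K"
 by (rule order_trans[of _ 0]) auto

lemma \<Theta>_bounds: "0 < C ==> C < \<sigma> ==> 0 < \<Theta> C & \<Theta> C < pi / 2"
proof -
 assume C: "0 < C" "C < \<sigma>"
 hence q: "0 < C / \<sigma>" "C / \<sigma> < 1" using \<sigma>_pos by auto
 have "arccos (C / \<sigma>) < arccos 0" using q by (intro arccos_less_arccos) auto
 moreover have "arccos 1 < arccos (C / \<sigma>)" using q by (intro arccos_less_arccos) auto
 ultimately show ?thesis by (simp add: \<Theta>_def)
qed

lemma cos_\<Theta>: "0 < C ==> C < \<sigma> ==> cos (\<Theta> C) = C / \<sigma>"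
 unfolding \<Theta>_def by (rule cos_arccos) (use \<sigma>_pos neg_one_le_quot[of C \<sigma>] in auto)

lemma cos_pos_inner: "\<bar>\<theta>\<bar> < pi / 2 ==> 0 < cos \<theta>"
 by (rule cos_gt_zero_pi) auto

lemma cos_abs_le_one: "\<bar>\<theta>\<bar> < pi / 2 ==> 0 < C ==> C <= C / cos \<theta>"
 using cos_pos_inner[of \<theta>] cos_le_one[of \<theta>] by (simp add: pos_le_divide_eq)

lemma quot_less_\<sigma>:
 assumes C: "0 < C" "C < \<sigma>" and th: "\<bar>\<theta>\<bar> < \<Theta> C"
 shows "C <= C / cos \<theta>" "C / cos \<theta> < \<sigma>" "0 < cos \<theta>"
proof -
 have b: "\<bar>\<theta>\<bar> < pi / 2" using th \<Theta>_bounds[OF C] by linarith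
 show "0 < cos \<theta>" by (rule cos_pos_inner[OF b])
 show "C <= C / cos \<theta>" by (rule cos_abs_le_one[OF b C(1)])
 have "cos (\<Theta> C) < cos \<bar>\<theta>\<bar>" using th \<Theta>_bounds[OF C] by (intro cos_monotone_0_pi) auto
 hence "C / \<sigma> < cos \<theta>" using cos_\<Theta>[OF C] by simp
 thus "C / cos \<theta> < \<sigma>" using \<open>0 < cos \<theta>\<close> \<sigma>_pos by (simp add: field_simps)
qed

lemma quot_ge_\<sigma>:
 assumes C: "0 < C" "C < \<sigma>" and th: "\<Theta> C <= \<theta>" "\<theta> < pi / 2"
 shows "\<sigma> <= C / cos \<theta>"
proof -
 have b: "\<bar>\<theta>\<bar> < pi / 2" using th \<Theta>_bounds[OF C] by auto
 have "cos \<theta> <= cos (\<Theta> C)" using th \<Theta>_bounds[OF C] by (intro cos_monotone_0_pi_le) auto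
 thus ?thesis using cos_pos_inner[OF b] \<sigma>_pos by (simp add: cos_\<Theta>[OF C] field_simps)
qed

lemma gr_bounds: "\<bar>\<theta>\<bar> < pi / 2 ==> 0 < C ==> 0 <= gr C \<theta> & gr C \<theta> <= r C"
 using cos_abs_le_one[of \<theta> C] r_nonneg[of "C / cos \<theta>"] r_antimono[of C "C / cos \<theta>"] cos_pos_inner[of \<theta>]
 by (auto simp: gr_def)

lemma gr_pos:
 assumes C: "0 < C" "C < \<sigma>" and th: "\<bar>\<theta>\<bar> < \<Theta> C"
 shows "0 < gr C \<theta>"
 unfolding gr_def using quot_less_\<sigma>[OF assms] C by (intro r_pos) auto

lemma gr_zero: "0 < C ==> C < \<sigma> ==> \<Theta> C <= \<theta> ==> \<theta> < pi / 2 ==> gr C \<theta> = 0"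
 using quot_ge_\<sigma>[of C \<theta>] by (simp add: gr_def r_def)

lemma gr_continuous: "0 < C ==> C < \<sigma> ==> continuous_on {- \<Theta> C<..<\<Theta> C} (gr C)"
proof -
 assume C: "0 < C" "C < \<sigma>"
 have "continuous_on {- \<Theta> C<..<\<Theta> C} (%\<theta>. r (C / cos \<theta>))"
 proof (rule continuous_on_compose2[OF r_continuous])
  show "continuous_on {- \<Theta> C<..<\<Theta> C} (%\<theta>. C / cos \<theta>)"
  proof (intro continuous_intros ballI)
   fix \<theta> assume "\<theta> \<in> {- \<Theta> C<..<\<Theta> C}"
   hence "\<bar>\<theta>\<bar> < \<Theta> C" by auto
   thus "cos \<theta> ~= 0" using quot_less_\<sigma>(3)[OF C] by force
  qed
  show "(%\<theta>. C / cos \<theta>) ` {- \<Theta> C<..<\<Theta> C} \<subseteq> {0<..<\<sigma>}"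
   using quot_less_\<sigma>[OF C] C by fastforce
 qed
 thus ?thesis by (simp add: gr_def[abs_def])
qed

lemma gr_abs_integrable:
 assumes C: "0 < C" "C < \<sigma>" and ab: "0 <= a" "b <= pi / 2"
 shows "gr C absolutely_integrable_on {a..b}"
proof -
 have 1: "gr C absolutely_integrable_on {0..\<Theta> C}"
 proof (rule bounded_continuous_abs_integrable)
  show "continuous_on {0<..<\<Theta> C} (gr C)"
   by (rule continuous_on_subset[OF gr_continuous[OF C]]) (use \<Theta>_bounds[OF C] in auto)
  show "\<bar>gr C x\<bar> <= r C" if "x \<in> {0<..<\<Theta> C}" for x
   using gr_bounds[of x C] that \<Theta>_bounds[OF C] C by auto
 qed
 have 2: "gr C absolutely_integrable_on {\<Theta> C..pi / 2}"
  by (rule absolutely_integrable_spike[OF absolutely_integrable_zero, of "{pi / 2}"]) (use gr_zero[OF C] in auto)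
 have "gr C absolutely_integrable_on {0..pi / 2}"
  by (rule absolutely_integrable_on_combine[OF 1 2]) (use \<Theta>_bounds[OF C] in auto)
 thus ?thesis by (rule abs_integrable_sub) (use ab in auto)
qed

lemma gr_integrable:
 "0 < C ==> C < \<sigma> ==> 0 <= a ==> b <= pi / 2 ==> gr C integrable_on {a..b}"
 using gr_abs_integrable by (simp add: absolutely_integrable_on_def)

lemma RR_increment:
 assumes C: "0 < C" "C < \<sigma>" and ab: "0 <= a" "a <= b" "b <= pi / 2"
 shows "RR C b - RR C a = integral {a..b} (gr C)"
 using Henstock_Kurzweil_Integration.integral_combine[OF ab(1,2) gr_integrable[OF C order_refl ab(3)]]
 by (simp add: RR_def)

lemma RR_0 [simp]: "RR C 0 = 0" by (simp add: RR_def)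

lemma RR_increment_le:
 assumes C: "0 < C" "C < \<sigma>" and ab: "0 <= a" "a <= b" "b <= pi / 2"
  and M: "!!\<theta>. a < \<theta> ==> \<theta> < b ==> gr C \<theta> <= M"
 shows "RR C b - RR C a <= M * (b - a)"
proof -
 have "integral {a..b} (gr C) <= integral {a..b} (%x. M)"
  by (rule integral_le_open) (use gr_integrable[OF C ab(1,3)] M in auto)
 thus ?thesis using RR_increment[OF C ab] ab by (simp add: mult.commute)
qed

lemma RR_increment_ge:
 assumes C: "0 < C" "C < \<sigma>" and ab: "0 <= a" "a <= b" "b <= pi / 2"
  and M: "!!\<theta>. a < \<theta> ==> \<theta> < b ==> M <= gr C \<theta>"
 shows "M * (b - a) <= RR C b - RR C a"
proof -
 have "integral {a..b} (%x. M) <= integral {a..b} (gr C)"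
  by (rule integral_le_open) (use gr_integrable[OF C ab(1,3)] M in auto)
 thus ?thesis using RR_increment[OF C ab] ab by (simp add: mult.commute)
qed

lemma RR_mono:
 assumes C: "0 < C" "C < \<sigma>" and ab: "0 <= a" "a <= b" "b <= pi / 2"
 shows "RR C a <= RR C b"
 using RR_increment_ge[OF assms, of 0] gr_bounds[of _ C] C ab by fastforce

lemma gr_antimono:
 assumes "0 < C" "0 <= a" "a <= b" "b < pi / 2"
 shows "gr C b <= gr C a"
proof -
 have "cos b <= cos a" using assms by (intro cos_monotone_0_pi_le) auto
 moreover have "0 < cos b" "0 < cos a" using assms by (auto intro!: cos_pos_inner)
 ultimately have "C / cos a <= C / cos b" using assms by (intro divide_left_mono) auto
 thus ?thesis unfolding gr_def using assms \<open>0 < cos a\<close> by (intro r_antimono) auto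
qed

lemma gr_antimono_C:
 assumes "0 < C" "C <= C'" "\<bar>\<theta>\<bar> < pi / 2"
 shows "gr C' \<theta> <= gr C \<theta>"
 unfolding gr_def using assms cos_pos_inner[OF assms(3)] by (intro r_antimono) (auto simp: divide_right_mono)

lemma RR_strict_mono:
 assumes C: "0 < C" "C < \<sigma>" and ab: "0 <= a" "a < b" "b <= \<Theta> C"
 shows "RR C a < RR C b"
proof -
 define c where "c = (a + b) / 2"
 note T = \<Theta>_bounds[OF C]
 have c: "a < c" "c < b" using ab by (auto simp: c_def)
 have "gr C c * (c - a) <= RR C c - RR C a"
  by (rule RR_increment_ge[OF C]) (use ab c T C in \<open>auto intro!: gr_antimono\<close>)
 moreover have "0 < gr C c" by (rule gr_pos[OF C]) (use ab c in auto)
 moreover have "RR C c <= RR C b" by (rule RR_mono[OF C]) (use ab c T in auto)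
 moreover have "0 < gr C c * (c - a)" using c \<open>0 < gr C c\<close> by simp
 ultimately show ?thesis by linarith
qed

lemma S_eq:
 assumes C: "0 < C" "C < \<sigma>"
 shows "S C = 2 * RR C (\<Theta> C)"
proof -
 note T = \<Theta>_bounds[OF C]
 have "RR C (pi / 2) - RR C (\<Theta> C) <= 0 * (pi / 2 - \<Theta> C)"
  by (rule RR_increment_le[OF C]) (use T gr_zero[OF C] in auto)
 moreover have "RR C (\<Theta> C) <= RR C (pi / 2)" by (rule RR_mono[OF C]) (use T in auto)
 ultimately show ?thesis by (simp add: S_def)
qed

lemma S_pos: "0 < C ==> C < \<sigma> ==> 0 < S C"
 using RR_strict_mono[of C 0 "\<Theta> C"] \<Theta>_bounds[of C] S_eq[of C] by simp

text \<open>A larger \<open>C\<close> both shortens the range of angles and, \<open>r\<close> being nonincreasing, lowers the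
integrand.\<close>

lemma S_strict_antimono:
 assumes "0 < C" "C < C'" "C' < \<sigma>"
 shows "S C' < S C"
proof -
 have C: "0 < C" "C < \<sigma>" and C': "0 < C'" "C' < \<sigma>" using assms by auto
 note T = \<Theta>_bounds[OF C] \<Theta>_bounds[OF C']
 have lt: "\<Theta> C' < \<Theta> C"
  unfolding \<Theta>_def using assms \<sigma>_pos neg_one_le_quot[of C \<sigma>] by (intro arccos_less_arccos) (auto simp: divide_strict_right_mono)
 have "RR C' (\<Theta> C') <= RR C (\<Theta> C')"
  unfolding RR_def
 proof (rule integral_le_open)
  show "gr C' integrable_on {0..\<Theta> C'}" "gr C integrable_on {0..\<Theta> C'}"
   by (rule gr_integrable; use T C C' in auto)+
  show "gr C' x <= gr C x" if "0 < x" "x < \<Theta> C'" for x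
   by (rule gr_antimono_C) (use assms that T in auto)
 qed
 also have "\<dots> < RR C (\<Theta> C)" by (rule RR_strict_mono[OF C]) (use lt T in auto)
 finally show ?thesis by (simp add: S_eq C C')
qed

lemma S_antimono: "0 < C ==> C <= C' ==> C' < \<sigma> ==> S C' <= S C"
 using S_strict_antimono[of C C'] by (cases "C = C'") auto

lemma S_le: "0 < C ==> C < \<sigma> ==> S C <= 2 * r C * \<Theta> C"
 using RR_increment_le[of C 0 "\<Theta> C" "r C"] \<Theta>_bounds[of C] gr_bounds[of _ C] S_eq[of C]
 by fastforce

lemma S_seq_continuous:
 assumes lim: "Cn ----> C" and C: "0 < C" "C < \<sigma>"
 shows "(%n. S (Cn n)) ----> S C"
proof -
 have "\<forall>\<^sub>F n in sequentially. C / 2 < Cn n" using lim C by (intro order_tendstoD) auto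
 moreover have "\<forall>\<^sub>F n in sequentially. Cn n < \<sigma>" using lim C by (intro order_tendstoD) auto
 ultimately have "\<forall>\<^sub>F n in sequentially. C / 2 < Cn n & Cn n < \<sigma>" by eventually_elim simp
 then obtain N where N: "!!n. n \<ge> N ==> C / 2 < Cn n & Cn n < \<sigma>" by (auto simp: eventually_sequentially)
 define D where "D n = Cn (n + N)" for n
 have D: "0 < D n" "C / 2 < D n" "D n < \<sigma>" for n using N[of "n + N"] C by (auto simp: D_def)
 have Dlim: "D ----> C" unfolding D_def using lim by (rule LIMSEQ_ignore_initial_segment)
 define Z where "Z = {\<Theta> C, pi / 2}"
 define h where "h c x = (if x \<in> Z then 0 else gr c x)" for c x
 have hg: "integral {0..pi / 2} (h c) = integral {0..pi / 2} (gr c)" for c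
  by (rule integral_spike[of Z, symmetric]) (auto simp: h_def Z_def)
 have "(%n. integral {0..pi / 2} (h (D n))) ----> integral {0..pi / 2} (h C)"
 proof (rule dominated_convergence(2)[where h = "%x. r (C / 2)"])
  fix n
  show "h (D n) integrable_on {0..pi / 2}"
   by (rule integrable_spike[OF gr_integrable[OF D(1,3), of 0 "pi / 2"], of Z]) (auto simp: h_def Z_def)
  fix x :: real assume x: "x \<in> {0..pi / 2}"
  show "norm (h (D n) x) <= r (C / 2)"
  proof (cases "x \<in> Z")
   case True thus ?thesis using r_nonneg[of "C / 2"] C by (simp add: h_def)
  next
   case False
   hence "\<bar>x\<bar> < pi / 2" using x by (auto simp: Z_def)
   hence "0 <= gr (D n) x" "gr (D n) x <= r (D n)" using gr_bounds[of x "D n"] D by auto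
   moreover have "r (D n) <= r (C / 2)" using D[of n] C by (intro r_antimono) auto
   ultimately show ?thesis using False by (simp add: h_def)
  qed
 next
  fix x :: real assume x: "x \<in> {0..pi / 2}"
  show "(%n. h (D n) x) ----> h C x"
  proof (cases "x \<in> Z")
   case False
   hence xb: "\<bar>x\<bar> < pi / 2" using x by (auto simp: Z_def)
   have cx: "0 < cos x" by (rule cos_pos_inner[OF xb])
   have ql: "(%n. D n / cos x) ----> C / cos x" using cx by (intro tendsto_divide Dlim tendsto_const) auto
   have "(%n. gr (D n) x) ----> gr C x"
   proof (cases "x < \<Theta> C")
    case True
    hence "C / cos x \<in> {0<..<\<sigma>}" using quot_less_\<sigma>[OF C, of x] x C by auto
    hence "isCont r (C / cos x)" using r_continuous by (simp add: continuous_on_eq_continuous_at)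
    thus ?thesis unfolding gr_def using ql by (rule isCont_tendsto_compose)
   next
    case False
    hence "\<Theta> C < x" using \<open>x \<notin> Z\<close> by (auto simp: Z_def)
    hence "cos x < cos (\<Theta> C)" using xb \<Theta>_bounds[OF C] by (intro cos_monotone_0_pi) auto
    hence "\<sigma> < C / cos x" using cx \<sigma>_pos by (simp add: cos_\<Theta>[OF C] field_simps)
    have "\<forall>\<^sub>F n in sequentially. \<sigma> < D n / cos x" by (rule order_tendstoD(1)[OF ql \<open>\<sigma> < C / cos x\<close>])
    hence "\<forall>\<^sub>F n in sequentially. gr (D n) x = gr C x"
     by eventually_elim (use \<open>\<sigma> < C / cos x\<close> in \<open>simp add: gr_def r_def\<close>)
    thus ?thesis by (rule tendsto_eventually)
   qed
   thus ?thesis using False by (simp add: h_def)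
  qed (simp add: h_def)
 qed (auto intro: integrable_const_ivl)
 hence "(%n. S (D n)) ----> S C" unfolding S_def RR_def hg by (intro tendsto_mult tendsto_const)
 thus ?thesis unfolding D_def by (rule LIMSEQ_offset)
qed

text \<open>The speed stays bounded as \<open>C\<close> approaches \<open>\<sigma>\<close>, while the range of angles shrinks to a point.\<close>

lemma S_tendsto_0:
 assumes lim: "Cn ----> \<sigma>" and C: "!!n. 0 < Cn n" "!!n. Cn n < \<sigma>"
 shows "(%n. S (Cn n)) ----> 0"
proof (rule tendsto_sandwich[where f = "%n. 0" and h = "%n. 2 * r (\<sigma> / 2) * \<Theta> (Cn n)"])
 show "\<forall>\<^sub>F n in sequentially. 0 <= S (Cn n)" using S_pos[OF C] by (intro always_eventually) (simp add: less_imp_le)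
 have "\<forall>\<^sub>F n in sequentially. \<sigma> / 2 < Cn n" using lim \<sigma>_pos by (intro order_tendstoD) auto
 thus "\<forall>\<^sub>F n in sequentially. S (Cn n) <= 2 * r (\<sigma> / 2) * \<Theta> (Cn n)"
 proof eventually_elim
  case (elim n)
  have "r (Cn n) <= r (\<sigma> / 2)" using elim \<sigma>_pos by (intro r_antimono) auto
  hence "2 * r (Cn n) * \<Theta> (Cn n) <= 2 * r (\<sigma> / 2) * \<Theta> (Cn n)"
   using \<Theta>_bounds[OF C, of n] by (intro mult_right_mono) auto
  thus ?case using S_le[OF C, of n] by linarith
 qed
 have "(%n. arccos (Cn n / \<sigma>)) ----> arccos (\<sigma> / \<sigma>)"
 proof (rule continuous_on_tendsto_compose[OF continuous_on_arccos'])
  show "(%n. Cn n / \<sigma>) ----> \<sigma> / \<sigma>" using lim \<sigma>_pos by (intro tendsto_divide) auto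
  have "Cn n / \<sigma> \<in> {-1..1}" for n using C[of n] \<sigma>_pos by (auto simp: field_simps add_pos_pos intro: order_trans[of _ 0])
  thus "\<forall>\<^sub>F n in sequentially. Cn n / \<sigma> \<in> {-1..1}" by simp
 qed (use \<sigma>_pos in auto)
 hence "(%n. \<Theta> (Cn n)) ----> 0" using \<sigma>_pos by (simp add: \<Theta>_def)
 thus "(%n. 2 * r (\<sigma> / 2) * \<Theta> (Cn n)) ----> 0" by (rule tendsto_mult_right_zero)
qed simp

lemma zs_bounds: "\<bar>\<theta>\<bar> < pi / 2 ==> 0 < C ==> 0 <= zs C \<theta> & zs C \<theta> <= 1 / 2"
proof -
 assume "\<bar>\<theta>\<bar> < pi / 2" "0 < C"
 hence "min (C / cos \<theta>) \<sigma> \<in> {0..\<sigma>}" using cos_pos_inner[of \<theta>] \<sigma>_pos by auto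
 hence "\<kappa> (min (C / cos \<theta>) \<sigma>) \<in> {0..1}" by (rule \<kappa>_range)
 hence "(1 - \<kappa> (min (C / cos \<theta>) \<sigma>))\<^sup>2 <= 1\<^sup>2" by (intro power_mono) auto
 thus ?thesis by (simp add: zs_def)
qed

lemma \<kappa>_\<sigma>: "\<kappa> \<sigma> = 1" using \<kappa>_k[of 1] by simp
lemma \<kappa>_0: "\<kappa> 0 = 0" using \<kappa>_k[of 0] by simp

lemma zs_continuous: "0 < C ==> continuous_on {- (pi / 2)<..<pi / 2} (zs C)"
proof -
 assume C: "0 < C"
 have "continuous_on {- (pi / 2)<..<pi / 2} (%\<theta>. \<kappa> (min (C / cos \<theta>) \<sigma>))"
 proof (rule continuous_on_compose2[OF \<kappa>_continuous])
  have "cos \<theta> ~= 0" if "\<theta> \<in> {- (pi / 2)<..<pi / 2}" for \<theta>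
  proof -
   have "- (pi / 2) < \<theta>" "\<theta> < pi / 2" using that by auto
   hence "\<bar>\<theta>\<bar> < pi / 2" by linarith
   thus ?thesis using cos_pos_inner[of \<theta>] by simp
  qed
  thus "continuous_on {- (pi / 2)<..<pi / 2} (%\<theta>. min (C / cos \<theta>) \<sigma>)"
   by (intro continuous_intros) auto
  show "(%\<theta>. min (C / cos \<theta>) \<sigma>) ` {- (pi / 2)<..<pi / 2} \<subseteq> {0..\<sigma>}"
  proof
   fix y assume "y \<in> (%\<theta>. min (C / cos \<theta>) \<sigma>) ` {- (pi / 2)<..<pi / 2}"
   then obtain \<theta> where \<theta>: "y = min (C / cos \<theta>) \<sigma>" "- (pi / 2) < \<theta>" "\<theta> < pi / 2" by auto
   hence "\<bar>\<theta>\<bar> < pi / 2" by linarith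
   note \<theta> = \<theta>(1) this
   thus "y \<in> {0..\<sigma>}" using cos_pos_inner[of \<theta>] C \<sigma>_pos \<theta> by auto
  qed
 qed
 thus ?thesis unfolding zs_def[abs_def] by (intro continuous_intros) auto
qed

lemma cos_zs_abs_integrable:
 assumes C: "0 < C" and ab: "0 <= a" "b <= pi / 2"
 shows "(%\<theta>. cos \<theta> * zs C \<theta>) absolutely_integrable_on {a..b}"
proof -
 have "(%\<theta>. cos \<theta> * zs C \<theta>) absolutely_integrable_on {0..pi / 2}"
 proof (rule bounded_continuous_abs_integrable)
  show "continuous_on {0<..<pi / 2} (%\<theta>. cos \<theta> * zs C \<theta>)"
   by (intro continuous_intros continuous_on_subset[OF zs_continuous[OF C]]) auto
  show "\<bar>cos x * zs C x\<bar> <= 1 * (1 / 2)" if "x \<in> {0<..<pi / 2}" for x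
   unfolding abs_mult using zs_bounds[of x C] C that by (intro mult_mono) auto
 qed
 thus ?thesis by (rule abs_integrable_sub) (use ab in auto)
qed

lemma KK_eq:
 assumes C: "0 < C" "C < \<sigma>"
 shows "KK C = 2 * integral {0..\<Theta> C} (%\<theta>. cos \<theta> * zs C \<theta>)"
proof -
 note T = \<Theta>_bounds[OF C]
 have "integral {0..\<Theta> C} (%\<theta>. cos \<theta> * zs C \<theta>) + integral {\<Theta> C..pi / 2} (%\<theta>. cos \<theta> * zs C \<theta>) = integral {0..pi / 2} (%\<theta>. cos \<theta> * zs C \<theta>)"
  by (rule Henstock_Kurzweil_Integration.integral_combine)
   (use T cos_zs_abs_integrable[OF C(1), of 0 "pi / 2"] in \<open>auto simp: absolutely_integrable_on_def\<close>)
 moreover have "integral {\<Theta> C..pi / 2} (%\<theta>. cos \<theta> * zs C \<theta>) = integral {\<Theta> C..pi / 2} (%\<theta>. 0)"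
 proof (rule integral_spike[of "{pi / 2}"])
  fix x assume "x \<in> {\<Theta> C..pi / 2} - {pi / 2}"
  hence "\<sigma> <= C / cos x" using quot_ge_\<sigma>[OF C, of x] by auto
  thus "0 = cos x * zs C x" by (simp add: zs_def min_absorb2 \<kappa>_\<sigma>)
 qed simp
 ultimately show ?thesis by (simp add: KK_def)
qed

text \<open>As \<open>C \<rightarrow> 0\<close> the geodesic descends to \<open>t = 0\<close> and back along the vertical direction, so \<open>zs\<close> tends
to \<open>1/2\<close> and the length to \<open>2 \<integral> cos \<theta> / 2 = 1\<close>, the energy of full fracture.\<close>

lemma KK_tendsto_1:
 assumes lim: "Cn ----> 0" and C: "!!n. 0 < Cn n"
 shows "(%n. KK (Cn n)) ----> 1"
proof -
 define h where "h c x = (if x = pi / 2 then 0 else cos x * zs c x)" for c x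
 have hg: "integral {0..pi / 2} (%\<theta>. cos \<theta> * zs c \<theta>) = integral {0..pi / 2} (h c)" for c
  by (rule integral_spike[of "{pi / 2}"]) (auto simp: h_def)
 have "(%n. integral {0..pi / 2} (h (Cn n))) ----> integral {0..pi / 2} (%x. cos x * (1 / 2))"
 proof (rule dominated_convergence(2)[where h = "%x. 1"])
  fix n
  show "h (Cn n) integrable_on {0..pi / 2}"
   by (rule integrable_spike[of "%\<theta>. cos \<theta> * zs (Cn n) \<theta>" _ "{pi / 2}"])
    (use cos_zs_abs_integrable[OF C, of 0 "pi / 2"] in \<open>auto simp: h_def absolutely_integrable_on_def\<close>)
  fix x :: real assume x: "x \<in> {0..pi / 2}"
  show "norm (h (Cn n) x) <= 1"
  proof (cases "x = pi / 2")
   case False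
   hence "\<bar>cos x * zs (Cn n) x\<bar> <= 1 * 1"
    unfolding abs_mult using zs_bounds[of x "Cn n"] C[of n] x by (intro mult_mono) auto
   thus ?thesis using False by (simp add: h_def)
  qed (simp add: h_def)
 next
  fix x :: real assume x: "x \<in> {0..pi / 2}"
  show "(%n. h (Cn n) x) ----> cos x * (1 / 2)"
  proof (cases "x = pi / 2")
   case True show ?thesis unfolding True by (simp add: h_def)
  next
   case False
   hence xb: "\<bar>x\<bar> < pi / 2" using x by auto
   have cx: "0 < cos x" by (rule cos_pos_inner[OF xb])
   have "(%n. min (Cn n / cos x) \<sigma>) ----> min (0 / cos x) \<sigma>"
    using cx by (intro tendsto_min tendsto_divide lim tendsto_const) auto
   hence "(%n. min (Cn n / cos x) \<sigma>) ----> 0" using \<sigma>_pos by simp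
   hence "(%n. \<kappa> (min (Cn n / cos x) \<sigma>)) ----> \<kappa> 0"
    by (rule continuous_on_tendsto_compose[OF \<kappa>_continuous]) (use \<sigma>_pos cx C in \<open>auto intro!: always_eventually less_imp_le\<close>)
   hence "(%n. cos x * zs (Cn n) x) ----> cos x * ((1 - \<kappa> 0)\<^sup>2 / 2)"
    unfolding zs_def by (intro tendsto_intros) auto
   thus ?thesis using False by (simp add: h_def \<kappa>_0)
  qed
 qed (auto intro: integrable_const_ivl)
 moreover have "integral {0..pi / 2} (%x. cos x * (1 / 2)) = 1 / 2"
 proof -
  have "(cos has_integral (sin (pi / 2) - sin 0)) {0..pi / 2}"
   by (rule fundamental_theorem_of_calculus)
    (auto intro!: derivative_eq_intros simp: has_real_derivative_iff_has_vector_derivative[symmetric])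
  thus ?thesis by (simp add: integral_unique)
 qed
 ultimately have "(%n. 2 * integral {0..pi / 2} (h (Cn n))) ----> 2 * (1 / 2)"
  by (intro tendsto_mult tendsto_const) simp
 thus ?thesis by (simp add: KK_def hg)
qed

text \<open>The tangent line at a point of the geodesic, evaluated at \<open>t = 0\<close> where \<open>k\<close> vanishes: this
 is why the energy stays below the fracture energy \<open>1\<close>.\<close>

lemma tangent_gr:
 assumes C: "0 < C" "C < \<sigma>" and th: "\<bar>\<theta>\<bar> < \<Theta> C" and x: "x \<in> {0..1}"
 shows "C / cos \<theta> + (zs C \<theta> - (1 - x)\<^sup>2 / 2) / gr C \<theta> <= k x"
proof -
 note q = quot_less_\<sigma>[OF C th]
 have "\<kappa> (C / cos \<theta>) \<in> {0<..<1}" using q C by (intro \<kappa>_inner) auto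
 from k_tangent[OF this x] show ?thesis
  using q C by (simp add: zs_def gr_def r_def min_absorb1 k_\<kappa>)
qed

text \<open>By \<open>tangent_gr\<close> at \<open>t = 0\<close> the length density \<open>C gr + cos \<theta> zs\<close> is at most \<open>(cos \<theta>)/2\<close>, whose
integral over the angles is \<open>sin (\<Theta> C) < 1\<close>.\<close>

lemma energy_less_one:
 assumes C: "0 < C" "C < \<sigma>"
 shows "C * S C + KK C < 1"
proof -
 note T = \<Theta>_bounds[OF C]
 have i1: "gr C integrable_on {0..\<Theta> C}" using T C by (intro gr_integrable) auto
 have i2: "(%\<theta>. cos \<theta> * zs C \<theta>) integrable_on {0..\<Theta> C}"
  using cos_zs_abs_integrable[OF C(1), of 0 "\<Theta> C"] T by (simp add: absolutely_integrable_on_def)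
 have hc: "(cos has_integral (sin (\<Theta> C) - sin 0)) {0..\<Theta> C}"
  by (rule fundamental_theorem_of_calculus)
   (use T in \<open>auto intro!: derivative_eq_intros simp: has_real_derivative_iff_has_vector_derivative[symmetric]\<close>)
 have "integral {0..\<Theta> C} (%\<theta>. C * gr C \<theta> + cos \<theta> * zs C \<theta>) <= integral {0..\<Theta> C} (%\<theta>. cos \<theta> * (1 / 2))"
 proof (rule integral_le_open)
  show "(%\<theta>. C * gr C \<theta> + cos \<theta> * zs C \<theta>) integrable_on {0..\<Theta> C}"
   by (intro integrable_add integrable_on_mult_right i1 i2)
  show "(%\<theta>. cos \<theta> * (1 / 2)) integrable_on {0..\<Theta> C}" using hc by (intro integrable_on_mult_left) auto
  fix x assume x: "0 < x" "x < \<Theta> C"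
  hence xb: "\<bar>x\<bar> < \<Theta> C" by simp
  have g: "0 < gr C x" by (rule gr_pos[OF C xb])
  have c: "0 < cos x" using quot_less_\<sigma>(3)[OF C xb] .
  have "C / cos x + (zs C x - 1 / 2) / gr C x <= 0" using tangent_gr[OF C xb, of 0] by simp
  thus "C * gr C x + cos x * zs C x <= cos x * (1 / 2)" using g c by (simp add: field_simps)
 qed
 also have "\<dots> = sin (\<Theta> C) / 2" using hc by (simp add: integral_unique)
 also have "integral {0..\<Theta> C} (%\<theta>. C * gr C \<theta> + cos \<theta> * zs C \<theta>) = C * RR C (\<Theta> C) + KK C / 2"
  using i1 i2 by (subst Henstock_Kurzweil_Integration.integral_add)
   (auto simp: RR_def KK_eq[OF C] intro: integrable_on_mult_right)
 finally have "C * S C + KK C <= sin (\<Theta> C)" by (simp add: S_eq[OF C])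
 moreover have "sin (\<Theta> C) < sin (pi / 2)" using T by (intro sin_monotone_2pi) auto
 ultimately show ?thesis by simp
qed

definition th :: "real => real => real" where "th C t = arccos (C / k t)"

lemma quot_k_bounds: "0 < C ==> C <= k t ==> 0 < C / k t & C / k t <= 1 & - 1 <= C / k t"
 using neg_one_le_quot[of C "k t"] by (simp add: pos_divide_le_eq)

lemma cos_th: "0 < C ==> C <= k t ==> cos (th C t) = C / k t"
 unfolding th_def using quot_k_bounds[of C t] by (intro cos_arccos) auto

lemma sin_th: "0 < C ==> C <= k t ==> sin (th C t) = sqrt (1 - (C / k t)\<^sup>2)"
 unfolding th_def using quot_k_bounds[of C t] by (intro sin_arccos) auto

lemma th_bounds: "0 < C ==> C <= k t ==> 0 <= th C t & th C t < pi / 2"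
proof -
 assume C: "0 < C" "C <= k t"
 have "arccos (C / k t) < arccos 0" using quot_k_bounds[OF C] by (intro arccos_less_arccos) auto
 thus ?thesis using quot_k_bounds[OF C] by (auto simp: th_def intro!: arccos_lbound)
qed

lemma th_less_\<Theta>: "0 < C ==> C <= k t ==> 0 <= t ==> t < 1 ==> th C t < \<Theta> C"
proof -
 assume C: "0 < C" "C <= k t" "0 <= t" "t < 1"
 have "k t < \<sigma>" using k_less_\<sigma> C by auto
 hence "C / \<sigma> < C / k t" using C by (intro divide_strict_left_mono) (auto simp: mult_pos_pos \<sigma>_pos)
 thus ?thesis unfolding th_def \<Theta>_def using quot_k_bounds[OF C(1,2)] C \<sigma>_pos
  by (intro arccos_less_arccos) (auto intro: order_trans[of _ 0])
qed

lemma th_continuous: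
 assumes C: "0 < C" "C <= k m" and m: "0 <= m"
 shows "continuous_on {m..1} (th C)"
 unfolding th_def[abs_def]
proof (rule continuous_on_arccos)
 have kk: "C <= k t" if "t \<in> {m..1}" for t using k_mono[of m t] that C m by auto
 show "continuous_on {m..1} (%t. C / k t)"
  by (intro continuous_intros continuous_on_subset[OF k_continuous]) (use kk C m in force)+
 show "\<forall>t\<in>{m..1}. - 1 <= C / k t & C / k t <= 1"
  using quot_k_bounds[OF C(1) kk] by fastforce
qed

lemma th_deriv:
 assumes C: "0 < C" "C < k t" and t: "t \<in> {0<..<1}"
 shows "(th C has_real_derivative C * k1 t / ((k t)\<^sup>2 * sqrt (1 - (C / k t)\<^sup>2))) (at t)"
proof -
 have kt: "0 < k t" using C by linarith
 have q: "0 < C / k t" "C / k t < 1" using C kt by auto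
 have s: "0 < sqrt (1 - (C / k t)\<^sup>2)"
  using q by (simp add: power_less_one_iff)
 have d: "((%t. C / k t) has_real_derivative - (C * k1 t / (k t)\<^sup>2)) (at t)"
  using k_deriv[OF t] kt by (auto intro!: derivative_eq_intros simp: power2_eq_square)
 have "(arccos has_real_derivative inverse (- sqrt (1 - (C / k t)\<^sup>2))) (at (C / k t))"
  by (rule DERIV_arccos) (use q in auto)
 from DERIV_chain2[OF this d] show ?thesis
  unfolding th_def[abs_def] by (rule DERIV_cong) (use s kt in \<open>simp add: field_simps\<close>)
qed

lemma C_div_cos_th: "0 < C ==> C <= k t ==> C / cos (th C t) = k t"
 by (simp add: cos_th)

lemma zs_th: "0 < C ==> C <= k t ==> 0 <= t ==> t <= 1 ==> zs C (th C t) = (1 - t)\<^sup>2 / 2"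
 using k_mono[of t 1] by (simp add: zs_def C_div_cos_th min_absorb1 \<kappa>_k)

lemma gr_th: "0 < C ==> C <= k t ==> t \<in> {0<..<1} ==> gr C (th C t) = \<rho> t"
 by (simp add: gr_def C_div_cos_th r_k)

lemma RR_deriv:
 assumes C: "0 < C" "C < \<sigma>" and th: "0 < \<theta>" "\<theta> < \<Theta> C"
 shows "(RR C has_real_derivative gr C \<theta>) (at \<theta>)"
proof -
 note T = \<Theta>_bounds[OF C]
 have "(primitive 0 (gr C) has_real_derivative gr C \<theta>) (at \<theta>)"
  by (rule primitive_has_derivative[where S = "{- \<Theta> C<..<\<Theta> C}"]) (use gr_continuous[OF C] T th in auto)
 moreover have ev: "\<forall>\<^sub>F y in nhds \<theta>. primitive 0 (gr C) y = RR C y"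
  by (rule eventually_mono[OF eventually_nhds_in_open[of "{0<..}"]]) (use th in \<open>auto simp: primitive_def RR_def\<close>)
 ultimately show ?thesis using DERIV_cong_ev[OF refl ev refl] by blast
qed

lemma RR_th_deriv:
 assumes C: "0 < C" "C < k t" and t: "t \<in> {0<..<1}"
 shows "((%t. RR C (th C t)) has_real_derivative C * (1 - t) / ((k t)\<^sup>2 * sqrt (1 - (C / k t)\<^sup>2))) (at t)"
proof -
 have Cs: "C < \<sigma>" using C k_less_\<sigma>[of t] t by auto
 have kt: "0 < k t" using C by linarith
 have "0 < th C t"
 proof -
  have "arccos 1 < arccos (C / k t)" using C kt neg_one_le_quot[OF C(1) kt] by (intro arccos_less_arccos) auto
  thus ?thesis by (simp add: th_def)
 qed
 hence "(RR C has_real_derivative gr C (th C t)) (at (th C t))"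
  using th_less_\<Theta>[of C t] C t by (intro RR_deriv[OF C(1) Cs]) auto
 from DERIV_chain2[OF this th_deriv[OF C t]] show ?thesis
  by (rule DERIV_cong) (use C t k1_pos[OF t] in \<open>simp add: gr_th \<rho>_def field_simps\<close>)
qed

lemma th_k_self [simp]: "0 < k m ==> th (k m) m = 0"
 by (simp add: th_def)

lemma th_1: "th C 1 = \<Theta> C"
 by (simp add: th_def \<Theta>_def)

text \<open>Integration by parts and the substitution \<open>cos \<theta> = k(m)/k(t)\<close> turn \<open>KK\<close> into the kinetic
integral that appears in the energy of a critical point.\<close>

lemma KK_integral:
 assumes m: "m \<in> {0<..<1}"
 shows "((%t. 2 * (1 - t) * sqrt (1 - (k m / k t)\<^sup>2)) has_integral KK (k m)) {m..1}"
proof -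
 define C where "C = k m"
 have C: "0 < C" "C < \<sigma>" using k_pos[of m] k_less_\<sigma>[of m] m by (auto simp: C_def)
 note T = \<Theta>_bounds[OF C]
 have Ck: "C <= k t" if "t \<in> {m..1}" for t using k_mono[of m t] that m by (auto simp: C_def)
 define w where "w \<theta> = cos \<theta> * zs C \<theta>" for \<theta>
 define I where "I \<theta> = integral {0..\<theta>} w" for \<theta>
 have wc: "continuous_on {- (pi / 2)<..<pi / 2} w"
  unfolding w_def by (intro continuous_intros zs_continuous[OF C(1)])
 have Ic: "continuous_on {0..\<Theta> C} I"
  unfolding I_def by (intro indefinite_integral_continuous_1 integrable_continuous_real continuous_on_subset[OF wc]) (use T in auto)
 have Id: "(I has_real_derivative w \<theta>) (at \<theta>)" if "0 < \<theta>" "\<theta> < pi / 2" for \<theta>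
 proof -
  have "(primitive 0 w has_real_derivative w \<theta>) (at \<theta>)"
   by (rule primitive_has_derivative[where S = "{- (pi / 2)<..<pi / 2}"]) (use wc that in auto)
  moreover have ev: "\<forall>\<^sub>F y in nhds \<theta>. primitive 0 w y = I y"
   by (rule eventually_mono[OF eventually_nhds_in_open[of "{0<..}"]]) (use that in \<open>auto simp: primitive_def I_def\<close>)
  ultimately show ?thesis using DERIV_cong_ev[OF refl ev refl] by blast
 qed
 define G where "G t = - ((1 - t)\<^sup>2 * sin (th C t)) + 2 * I (th C t)" for t
 have thr: "th C ` {m..1} \<subseteq> {0..\<Theta> C}"
 proof
  fix y assume "y \<in> th C ` {m..1}"
  then obtain t where t: "t \<in> {m..1}" "y = th C t" by auto
  thus "y \<in> {0..\<Theta> C}" using th_bounds[OF C(1) Ck, of t] th_less_\<Theta>[OF C(1) Ck, of t] m T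
   by (cases "t = 1") (auto simp: th_1)
 qed
 have thc: "continuous_on {m..1} (th C)" by (rule th_continuous) (use C m in \<open>auto simp: C_def\<close>)
 have "((%t. 2 * (1 - t) * sqrt (1 - (C / k t)\<^sup>2)) has_integral (G 1 - G m)) {m..1}"
 proof (rule fundamental_theorem_of_calculus_interior)
  show "m <= 1" using m by simp
  show "continuous_on {m..1} G" unfolding G_def
   by (intro continuous_intros thc continuous_on_compose2[OF Ic thc thr])
  fix t assume t: "t \<in> {m<..<1}"
  hence t': "t \<in> {0<..<1}" using m by auto
  have Clt: "C < k t" using k_strict_mono[of m t] t m by (auto simp: C_def)
  note dth = th_deriv[OF C(1) Clt t']
  define D where "D = C * k1 t / ((k t)\<^sup>2 * sqrt (1 - (C / k t)\<^sup>2))"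
  have th0: "0 < th C t"
  proof -
   have "arccos 1 < arccos (C / k t)" using C Clt neg_one_le_quot[of C "k t"] by (intro arccos_less_arccos) auto
   thus ?thesis by (simp add: th_def)
  qed
  have thp: "th C t < pi / 2" using th_bounds[of C t] C Clt by auto
  have "(G has_real_derivative (- ((- 2 * (1 - t)) * sin (th C t) + (1 - t)\<^sup>2 * (cos (th C t) * D)) + 2 * (w (th C t) * D))) (at t)"
   unfolding G_def
   by (rule derivative_eq_intros DERIV_chain2[OF Id[OF th0 thp] dth[folded D_def]] dth[folded D_def] refl)+ (simp add: algebra_simps)
  moreover have "w (th C t) = cos (th C t) * ((1 - t)\<^sup>2 / 2)"
   unfolding w_def using zs_th[of C t] C Clt t' by simp
  ultimately have "(G has_real_derivative 2 * (1 - t) * sin (th C t)) (at t)"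
   by (rule_tac DERIV_cong) (auto simp: algebra_simps)
  thus "(G has_vector_derivative 2 * (1 - t) * sqrt (1 - (C / k t)\<^sup>2)) (at t)"
   using sin_th[of C t] C Clt by (simp add: has_real_derivative_iff_has_vector_derivative)
 qed
 moreover have "G m = 0" using C by (simp add: G_def C_def I_def)
 moreover have "w = (%\<theta>. cos \<theta> * zs C \<theta>)" by (rule ext) (simp add: w_def)
 hence "G 1 = KK C" by (simp add: G_def th_1 I_def KK_eq[OF C])
 ultimately show ?thesis by (simp add: C_def)
qed

end

section \<open>Lower bound for the cohesive energy by calibration\<close>

lemma C1_inverse:
 fixes P :: "real => real"
 assumes d: "!!x. x \<in> {a<..<b} ==> (P has_real_derivative P' x) (at x)"
  and pos: "!!x. x \<in> {a<..<b} ==> 0 < P' x"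
 obtains T where "!!x. x \<in> {a<..<b} ==> T (P x) = x"
  "!!x. x \<in> {a<..<b} ==> (T has_real_derivative inverse (P' x)) (at (P x))"
proof -
 define I where "I = {a<..<b}"
 have smono: "P x < P y" if "x \<in> I" "y \<in> I" "x < y" for x y
 proof (rule DERIV_pos_imp_increasing[OF that(3)])
  fix z assume "x <= z" "z <= y"
  hence "z \<in> I" using that by (auto simp: I_def)
  thus "\<exists>l. (P has_real_derivative l) (at z) & 0 < l" using d pos unfolding I_def by blast
 qed
 have inj: "inj_on P I"
  by (rule inj_onI) (metis linorder_cases less_irrefl smono)
 define T where "T = inv_into I P"
 have TP: "T (P x) = x" if "x \<in> I" for x unfolding T_def by (rule inv_into_f_f[OF inj that])
 have cP: "isCont P x" if "x \<in> I" for x using d that unfolding I_def by (blast intro: DERIV_isCont)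
 have dT: "(T has_real_derivative inverse (P' x)) (at (P x))" if x: "x \<in> I" for x
 proof -
  define e where "e = min (b - x) (x - a) / 2"
  have e: "e > 0" using x by (auto simp: I_def e_def)
  have eI: "z \<in> I" if "\<bar>z - x\<bar> <= e" for z
  proof -
   have "2 * e <= b - x" "2 * e <= x - a" by (auto simp: e_def)
   thus ?thesis using that e by (auto simp: I_def abs_le_iff)
  qed
  have cT: "isCont T (P x)"
   by (rule isCont_inverse_function[OF e]) (use eI TP cP in auto)
  have m: "x - e \<in> I" "x + e \<in> I" using eI e by auto
  show ?thesis
  proof (rule DERIV_inverse_function[where f = P and g = T and a = "P (x - e)" and b = "P (x + e)"])
   show "(P has_real_derivative P' x) (at (T (P x)))" using d x TP by (simp add: I_def)
   show "P' x ~= 0" using pos[of x] x by (simp add: I_def)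
   show "P (x - e) < P x" "P x < P (x + e)" using smono m x e by auto
   fix y assume y: "P (x - e) < y" "y < P (x + e)"
   have "\<exists>z\<ge>x - e. z <= x + e & P z = y"
    by (rule IVT') (use y e eI cP in \<open>auto intro!: continuous_at_imp_continuous_on simp: abs_le_iff\<close>)
   then obtain z where "x - e <= z" "z <= x + e" "P z = y" by blast
   thus "P (T y) = y" using TP[of z] eI[of z] by (auto simp: abs_le_iff)
  qed (rule cT)
 qed
 show ?thesis by (rule that[of T]) (use TP dT in \<open>auto simp: I_def\<close>)
qed

context degr
begin

lemma gr_even: "gr C (- \<theta>) = gr C \<theta>" by (simp add: gr_def)
lemma zs_even: "zs C (- \<theta>) = zs C \<theta>" by (simp add: zs_def)

lemma primitive_odd:
 assumes "!!x. w (- x) = w x"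
 shows "primitive 0 w (- x) = - primitive 0 w x"
proof -
 have *: "integral {- y..0} w = integral {0..y} w" for y
  using Henstock_Kurzweil_Integration.integral_reflect_real[of y 0 w] assms by simp
 consider "x = 0" | "x > 0" | "x < 0" by linarith
 thus ?thesis by cases (use *[of x] *[of "- x"] in \<open>auto simp: primitive_def\<close>)
qed

text \<open>Along a geodesic the displacement is a strictly increasing odd function of the angle, and \<open>T\<close> is
its inverse.\<close>

lemma geodesic_parameter:
 assumes C: "0 < C" "C < \<sigma>"
 obtains T where "!!x. x \<in> {- (S C / 2)<..<S C / 2} ==> T x \<in> {- \<Theta> C<..<\<Theta> C}"
  "!!x. x \<in> {- (S C / 2)<..<S C / 2} ==> (T has_real_derivative 1 / gr C (T x)) (at x)"
  "!!\<theta>. \<theta> \<in> {- \<Theta> C<..<\<Theta> C} ==> primitive 0 (gr C) \<theta> \<in> {- (S C / 2)<..<S C / 2}"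
  "!!\<theta>. \<theta> \<in> {- \<Theta> C<..<\<Theta> C} ==> T (primitive 0 (gr C) \<theta>) = \<theta>"
proof -
 define I where "I = {- \<Theta> C<..<\<Theta> C}"
 define J where "J = {- (S C / 2)<..<S C / 2}"
 define P where "P = primitive 0 (gr C)"
 note Tb = \<Theta>_bounds[OF C]
 have odd: "P (- x) = - P x" for x unfolding P_def by (rule primitive_odd) (rule gr_even)
 have PRR: "P x = RR C x" if "0 <= x" for x using that by (simp add: P_def primitive_def RR_def)
 have dP: "(P has_real_derivative gr C \<theta>) (at \<theta>)" if "\<theta> \<in> I" for \<theta>
  unfolding P_def by (rule primitive_has_derivative[where S = I]) (use gr_continuous[OF C] Tb that in \<open>auto simp: I_def\<close>)
 have gp: "0 < gr C \<theta>" if "\<theta> \<in> I" for \<theta> using gr_pos[OF C, of \<theta>] that by (auto simp: I_def)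
 obtain T where T: "!!x. x \<in> I ==> T (P x) = x" "!!x. x \<in> I ==> (T has_real_derivative inverse (gr C x)) (at (P x))"
  unfolding I_def by (rule C1_inverse[of "- \<Theta> C" "\<Theta> C" P "gr C"]) (use dP gp in \<open>auto simp: I_def\<close>)
 have PJ: "P \<theta> \<in> J" if "\<theta> \<in> I" for \<theta>
 proof -
  have "RR C x < S C / 2" if "0 <= x" "x < \<Theta> C" for x
   using RR_strict_mono[OF C that(1,2)] S_eq[OF C] by simp
  moreover have "0 <= RR C x" if "0 <= x" "x < \<Theta> C" for x
   using RR_mono[OF C, of 0 x] that Tb by simp
  ultimately have R: "0 <= RR C \<bar>\<theta>\<bar>" "RR C \<bar>\<theta>\<bar> < S C / 2" using that by (auto simp: I_def)
  have "P \<theta> = RR C \<bar>\<theta>\<bar> \<or> P \<theta> = - RR C \<bar>\<theta>\<bar>"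
   using PRR[of \<theta>] PRR[of "- \<theta>"] odd[of \<theta>] by (cases "0 <= \<theta>") auto
  thus ?thesis using R S_pos[OF C] unfolding J_def greaterThanLessThan_iff by linarith
 qed
 have RRc: "continuous_on {0..\<Theta> C} (RR C)"
  unfolding RR_def using gr_integrable[OF C, of 0 "\<Theta> C"] Tb by (intro indefinite_integral_continuous_1) auto
 have surj: "\<exists>\<theta>\<in>I. P \<theta> = x" if x: "x \<in> J" for x
 proof -
  have pos: "\<exists>\<theta>. 0 <= \<theta> & \<theta> < \<Theta> C & RR C \<theta> = y" if "0 <= y" "y < S C / 2" for y
  proof -
   have "\<exists>\<theta>\<ge>0. \<theta> <= \<Theta> C & RR C \<theta> = y"
    by (rule IVT'[OF _ _ _ RRc]) (use that S_eq[OF C] Tb in auto)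
   then obtain \<theta> where "0 <= \<theta>" "\<theta> <= \<Theta> C" "RR C \<theta> = y" by blast
   thus ?thesis using that S_eq[OF C] by (cases "\<theta> = \<Theta> C") auto
  qed
  show ?thesis
  proof (cases "0 <= x")
   case True
   then obtain \<theta> where "0 <= \<theta>" "\<theta> < \<Theta> C" "RR C \<theta> = x" using pos[of x] x by (auto simp: J_def)
   thus ?thesis using PRR[of \<theta>] Tb by (intro bexI[of _ \<theta>]) (auto simp: I_def)
  next
   case False
   then obtain \<theta> where "0 <= \<theta>" "\<theta> < \<Theta> C" "RR C \<theta> = - x" using pos[of "- x"] x by (auto simp: J_def)
   thus ?thesis using PRR[of \<theta>] odd[of \<theta>] Tb by (intro bexI[of _ "- \<theta>"]) (auto simp: I_def)
  qed
 qed
 have "T x \<in> I & (T has_real_derivative 1 / gr C (T x)) (at x)" if "x \<in> J" for x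
  using surj[OF that] T by (auto simp: inverse_eq_divide)
 thus ?thesis by (intro that[of T]) (use T(1) PJ in \<open>auto simp only: I_def J_def P_def\<close>)
qed

text \<open>The calibration. The function \<open>- sin \<theta> \<cdot> z + E \<theta>\<close>, with \<open>\<theta>\<close> the parameter of the geodesic
 lying over the current value of \<open>\<alpha>\<close>, is affine in \<open>z\<close>; since \<open>k\<close> is convex in \<open>z\<close>, its
 increments along any path are at most the length of the path.\<close>

lemma calibration_along_path:
 assumes C: "0 < C" "C < \<sigma>"
  and T: "!!x. x \<in> {- (S C / 2)<..<S C / 2} ==> T x \<in> {- \<Theta> C<..<\<Theta> C}"
  "!!x. x \<in> {- (S C / 2)<..<S C / 2} ==> (T has_real_derivative 1 / gr C (T x)) (at x)"
  and \<alpha>: "ac_on p q \<alpha> a" "\<alpha> ` {p..q} \<subseteq> {- (S C / 2)<..<S C / 2}" "!!t. 0 <= a t"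
  and \<beta>: "ac_on p q \<beta> b" "!!t. t \<in> {p..q} ==> 0 <= \<beta> t & \<beta> t <= 1"
 obtains w where "ac_on p q (%t. primitive 0 (%\<theta>. C * gr C \<theta> + cos \<theta> * zs C \<theta>) (T (\<alpha> t)) - sin (T (\<alpha> t)) * ((1 - \<beta> t)\<^sup>2 / 2)) w"
  "!!t. t \<in> {p..q} ==> \<exists>c s. 0 <= c & 0 <= s & c\<^sup>2 + s\<^sup>2 = 1 & w t <= a t * c * k (\<beta> t) + s * (1 - \<beta> t) * \<bar>b t\<bar>"
proof -
 define I where "I = {- \<Theta> C<..<\<Theta> C}"
 define J where "J = {- (S C / 2)<..<S C / 2}"
 note Tb = \<Theta>_bounds[OF C]
 define e where "e \<theta> = C * gr C \<theta> + cos \<theta> * zs C \<theta>" for \<theta>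
 have ec: "continuous_on I e"
  unfolding e_def I_def
  by (intro continuous_intros gr_continuous[OF C] continuous_on_subset[OF zs_continuous[OF C(1)]]) (use Tb in auto)
 have dE: "(primitive 0 e has_real_derivative e \<theta>) (at \<theta>)" if "\<theta> \<in> I" for \<theta>
  by (rule primitive_has_derivative[where S = I]) (use ec Tb that in \<open>auto simp: I_def\<close>)
 have Tc: "continuous_on J T" using T(2) by (intro DERIV_continuous_on[of J T]) (auto simp: J_def intro: has_field_derivative_at_within)
 have gp: "0 < gr C \<theta>" if "\<theta> \<in> I" for \<theta> using gr_pos[OF C, of \<theta>] that by (auto simp: I_def)
 have T1c: "continuous_on J (%x. 1 / gr C (T x))"
 proof (intro continuous_intros continuous_on_compose2[OF gr_continuous[OF C] Tc])
  show "T ` J \<subseteq> {- \<Theta> C<..<\<Theta> C}" using T(1) by (auto simp: J_def)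
  show "\<forall>x\<in>J. gr C (T x) ~= 0" using gp T(1) by (force simp: J_def I_def)
 qed
 define \<theta> where "\<theta> t = T (\<alpha> t)" for t
 define d where "d t = 1 / gr C (\<theta> t) * a t" for t
 have ac\<theta>: "ac_on p q \<theta> d"
  unfolding \<theta>_def d_def
  by (rule ac_on_compose[OF \<alpha>(1), of J]) (use \<alpha>(2) T(2) T1c in \<open>auto simp: J_def intro: has_field_derivative_at_within\<close>)
 have \<theta>I: "\<theta> t \<in> I" if "t \<in> {p..q}" for t
  unfolding \<theta>_def I_def by (rule T(1)[OF subsetD[OF \<alpha>(2) imageI[OF that]]])
 have acE: "ac_on p q (%t. primitive 0 e (\<theta> t)) (%t. e (\<theta> t) * d t)"
  by (rule ac_on_compose[OF ac\<theta>, of I]) (use \<theta>I ec dE in \<open>auto simp: I_def intro: has_field_derivative_at_within\<close>)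
 have acs: "ac_on p q (%t. sin (\<theta> t)) (%t. cos (\<theta> t) * d t)"
  by (rule ac_on_compose[OF ac\<theta>, of UNIV]) (auto intro!: derivative_eq_intros continuous_intros)
 have acz: "ac_on p q (%t. (1 - \<beta> t)\<^sup>2 / 2) (%t. - (1 - \<beta> t) * b t)"
  by (rule ac_on_compose[OF \<beta>(1), of UNIV]) (auto intro!: derivative_eq_intros continuous_intros)
 note acW = ac_on_add[OF acE ac_on_cmult[OF ac_on_mult[OF acs acz], of "-1"]]
 define w where "w t = e (\<theta> t) * d t + - 1 * ((1 - \<beta> t)\<^sup>2 / 2 * (cos (\<theta> t) * d t) + sin (\<theta> t) * (- (1 - \<beta> t) * b t))" for t
 show ?thesis
 proof (rule that[of w])
  show "ac_on p q (%t. primitive 0 (%\<theta>. C * gr C \<theta> + cos \<theta> * zs C \<theta>) (T (\<alpha> t)) - sin (T (\<alpha> t)) * ((1 - \<beta> t)\<^sup>2 / 2)) w"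
   using acW by (simp add: w_def[abs_def] e_def[abs_def] \<theta>_def)
  fix t assume t: "t \<in> {p..q}"
  have tI: "\<bar>\<theta> t\<bar> < \<Theta> C" using \<theta>I[OF t] by (auto simp: I_def)
  have c0: "0 < cos (\<theta> t)" using quot_less_\<sigma>(3)[OF C tI] .
  have g0: "0 < gr C (\<theta> t)" by (rule gr_pos[OF C tI])
  have tang: "C / cos (\<theta> t) + (zs C (\<theta> t) - (1 - \<beta> t)\<^sup>2 / 2) / gr C (\<theta> t) <= k (\<beta> t)"
   by (rule tangent_gr[OF C tI]) (use \<beta>(2)[OF t] in auto)
  have "w t = a t * (cos (\<theta> t) * (C / cos (\<theta> t) + (zs C (\<theta> t) - (1 - \<beta> t)\<^sup>2 / 2) / gr C (\<theta> t))) + sin (\<theta> t) * (1 - \<beta> t) * b t"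
   using c0 g0 by (simp add: w_def e_def d_def field_simps)
  also have "\<dots> <= a t * (cos (\<theta> t) * k (\<beta> t)) + \<bar>sin (\<theta> t)\<bar> * (1 - \<beta> t) * \<bar>b t\<bar>"
  proof (rule add_mono)
   show "a t * (cos (\<theta> t) * (C / cos (\<theta> t) + (zs C (\<theta> t) - (1 - \<beta> t)\<^sup>2 / 2) / gr C (\<theta> t))) <= a t * (cos (\<theta> t) * k (\<beta> t))"
    using tang c0 \<alpha>(3) by (intro mult_left_mono) auto
   have "sin (\<theta> t) * (1 - \<beta> t) * b t <= \<bar>sin (\<theta> t) * (1 - \<beta> t) * b t\<bar>" by simp
   also have "\<dots> = \<bar>sin (\<theta> t)\<bar> * (1 - \<beta> t) * \<bar>b t\<bar>" using \<beta>(2)[OF t] by (simp add: abs_mult)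
   finally show "sin (\<theta> t) * (1 - \<beta> t) * b t <= \<bar>sin (\<theta> t)\<bar> * (1 - \<beta> t) * \<bar>b t\<bar>" .
  qed
  finally show "\<exists>c s. 0 <= c & 0 <= s & c\<^sup>2 + s\<^sup>2 = 1 & w t <= a t * c * k (\<beta> t) + s * (1 - \<beta> t) * \<bar>b t\<bar>"
   using c0 by (intro exI[of _ "cos (\<theta> t)"] exI[of _ "\<bar>sin (\<theta> t)\<bar>"]) (auto simp: mult.assoc)
 qed
qed

text \<open>Young's inequality bounds the energy density below by the component of the velocity in any unit
direction \<open>(c, s)\<close>, weighted by \<open>Z\<close>, which stands for \<open>1 - \<beta>\<close>.\<close>

lemma young_length:
 fixes X Y Z c s :: real
 assumes "c\<^sup>2 + s\<^sup>2 = 1"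
 shows "Z * (c * X + s * Y) <= X\<^sup>2 + Y\<^sup>2 + Z\<^sup>2 / 4"
proof -
 have "0 <= (Z / 2 - (c * X + s * Y))\<^sup>2" by simp
 hence "Z * (c * X + s * Y) <= Z\<^sup>2 / 4 + (c * X + s * Y)\<^sup>2" by (simp add: power2_diff power_divide)
 moreover have "(c * X + s * Y)\<^sup>2 + (c * Y - s * X)\<^sup>2 = (c\<^sup>2 + s\<^sup>2) * (X\<^sup>2 + Y\<^sup>2)"
  by (simp add: power2_eq_square algebra_simps)
 moreover have "0 <= (c * Y - s * X)\<^sup>2" by simp
 moreover have "(c\<^sup>2 + s\<^sup>2) * (X\<^sup>2 + Y\<^sup>2) = X\<^sup>2 + Y\<^sup>2" using assms by simp
 ultimately show ?thesis by linarith
qed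

lemma ennreal_integral_le_nn_integral:
 fixes h :: "'a => real"
 assumes "integrable M h"
 shows "ennreal (\<integral>x. h x \<partial>M) <= (\<integral>\<^sup>+x. ennreal (h x) \<partial>M)"
proof -
 have "(\<integral>x. h x \<partial>M) <= (\<integral>x. max 0 (h x) \<partial>M)" using assms by (intro integral_mono) auto
 hence "ennreal (\<integral>x. h x \<partial>M) <= ennreal (\<integral>x. max 0 (h x) \<partial>M)" by (rule ennreal_leI)
 also have "\<dots> = (\<integral>\<^sup>+x. ennreal (max 0 (h x)) \<partial>M)"
  using assms by (intro nn_integral_eq_integral[symmetric]) auto
 also have "\<dots> = (\<integral>\<^sup>+x. ennreal (h x) \<partial>M)" by (simp add: ennreal_max_0)
 finally show ?thesis .
qed

text \<open>The displacement is replaced by its total variation and rescaled so as to move exactly from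
\<open>-x1\<close> to \<open>x1\<close>, strictly inside the range of the calibration. The angle \<open>\<theta>\<close> is below \<open>\<Theta>\<close> because
the calibration degenerates at the end of the geodesic.\<close>

lemma G_lower_bound_\<theta>:
 assumes C: "0 < C" "C < \<sigma>" and adm: "(\<alpha>, \<beta>) \<in> U_adm s" and s: "S C <= s" and \<theta>: "0 < \<theta>" "\<theta> < \<Theta> C"
 shows "ennreal (2 * C * RR C \<theta> + 2 * integral {0..\<theta>} (%\<theta>. cos \<theta> * zs C \<theta>)) <= G_energy f \<alpha> \<beta>"
proof -
 define a0 where "a0 = wderiv UNIV \<alpha>"
 define b where "b = wderiv UNIV \<beta>"
 have H: "H1_loc UNIV \<alpha>" "H1_loc UNIV \<beta>" "continuous_on UNIV \<beta>" "integrable lebesgue a0"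
  "\<bar>\<integral>t. a0 t \<partial>lebesgue\<bar> = s" "!!t. 0 <= \<beta> t & \<beta> t <= 1" "(\<beta> \<longlongrightarrow> 1) at_top" "(\<beta> \<longlongrightarrow> 1) at_bot"
  using adm unfolding U_adm_def a0_def by auto
 have wb: "weak_deriv UNIV \<beta> b" using H(2) wderiv_weak_deriv unfolding H1_loc_def b_def by blast
 have ac\<beta>: "ac_on p q \<beta> b" if "p <= q" for p q
  by (rule weak_deriv_continuous_imp_ac[OF _ _ wb H(3) that]) auto
 define A where "A = (\<integral>t. \<bar>a0 t\<bar> \<partial>lebesgue)"
 have iabs: "integrable lebesgue (%t. \<bar>a0 t\<bar>)" using H(4) by simp
 have "s <= A" using H(5) Bochner_Integration.integral_abs_bound[of lebesgue a0] by (simp add: A_def)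
 hence A: "S C <= A" "0 < A" using s S_pos[OF C] by auto
 define x1 where "x1 = RR C \<theta>"
 obtain T where T: "!!x. x \<in> {- (S C / 2)<..<S C / 2} ==> T x \<in> {- \<Theta> C<..<\<Theta> C}"
  "!!x. x \<in> {- (S C / 2)<..<S C / 2} ==> (T has_real_derivative 1 / gr C (T x)) (at x)"
  "!!\<theta>. \<theta> \<in> {- \<Theta> C<..<\<Theta> C} ==> primitive 0 (gr C) \<theta> \<in> {- (S C / 2)<..<S C / 2}"
  "!!\<theta>. \<theta> \<in> {- \<Theta> C<..<\<Theta> C} ==> T (primitive 0 (gr C) \<theta>) = \<theta>"
  by (rule geodesic_parameter[OF C]) (rule that)
 have px1: "primitive 0 (gr C) \<theta> = x1" using \<theta> by (simp add: primitive_def x1_def RR_def)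
 have pmx1: "primitive 0 (gr C) (- \<theta>) = - x1" using primitive_odd[of "gr C" \<theta>] gr_even px1 by simp
 have x1: "0 < x1" "x1 < S C / 2" "T x1 = \<theta>" "T (- x1) = - \<theta>"
  using T(3)[of \<theta>] T(4)[of \<theta>] T(4)[of "- \<theta>"] \<theta> px1 pmx1 RR_strict_mono[OF C, of 0 \<theta>] by (auto simp: x1_def)
 \<comment> \<open>Scaling factor from the total variation \<open>A\<close> of \<open>\<alpha>\<close> to the displacement from \<open>-x1\<close> to \<open>x1\<close>; it is at most one because \<open>S C \<le> s \<le> A\<close>.\<close>
 define l where "l = 2 * x1 / A"
 have l: "0 < l" "l <= 1" using x1 A by (auto simp: l_def divide_le_eq)
 define a where "a t = l * \<bar>a0 t\<bar>" for t
 have a0: "0 <= a t" for t using l by (simp add: a_def)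
 have ia: "integrable lebesgue a" unfolding a_def using iabs by (intro integrable_mult_right)
 have ai: "a absolutely_integrable_on {p..q}" for p q
  unfolding set_integrable_def using integrable_mult_indicator[OF _ ia, of "{p..q}"] by simp
 have aI: "integral {p..q} a = (\<integral>t. indicator {p..q} t * a t \<partial>lebesgue)" for p q
  using set_lebesgue_integral_eq_integral(2)[OF ai[of p q]] by (simp add: set_lebesgue_integral_def)
 have ab: "0 <= integral {p..q} a & integral {p..q} a <= 2 * x1" for p q
 proof
  show "0 <= integral {p..q} a" unfolding aI by (intro Bochner_Integration.integral_nonneg) (use a0 in auto)
  have "(\<integral>t. indicator {p..q} t * a t \<partial>lebesgue) <= (\<integral>t. a t \<partial>lebesgue)"
   using ia integrable_mult_indicator[OF _ ia, of "{p..q}"] a0 by (intro integral_mono) (auto simp: indicator_def)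
  also have "\<dots> = 2 * x1" using A by (simp add: a_def A_def[symmetric] l_def)
  finally show "integral {p..q} a <= 2 * x1" unfolding aI .
 qed
 define E where "E = primitive 0 (%\<theta>. C * gr C \<theta> + cos \<theta> * zs C \<theta>)"
 define al where "al N t = - x1 + integral {- N..t} a" for N t :: real
 have bound: "ennreal (E (T (al N N)) - sin (T (al N N)) * ((1 - \<beta> N)\<^sup>2 / 2) - E (- \<theta>) - sin \<theta> * ((1 - \<beta> (- N))\<^sup>2 / 2)) <= G_energy f \<alpha> \<beta>"
  if N: "0 <= N" for N
 proof -
  have acal: "ac_on (- N) N (al N) a"
   unfolding ac_on_def al_def using ai by auto
  have rng: "al N ` {- N..N} \<subseteq> {- (S C / 2)<..<S C / 2}"
  proof
   fix y assume "y \<in> al N ` {- N..N}"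
   then obtain t where "y = - x1 + integral {- N..t} a" by (auto simp: al_def)
   thus "y \<in> {- (S C / 2)<..<S C / 2}" using ab[of "- N" t] x1 by auto
  qed
  have NN: "- N <= N" using N by simp
  obtain w where w: "ac_on (- N) N (%t. primitive 0 (%\<theta>. C * gr C \<theta> + cos \<theta> * zs C \<theta>) (T (al N t)) - sin (T (al N t)) * ((1 - \<beta> t)\<^sup>2 / 2)) w"
   "!!t. t \<in> {- N..N} ==> \<exists>c s. 0 <= c & 0 <= s & c\<^sup>2 + s\<^sup>2 = 1 & w t <= a t * c * k (\<beta> t) + s * (1 - \<beta> t) * \<bar>b t\<bar>"
   by (rule calibration_along_path[OF C T(1,2) acal rng a0 ac\<beta>[OF NN] H(6)], assumption, assumption) (rule that)
  have inc: "E (T (al N N)) - sin (T (al N N)) * ((1 - \<beta> N)\<^sup>2 / 2) - E (- \<theta>) - sin \<theta> * ((1 - \<beta> (- N))\<^sup>2 / 2) = integral {- N..N} w"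
   using ac_on_increment[OF w(1), of "- N" N] N x1(4) by (simp add: E_def al_def)
  have wi: "w absolutely_integrable_on {- N..N}" using w(1) by (rule ac_on_abs_integrable)
  have "ennreal (integral {- N..N} w) = ennreal (\<integral>t. indicator {- N..N} t * w t \<partial>lebesgue)"
   using set_lebesgue_integral_eq_integral(2)[OF wi] by (simp add: set_lebesgue_integral_def)
  also have "\<dots> <= (\<integral>\<^sup>+t. ennreal (indicator {- N..N} t * w t) \<partial>lebesgue)"
   using wi by (intro ennreal_integral_le_nn_integral) (simp add: set_integrable_def)
  also have "\<dots> <= G_energy f \<alpha> \<beta>"
   unfolding G_energy_def a0_def[symmetric] b_def[symmetric]
  proof (rule nn_integral_mono)
   fix t :: real
   show "ennreal (indicator {- N..N} t * w t) <= (if \<beta> t < 1 then ennreal ((f (\<beta> t))\<^sup>2 * \<bar>a0 t\<bar>\<^sup>2) else if a0 t = 0 then 0 else \<infinity>)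
       + ennreal ((1 - \<beta> t)\<^sup>2 / 4 + \<bar>b t\<bar>\<^sup>2)" (is "_ <= ?r")
   proof (cases "t \<in> {- N..N}")
    case True
    obtain c s where cs: "0 <= c" "0 <= s" "c\<^sup>2 + s\<^sup>2 = 1" "w t <= a t * c * k (\<beta> t) + s * (1 - \<beta> t) * \<bar>b t\<bar>"
     using w(2)[OF True] by blast
    show ?thesis
    proof (cases "\<beta> t < 1")
     case lt: True
     have fn: "0 <= f (\<beta> t)" using f_pos[of "\<beta> t"] f_zero H(6)[of t] lt by (cases "\<beta> t = 0") auto
     have "a t <= \<bar>a0 t\<bar>" using l by (simp add: a_def mult_left_le_one_le)
     hence "a t * c * k (\<beta> t) <= \<bar>a0 t\<bar> * c * k (\<beta> t)"
      using cs H(6) k_nonneg[of "\<beta> t"] by (intro mult_right_mono) auto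
     hence "w t <= (1 - \<beta> t) * (c * (f (\<beta> t) * \<bar>a0 t\<bar>) + s * \<bar>b t\<bar>)"
      using cs(4) lt by (simp add: k_def algebra_simps)
     also have "\<dots> <= (f (\<beta> t) * \<bar>a0 t\<bar>)\<^sup>2 + \<bar>b t\<bar>\<^sup>2 + (1 - \<beta> t)\<^sup>2 / 4" by (rule young_length[OF cs(3)])
     finally have "w t <= (f (\<beta> t))\<^sup>2 * \<bar>a0 t\<bar>\<^sup>2 + ((1 - \<beta> t)\<^sup>2 / 4 + \<bar>b t\<bar>\<^sup>2)" by (simp add: power_mult_distrib)
     hence "ennreal (w t) <= ennreal ((f (\<beta> t))\<^sup>2 * \<bar>a0 t\<bar>\<^sup>2 + ((1 - \<beta> t)\<^sup>2 / 4 + \<bar>b t\<bar>\<^sup>2))" by (rule ennreal_leI)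
     also have "\<dots> = ennreal ((f (\<beta> t))\<^sup>2 * \<bar>a0 t\<bar>\<^sup>2) + ennreal ((1 - \<beta> t)\<^sup>2 / 4 + \<bar>b t\<bar>\<^sup>2)" by (rule ennreal_plus) auto
     finally show ?thesis using lt True by simp
    next
     case False
     hence b1: "\<beta> t = 1" using H(6)[of t] by simp
     show ?thesis
     proof (cases "a0 t = 0")
      case True
      hence "w t <= 0" using cs(4) b1 by (simp add: a_def)
      thus ?thesis by (simp add: ennreal_neg indicator_def)
     qed (use b1 in simp)
    qed
   qed simp
  qed
  finally show ?thesis using inc by simp
 qed
 have al_lim: "((%N. al N N) \<longlongrightarrow> x1) at_top"
 proof -
  have "((%N. \<integral>t. indicator {- N..N} t * a t \<partial>lebesgue) \<longlongrightarrow> (\<integral>t. a t \<partial>lebesgue)) at_top"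
  proof (rule integral_dominated_convergence_at_top[where w = a])
   show "\<forall>\<^sub>F N in at_top. AE t in lebesgue. norm (indicator {- N..N} t * a t) <= a t"
    using a0 by (auto simp: indicator_def intro!: always_eventually)
   show "AE t in lebesgue. ((%N. indicator {- N..N} t * a t) \<longlongrightarrow> a t) at_top"
   proof (rule AE_I2)
    fix t :: real
    have "\<forall>\<^sub>F N in at_top. indicator {- N..N} t * a t = a t"
     using eventually_ge_at_top[of "\<bar>t\<bar>"] by eventually_elim (auto simp: indicator_def)
    thus "((%N. indicator {- N..N} t * a t) \<longlongrightarrow> a t) at_top" by (rule tendsto_eventually)
   qed
   show "(%t. indicator {- N..N} t * a t) \<in> borel_measurable lebesgue" for N
    using ia by (intro borel_measurable_times borel_measurable_indicator) auto
  qed (use ia in auto)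
  moreover have "(\<integral>t. a t \<partial>lebesgue) = 2 * x1" using A by (simp add: a_def A_def[symmetric] l_def)
  ultimately have "((%N. - x1 + integral {- N..N} a) \<longlongrightarrow> - x1 + 2 * x1) at_top"
   unfolding aI by (intro tendsto_add tendsto_const) simp
  thus ?thesis by (simp add: al_def)
 qed
 have x1J: "x1 \<in> {- (S C / 2)<..<S C / 2}" using x1 by auto
 have T_lim: "((%N. T (al N N)) \<longlongrightarrow> \<theta>) at_top"
  using isCont_tendsto_compose[OF DERIV_isCont[OF T(2)[OF x1J]] al_lim] x1 by simp
 have "isCont E \<theta>"
 proof -
  have "(E has_real_derivative C * gr C \<theta> + cos \<theta> * zs C \<theta>) (at \<theta>)"
   unfolding E_def
   by (rule primitive_has_derivative[where S = "{- \<Theta> C<..<\<Theta> C}"])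
    (use \<theta> \<Theta>_bounds[OF C] in \<open>auto intro!: continuous_intros gr_continuous[OF C] continuous_on_subset[OF zs_continuous[OF C(1)]]\<close>)
  thus ?thesis by (rule DERIV_isCont)
 qed
 note E_lim = isCont_tendsto_compose[OF this T_lim]
 have z1: "((%N. (1 - \<beta> N)\<^sup>2 / 2) \<longlongrightarrow> (1 - 1)\<^sup>2 / 2) at_top" by (intro tendsto_intros H(7)) auto
 have "((%N. \<beta> (- N)) \<longlongrightarrow> 1) at_top" using filterlim_compose[OF H(8) filterlim_uminus_at_bot_at_top] .
 hence z2: "((%N. (1 - \<beta> (- N))\<^sup>2 / 2) \<longlongrightarrow> (1 - 1)\<^sup>2 / 2) at_top" by (intro tendsto_intros) auto
 have lim: "((%N. E (T (al N N)) - sin (T (al N N)) * ((1 - \<beta> N)\<^sup>2 / 2) - E (- \<theta>) - sin \<theta> * ((1 - \<beta> (- N))\<^sup>2 / 2))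
   \<longlongrightarrow> E \<theta> - sin \<theta> * ((1 - 1)\<^sup>2 / 2) - E (- \<theta>) - sin \<theta> * ((1 - 1)\<^sup>2 / 2)) at_top"
  by (intro tendsto_intros E_lim T_lim z1 z2)
 have "ennreal (E \<theta> - E (- \<theta>)) <= G_energy f \<alpha> \<beta>"
 proof (rule tendsto_upperbound)
  show "((%N. ennreal (E (T (al N N)) - sin (T (al N N)) * ((1 - \<beta> N)\<^sup>2 / 2) - E (- \<theta>) - sin \<theta> * ((1 - \<beta> (- N))\<^sup>2 / 2)))
    \<longlongrightarrow> ennreal (E \<theta> - E (- \<theta>))) at_top"
   using tendsto_ennrealI[OF lim] by simp
  show "\<forall>\<^sub>F N in at_top. ennreal (E (T (al N N)) - sin (T (al N N)) * ((1 - \<beta> N)\<^sup>2 / 2) - E (- \<theta>) - sin \<theta> * ((1 - \<beta> (- N))\<^sup>2 / 2)) <= G_energy f \<alpha> \<beta>"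
   using eventually_ge_at_top[of 0] by eventually_elim (rule bound)
 qed simp
 moreover have "E (- \<theta>) = - E \<theta>" unfolding E_def by (rule primitive_odd) (simp add: gr_even zs_even)
 moreover have "E \<theta> = C * RR C \<theta> + integral {0..\<theta>} (%\<theta>. cos \<theta> * zs C \<theta>)"
 proof -
  have "E \<theta> = integral {0..\<theta>} (%\<theta>. C * gr C \<theta> + cos \<theta> * zs C \<theta>)" using \<theta> by (simp add: E_def primitive_def)
  also have "\<dots> = C * RR C \<theta> + integral {0..\<theta>} (%\<theta>. cos \<theta> * zs C \<theta>)"
   using gr_integrable[OF C, of 0 \<theta>] cos_zs_abs_integrable[OF C(1), of 0 \<theta>] \<theta> \<Theta>_bounds[OF C]
   by (subst Henstock_Kurzweil_Integration.integral_add)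
    (auto simp: RR_def absolutely_integrable_on_def intro: integrable_on_mult_right)
  finally show ?thesis .
 qed
 ultimately show ?thesis by (simp add: distrib_left mult.assoc)
qed

lemma G_lower_bound:
 assumes C: "0 < C" "C < \<sigma>" and adm: "(\<alpha>, \<beta>) \<in> U_adm s" and s: "S C <= s"
 shows "ennreal (C * S C + KK C) <= G_energy f \<alpha> \<beta>"
proof -
 note Tb = \<Theta>_bounds[OF C]
 have c1: "continuous_on {0..\<Theta> C} (RR C)"
  unfolding RR_def using gr_integrable[OF C, of 0 "\<Theta> C"] Tb by (intro indefinite_integral_continuous_1) auto
 have c2: "continuous_on {0..\<Theta> C} (%x. integral {0..x} (%\<theta>. cos \<theta> * zs C \<theta>))"
  using cos_zs_abs_integrable[OF C(1), of 0 "\<Theta> C"] Tb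
  by (intro indefinite_integral_continuous_1) (auto simp: absolutely_integrable_on_def)
 have "continuous_on {0..\<Theta> C} (%x. 2 * C * RR C x + 2 * integral {0..x} (%\<theta>. cos \<theta> * zs C \<theta>))"
  by (intro continuous_intros c1 c2)
 hence "((%x. 2 * C * RR C x + 2 * integral {0..x} (%\<theta>. cos \<theta> * zs C \<theta>)) \<longlongrightarrow>
   2 * C * RR C (\<Theta> C) + 2 * integral {0..\<Theta> C} (%\<theta>. cos \<theta> * zs C \<theta>)) (at_left (\<Theta> C))"
  by (rule continuous_on_Icc_at_leftD) (use Tb in auto)
 from tendsto_ennrealI[OF this]
 have "ennreal (2 * C * RR C (\<Theta> C) + 2 * integral {0..\<Theta> C} (%\<theta>. cos \<theta> * zs C \<theta>)) <= G_energy f \<alpha> \<beta>"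
 proof (rule tendsto_upperbound)
  show "\<forall>\<^sub>F x in at_left (\<Theta> C). ennreal (2 * C * RR C x + 2 * integral {0..x} (%\<theta>. cos \<theta> * zs C \<theta>)) <= G_energy f \<alpha> \<beta>"
   unfolding eventually_at_left_field
   by (intro exI[of _ 0] conjI allI impI G_lower_bound_\<theta>[OF C adm s]) (use Tb in auto)
 qed simp
 thus ?thesis by (simp add: S_eq[OF C] KK_eq[OF C] mult.left_commute mult.assoc)
qed

end

section \<open>Competitors for the cohesive energy\<close>

lemma ac_on_piecewise:
 fixes A A' :: "real => real"
 assumes "continuous_on {p..q} A" "finite N"
  "!!x. x \<in> {p<..<q} - N ==> (A has_real_derivative A' x) (at x)" "!!x. \<bar>A' x\<bar> <= B"
 shows "ac_on p q A A'"
proof -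
 have hi: "(A' has_integral (A x - A p)) {p..x}" if "x \<in> {p..q}" for x
 proof (rule fundamental_theorem_of_calculus_interior_strong[OF assms(2)])
  show "p <= x" using that by simp
  show "continuous_on {p..x} A" by (rule continuous_on_subset[OF assms(1)]) (use that in auto)
  show "(A has_vector_derivative A' z) (at z)" if "z \<in> {p<..<x} - N" for z
   using assms(3)[of z] that \<open>x \<in> {p..q}\<close> by (simp add: has_real_derivative_iff_has_vector_derivative)
 qed
 have "A' absolutely_integrable_on {p..q}"
 proof (cases "p <= q")
  case True
  show ?thesis
   by (rule absolutely_integrable_integrable_bound[where g = "%x. B"])
    (use assms(4) hi[of q] True in \<open>auto intro: integrable_const_ivl\<close>)
 qed simp
 moreover have "A x = A p + integral {p..x} A'" if "x \<in> {p..q}" for x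
  using integral_unique[OF hi[OF that]] by simp
 ultimately show ?thesis unfolding ac_on_def by blast
qed

lemma bounded_measurable_L2:
 fixes h :: "real => real"
 assumes h: "h \<in> borel_measurable lebesgue" and B: "!!x. x \<in> K ==> \<bar>h x\<bar> <= B" and K: "compact K"
 shows "L2 K h"
 unfolding L2_def
proof
 have Kl: "K \<in> lmeasurable" using K by (rule lmeasurable_compact)
 show m: "h \<in> borel_measurable (lebesgue_on K)" by (rule measurable_restrict_space1[OF h])
 have "(%x. (h x)\<^sup>2) absolutely_integrable_on K"
 proof (rule measurable_bounded_by_integrable_imp_absolutely_integrable)
  show "(%x. (h x)\<^sup>2) \<in> borel_measurable (lebesgue_on K)" using m by measurable
  show "K \<in> sets lebesgue" using Kl by auto
  show "(%x. B\<^sup>2) integrable_on K" by (rule integrable_on_const[OF Kl])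
  show "norm ((h x)\<^sup>2) <= B\<^sup>2" if "x \<in> K" for x
   using power_mono[OF B[OF that], of 2] by simp
 qed
 thus "integrable (lebesgue_on K) (%x. (h x)\<^sup>2)" using Kl by (subst integrable_lebesgue_on_iff) auto
qed

lemma continuous_measurable_lebesgue: "continuous_on UNIV h ==> (h :: real => real) \<in> borel_measurable lebesgue"
 using borel_measurable_continuous_onI[of h] by (intro measurable_completion) simp

lemma continuous_bounded_on_compact:
 fixes h :: "real => real"
 assumes "continuous_on UNIV h" "compact K"
 obtains B where "!!x. x \<in> K ==> \<bar>h x\<bar> <= B"
proof -
 have "bounded (h ` K)"
  by (intro compact_imp_bounded compact_continuous_image assms continuous_on_subset[OF assms(1)]) auto
 then obtain B where "!!y. y \<in> h ` K ==> norm y <= B" unfolding bounded_iff by blast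
 thus ?thesis using that[of B] by auto
qed

lemma H1_locI:
 assumes c: "continuous_on UNIV h" and m: "w \<in> borel_measurable lebesgue" and B: "!!x. \<bar>w x\<bar> <= B"
  and ac: "!!p q. p <= q ==> ac_on p q h w"
 shows "H1_loc UNIV h" "weak_deriv UNIV h w" "negligible {x. wderiv UNIV h x ~= w x}"
proof -
 have L2h: "L2 K h" if K: "compact K" for K
 proof -
  obtain B where "!!x. x \<in> K ==> \<bar>h x\<bar> <= B"
   by (rule continuous_bounded_on_compact[OF c K]) (rule that)
  thus ?thesis by (rule bounded_measurable_L2[OF continuous_measurable_lebesgue[OF c] _ K])
 qed
 have L2w: "L2 K w" if "compact K" for K by (rule bounded_measurable_L2[OF m B that])
 show wd: "weak_deriv UNIV h w"
  by (rule weak_deriv_if_ac) (use continuous_measurable_lebesgue[OF c] m ac in auto)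
 show "H1_loc UNIV h" unfolding H1_loc_def using L2h L2w wd by blast
 show "negligible {x. wderiv UNIV h x ~= w x}" using wderiv_ae[OF _ _ _ wd] by simp
qed

lemma integral_even:
 fixes h :: "real => real"
 assumes "!!t. h (- t) = h t" "h absolutely_integrable_on {- T..T}" "0 <= T"
 shows "integral {- T..T} h = 2 * integral {0..T} h"
proof -
 have "integral {- T..0} h + integral {0..T} h = integral {- T..T} h"
  by (rule Henstock_Kurzweil_Integration.integral_combine) (use assms in \<open>auto simp: absolutely_integrable_on_def\<close>)
 moreover have "integral {- T..0} h = integral {0..T} h"
  using Henstock_Kurzweil_Integration.integral_reflect_real[of T 0 h] assms(1) by simp
 ultimately show ?thesis by simp
qed

context degr
begin

text \<open>The competitor follows the geodesic with an energy level raised by \<open>\<eta>\<close>, so that \<open>\<beta>' = sqrt (Q(\<beta>)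
+ \<eta>)\<close> has positive speed at the turning point and \<open>\<beta>\<close> reaches \<open>1\<close> in finite time; the
displacement is scaled by the factor \<open>s/s\<eta>\<close> to obtain the prescribed opening \<open>s\<close>, which only
affects the elastic term, quadratically.\<close>

lemma competitor:
 assumes m: "m \<in> {0<..<1}" and \<eta>: "0 < \<eta>" and s: "0 < s"
 defines "C \<equiv> k m"
 defines "q \<equiv> %t. (1 - t)\<^sup>2 / 4 * (C / k t)\<^sup>2" and "Q \<equiv> %t. (1 - t)\<^sup>2 / 4 * (1 - (C / k t)\<^sup>2)"
 defines "s\<eta> \<equiv> 2 * integral {m..1} (%t. 2 / C * q t / sqrt (Q t + \<eta>))"
 shows "0 < s\<eta>" "(INF (\<alpha>, \<beta>)\<in>U_adm s. G_energy f \<alpha> \<beta>)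
  <= ennreal (((s / s\<eta>)\<^sup>2 + 1) * (C / 2) * s\<eta> + 4 * integral {m..1} (%t. sqrt (Q t + \<eta>)))"
proof -
 have C: "0 < C" "C < \<sigma>" using k_pos[of m] k_less_\<sigma>[of m] m by (auto simp: C_def)
 have Ck: "C <= k t" if "t \<in> {m..1}" for t using k_mono[of m t] that m by (auto simp: C_def)
 have kc: "continuous_on {m..1} k" by (rule continuous_on_subset[OF k_continuous]) (use m in auto)
 have kn0: "k t ~= 0" if "t \<in> {m..1}" for t using Ck[OF that] C by auto
 have qc: "continuous_on {m..1} q" and Qc: "continuous_on {m..1} Q"
 proof -
  have r: "continuous_on {m..1} (%t. C / k t)" by (intro continuous_on_divide continuous_on_const kc) (use kn0 in auto)
  show "continuous_on {m..1} q" "continuous_on {m..1} Q"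
   unfolding q_def Q_def by (intro continuous_intros r; simp)+
 qed
 have Q0: "0 <= Q t" if "t \<in> {m..1}" for t
  using quot_k_bounds[OF C(1) Ck[OF that]] by (simp add: Q_def power_le_one)
 have q0: "0 <= q t" for t by (simp add: q_def)
 have qQ: "q t + Q t = (1 - t)\<^sup>2 / 4" for t by (simp add: q_def Q_def right_diff_distrib)
 \<comment> \<open>Constant extension of \<open>Q\<close>, so that the profile is the restriction of a diffeomorphism.\<close>
 define cl where "cl t = max m (min 1 t)" for t :: real
 have clc: "continuous_on UNIV cl" unfolding cl_def by (intro continuous_intros)
 have clr: "cl t \<in> {m..1}" for t using m by (auto simp: cl_def)
 have cl_id: "cl t = t" if "t \<in> {m..1}" for t using that by (auto simp: cl_def)
 define X1 where "X1 t = 1 / sqrt (Q (cl t) + \<eta>)" for t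
 have sq0: "0 < sqrt (Q (cl t) + \<eta>)" for t using Q0[OF clr] \<eta> by (simp add: add_nonneg_pos)
 have X1c: "continuous_on UNIV X1"
  unfolding X1_def
  by (intro continuous_intros continuous_on_compose2[OF Qc clc]) (use clr sq0 in \<open>auto simp: less_imp_neq[symmetric] image_subset_iff\<close>)
 define X where "X = primitive m X1"
 have Xd: "(X has_real_derivative X1 t) (at t)" for t
  unfolding X_def by (rule primitive_has_derivative[where S = UNIV]) (use X1c in auto)
 have X1p: "0 < X1 t" for t using sq0 by (simp add: X1_def)
 obtain Y where Y: "!!x. x \<in> {m - 1<..<2} ==> Y (X x) = x"
  "!!x. x \<in> {m - 1<..<2} ==> (Y has_real_derivative inverse (X1 x)) (at (X x))"
  by (rule C1_inverse[where P = X and P' = X1 and a = "m - 1" and b = 2]) (use Xd X1p in auto)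
 define T where "T = X 1"
 have Xm: "X m = 0" by (simp add: X_def primitive_def)
 have Xmono: "X x < X y" if "x < y" for x y
  by (rule DERIV_pos_imp_increasing[OF that]) (use Xd X1p in blast)
 have T0: "0 < T" using Xmono[of m 1] m Xm by (simp add: T_def)
 have Xc: "continuous_on A X" for A using DERIV_isCont[OF Xd] by (intro continuous_at_imp_continuous_on) auto
 have Ysurj: "\<exists>x\<in>{m..1}. X x = y" if "y \<in> {0..T}" for y
 proof -
  have "\<exists>x\<ge>m. x <= 1 & X x = y" by (rule IVT') (use that m Xm Xc T_def in auto)
  thus ?thesis by auto
 qed
 have Yr: "Y y \<in> {m..1}" and Yd: "(Y has_real_derivative sqrt (Q (Y y) + \<eta>)) (at y)" and XY: "X (Y y) = y"
  if y: "y \<in> {0..T}" for y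
 proof -
  obtain x where x: "x \<in> {m..1}" "X x = y" using Ysurj[OF y] by blast
  hence xi: "x \<in> {m - 1<..<2}" using m by auto
  have Yx: "Y y = x" using Y(1)[OF xi] x by simp
  show "Y y \<in> {m..1}" "X (Y y) = y" using Yx x by auto
  show "(Y has_real_derivative sqrt (Q (Y y) + \<eta>)) (at y)"
   using Y(2)[OF xi] x Yx sq0[of x] by (simp add: X1_def cl_id)
 qed
 have Yc: "continuous_on {0..T} Y" by (rule DERIV_continuous_on, rule has_field_derivative_at_within, erule Yd)
 have Y0: "Y 0 = m" using Y(1)[of m] Xm m by simp
 have YT: "Y T = 1" using Y(1)[of 1] m by (simp add: T_def)
 have Ylt: "Y y < 1" if "y \<in> {0..<T}" for y
 proof -
  have "Y y ~= 1" using XY[of y] that T_def by auto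
  thus ?thesis using Yr[of y] that by auto
 qed
 have cov: "integral {0..T} (%t. h (Y t)) = integral {m..1} (%t. h t / sqrt (Q t + \<eta>))"
  if h: "continuous_on {m..1} h" for h
 proof -
  define h' where "h' t = h (cl t) * X1 t" for t
  have h'c: "continuous_on UNIV h'"
   unfolding h'_def by (intro continuous_intros X1c continuous_on_compose2[OF h clc]) (use clr in auto)
  have Pd: "(primitive m h' has_real_derivative h' t) (at t)" for t
   by (rule primitive_has_derivative[where S = UNIV]) (use h'c in auto)
  have "((%t. h (Y t)) has_integral (primitive m h' (Y T) - primitive m h' (Y 0))) {0..T}"
  proof (rule fundamental_theorem_of_calculus)
   show "0 <= T" using T0 by simp
   fix t assume t: "t \<in> {0..T}"
   have "((%t. primitive m h' (Y t)) has_real_derivative h' (Y t) * sqrt (Q (Y t) + \<eta>)) (at t)"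
    by (rule DERIV_chain2[OF Pd Yd[OF t]])
   moreover have "h' (Y t) * sqrt (Q (Y t) + \<eta>) = h (Y t)"
    using sq0[of "Y t"] by (simp add: h'_def X1_def cl_id[OF Yr[OF t]])
   ultimately show "((%t. primitive m h' (Y t)) has_vector_derivative h (Y t)) (at t within {0..T})"
    by (simp add: has_real_derivative_iff_has_vector_derivative has_vector_derivative_at_within)
  qed
  hence "integral {0..T} (%t. h (Y t)) = integral {m..1} h'"
   using m by (simp add: integral_unique Y0 YT primitive_def)
  also have "\<dots> = integral {m..1} (%t. h t / sqrt (Q t + \<eta>))"
   by (rule integral_cong) (simp add: h'_def X1_def cl_id)
  finally show ?thesis .
 qed
 define A where "A t = min \<bar>t\<bar> T" for t :: real
 have AT: "A t \<in> {0..T}" for t using T0 by (auto simp: A_def)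
 have Ac: "continuous_on UNIV A" unfolding A_def by (intro continuous_intros)
 define \<beta> where "\<beta> t = Y (A t)" for t
 have \<beta>r: "\<beta> t \<in> {m..1}" for t unfolding \<beta>_def by (rule Yr[OF AT])
 have \<beta>c: "continuous_on UNIV \<beta>" unfolding \<beta>_def by (rule continuous_on_compose2[OF Yc Ac]) (use AT in auto)
 have acA: "ac_on p q A (%t. if \<bar>t\<bar> < T then sgn t else 0)" for p q
 proof (rule ac_on_piecewise[where N = "{- T, 0, T}" and B = 1])
  show "continuous_on {p..q} A" by (rule continuous_on_subset[OF Ac]) auto
  fix x assume x: "x \<in> {p<..<q} - {- T, 0, T}"
  consider "\<bar>x\<bar> > T" | "0 < x" "x < T" | "x < 0" "- T < x" using x by fastforce
  thus "(A has_real_derivative (if \<bar>x\<bar> < T then sgn x else 0)) (at x)"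
  proof cases
   case 1
   have ev: "\<forall>\<^sub>F y in nhds x. A y = T"
    by (rule eventually_mono[OF eventually_nhds_in_open[of "{y. T < \<bar>y\<bar>}"]])
     (use 1 in \<open>auto simp: A_def intro!: open_Collect_less continuous_intros\<close>)
   show ?thesis using 1 by (subst DERIV_cong_ev[OF refl ev refl]) auto
  next
   case 2
   have ev: "\<forall>\<^sub>F y in nhds x. A y = y"
    by (rule eventually_mono[OF eventually_nhds_in_open[of "{0<..<T}"]]) (use 2 in \<open>auto simp: A_def\<close>)
   show ?thesis using 2 by (subst DERIV_cong_ev[OF refl ev refl]) auto
  next
   case 3
   have ev: "\<forall>\<^sub>F y in nhds x. A y = - y"
    by (rule eventually_mono[OF eventually_nhds_in_open[of "{- T<..<0}"]]) (use 3 in \<open>auto simp: A_def\<close>)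
   show ?thesis using 3 by (subst DERIV_cong_ev[OF refl ev refl]) (auto intro!: derivative_eq_intros)
  qed
 qed (auto simp: sgn_if)
 define b where "b t = sqrt (Q (\<beta> t) + \<eta>) * (if \<bar>t\<bar> < T then sgn t else 0)" for t
 have rc: "continuous_on {m..1} (%t. sqrt (Q t + \<eta>))" by (intro continuous_intros Qc)
 have sbc: "continuous_on UNIV (%t. sqrt (Q (\<beta> t) + \<eta>))"
  by (rule continuous_on_compose2[OF rc \<beta>c]) (use \<beta>r in auto)
 have ac\<beta>: "ac_on p q \<beta> b" for p q
  unfolding \<beta>_def b_def
  by (rule ac_on_compose[OF acA, of p q "{0..T}"])
   (use AT Yd in \<open>auto intro: has_field_derivative_at_within continuous_on_compose2[OF rc Yc] Yr\<close>)
 have b2: "\<bar>b t\<bar>\<^sup>2 = (if \<bar>t\<bar> < T & t ~= 0 then Q (\<beta> t) + \<eta> else 0)" for t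
  using Q0[OF \<beta>r, of t] \<eta> by (auto simp: b_def power_mult_distrib sgn_if)
 obtain M where M: "!!t. t \<in> {m..1} ==> \<bar>sqrt (Q t + \<eta>)\<bar> <= M"
 proof -
  have "bounded ((%t. sqrt (Q t + \<eta>)) ` {m..1})" by (intro compact_imp_bounded compact_continuous_image rc) auto
  thus ?thesis unfolding bounded_iff by (auto intro: that)
 qed
 have bB: "\<bar>b t\<bar> <= M" for t
  using M[OF \<beta>r, of t] M[of m] m by (auto simp: b_def abs_mult abs_sgn_eq)
 have bm: "b \<in> borel_measurable lebesgue"
  unfolding b_def
  by (intro borel_measurable_times continuous_measurable_lebesgue[OF sbc] measurable_completion) measurable
 note H\<beta> = H1_locI[OF \<beta>c bm bB ac\<beta>]
 have qbc: "continuous_on UNIV (%t. 2 / C * q (\<beta> t))"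
  by (intro continuous_intros continuous_on_compose2[OF qc \<beta>c]) (use \<beta>r in auto)
 have \<beta>1: "\<beta> t = 1" if "T <= \<bar>t\<bar>" for t using that by (simp add: \<beta>_def A_def YT)
 have q1: "q 1 = 0" by (simp add: q_def)
 have \<beta>even: "\<beta> (- t) = \<beta> t" for t by (simp add: \<beta>_def A_def)
 have \<beta>Y: "\<beta> t = Y t" if "t \<in> {0..T}" for t using that by (simp add: \<beta>_def A_def)
 have iq: "integral {- T..T} (%t. 2 / C * q (\<beta> t)) = s\<eta>"
 proof -
  have "integral {- T..T} (%t. 2 / C * q (\<beta> t)) = 2 * integral {0..T} (%t. 2 / C * q (\<beta> t))"
   by (rule integral_even) (use \<beta>even T0 in \<open>auto intro!: absolutely_integrable_continuous_real continuous_on_subset[OF qbc, simplified]\<close>)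
  also have "integral {0..T} (%t. 2 / C * q (\<beta> t)) = integral {0..T} (%t. 2 / C * q (Y t))"
   by (rule integral_cong) (simp add: \<beta>Y)
  also have "\<dots> = integral {m..1} (%t. 2 / C * q t / sqrt (Q t + \<eta>))"
   by (rule cov) (intro continuous_intros qc)
  finally show ?thesis by (simp add: s\<eta>_def)
 qed
 show s\<eta>0: "0 < s\<eta>"
 proof -
  have "0 <= integral {m..1} (%t. 2 / C * q t / sqrt (Q t + \<eta>))"
   using q0 C Q0 \<eta> by (intro Henstock_Kurzweil_Integration.integral_nonneg integrable_continuous_real continuous_intros qc Qc)
    (force simp: add_nonneg_pos[THEN less_imp_neq, symmetric] add_nonneg_eq_0_iff)+
  moreover have "integral {m..1} (%t. 2 / C * q t / sqrt (Q t + \<eta>)) ~= 0"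
  proof
   assume "integral {m..1} (%t. 2 / C * q t / sqrt (Q t + \<eta>)) = 0"
   hence "2 / C * q m / sqrt (Q m + \<eta>) = 0"
    using q0 C Q0 \<eta> m
    by (subst (asm) integral_eq_0_iff) (force intro!: continuous_intros qc Qc simp: add_nonneg_eq_0_iff)+
   moreover have "0 < q m" using m C by (simp add: q_def C_def)
   ultimately show False using C Q0[of m] m \<eta> by (auto simp: add_nonneg_eq_0_iff)
  qed
  ultimately show ?thesis by (simp add: s\<eta>_def)
 qed
 define l where "l = s / s\<eta>"
 define a where "a t = l * (2 / C * q (\<beta> t))" for t
 have ac: "continuous_on UNIV a" unfolding a_def by (intro continuous_on_mult continuous_on_const qbc)
 have a0: "a t = 0" if "t \<notin> {- T..T}" for t
 proof -
  have "T <= \<bar>t\<bar>" using that by auto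
  thus ?thesis by (simp add: a_def \<beta>1 q1)
 qed
 have aT: "a t = 0" if "T <= \<bar>t\<bar>" for t using that by (simp add: a_def \<beta>1 q1)
 obtain M' where M': "!!t. t \<in> {- T..T} ==> \<bar>a t\<bar> <= M'" by (rule continuous_bounded_on_compact[OF ac compact_Icc]) (rule that)
 have aB: "\<bar>a t\<bar> <= M'" for t using M'[of t] M'[of 0] a0[of t] T0 by (cases "t \<in> {- T..T}") auto
 define \<alpha> where "\<alpha> = primitive 0 a"
 have \<alpha>d: "(\<alpha> has_real_derivative a t) (at t)" for t
  unfolding \<alpha>_def by (rule primitive_has_derivative[where S = UNIV]) (use ac in auto)
 have ac\<alpha>: "ac_on p q \<alpha> a" for p q
  by (rule ac_on_C1[OF has_field_derivative_at_within[OF \<alpha>d] continuous_on_subset[OF ac]]) auto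
 have \<alpha>c: "continuous_on UNIV \<alpha>" using DERIV_isCont[OF \<alpha>d] by (intro continuous_at_imp_continuous_on) auto
 note H\<alpha> = H1_locI[OF \<alpha>c continuous_measurable_lebesgue[OF ac] aB ac\<alpha>]
 have aai: "a absolutely_integrable_on {- T..T}"
  by (rule absolutely_integrable_continuous_real[OF continuous_on_subset[OF ac]]) auto
 have ael: "AE t in lebesgue. wderiv UNIV \<alpha> t = a t" "AE t in lebesgue. wderiv UNIV \<beta> t = b t"
  unfolding eventually_ae_filter_negligible using H\<alpha>(3) H\<beta>(3) by blast+
 have wm: "wderiv UNIV \<alpha> \<in> borel_measurable lebesgue"
  using wderiv_weak_deriv[OF H\<alpha>(2)] by (simp add: weak_deriv_def L1_loc_def lebesgue_on_UNIV_eq)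
 have aint: "integrable lebesgue a" "(\<integral>t. a t \<partial>lebesgue) = s"
 proof -
  have "integrable (lebesgue_on UNIV) a" "(\<integral>t. a t \<partial>lebesgue_on UNIV) = integral {- T..T} a"
   using LINT_support[of "- T" T UNIV a] a0 aai by auto
  moreover have "integral {- T..T} a = l * s\<eta>" unfolding a_def iq[symmetric] by simp
  ultimately show "integrable lebesgue a" "(\<integral>t. a t \<partial>lebesgue) = s" using s\<eta>0 by (simp_all add: l_def lebesgue_on_UNIV_eq)
 qed
 have adm: "(\<alpha>, \<beta>) \<in> U_adm s"
 proof -
  have "integrable lebesgue (wderiv UNIV \<alpha>)"
   using aint(1) ael(1) wm by (subst Bochner_Integration.integrable_cong_AE) (auto intro: continuous_measurable_lebesgue[OF ac])
  moreover have "(\<integral>t. wderiv UNIV \<alpha> t \<partial>lebesgue) = s"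
   using aint(2) ael(1) wm by (subst Bochner_Integration.integral_cong_AE[where g = a]) (auto intro: continuous_measurable_lebesgue[OF ac])
  moreover have "(\<beta> \<longlongrightarrow> 1) at_top"
   by (rule tendsto_eventually) (use eventually_ge_at_top[of T] in eventually_elim, use \<beta>1 T0 in auto)
  moreover have "(\<beta> \<longlongrightarrow> 1) at_bot"
   by (rule tendsto_eventually) (use eventually_le_at_bot[of "- T"] in eventually_elim, use \<beta>1 T0 in auto)
  moreover have "0 <= \<beta> t & \<beta> t <= 1" for t using \<beta>r[of t] m by auto
  ultimately show ?thesis using H\<alpha>(1) H\<beta>(1) \<beta>c s by (simp add: U_adm_def)
 qed
 define e where "e t = (l\<^sup>2 + 1) * q (\<beta> t) + 2 * Q (\<beta> t) + \<eta>" for t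
 have ec: "continuous_on UNIV e"
  unfolding e_def by (intro continuous_intros continuous_on_compose2[OF qc \<beta>c] continuous_on_compose2[OF Qc \<beta>c]) (use \<beta>r in auto)
 have e0: "0 <= e t" for t using q0 Q0[OF \<beta>r, of t] \<eta> by (simp add: e_def)
 have en: "G_energy f \<alpha> \<beta> <= ennreal (integral {- T..T} e)"
 proof -
  have "G_energy f \<alpha> \<beta> <= (\<integral>\<^sup>+t. ennreal (indicator {- T..T} t * e t) \<partial>lebesgue)"
   unfolding G_energy_def
  proof (rule nn_integral_mono_AE)
   show "AE t in lebesgue. (if \<beta> t < 1 then ennreal ((f (\<beta> t))\<^sup>2 * \<bar>wderiv UNIV \<alpha> t\<bar>\<^sup>2) else if wderiv UNIV \<alpha> t = 0 then 0 else \<infinity>)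
      + ennreal ((1 - \<beta> t)\<^sup>2 / 4 + \<bar>wderiv UNIV \<beta> t\<bar>\<^sup>2) <= ennreal (indicator {- T..T} t * e t)"
    using ael
   proof eventually_elim
    case (elim t)
    show ?case
    proof (cases "\<bar>t\<bar> < T")
     case True
     hence bt: "\<beta> t < 1" unfolding \<beta>_def using T0 by (intro Ylt) (auto simp: A_def)
     have b0: "0 < \<beta> t" using \<beta>r[of t] m by auto
     have fa: "(f (\<beta> t))\<^sup>2 * \<bar>a t\<bar>\<^sup>2 = l\<^sup>2 * q (\<beta> t)"
     proof -
      have "k (\<beta> t) = (1 - \<beta> t) * f (\<beta> t)" using bt by (simp add: k_def)
      moreover have "f (\<beta> t) ~= 0" using f_pos[of "\<beta> t"] bt b0 by auto
      ultimately show ?thesis using bt C by (simp add: a_def q_def power_mult_distrib power_divide divide_simps power2_eq_square)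
     qed
     have "\<bar>b t\<bar>\<^sup>2 <= Q (\<beta> t) + \<eta>" using b2[of t] Q0[OF \<beta>r, of t] \<eta> by auto
     hence "(f (\<beta> t))\<^sup>2 * \<bar>a t\<bar>\<^sup>2 + ((1 - \<beta> t)\<^sup>2 / 4 + \<bar>b t\<bar>\<^sup>2) <= e t"
      using fa qQ[of "\<beta> t"] by (simp add: e_def algebra_simps)
     moreover have "t \<in> {- T..T}" using True by auto
     ultimately show ?thesis using bt elim e0
      by (simp add: ennreal_plus[symmetric] del: ennreal_plus) 
    next
     case False
     hence "\<beta> t = 1" "a t = 0" "b t = 0" using \<beta>1[of t] aT[of t] by (auto simp: b_def)
     thus ?thesis using elim by simp
    qed
   qed
  qed
  also have "\<dots> = ennreal (integral {- T..T} e)"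
  proof -
   have ei: "e absolutely_integrable_on {- T..T}"
    by (rule absolutely_integrable_continuous_real[OF continuous_on_subset[OF ec]]) auto
   hence "integrable lebesgue (%t. indicator {- T..T} t * e t)" by (simp add: set_integrable_def)
   hence "(\<integral>\<^sup>+t. ennreal (indicator {- T..T} t * e t) \<partial>lebesgue) = ennreal (\<integral>t. indicator {- T..T} t * e t \<partial>lebesgue)"
    using e0 by (intro nn_integral_eq_integral) auto
   thus ?thesis using set_lebesgue_integral_eq_integral(2)[OF ei] by (simp add: set_lebesgue_integral_def)
  qed
  finally show ?thesis .
 qed
 have ie: "integral {- T..T} e <= (l\<^sup>2 + 1) * (C / 2) * s\<eta> + 4 * integral {m..1} (%t. sqrt (Q t + \<eta>))"
 proof -
  have i0: "integral {- T..T} e = 2 * integral {0..T} e"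
   by (rule integral_even) (use \<beta>even T0 in \<open>auto intro!: absolutely_integrable_continuous_real continuous_on_subset[OF ec] simp: e_def\<close>)
  have "integral {0..T} e = integral {0..T} (%t. (%\<tau>. (l\<^sup>2 + 1) * q \<tau> + 2 * Q \<tau> + \<eta>) (Y t))"
   by (rule integral_cong) (simp add: \<beta>Y e_def)
  also have "\<dots> = integral {m..1} (%t. ((l\<^sup>2 + 1) * q t + 2 * Q t + \<eta>) / sqrt (Q t + \<eta>))"
   by (rule cov) (intro continuous_intros qc Qc)
  also have "\<dots> <= integral {m..1} (%t. (l\<^sup>2 + 1) * (C / 2) * (2 / C * q t / sqrt (Q t + \<eta>)) + 2 * sqrt (Q t + \<eta>))"
  proof (rule integral_le)
   have nz: "\<forall>t\<in>{m..1}. sqrt (Q t + \<eta>) ~= 0" using Q0 \<eta> by (force simp: add_nonneg_eq_0_iff)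
   show "(%t. ((l\<^sup>2 + 1) * q t + 2 * Q t + \<eta>) / sqrt (Q t + \<eta>)) integrable_on {m..1}"
    by (intro integrable_continuous_real continuous_intros qc Qc nz)
   show "(%t. (l\<^sup>2 + 1) * (C / 2) * (2 / C * q t / sqrt (Q t + \<eta>)) + 2 * sqrt (Q t + \<eta>)) integrable_on {m..1}"
    by (intro integrable_continuous_real continuous_intros qc Qc nz)
   fix t assume t: "t \<in> {m..1}"
   define w where "w = sqrt (Q t + \<eta>)"
   have w: "0 < w" "w\<^sup>2 = Q t + \<eta>" using Q0[OF t] \<eta> by (auto simp: w_def add_nonneg_pos)
   have "((l\<^sup>2 + 1) * q t + 2 * Q t + \<eta>) / w <= ((l\<^sup>2 + 1) * q t + 2 * w\<^sup>2) / w"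
    using w \<eta> by (intro divide_right_mono) auto
   also have "\<dots> = (l\<^sup>2 + 1) * (C / 2) * (2 / C * q t / w) + 2 * w"
    using w(1) C by (simp add: add_divide_distrib power2_eq_square)
   finally show "((l\<^sup>2 + 1) * q t + 2 * Q t + \<eta>) / sqrt (Q t + \<eta>) <= (l\<^sup>2 + 1) * (C / 2) * (2 / C * q t / sqrt (Q t + \<eta>)) + 2 * sqrt (Q t + \<eta>)"
    by (simp only: w_def)
  qed
  also have "\<dots> = (l\<^sup>2 + 1) * (C / 2) * (s\<eta> / 2) + 2 * integral {m..1} (%t. sqrt (Q t + \<eta>))"
  proof -
   have nz: "\<forall>t\<in>{m..1}. sqrt (Q t + \<eta>) ~= 0" using Q0 \<eta> by (force simp: add_nonneg_eq_0_iff)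
   have i: "(%t. 2 / C * q t / sqrt (Q t + \<eta>)) integrable_on {m..1}" "(%t. sqrt (Q t + \<eta>)) integrable_on {m..1}"
    by (intro integrable_continuous_real continuous_intros qc Qc nz)+
   hence "integral {m..1} (%t. (l\<^sup>2 + 1) * (C / 2) * (2 / C * q t / sqrt (Q t + \<eta>)) + 2 * sqrt (Q t + \<eta>))
    = integral {m..1} (%t. (l\<^sup>2 + 1) * (C / 2) * (2 / C * q t / sqrt (Q t + \<eta>))) + integral {m..1} (%t. 2 * sqrt (Q t + \<eta>))"
    by (intro Henstock_Kurzweil_Integration.integral_add integrable_on_mult_right)
   also have "\<dots> = (l\<^sup>2 + 1) * (C / 2) * (s\<eta> / 2) + 2 * integral {m..1} (%t. sqrt (Q t + \<eta>))"
    unfolding s\<eta>_def by (simp only: integral_mult_right mult_2 nonzero_mult_div_cancel_left) simp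
   finally show ?thesis .
  qed
  finally show ?thesis using i0 by simp
 qed
 have "(INF (\<alpha>, \<beta>)\<in>U_adm s. G_energy f \<alpha> \<beta>) <= G_energy f \<alpha> \<beta>"
  using INF_lower[OF adm, of "%(\<alpha>, \<beta>). G_energy f \<alpha> \<beta>"] by simp
 also have "\<dots> <= ennreal (integral {- T..T} e)" by (rule en)
 also have "\<dots> <= ennreal ((l\<^sup>2 + 1) * (C / 2) * s\<eta> + 4 * integral {m..1} (%t. sqrt (Q t + \<eta>)))"
  by (rule ennreal_leI[OF ie])
 finally show "(INF (\<alpha>, \<beta>)\<in>U_adm s. G_energy f \<alpha> \<beta>)
  <= ennreal (((s / s\<eta>)\<^sup>2 + 1) * (C / 2) * s\<eta> + 4 * integral {m..1} (%t. sqrt (Q t + \<eta>)))"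
  by (simp only: l_def)
qed

end

section \<open>The cohesive density\<close>

context degr
begin

text \<open>Dominated convergence as \<open>\<eta> \<rightarrow> 0\<close>; the integrand of the limit is the derivative of \<open>RR \<circ> th\<close>,
unbounded at the turning point \<open>m\<close> but integrable.\<close>

lemma s_eta_tendsto:
 assumes m: "m \<in> {0<..<1}" and \<eta>: "!!n. 0 < \<eta> n" "\<eta> ----> 0"
 defines "C \<equiv> k m"
 defines "q \<equiv> %t. (1 - t)\<^sup>2 / 4 * (C / k t)\<^sup>2" and "Q \<equiv> %t. (1 - t)\<^sup>2 / 4 * (1 - (C / k t)\<^sup>2)"
 shows "(%n. 2 * integral {m..1} (%t. 2 / C * q t / sqrt (Q t + \<eta> n))) ----> S C"
proof -
 have C: "0 < C" "C < \<sigma>" using k_pos[of m] k_less_\<sigma>[of m] m by (auto simp: C_def)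
 have Ck: "C <= k t" if "t \<in> {m..1}" for t using k_mono[of m t] that m by (auto simp: C_def)
 have Clt: "C < k t" if "t \<in> {m<..<1}" for t using k_strict_mono[of m t] that m by (auto simp: C_def)
 have kc: "continuous_on {m..1} k" by (rule continuous_on_subset[OF k_continuous]) (use m in auto)
 have r: "continuous_on {m..1} (%t. C / k t)" by (intro continuous_on_divide continuous_on_const kc) (use Ck C in force)
 have qc: "continuous_on {m..1} q" and Qc: "continuous_on {m..1} Q"
  unfolding q_def Q_def by (intro continuous_intros r; simp)+
 have Q0: "0 <= Q t" if "t \<in> {m..1}" for t
  using quot_k_bounds[OF C(1) Ck[OF that]] by (simp add: Q_def power_le_one)
 define D where "D t = C * (1 - t) / ((k t)\<^sup>2 * sqrt (1 - (C / k t)\<^sup>2))" for t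
 have thc: "continuous_on {m..1} (th C)" by (rule th_continuous) (use C m in \<open>auto simp: C_def\<close>)
 have RRc: "continuous_on {0..\<Theta> C} (RR C)"
  unfolding RR_def using gr_integrable[OF C, of 0 "\<Theta> C"] \<Theta>_bounds[OF C] by (intro indefinite_integral_continuous_1) auto
 have thr: "th C ` {m..1} \<subseteq> {0..\<Theta> C}"
 proof
  fix y assume "y \<in> th C ` {m..1}"
  then obtain t where t: "t \<in> {m..1}" "y = th C t" by auto
  thus "y \<in> {0..\<Theta> C}" using th_bounds[OF C(1) Ck, of t] th_less_\<Theta>[OF C(1) Ck, of t] m \<Theta>_bounds[OF C]
   by (cases "t = 1") (auto simp: th_1)
 qed
 have Di: "(D has_integral (RR C (th C 1) - RR C (th C m))) {m..1}"
 proof (rule fundamental_theorem_of_calculus_interior)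
  show "continuous_on {m..1} (%t. RR C (th C t))" by (rule continuous_on_compose2[OF RRc thc thr])
  fix t assume t: "t \<in> {m<..<1}"
  hence "((%t. RR C (th C t)) has_real_derivative D t) (at t)"
   unfolding D_def by (intro RR_th_deriv C Clt) (use m in auto)
  thus "((%t. RR C (th C t)) has_vector_derivative D t) (at t)"
   by (simp add: has_real_derivative_iff_has_vector_derivative)
 qed (use m in simp)
 have "th C m = 0" using C by (simp add: C_def)
 hence D2: "2 * integral {m..1} D = S C"
  by (simp add: integral_unique[OF Di] th_1 S_eq[OF C])
 have sqQ: "sqrt (Q t) = (1 - t) / 2 * sqrt (1 - (C / k t)\<^sup>2)" if "t \<in> {m..1}" for t
  using that by (simp add: Q_def real_sqrt_mult real_sqrt_divide)
 have Deq: "2 / C * q t / sqrt (Q t) = D t" and Qpos: "0 < Q t" if t: "t \<in> {m<..<1}" for t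
 proof -
  have kt: "0 < k t" "C < k t" using Clt[OF t] C by auto
  hence l1: "(C / k t)\<^sup>2 < 1" using C by (simp add: power_less_one_iff)
  hence s: "0 < sqrt (1 - (C / k t)\<^sup>2)" by simp
  show "0 < Q t" using l1 t by (simp add: Q_def)
  have "2 / C * q t / sqrt (Q t) = 2 / C * ((1 - t)\<^sup>2 / 4 * (C / k t)\<^sup>2) / ((1 - t) / 2 * sqrt (1 - (C / k t)\<^sup>2))"
   using t by (subst sqQ) (auto simp: q_def)
  also have "\<dots> = D t"
   using t C kt s unfolding D_def
   by (simp add: power_divide divide_simps power2_eq_square)
  finally show "2 / C * q t / sqrt (Q t) = D t" .
 qed
 define h where "h n t = (if t \<in> {m, 1} then 0 else 2 / C * q t / sqrt (Q t + \<eta> n))" for n t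
 define h0 where "h0 t = (if t \<in> {m, 1} then 0 else D t)" for t
 have "(%n. integral {m..1} (h n)) ----> integral {m..1} h0"
 proof (rule dominated_convergence(2)[where h = h0])
  fix n
  have nz: "\<forall>t\<in>{m..1}. sqrt (Q t + \<eta> n) ~= 0" using Q0 \<eta>(1)[of n] by (force simp: add_nonneg_eq_0_iff)
  have "(%t. 2 / C * q t / sqrt (Q t + \<eta> n)) integrable_on {m..1}"
   by (intro integrable_continuous_real continuous_intros qc Qc nz)
  thus "h n integrable_on {m..1}" by (rule integrable_spike[of _ _ "{m, 1}"]) (auto simp: h_def)
  fix t assume t: "t \<in> {m..1}"
  show "norm (h n t) <= h0 t"
  proof (cases "t \<in> {m, 1}")
   case False
   hence ti: "t \<in> {m<..<1}" using t by auto
   have qn: "0 <= q t" by (simp add: q_def)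
   have "2 / C * q t / sqrt (Q t + \<eta> n) <= 2 / C * q t / sqrt (Q t)"
    using Qpos[OF ti] \<eta>(1)[of n] C qn by (intro divide_left_mono) auto
   thus ?thesis using False Deq[OF ti] C qn Qpos[OF ti] \<eta>(1)[of n] by (simp add: h_def h0_def)
  qed (simp add: h_def h0_def)
 next
  show "h0 integrable_on {m..1}"
   by (rule integrable_spike[of D _ "{m, 1}"]) (use Di in \<open>auto simp: h0_def\<close>)
  fix t assume t: "t \<in> {m..1}"
  show "(%n. h n t) ----> h0 t"
  proof (cases "t \<in> {m, 1}")
   case False
   hence ti: "t \<in> {m<..<1}" using t by auto
   have "(%n. 2 / C * q t / sqrt (Q t + \<eta> n)) ----> 2 / C * q t / sqrt (Q t + 0)"
    using Qpos[OF ti] by (intro tendsto_intros \<eta>(2)) auto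
   thus ?thesis using False Deq[OF ti] by (simp add: h_def h0_def)
  qed (simp add: h_def h0_def)
 qed
 moreover have "integral {m..1} (h n) = integral {m..1} (%t. 2 / C * q t / sqrt (Q t + \<eta> n))" for n
  by (rule integral_spike[of "{m, 1}"]) (auto simp: h_def)
 moreover have "integral {m..1} h0 = integral {m..1} D"
  by (rule integral_spike[of "{m, 1}"]) (auto simp: h0_def)
 ultimately have "(%n. 2 * integral {m..1} (%t. 2 / C * q t / sqrt (Q t + \<eta> n))) ----> 2 * integral {m..1} D"
  by (intro tendsto_mult tendsto_const) simp
 thus ?thesis by (simp only: D2)
qed

lemma G_upper_bound:
 assumes C: "0 < C" "C < \<sigma>" and s: "0 < s"
 shows "(INF (\<alpha>, \<beta>)\<in>U_adm s. G_energy f \<alpha> \<beta>) <= ennreal (((s / S C)\<^sup>2 + 1) * (C / 2) * S C + KK C)"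
proof -
 define m where "m = \<kappa> C"
 have m: "m \<in> {0<..<1}" using \<kappa>_inner[OF C] by (simp add: m_def)
 have km: "k m = C" using k_\<kappa>[of C] C by (simp add: m_def)
 define \<eta> where "\<eta> n = 1 / real (Suc n)" for n
 have \<eta>: "0 < \<eta> n" for n by (simp add: \<eta>_def)
 have \<eta>l: "\<eta> ----> 0" using LIMSEQ_inverse_real_of_nat by (simp add: \<eta>_def[abs_def] inverse_eq_divide)
 define q where "q t = (1 - t)\<^sup>2 / 4 * (C / k t)\<^sup>2" for t
 define Q where "Q t = (1 - t)\<^sup>2 / 4 * (1 - (C / k t)\<^sup>2)" for t
 define sn where "sn n = 2 * integral {m..1} (%t. 2 / C * q t / sqrt (Q t + \<eta> n))" for n
 have snl: "sn ----> S C"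
  using s_eta_tendsto[OF m \<eta> \<eta>l] by (simp add: sn_def[abs_def] q_def Q_def km)
 have Ck: "C <= k t" if "t \<in> {m..1}" for t using k_mono[of m t] that m km by auto
 have Q0: "0 <= Q t" if "t \<in> {m..1}" for t
  using quot_k_bounds[OF C(1) Ck[OF that]] by (simp add: Q_def power_le_one)
 have kc: "continuous_on {m..1} k" by (rule continuous_on_subset[OF k_continuous]) (use m in auto)
 have r: "continuous_on {m..1} (%t. C / k t)" by (intro continuous_on_divide continuous_on_const kc) (use Ck C in force)
 have Qc: "continuous_on {m..1} Q" unfolding Q_def by (intro continuous_intros r; simp)
 have KKi: "((%t. 4 * sqrt (Q t)) has_integral KK C) {m..1}"
 proof -
  have "((%t. 2 * (1 - t) * sqrt (1 - (C / k t)\<^sup>2)) has_integral KK C) {m..1}"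
   using KK_integral[OF m] by (simp add: km)
  thus ?thesis
   by (rule has_integral_eq[rotated]) (simp add: Q_def real_sqrt_mult real_sqrt_divide)
 qed
 have Qb: "4 * integral {m..1} (%t. sqrt (Q t + \<eta> n)) <= KK C + 4 * sqrt (\<eta> n)" for n
 proof -
  have "integral {m..1} (%t. sqrt (Q t + \<eta> n)) <= integral {m..1} (%t. sqrt (Q t) + sqrt (\<eta> n))"
   by (intro integral_le integrable_continuous_real continuous_intros Qc sqrt_add_le_add_sqrt) (use Q0 \<eta>[of n] in auto)
  also have "\<dots> = integral {m..1} (%t. sqrt (Q t)) + sqrt (\<eta> n) * (1 - m)"
   using m by (subst Henstock_Kurzweil_Integration.integral_add) (auto intro!: integrable_continuous_real continuous_intros Qc)
  also have "sqrt (\<eta> n) * (1 - m) <= sqrt (\<eta> n) * 1" using m \<eta>[of n] by (intro mult_left_mono) auto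
  finally have "4 * integral {m..1} (%t. sqrt (Q t + \<eta> n)) <= 4 * integral {m..1} (%t. sqrt (Q t)) + 4 * sqrt (\<eta> n)" by simp
  moreover have "4 * integral {m..1} (%t. sqrt (Q t)) = KK C" using integral_unique[OF KKi] by simp
  ultimately show ?thesis by simp
 qed
 have bound: "(INF (\<alpha>, \<beta>)\<in>U_adm s. G_energy f \<alpha> \<beta>) <= ennreal (((s / sn n)\<^sup>2 + 1) * (C / 2) * sn n + KK C + 4 * sqrt (\<eta> n))" for n
 proof -
  have "(INF (\<alpha>, \<beta>)\<in>U_adm s. G_energy f \<alpha> \<beta>)
   <= ennreal (((s / sn n)\<^sup>2 + 1) * (C / 2) * sn n + 4 * integral {m..1} (%t. sqrt (Q t + \<eta> n)))"
   using competitor(2)[OF m \<eta>[of n] s] by (simp add: sn_def q_def Q_def km)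
  also have "\<dots> <= ennreal (((s / sn n)\<^sup>2 + 1) * (C / 2) * sn n + KK C + 4 * sqrt (\<eta> n))"
   using Qb[of n] by (intro ennreal_leI) simp
  finally show ?thesis .
 qed
 have S0: "S C ~= 0" using S_pos[OF C] by simp
 have "(%n. ((s / sn n)\<^sup>2 + 1) * (C / 2) * sn n + KK C + 4 * sqrt (\<eta> n)) ----> ((s / S C)\<^sup>2 + 1) * (C / 2) * S C + KK C + 4 * sqrt 0"
  by (intro tendsto_intros snl \<eta>l S0)
 from tendsto_ennrealI[OF this]
 have "(%n. ennreal (((s / sn n)\<^sup>2 + 1) * (C / 2) * sn n + KK C + 4 * sqrt (\<eta> n))) ----> ennreal (((s / S C)\<^sup>2 + 1) * (C / 2) * S C + KK C)"
  by simp
 thus ?thesis by (rule LIMSEQ_le_const) (use bound in auto)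
qed

lemma KK_nonneg: "0 < C ==> C < \<sigma> ==> 0 <= KK C"
proof -
 assume C: "0 < C" "C < \<sigma>"
 have "0 <= integral {0..\<Theta> C} (%\<theta>. cos \<theta> * zs C \<theta>)"
  using \<Theta>_bounds[OF C] zs_bounds[of _ C] C cos_zs_abs_integrable[OF C(1), of 0 "\<Theta> C"]
  by (intro Henstock_Kurzweil_Integration.integral_nonneg) (auto simp: absolutely_integrable_on_def intro!: mult_nonneg_nonneg cos_ge_zero)
 thus ?thesis by (simp add: KK_eq[OF C])
qed

lemma g_upper:
 assumes C: "0 < C" "C < \<sigma>" and s: "0 < s"
 shows "g_coh f s <= ((s / S C)\<^sup>2 + 1) * (C / 2) * S C + KK C"
 unfolding g_coh_def
 by (rule enn2real_leI[OF _ G_upper_bound[OF C s]]) (use C S_pos[OF C] KK_nonneg[OF C] in simp)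

lemma g_lower:
 assumes C: "0 < C" "C < \<sigma>" and s: "S C <= s"
 shows "C * S C + KK C <= g_coh f s"
proof -
 define I where "I = (INF (\<alpha>, \<beta>)\<in>U_adm s. G_energy f \<alpha> \<beta>)"
 have "0 < s" using S_pos[OF C] s by simp
 hence fin: "I < top" using G_upper_bound[OF C, of s] by (simp add: I_def order_le_less_trans)
 have "ennreal (C * S C + KK C) <= I"
  unfolding I_def by (rule INF_greatest) (use G_lower_bound[OF C _ s] in auto)
 hence "enn2real (ennreal (C * S C + KK C)) <= enn2real I" using fin by (rule enn2real_mono)
 thus ?thesis using C S_pos[OF C] KK_nonneg[OF C] by (simp add: g_coh_def I_def del: ennreal_plus)
qed

lemma g_eq: "0 < C ==> C < \<sigma> ==> g_coh f (S C) = C * S C + KK C"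
 using g_lower[of C "S C"] g_upper[of C "S C"] S_pos[of C] by simp

lemma S_continuous_on: "0 < C1 ==> C2 < \<sigma> ==> continuous_on {C1..C2} S"
 unfolding continuous_on_sequentially comp_def using S_seq_continuous by auto

text \<open>An envelope argument. Put \<open>s0 = S(C)\<close>. The competitor bound \<open>g_upper\<close>, used with the fixed
constant \<open>C\<close>, is a parabola in \<open>s\<close> that touches \<open>g\<close> at \<open>s0\<close> with slope \<open>C\<close>. Exchanging the roles
of \<open>s0\<close> and a nearby \<open>s = S(c)\<close>, with \<open>c\<close> close to \<open>C\<close>, gives the opposite inequality.\<close>

theorem g_derivative:
 assumes C: "0 < C" "C < \<sigma>"
 shows "(g_coh f has_real_derivative C) (at (S C))"
proof -
 define s0 where "s0 = S C"
 have s0: "0 < s0" using S_pos[OF C] by (simp add: s0_def)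
 have "\<exists>d>0. \<forall>s. \<bar>s - s0\<bar> < d --> \<bar>g_coh f s - g_coh f s0 - C * (s - s0)\<bar> <= e * \<bar>s - s0\<bar>" if e: "e > 0" for e
 proof -
  define \<delta> where "\<delta> = min (e / 2) (min C (\<sigma> - C) / 2)"
  have \<delta>: "0 < \<delta>" "\<delta> <= e / 2" "\<delta> < C" "\<delta> < \<sigma> - C" using e C by (auto simp: \<delta>_def min_def)
  have lt: "S (C + \<delta>) < s0" "s0 < S (C - \<delta>)"
   unfolding s0_def using \<delta> C by (auto intro!: S_strict_antimono)
  define d where "d = min (min (s0 - S (C + \<delta>)) (S (C - \<delta>) - s0)) (min (s0 / 2) (min (e * s0 / (2 * \<sigma>)) (2 * s0 * e / C)) / 2)"
  have d: "0 < d" using lt s0 e C \<sigma>_pos by (auto simp: d_def)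
  define w where "w = min (s0 / 2) (min (e * s0 / (2 * \<sigma>)) (2 * s0 * e / C))"
  have w: "0 < w" "w <= s0 / 2" "w <= e * s0 / (2 * \<sigma>)" "w <= 2 * s0 * e / C" using s0 e C \<sigma>_pos by (auto simp: w_def)
  have "d <= w / 2" unfolding d_def w_def by (rule min.cobounded2)
  hence db: "d <= s0 - S (C + \<delta>)" "d <= S (C - \<delta>) - s0" "d < s0 / 2" "d < e * s0 / (2 * \<sigma>)" "d < 2 * s0 * e / C"
  proof -
   have "d <= min (s0 - S (C + \<delta>)) (S (C - \<delta>) - s0)" unfolding d_def by (rule min.cobounded1)
   thus "d <= s0 - S (C + \<delta>)" "d <= S (C - \<delta>) - s0" by simp_all
   show "d < s0 / 2" "d < e * s0 / (2 * \<sigma>)" "d < 2 * s0 * e / C" using w \<open>d <= w / 2\<close> by linarith+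
  qed
  show ?thesis
  proof (intro exI[of _ d] conjI allI impI d)
   fix s assume sd: "\<bar>s - s0\<bar> < d"
   hence sp: "s0 / 2 < s" using db(3) by linarith
   have s0s: "0 < s" using sp s0 by linarith
   have "g_coh f s <= ((s / s0)\<^sup>2 + 1) * (C / 2) * s0 + KK C" using g_upper[OF C s0s] by (simp add: s0_def)
   also have "\<dots> = g_coh f s0 + C * (s - s0) + C * (s - s0)\<^sup>2 / (2 * s0)"
    using s0 g_eq[OF C] by (simp add: s0_def[symmetric] power_divide field_simps power2_eq_square)
   finally have up: "g_coh f s - g_coh f s0 - C * (s - s0) <= C * (s - s0)\<^sup>2 / (2 * s0)" by simp
   have "C * (s - s0)\<^sup>2 / (2 * s0) = (C * \<bar>s - s0\<bar> / (2 * s0)) * \<bar>s - s0\<bar>"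
    by (simp add: power2_eq_square)
   also have "\<dots> <= e * \<bar>s - s0\<bar>"
   proof (rule mult_right_mono)
    have "\<bar>s - s0\<bar> <= 2 * s0 * e / C" using sd db(5) by linarith
    thus "C * \<bar>s - s0\<bar> / (2 * s0) <= e" using C s0 by (simp add: field_simps)
   qed simp
   finally have up': "g_coh f s - g_coh f s0 - C * (s - s0) <= e * \<bar>s - s0\<bar>" using up by linarith
   have "\<exists>c\<ge>C - \<delta>. c <= C + \<delta> & S c = s"
    by (rule IVT2') (use sd db(1,2) \<delta> in \<open>auto intro!: S_continuous_on\<close>)
   then obtain c where c: "C - \<delta> <= c" "c <= C + \<delta>" "S c = s" by blast
   have c0: "0 < c" "c < \<sigma>" using c \<delta> by auto
   have "g_coh f s0 <= ((s0 / s)\<^sup>2 + 1) * (c / 2) * s + KK c" using g_upper[OF c0 s0] c(3) by simp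
   also have "\<dots> = g_coh f s - c * (s - s0) + c * (s - s0)\<^sup>2 / (2 * s)"
    using s0s g_eq[OF c0] c(3) by (simp add: power_divide field_simps power2_eq_square)
   finally have lo: "c * (s - s0) - c * (s - s0)\<^sup>2 / (2 * s) <= g_coh f s - g_coh f s0" by simp
   have "c * (s - s0)\<^sup>2 / (2 * s) <= \<sigma> * (s - s0)\<^sup>2 / s0"
   proof -
    have "c * (s - s0)\<^sup>2 / (2 * s) <= \<sigma> * (s - s0)\<^sup>2 / (2 * s)"
     using c0 s0s by (intro divide_right_mono mult_right_mono) auto
    also have "\<dots> <= \<sigma> * (s - s0)\<^sup>2 / s0" using sp s0 s0s \<sigma>_pos by (intro divide_left_mono) auto
    finally show ?thesis .
   qed
   also have "\<sigma> * (s - s0)\<^sup>2 / s0 = (\<sigma> * \<bar>s - s0\<bar> / s0) * \<bar>s - s0\<bar>" by (simp add: power2_eq_square)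
   also have "\<dots> <= (e / 2) * \<bar>s - s0\<bar>"
   proof (rule mult_right_mono)
    have "\<bar>s - s0\<bar> <= e * s0 / (2 * \<sigma>)" using sd db(4) by linarith
    thus "\<sigma> * \<bar>s - s0\<bar> / s0 <= e / 2" using \<sigma>_pos s0 by (simp add: field_simps)
   qed simp
   finally have 1: "c * (s - s0)\<^sup>2 / (2 * s) <= (e / 2) * \<bar>s - s0\<bar>" .
   have "\<bar>(c - C) * (s - s0)\<bar> <= (e / 2) * \<bar>s - s0\<bar>"
    unfolding abs_mult
   proof (rule mult_right_mono)
    have "\<bar>c - C\<bar> <= \<delta>" using c by (simp add: abs_le_iff)
    thus "\<bar>c - C\<bar> <= e / 2" using \<delta> by linarith
   qed simp
   hence "- ((e / 2) * \<bar>s - s0\<bar>) <= (c - C) * (s - s0)" by linarith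
   hence "C * (s - s0) - (e / 2) * \<bar>s - s0\<bar> <= c * (s - s0)" by (simp add: algebra_simps)
   hence "- (e * \<bar>s - s0\<bar>) <= g_coh f s - g_coh f s0 - C * (s - s0)"
    using lo 1 by (simp add: field_simps)
   thus "\<bar>g_coh f s - g_coh f s0 - C * (s - s0)\<bar> <= e * \<bar>s - s0\<bar>" using up' by (simp add: abs_le_iff)
  qed
 qed
 hence "(g_coh f has_derivative (%h. C * h)) (at s0)"
  unfolding has_derivative_at_alt by (auto simp: bounded_linear_mult_right)
 thus ?thesis by (simp add: has_field_derivative_def s0_def)
qed

lemma g_less_one: "0 < C ==> C < \<sigma> ==> g_coh f (S C) < 1"
 using g_eq energy_less_one by simp

text \<open>For an opening beyond all \<open>S C\<close> every calibration is available, and \<open>KK(C) \<rightarrow> 1\<close> as \<open>C \<rightarrow> 0\<close>.\<close>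

lemma g_ge_one:
 assumes "!!C. 0 < C ==> C < \<sigma> ==> S C <= s"
 shows "1 <= g_coh f s"
proof -
 define Cn where "Cn n = \<sigma> / real (n + 2)" for n
 have C: "0 < Cn n" "Cn n < \<sigma>" for n using \<sigma>_pos by (simp_all add: Cn_def pos_divide_less_eq)
 have "Cn ----> 0" unfolding Cn_def
  by (rule LIMSEQ_ignore_initial_segment[of "%n. \<sigma> / real n"]) (rule lim_const_over_n)
 hence "(%n. KK (Cn n)) ----> 1" by (rule KK_tendsto_1) (rule C)
 moreover have "KK (Cn n) <= g_coh f s" for n
  using g_lower[OF C assms[OF C], of n] mult_pos_pos[OF C(1)[of n] S_pos[OF C, of n]] by linarith
 ultimately show ?thesis by (intro LIMSEQ_le_const2) auto
qed

lemma S_less_s_frac: "0 < C ==> C < \<sigma> ==> ereal (S C) < s_frac f"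
proof -
 assume C: "0 < C" "C < \<sigma>"
 have "S C < S (C / 2)" by (rule S_strict_antimono) (use C in auto)
 hence "ereal (S C) < ereal (S (C / 2))" by simp
 also have "\<dots> <= s_frac f"
  unfolding s_frac_def by (rule SUP_upper) (use g_less_one[of "C / 2"] S_pos[of "C / 2"] C in auto)
 finally show ?thesis .
qed

text \<open>When the openings are bounded, their supremum \<open>a\<close> is the threshold beyond which \<open>g\<close> is at least
one; at \<open>a\<close> itself the competitors with \<open>C \<rightarrow> 0\<close> have energy tending to \<open>1\<close>.\<close>

lemma fracture_case:
 assumes Cn: "!!n. 0 < Cn n" "!!n. Cn n < \<sigma>" "Cn ----> 0" and lim: "(%n. S (Cn n)) ----> a"
  and le: "!!C. 0 < C ==> C < \<sigma> ==> S C <= a"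
 shows "s_frac f = ereal a" "g_coh f a = 1"
proof -
 have a0: "0 < a" using le[of "\<sigma> / 2"] S_pos[of "\<sigma> / 2"] \<sigma>_pos by auto
 show "s_frac f = ereal a"
 proof (rule antisym)
  show "s_frac f <= ereal a" unfolding s_frac_def
  proof (rule SUP_least)
   fix s assume "s \<in> {s. 0 <= s & g_coh f s < 1}"
   hence s: "g_coh f s < 1" by simp
   have "s <= a"
   proof (rule ccontr)
    assume "\<not> s <= a"
    hence "1 <= g_coh f s" using le by (intro g_ge_one) (meson linear order_trans)
    thus False using s by simp
   qed
   thus "ereal s <= ereal a" by simp
  qed
  have "(%n. ereal (S (Cn n))) ----> ereal a" using lim by simp
  moreover have "\<exists>N. \<forall>n\<ge>N. ereal (S (Cn n)) <= s_frac f" using S_less_s_frac[OF Cn(1,2)] by (intro exI[of _ 0]) (simp add: less_imp_le)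
  ultimately show "ereal a <= s_frac f" by (rule LIMSEQ_le_const2)
 qed
 have "(%n. ((a / S (Cn n))\<^sup>2 + 1) * (Cn n / 2) * S (Cn n) + KK (Cn n)) ----> ((a / a)\<^sup>2 + 1) * (0 / 2) * a + 1"
  by (intro tendsto_intros lim Cn(3) KK_tendsto_1 Cn(1)) (use a0 in auto)
 hence "g_coh f a <= ((a / a)\<^sup>2 + 1) * (0 / 2) * a + 1"
  by (rule LIMSEQ_le_const) (use g_upper[OF Cn(1,2) a0] in auto)
 thus "g_coh f a = 1" using g_ge_one[OF le] by simp
qed

end

section \<open>Critical points are classical solutions\<close>

lemma ac_on_closed_interval:
 assumes L: "0 < L" and c: "continuous_on {0..L} h" and w: "w absolutely_integrable_on {0..L}"
  and ac: "!!p q. p <= q ==> {p..q} \<subseteq> {0<..<L} ==> ac_on p q h w"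
 shows "ac_on 0 L h w"
proof -
 define I where "I x = integral {0..x} w" for x
 have wi: "w integrable_on {0..L}" using w by (simp add: absolutely_integrable_on_def)
 have Ic: "continuous_on {0..L} I" unfolding I_def by (rule indefinite_integral_continuous_1[OF wi])
 have acI: "ac_on 0 L I w" unfolding ac_on_def using w by (simp add: I_def)
 have const: "h x - I x = h (L / 2) - I (L / 2)" if "x \<in> {0<..<L}" for x
 proof -
  define p where "p = min x (L / 2)"
  define q where "q = max x (L / 2)"
  have pq: "p <= q" "0 < p" "q < L" using that L by (auto simp: p_def q_def)
  have "h q - h p = integral {p..q} w"
   by (rule ac_on_increment[OF ac[OF pq(1)]]) (use pq in auto)
  moreover have "I q - I p = integral {p..q} w"
   by (rule ac_on_increment[OF acI]) (use pq in auto)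
  ultimately have "h q - I q = h p - I p" by simp
  thus ?thesis unfolding p_def q_def by (cases "x <= L / 2") auto
 qed
 have cl: "h x - I x = h (L / 2) - I (L / 2)" if "x \<in> {0..L}" for x
 proof (rule continuous_constant_on_closure[where S = "{0<..<L}" and f = "%x. h x - I x"])
  show "continuous_on (closure {0<..<L}) (%x. h x - I x)" using L by (simp add: continuous_on_diff c Ic)
  show "x \<in> closure {0<..<L}" using that L by simp
 qed (rule const)
 have "h x = h 0 + integral {0..x} w" if "x \<in> {0..L}" for x
  using cl[OF that] cl[of 0] L by (simp add: I_def)
 thus ?thesis unfolding ac_on_def using w by blast
qed

lemma ac_on_continuous_deriv:
 assumes "ac_on a b h w" "continuous_on {a..b} w" "x \<in> {a..b}"
 shows "(h has_real_derivative w x) (at x within {a..b})"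
proof -
 have "((%y. h a + integral {a..y} w) has_real_derivative 0 + w x) (at x within {a..b})"
  by (intro DERIV_add DERIV_const integral_has_real_derivative assms)
 hence d: "((%y. h a + integral {a..y} w) has_real_derivative w x) (at x within {a..b})" by simp
 show ?thesis
  by (rule has_field_derivative_transform_within[OF d zero_less_one assms(3)])
   (use ac_onD[OF assms(1), symmetric] in auto)
qed

lemma at_within_Icc_interior: "x \<in> {a<..<b} ==> at x within {a..b::real} = at x"
 by (rule at_within_interior) simp

lemma L2_abs_integrable:
 assumes L: "0 < L" and p: "L2 {0<..<L} p"
 shows "p absolutely_integrable_on {0..L}" "(%x. (p x)\<^sup>2) absolutely_integrable_on {0..L}"
proof -
 have m: "p \<in> borel_measurable (lebesgue_on {0<..<L})" and i: "integrable (lebesgue_on {0<..<L}) (%x. (p x)\<^sup>2)"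
  using p by (auto simp: L2_def)
 have a2: "(%x. (p x)\<^sup>2) absolutely_integrable_on {0<..<L}" using i by (simp add: integrable_lebesgue_on_iff)
 thus "(%x. (p x)\<^sup>2) absolutely_integrable_on {0..L}" by (simp add: absolutely_integrable_on_Icc_iff_Ioo)
 have "p absolutely_integrable_on {0<..<L}"
 proof (rule measurable_bounded_by_integrable_imp_absolutely_integrable[OF m])
  show "(%x. 1 + (p x)\<^sup>2) integrable_on {0<..<L}"
   using a2 by (intro integrable_add integrable_on_const) (auto simp: absolutely_integrable_on_def)
  show "norm (p x) <= 1 + (p x)\<^sup>2" if "x \<in> {0<..<L}" for x
  proof -
   have "0 <= (\<bar>p x\<bar> - 1)\<^sup>2" by simp
   hence "2 * \<bar>p x\<bar> <= 1 + (p x)\<^sup>2" by (simp add: power2_diff)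
   thus ?thesis by simp
  qed
 qed simp
 thus "p absolutely_integrable_on {0..L}" by (simp add: absolutely_integrable_on_Icc_iff_Ioo)
qed

lemma H1_wderiv:
 assumes L: "0 < L" and h: "H1 {0<..<L} h" "continuous_on {0..L} h"
 shows "L2 {0<..<L} (wderiv {0<..<L} h)" "ac_on 0 L h (wderiv {0<..<L} h)"
proof -
 have S: "open {0<..<L}" "convex {0<..<L}" "{0<..<L} ~= {}" using L by auto
 obtain w where w: "L2 {0<..<L} w" "weak_deriv {0<..<L} h w" using h(1) by (auto simp: H1_def)
 define p where "p = wderiv {0<..<L} h"
 have wp: "weak_deriv {0<..<L} h p" unfolding p_def by (rule wderiv_weak_deriv[OF w(2)])
 have ae: "AE x in lebesgue_on {0<..<L}. p x = w x"
  using wderiv_ae[OF S w(2)] by (simp add: AE_lebesgue_on_iff_negligible p_def)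
 have m: "p \<in> borel_measurable (lebesgue_on {0<..<L})" using wp by (simp add: weak_deriv_def L1_loc_def)
 have "integrable (lebesgue_on {0<..<L}) (%x. (p x)\<^sup>2) \<longleftrightarrow> integrable (lebesgue_on {0<..<L}) (%x. (w x)\<^sup>2)"
  using m w(1) ae by (intro Bochner_Integration.integrable_cong_AE) (auto simp: L2_def)
 thus L2: "L2 {0<..<L} p" using w(1) m by (simp add: L2_def)
 show "ac_on 0 L h p"
 proof (rule ac_on_closed_interval[OF L h(2) L2_abs_integrable(1)[OF L L2]])
  fix x y assume "x <= y" "{x..y} \<subseteq> {0<..<L}"
  thus "ac_on x y h p"
   by (intro weak_deriv_continuous_imp_ac[OF S(1,2) wp continuous_on_subset[OF h(2)]]) auto
 qed
qed

text \<open>The primitive of \<open>K/(x - x0)\<^sup>2\<close> blows up at \<open>x0\<close>.\<close>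

lemma inverse_square_not_integrable:
 fixes p :: "real => real"
 assumes p: "p absolutely_integrable_on {a..b}" and x0: "a <= x0" "x0 < b" and K: "0 < K"
  and N: "negligible N" and lb: "!!x. x0 < x ==> x <= b ==> x \<notin> N ==> K / (x - x0)\<^sup>2 <= \<bar>p x\<bar>"
 shows False
proof -
 have api: "(%x. \<bar>p x\<bar>) integrable_on {a..b}" using p by (simp add: absolutely_integrable_on_def)
 define B where "B = integral {a..b} (%x. \<bar>p x\<bar>)"
 have B0: "0 <= B" unfolding B_def by (rule Henstock_Kurzweil_Integration.integral_nonneg[OF api]) simp
 define h where "h = 1 / (1 / (b - x0) + B / K + 1)"
 have den: "0 < 1 / (b - x0) + B / K + 1" using x0 B0 K by (auto intro!: add_nonneg_pos)
 have h: "0 < h" "1 / h = 1 / (b - x0) + B / K + 1" using den by (auto simp: h_def)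
 have hb: "x0 + h < b"
 proof -
  have "0 < B / K + 1" using B0 K by (intro add_nonneg_pos) auto
  hence "1 / (b - x0) < 1 / h" using h(2) by linarith
  hence "inverse (b - x0) < inverse h" by (simp add: inverse_eq_divide)
  hence "h < b - x0" using h(1) x0 by (simp add: inverse_less_iff_less)
  thus ?thesis by linarith
 qed
 have i: "((%x. K / (x - x0)\<^sup>2) has_integral (- K / (b - x0) - (- K / (x0 + h - x0)))) {x0 + h..b}"
 proof (rule fundamental_theorem_of_calculus)
  show "x0 + h <= b" using hb by simp
  fix x assume x: "x \<in> {x0 + h..b}"
  hence "x - x0 ~= 0" using h by auto
  hence "((%x. - K / (x - x0)) has_real_derivative K / (x - x0)\<^sup>2) (at x within {x0 + h..b})"
   by (auto intro!: derivative_eq_intros simp: power2_eq_square)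
  thus "((%x. - K / (x - x0)) has_vector_derivative K / (x - x0)\<^sup>2) (at x within {x0 + h..b})"
   by (simp add: has_real_derivative_iff_has_vector_derivative)
 qed
 have pi: "(%x. \<bar>p x\<bar>) integrable_on {x0 + h..b}"
  by (rule integrable_subinterval_real[OF api]) (use x0 h in auto)
 define p' where "p' x = (if x \<in> N then K / (x - x0)\<^sup>2 else \<bar>p x\<bar>)" for x
 have "integral {x0 + h..b} (%x. K / (x - x0)\<^sup>2) <= integral {x0 + h..b} p'"
 proof (rule integral_le)
  show "p' integrable_on {x0 + h..b}" by (rule integrable_spike[OF pi N]) (simp add: p'_def)
 qed (use i lb h in \<open>auto simp: p'_def\<close>)
 also have "\<dots> = integral {x0 + h..b} (%x. \<bar>p x\<bar>)" by (rule integral_spike[OF N, symmetric]) (simp add: p'_def)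
 also have "\<dots> <= B" unfolding B_def
  by (rule integral_subset_le[OF _ pi api]) (use x0 h in auto)
 also have "integral {x0 + h..b} (%x. K / (x - x0)\<^sup>2) = K * (1 / h - 1 / (b - x0))"
  using integral_unique[OF i] by (simp add: algebra_simps)
 also have "\<dots> = B + K" using h K by (simp add: algebra_simps)
 finally show False using K by simp
qed

text \<open>The properties of a truncated degradation function that the qualitative study of critical points
uses. The last one is the monotonicity of \<open>fe'/(fe\<^sup>3(1 - t))\<close>, responsible for the shape of the
potential.\<close>

locale profile =
 fixes fe fe1 :: "real => real"
 assumes fe_0: "fe 0 = 0" and fe_1: "fe 1 = 1"
  and fe_range: "!!t. 0 < t ==> t <= 1 ==> 0 < fe t & fe t <= 1"
  and fe_deriv: "!!t. t \<in> {0..1} ==> (fe has_real_derivative fe1 t) (at t)"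
  and fe1_continuous: "continuous_on {0..1} fe1"
  and fe_q: "!!s t. 0 < s ==> s <= t ==> t < 1 ==> fe1 t / (fe t ^ 3 * (1 - t)) <= fe1 s / (fe s ^ 3 * (1 - s))"

locale crit = profile +
 fixes \<epsilon> L a :: real and u v :: "real => real"
 assumes \<epsilon>: "0 < \<epsilon>" and L: "0 < L" and a: "0 < a"
  and cp: "critical_point L fe \<epsilon> a u v" and v01: "!!x. x \<in> {0..L} ==> v x \<in> {0..1}"
begin

lemma boundary: "u 0 = 0" "u L = a" "v 0 = 1" "v L = 1"
 and u_cont: "continuous_on {0..L} u" and v_cont: "continuous_on {0..L} v"
 using cp by (auto simp: critical_point_def)

lemma fe_continuous: "continuous_on {0..1} fe"
 by (rule DERIV_continuous_on, rule has_field_derivative_at_within, erule fe_deriv)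

definition "p = wderiv {0<..<L} u"
definition "b = wderiv {0<..<L} v"

lemma ac_u: "ac_on 0 L u p" and ac_v: "ac_on 0 L v b" and p_L2: "L2 {0<..<L} p" and b_L2: "L2 {0<..<L} b"
 using H1_wderiv[OF L, of u] H1_wderiv[OF L, of v] cp by (auto simp: critical_point_def p_def b_def)

lemma fev_cont: "continuous_on {0..L} (%x. fe (v x))" "continuous_on {0..L} (%x. fe1 (v x))"
 by (rule continuous_on_compose2[OF fe_continuous v_cont], use v01 in auto)
   (rule continuous_on_compose2[OF fe1_continuous v_cont], use v01 in auto)

lemma flux_constant:
 obtains c where "negligible {x \<in> {0<..<L}. (fe (v x))\<^sup>2 * p x ~= c}"
proof -
 have "!!pp q. {pp..q} \<subseteq> {0<..<L} ==> (%x. (fe (v x))\<^sup>2 * p x) absolutely_integrable_on {pp..q}"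
 proof -
  fix pp q assume s: "{pp..q} \<subseteq> {0<..<L}"
  have "(%x. (fe (v x))\<^sup>2 * p x) absolutely_integrable_on {0..L}"
   by (rule abs_integrable_mult_continuous[OF _ ac_on_abs_integrable[OF ac_u]]) (intro continuous_intros fev_cont)
  thus "(%x. (fe (v x))\<^sup>2 * p x) absolutely_integrable_on {pp..q}"
  proof (cases "pp <= q")
   case True
   hence "pp \<in> {0<..<L}" "q \<in> {0<..<L}" using s by auto
   thus ?thesis using abs_integrable_sub[OF \<open>_ absolutely_integrable_on {0..L}\<close>, of pp q] by simp
  qed simp
 qed
 note i = this
 have z: "(\<integral>x. (fe (v x))\<^sup>2 * p x * deriv \<eta> x \<partial>lebesgue_on {0<..<L}) = 0" if "test_fun {0<..<L} \<eta>" for \<eta>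
  using cp that by (simp add: critical_point_def p_def)
 have S: "open {0<..<L}" "convex {0<..<L}" "{0<..<L} ~= {}" using L by auto
 obtain c where "negligible {x \<in> {0<..<L}. (fe (v x))\<^sup>2 * p x ~= c}"
  by (rule du_Bois_Reymond[OF S i z])
 thus ?thesis by (rule that)
qed

definition "G x = fe (v x) * fe1 (v x) * (p x)\<^sup>2 + (v x - 1) / (4 * \<epsilon>)"

lemma G_abs_integrable: "G absolutely_integrable_on {0..L}"
proof -
 have "(%x. fe (v x) * fe1 (v x) * (p x)\<^sup>2) absolutely_integrable_on {0..L}"
  by (rule abs_integrable_mult_continuous[OF _ L2_abs_integrable(2)[OF L p_L2]]) (intro continuous_intros fev_cont)
 moreover have "(%x. (v x - 1) / (4 * \<epsilon>)) absolutely_integrable_on {0..L}"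
  by (intro absolutely_integrable_continuous_real continuous_intros v_cont) (use \<epsilon> in auto)
 ultimately show ?thesis unfolding G_def[abs_def] by (rule set_integral_add(1))
qed

text \<open>The equation says that \<open>\<epsilon> v'\<close> has weak derivative \<open>G\<close>, so \<open>v'\<close> has an absolutely continuous
representative.\<close>

lemma v_C1:
 obtains w where "continuous_on {0..L} w" "ac_on 0 L w (%x. G x / \<epsilon>)"
  "negligible {x \<in> {0<..<L}. b x ~= w x}"
  "!!x. x \<in> {0..L} ==> (v has_real_derivative w x) (at x within {0..L})"
proof -
 have S: "open {0<..<L}" "convex {0<..<L}" "L / 2 \<in> {0<..<L}" "{0<..<L} ~= {}" using L by auto
 have Gsub: "G absolutely_integrable_on {x..y}" if "x <= y" "{x..y} \<subseteq> {0<..<L}" for x y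
 proof -
  have "x \<in> {0<..<L}" "y \<in> {0<..<L}" using that by auto
  thus ?thesis by (intro abs_integrable_sub[OF G_abs_integrable]) auto
 qed
 have bsub: "(%x. \<epsilon> * b x) absolutely_integrable_on {x..y}" if "x <= y" "{x..y} \<subseteq> {0<..<L}" for x y
 proof -
  have "x \<in> {0<..<L}" "y \<in> {0<..<L}" using that by auto
  hence "b absolutely_integrable_on {x..y}" by (intro abs_integrable_sub[OF ac_on_abs_integrable[OF ac_v]]) auto
  thus ?thesis by (rule abs_integrable_mult_continuous[OF continuous_on_const])
 qed
 have weq: "(\<integral>x. \<epsilon> * b x * deriv \<eta> x \<partial>lebesgue_on {0<..<L}) = - (\<integral>x. G x * \<eta> x \<partial>lebesgue_on {0<..<L})"
  if \<eta>: "test_fun {0<..<L} \<eta>" for \<eta>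
 proof -
  obtain x y where xy: "x <= y" "{x..y} \<subseteq> {0<..<L}" "smooth \<eta>" "!!z. z \<notin> {x..y} ==> \<eta> z = 0"
   by (rule test_fun_support[OF \<eta> S(2,4)]) (rule that)
  have Sl: "{0<..<L} \<in> sets lebesgue" by simp
  have i1: "integrable (lebesgue_on {0<..<L}) (%x. \<epsilon> * b x * deriv \<eta> x)"
   by (rule LINT_support(2)[OF xy(2) Sl _ smooth_times_abs_integrable[OF smooth_deriv[OF xy(3)] bsub[OF xy(1,2)]]])
    (use deriv_zero_off_support[OF xy(4)] in auto)
  have i2: "integrable (lebesgue_on {0<..<L}) (%x. G x * \<eta> x)"
   by (rule LINT_support(2)[OF xy(2) Sl _ smooth_times_abs_integrable[OF xy(3) Gsub[OF xy(1,2)]]])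
    (use xy(4) in auto)
  have "0 = (\<integral>x. \<epsilon> * b x * deriv \<eta> x + fe (v x) * deriv fe (v x) * (p x)\<^sup>2 * \<eta> x
      + (v x - 1) / (4 * \<epsilon>) * \<eta> x \<partial>lebesgue_on {0<..<L})"
   using cp \<eta> by (simp add: critical_point_def p_def b_def)
  also have "\<dots> = (\<integral>x. \<epsilon> * b x * deriv \<eta> x + G x * \<eta> x \<partial>lebesgue_on {0<..<L})"
  proof (rule Bochner_Integration.integral_cong[OF refl])
   fix x assume "x \<in> space (lebesgue_on {0<..<L})"
   hence "x \<in> {0..L}" by auto
   hence "deriv fe (v x) = fe1 (v x)" using v01 fe_deriv by (blast intro: DERIV_imp_deriv)
   thus "\<epsilon> * b x * deriv \<eta> x + fe (v x) * deriv fe (v x) * (p x)\<^sup>2 * \<eta> x + (v x - 1) / (4 * \<epsilon>) * \<eta> x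
    = \<epsilon> * b x * deriv \<eta> x + G x * \<eta> x"
    by (simp add: G_def distrib_right)
  qed
  also have "\<dots> = (\<integral>x. \<epsilon> * b x * deriv \<eta> x \<partial>lebesgue_on {0<..<L}) + (\<integral>x. G x * \<eta> x \<partial>lebesgue_on {0<..<L})"
   by (rule Bochner_Integration.integral_add[OF i1 i2])
  finally show ?thesis by simp
 qed
 obtain c where c: "negligible {x \<in> {0<..<L}. \<epsilon> * b x ~= primitive (L / 2) G x + c}"
  by (rule weak_primitive[OF S(1-3) bsub Gsub weq])
 define w where "w x = (primitive (L / 2) G x + c) / \<epsilon>" for x
 have acP: "ac_on 0 L (primitive (L / 2) G) G"
  by (rule primitive_ac_on[where S = "{0..L}"])
   (use L in \<open>auto intro: abs_integrable_sub[OF G_abs_integrable]\<close>)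
 have acw: "ac_on 0 L w (%x. G x / \<epsilon>)"
 proof -
  have "ac_on 0 L (%x. 1 / \<epsilon> * (primitive (L / 2) G x + c)) (%x. 1 / \<epsilon> * (G x + 0))"
   by (intro ac_on_cmult ac_on_add acP ac_on_C1) auto
  thus ?thesis by (simp add: w_def[abs_def])
 qed
 have wc: "continuous_on {0..L} w" by (rule ac_on_continuous[OF acw])
 have bw: "negligible {x \<in> {0<..<L}. b x ~= w x}"
  by (rule negligible_subset[OF c]) (use \<epsilon> in \<open>auto simp: w_def field_simps\<close>)
 have "ac_on 0 L v w"
 proof (rule ac_on_cong_AE[OF ac_v])
  show "negligible ({x \<in> {0<..<L}. b x ~= w x} \<union> {0, L})" using bw by simp
 qed auto
 thus ?thesis using that[OF wc acw bw] ac_on_continuous_deriv[OF _ wc] by blast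
qed

text \<open>The slope vanishes at \<open>x0\<close> and decreases there, so it is negative to the right of \<open>x0\<close>.\<close>

lemma not_min_if_concave:
 assumes x0: "x0 \<in> {0<..<L}" and dv: "!!x. x \<in> {0..L} ==> (v has_real_derivative w x) (at x within {0..L})"
  and w0: "w x0 = 0" and dw: "(w has_real_derivative l) (at x0)" "l < 0"
 shows "\<exists>x\<in>{0..L}. v x < v x0"
proof -
 obtain d where d: "0 < d" "!!h. 0 < h ==> h < d ==> w (x0 + h) < w x0"
  using DERIV_neg_dec_right[OF dw] by blast
 define h where "h = min d (L - x0) / 2"
 have "h <= (L - x0) / 2" "h <= d / 2" "0 < h" using d x0 by (auto simp: h_def)
 hence h: "0 < h" "h < d" "x0 + h < L" using d x0 by (auto simp: field_simps)
 have "v (x0 + h) < v x0"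
 proof (rule DERIV_neg_imp_decreasing_open[of x0 "x0 + h" v])
  show "x0 < x0 + h" using h by simp
  show "continuous_on {x0..x0 + h} v" by (rule continuous_on_subset[OF v_cont]) (use x0 h in auto)
  fix x assume x: "x0 < x" "x < x0 + h"
  hence "w x < 0" using d(2)[of "x - x0"] w0 h by simp
  moreover have "(v has_real_derivative w x) (at x)"
   using dv[of x] at_within_Icc_interior[of x 0 L] x x0 h by auto
  ultimately show "\<exists>y. (v has_real_derivative y) (at x) & y < 0" by blast
 qed
 thus ?thesis using x0 h by (intro bexI[of _ "x0 + h"]) auto
qed

lemma v_min:
 obtains x0 where "x0 \<in> {0..L}" "!!x. x \<in> {0..L} ==> v x0 <= v x"
 using continuous_attains_inf[OF compact_Icc _ v_cont] L by (auto intro: that)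

lemma interior_min_slope:
 assumes x0: "x0 \<in> {0..L}" "!!x. x \<in> {0..L} ==> v x0 <= v x" "v x0 < 1"
  and dv: "!!x. x \<in> {0..L} ==> (v has_real_derivative w x) (at x within {0..L})"
 shows "x0 \<in> {0<..<L}" "w x0 = 0"
proof -
 have "x0 ~= 0" "x0 ~= L" using x0(3) boundary by auto
 thus xi: "x0 \<in> {0<..<L}" using x0(1) by auto
 have "(v has_real_derivative w x0) (at x0)" using dv[OF x0(1)] at_within_Icc_interior[OF xi] by simp
 thus "w x0 = 0"
 proof (rule DERIV_local_min)
  show "0 < min x0 (L - x0)" using xi by simp
  show "\<forall>y. \<bar>x0 - y\<bar> < min x0 (L - x0) --> v x0 <= v y" using x0(2) by (auto simp: abs_if split: if_splits)
 qed
qed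

text \<open>For zero flux the equation of \<open>v\<close> is \<open>\<epsilon> v'' = (v - 1)/(4\<epsilon>)\<close>; at a minimum below \<open>1\<close> the second
derivative would be negative. So \<open>v\<close> is constant, \<open>u' = 0\<close>, and this contradicts \<open>u(L) = a > 0\<close>.\<close>

lemma flux_nonzero:
 assumes c: "negligible {x \<in> {0<..<L}. (fe (v x))\<^sup>2 * p x ~= c}"
 shows "c ~= 0"
proof
 assume "c = 0"
 obtain w where w: "continuous_on {0..L} w" "ac_on 0 L w (%x. G x / \<epsilon>)"
  "!!x. x \<in> {0..L} ==> (v has_real_derivative w x) (at x within {0..L})"
  by (rule v_C1) (rule that)
 define N where "N = {x \<in> {0<..<L}. (fe (v x))\<^sup>2 * p x ~= c} \<union> {0, L}"
 have N: "negligible N" using c by (simp add: N_def)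
 have ac0: "ac_on 0 L w (%x. (v x - 1) / (4 * \<epsilon>) / \<epsilon>)"
 proof (rule ac_on_cong_AE[OF w(2) N])
  fix x assume "x \<in> {0..L} - N"
  hence "(fe (v x))\<^sup>2 * p x = 0" using \<open>c = 0\<close> by (auto simp: N_def)
  hence z: "fe (v x) * fe1 (v x) * (p x)\<^sup>2 = 0" by auto
  show "(v x - 1) / (4 * \<epsilon>) / \<epsilon> = G x / \<epsilon>" unfolding G_def z by simp
 qed simp
 have cc: "continuous_on {0..L} (%x. (v x - 1) / (4 * \<epsilon>) / \<epsilon>)" by (intro continuous_intros v_cont) (use \<epsilon> in auto)
 obtain x0 where x0: "x0 \<in> {0..L}" "!!x. x \<in> {0..L} ==> v x0 <= v x" by (rule v_min) (rule that)
 have "1 <= v x0"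
 proof (rule ccontr)
  assume "\<not> 1 <= v x0"
  hence lt: "v x0 < 1" by simp
  note i = interior_min_slope[OF x0 lt w(3)]
  have "(w has_real_derivative (v x0 - 1) / (4 * \<epsilon>) / \<epsilon>) (at x0)"
   using ac_on_continuous_deriv[OF ac0 cc x0(1)] at_within_Icc_interior[OF i(1)] by simp
  moreover have "(v x0 - 1) / (4 * \<epsilon>) / \<epsilon> < 0" using lt \<epsilon> by (simp add: divide_neg_pos)
  ultimately have "\<exists>x\<in>{0..L}. v x < v x0" using not_min_if_concave[OF i(1) w(3) i(2)] by blast
  thus False using x0(2) by force
 qed
 hence v1: "v x = 1" if "x \<in> {0..L}" for x using x0(2)[OF that] v01[OF that] by auto
 have "integral {0..L} p = integral {0..L} (%x. 0)"
  by (rule integral_spike[OF N]) (use v1 \<open>c = 0\<close> fe_1 in \<open>auto simp: N_def\<close>)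
 thus False using ac_on_increment[OF ac_u, of 0 L] boundary a L by simp
qed

text \<open>If \<open>v(x) = 0\<close>, then \<open>f\<^sub>\<epsilon>(v(y))\<close> is at most a multiple of \<open>\<bar>y - x\<bar>\<close>, because both functions are
Lipschitz, and \<open>u' = c/f\<^sub>\<epsilon>\<^sup>2(v)\<close> would not be integrable.\<close>

lemma v_pos:
 assumes c: "negligible {x \<in> {0<..<L}. (fe (v x))\<^sup>2 * p x ~= c}" and x: "x \<in> {0..L}"
 shows "0 < v x"
proof (rule ccontr)
 assume "\<not> 0 < v x"
 hence v0: "v x = 0" using v01[OF x] by auto
 have c0: "c ~= 0" by (rule flux_nonzero[OF c])
 obtain w where w: "continuous_on {0..L} w"
  "!!x. x \<in> {0..L} ==> (v has_real_derivative w x) (at x within {0..L})"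
  by (rule v_C1) (rule that)
 have xi: "x \<in> {0<..<L}" using x v0 boundary by (cases "x = 0 \<or> x = L") auto
 obtain M where M: "!!y. y \<in> {0..L} ==> \<bar>w y\<bar> <= M"
 proof -
  have "bounded (w ` {0..L})" by (intro compact_imp_bounded compact_continuous_image w) auto
  thus ?thesis unfolding bounded_iff by (auto intro: that)
 qed
 obtain F where F: "!!t. t \<in> {0..1} ==> \<bar>fe1 t\<bar> <= F"
 proof -
  have "bounded (fe1 ` {0..1})" by (intro compact_imp_bounded compact_continuous_image fe1_continuous) auto
  thus ?thesis unfolding bounded_iff by (auto intro: that)
 qed
 have vb: "v y <= M * (y - x)" if "x < y" "y <= L" for y
 proof -
  have "\<exists>l z. x < z & z < y & (v has_real_derivative l) (at z) & v y - v x = (y - x) * l"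
  proof (rule MVT[OF that(1)])
   show "continuous_on {x..y} v" by (rule continuous_on_subset[OF v_cont]) (use xi that in auto)
   show "v differentiable at z" if "x < z" "z < y" for z
    using w(2)[of z] at_within_Icc_interior[of z 0 L] that xi \<open>y <= L\<close> by (auto simp: real_differentiable_def)
  qed
  then obtain l z where lz: "x < z" "z < y" "(v has_real_derivative l) (at z)" "v y - v x = (y - x) * l" by blast
  have "(v has_real_derivative w z) (at z)" using w(2)[of z] at_within_Icc_interior[of z 0 L] lz xi that by auto
  hence "l = w z" using lz(3) DERIV_unique by blast
  hence "l <= M" using M[of z] lz xi that by auto
  thus ?thesis using lz(4) v0 that by (simp add: mult.commute mult_left_mono)
 qed
 have fb: "fe t <= F * t" if "t \<in> {0<..1}" for t
 proof -
  obtain z where "0 < z" "z < t" "fe t - fe 0 = (t - 0) * fe1 z"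
  proof -
   have "(fe has_real_derivative fe1 x) (at x)" if "0 <= x" "x <= t" for x using fe_deriv[of x] that \<open>t \<in> {0<..1}\<close> by simp
   thus ?thesis using MVT2[of 0 t fe fe1] \<open>t \<in> {0<..1}\<close> that by auto
  qed
  thus ?thesis using F[of z] that fe_0 by (auto simp: mult.commute intro!: mult_left_mono)
 qed
 \<comment> \<open>Adding \<open>1\<close> keeps \<open>K\<close> well defined when \<open>F M = 0\<close>.\<close>
 define K where "K = \<bar>c\<bar> / ((F * M)\<^sup>2 + 1)"
 have K: "0 < K" using c0 by (simp add: K_def add_nonneg_pos)
 define N where "N = {x \<in> {0<..<L}. (fe (v x))\<^sup>2 * p x ~= c} \<union> {0, L}"
 have N: "negligible N" using c by (simp add: N_def)
 show False
 proof (rule inverse_square_not_integrable[OF ac_on_abs_integrable[OF ac_u] _ _ K N])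
  show "0 <= x" "x < L" using xi by auto
  fix y assume y: "x < y" "y <= L" "y \<notin> N"
  have yL: "y \<in> {0..L}" using y xi by auto
  have eq: "(fe (v y))\<^sup>2 * p y = c" using y xi by (auto simp: N_def)
  hence "fe (v y) ~= 0" using c0 by auto
  hence "v y ~= 0" using fe_0 by auto
  hence vy: "v y \<in> {0<..1}" using v01[OF yL] by auto
  hence f0: "0 < fe (v y)" using fe_range by auto
  have F0: "0 <= F" using F[of 0] by (auto intro: order_trans[OF abs_ge_zero])
  have "fe (v y) <= F * (M * (y - x))"
   using fb[OF vy] vb[OF y(1,2)] F0 by (meson mult_left_mono order_trans)
  hence "(fe (v y))\<^sup>2 <= (F * (M * (y - x)))\<^sup>2" using f0 by (intro power_mono) auto
  also have "\<dots> = (F * M)\<^sup>2 * (y - x)\<^sup>2" by (simp add: power_mult_distrib)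
  also have "\<dots> <= ((F * M)\<^sup>2 + 1) * (y - x)\<^sup>2" by (rule mult_right_mono) auto
  finally have le: "(fe (v y))\<^sup>2 <= ((F * M)\<^sup>2 + 1) * (y - x)\<^sup>2" .
  have "K / (y - x)\<^sup>2 = \<bar>c\<bar> / (((F * M)\<^sup>2 + 1) * (y - x)\<^sup>2)" by (simp add: K_def)
  also have "\<dots> <= \<bar>c\<bar> / (fe (v y))\<^sup>2" by (rule divide_left_mono[OF le]) (use f0 y in \<open>auto intro!: mult_pos_pos add_nonneg_pos\<close>)
  also have "\<dots> = \<bar>p y\<bar>" using f0 by (simp add: eq[symmetric] abs_mult)
  finally show "K / (y - x)\<^sup>2 <= \<bar>p y\<bar>" .
 qed
qed

text \<open>The level \<open>d = c\<^sup>2 + \<epsilon> v'(0)\<^sup>2\<close> is the value that makes the first integral hold at \<open>x = 0\<close>.\<close>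

theorem classical_solution:
 obtains c d w where "0 < c" "c\<^sup>2 <= d" "!!x. x \<in> {0..L} ==> 0 < v x"
  "!!x. x \<in> {0..L} ==> (u has_real_derivative c / (fe (v x))\<^sup>2) (at x within {0..L})"
  "!!x. x \<in> {0..L} ==> (v has_real_derivative w x) (at x within {0..L})"
  "!!x. x \<in> {0..L} ==> (w has_real_derivative (c\<^sup>2 * fe1 (v x) / (fe (v x)) ^ 3 + (v x - 1) / (4 * \<epsilon>)) / \<epsilon>) (at x within {0..L})"
  "!!x. x \<in> {0..L} ==> \<epsilon> * (w x)\<^sup>2 = (1 - v x)\<^sup>2 / (4 * \<epsilon>) - c\<^sup>2 / (fe (v x))\<^sup>2 + d"
  "d = c\<^sup>2 + \<epsilon> * (w 0)\<^sup>2"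
  "negligible {x \<in> {0<..<L}. wderiv {0<..<L} u x ~= c / (fe (v x))\<^sup>2}"
  "negligible {x \<in> {0<..<L}. wderiv {0<..<L} v x ~= w x}"
proof -
 obtain c where c: "negligible {x \<in> {0<..<L}. (fe (v x))\<^sup>2 * p x ~= c}" by (rule flux_constant) (rule that)
 obtain w where w: "continuous_on {0..L} w" "ac_on 0 L w (%x. G x / \<epsilon>)"
  "negligible {x \<in> {0<..<L}. b x ~= w x}"
  "!!x. x \<in> {0..L} ==> (v has_real_derivative w x) (at x within {0..L})"
  by (rule v_C1) (rule that)
 have vp: "0 < v x" if "x \<in> {0..L}" for x by (rule v_pos[OF c that])
 have f0: "0 < fe (v x)" "fe (v x) <= 1" if "x \<in> {0..L}" for x using fe_range[of "v x"] vp[OF that] v01[OF that] by auto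
 define N where "N = {x \<in> {0<..<L}. (fe (v x))\<^sup>2 * p x ~= c} \<union> {0, L}"
 have N: "negligible N" using c by (simp add: N_def)
 have pe: "p x = c / (fe (v x))\<^sup>2" if "x \<in> {0..L} - N" for x
 proof -
  have "(fe (v x))\<^sup>2 * p x = c" using that by (auto simp: N_def)
  thus ?thesis using f0[of x] that by (auto simp: field_simps)
 qed
 have fnz: "\<forall>x\<in>{0..L}. fe (v x) ~= 0" using f0 by force
 have cu: "continuous_on {0..L} (%x. c / (fe (v x))\<^sup>2)"
  using fnz by (intro continuous_intros fev_cont) auto
 have acu: "ac_on 0 L u (%x. c / (fe (v x))\<^sup>2)"
  by (rule ac_on_cong_AE[OF ac_u N]) (use pe in auto)
 have du: "(u has_real_derivative c / (fe (v x))\<^sup>2) (at x within {0..L})" if "x \<in> {0..L}" for x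
  by (rule ac_on_continuous_deriv[OF acu cu that])
 have cG: "continuous_on {0..L} (%x. (c\<^sup>2 * fe1 (v x) / (fe (v x)) ^ 3 + (v x - 1) / (4 * \<epsilon>)) / \<epsilon>)"
  using fnz \<epsilon> by (intro continuous_intros fev_cont v_cont) auto
 have acw: "ac_on 0 L w (%x. (c\<^sup>2 * fe1 (v x) / (fe (v x)) ^ 3 + (v x - 1) / (4 * \<epsilon>)) / \<epsilon>)"
 proof (rule ac_on_cong_AE[OF w(2) N])
  fix x assume x: "x \<in> {0..L} - N"
  have "fe (v x) * fe1 (v x) * (c / (fe (v x))\<^sup>2)\<^sup>2 = c\<^sup>2 * fe1 (v x) / (fe (v x)) ^ 3"
   using f0(1)[of x] x by (simp add: field_simps power2_eq_square power3_eq_cube)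
  thus "(c\<^sup>2 * fe1 (v x) / (fe (v x)) ^ 3 + (v x - 1) / (4 * \<epsilon>)) / \<epsilon> = G x / \<epsilon>"
   using pe[OF x] by (simp add: G_def)
 qed simp
 have dw: "(w has_real_derivative (c\<^sup>2 * fe1 (v x) / (fe (v x)) ^ 3 + (v x - 1) / (4 * \<epsilon>)) / \<epsilon>) (at x within {0..L})" if "x \<in> {0..L}" for x
  by (rule ac_on_continuous_deriv[OF acw cG that])
 have c0: "0 < c"
 proof (rule ccontr)
  assume "\<not> 0 < c"
  hence "integral {0..L} (%x. c / (fe (v x))\<^sup>2) <= integral {0..L} (%x. 0)"
   by (intro integral_le integrable_continuous_real cu) (auto intro: divide_nonpos_nonneg)
  thus False using ac_on_increment[OF acu, of 0 L] boundary a L by simp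
 qed
 define d where "d = c\<^sup>2 + \<epsilon> * (w 0)\<^sup>2"
 define J where "J x = \<epsilon> * (w x)\<^sup>2 - (1 - v x)\<^sup>2 / (4 * \<epsilon>) + c\<^sup>2 / (fe (v x))\<^sup>2" for x
 have dJ: "(J has_real_derivative 0) (at x within {0..L})" if x: "x \<in> {0..L}" for x
 proof -
  have dfv: "((%x. fe (v x)) has_real_derivative fe1 (v x) * w x) (at x within {0..L})"
   by (rule DERIV_chain2[OF fe_deriv w(4)]) (use v01 x in auto)
  have "(J has_real_derivative \<epsilon> * (2 * w x * ((c\<^sup>2 * fe1 (v x) / (fe (v x)) ^ 3 + (v x - 1) / (4 * \<epsilon>)) / \<epsilon>))
    - 2 * (1 - v x) * (- w x) / (4 * \<epsilon>) + - (c\<^sup>2 * (2 * fe (v x) * (fe1 (v x) * w x))) / ((fe (v x))\<^sup>2 * (fe (v x))\<^sup>2)) (at x within {0..L})"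
  proof -
   have fz: "(fe (v x))\<^sup>2 ~= 0" using f0[OF x] by simp
   have d2: "((%x. (fe (v x))\<^sup>2) has_real_derivative 2 * fe (v x) * (fe1 (v x) * w x)) (at x within {0..L})"
    by (rule DERIV_cong[OF DERIV_power[OF dfv, of 2]]) simp
   have d3: "((%x. c\<^sup>2 / (fe (v x))\<^sup>2) has_real_derivative - (c\<^sup>2 * (2 * fe (v x) * (fe1 (v x) * w x))) / ((fe (v x))\<^sup>2 * (fe (v x))\<^sup>2)) (at x within {0..L})"
    by (rule DERIV_cong[OF DERIV_divide[OF DERIV_const d2 fz]]) simp
   have d4: "((%x. (1 - v x)\<^sup>2 / (4 * \<epsilon>)) has_real_derivative 2 * (1 - v x) * (- w x) / (4 * \<epsilon>)) (at x within {0..L})"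
   proof -
    have "((%x. 1 - v x) has_real_derivative - w x) (at x within {0..L})"
     using DERIV_diff[OF DERIV_const w(4)[OF x], of 1] by simp
    from DERIV_cdivide[OF DERIV_power[OF this, of 2], of "4 * \<epsilon>"] show ?thesis by (simp add: algebra_simps)
   qed
   have d5: "((%x. \<epsilon> * (w x)\<^sup>2) has_real_derivative \<epsilon> * (2 * w x * ((c\<^sup>2 * fe1 (v x) / (fe (v x)) ^ 3 + (v x - 1) / (4 * \<epsilon>)) / \<epsilon>))) (at x within {0..L})"
    by (rule DERIV_cong[OF DERIV_cmult[OF DERIV_power[OF dw[OF x], of 2]]]) simp
   show ?thesis unfolding J_def by (rule DERIV_add[OF DERIV_diff[OF d5 d4] d3])
  qed
  moreover have "\<epsilon> * (2 * w x * ((c\<^sup>2 * fe1 (v x) / (fe (v x)) ^ 3 + (v x - 1) / (4 * \<epsilon>)) / \<epsilon>))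
    - 2 * (1 - v x) * (- w x) / (4 * \<epsilon>) + - (c\<^sup>2 * (2 * fe (v x) * (fe1 (v x) * w x))) / ((fe (v x))\<^sup>2 * (fe (v x))\<^sup>2) = 0"
   using f0(1)[OF x] \<epsilon> by (simp add: field_simps power2_eq_square power3_eq_cube)
  ultimately show ?thesis by simp
 qed
 have Jd: "J x = d" if "x \<in> {0..L}" for x
 proof -
  have "\<exists>k. \<forall>x\<in>{0..L}. J x = k"
   by (rule has_field_derivative_zero_constant) (use dJ in auto)
  hence "J x = J 0" using that L by auto
  also have "J 0 = d" by (simp add: J_def d_def boundary fe_1)
  finally show ?thesis .
 qed
 have first: "\<epsilon> * (w x)\<^sup>2 = (1 - v x)\<^sup>2 / (4 * \<epsilon>) - c\<^sup>2 / (fe (v x))\<^sup>2 + d" if "x \<in> {0..L}" for x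
  using Jd[OF that] by (simp add: J_def)
 have "negligible {x \<in> {0<..<L}. p x ~= c / (fe (v x))\<^sup>2}"
 proof (rule negligible_subset[OF N], rule subsetI)
  fix x assume "x \<in> {x \<in> {0<..<L}. p x ~= c / (fe (v x))\<^sup>2}"
  thus "x \<in> N" using pe[of x] by force
 qed
 thus ?thesis
  using that[OF c0 _ vp du w(4) dw first d_def] w(3) \<epsilon> by (simp add: d_def p_def b_def)
qed

end

section \<open>The phase portrait of a critical point\<close>

locale classical = profile +
 fixes \<epsilon> L a :: real and u v :: "real => real" and c d :: real and w :: "real => real"
 assumes \<epsilon>: "0 < \<epsilon>" and L: "0 < L" and a: "0 < a" and c: "0 < c" and d: "d = c\<^sup>2 + \<epsilon> * (w 0)\<^sup>2"
  and boundary: "u 0 = 0" "u L = a" "v 0 = 1" "v L = 1"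
  and v_le: "!!x. x \<in> {0..L} ==> v x <= 1" and v_pos: "!!x. x \<in> {0..L} ==> 0 < v x"
  and du: "!!x. x \<in> {0..L} ==> (u has_real_derivative c / (fe (v x))\<^sup>2) (at x within {0..L})"
  and dv: "!!x. x \<in> {0..L} ==> (v has_real_derivative w x) (at x within {0..L})"
  and dw: "!!x. x \<in> {0..L} ==> (w has_real_derivative
   (c\<^sup>2 * fe1 (v x) / (fe (v x)) ^ 3 + (v x - 1) / (4 * \<epsilon>)) / \<epsilon>) (at x within {0..L})"
  and first_integral: "!!x. x \<in> {0..L} ==>
   \<epsilon> * (w x)\<^sup>2 = (1 - v x)\<^sup>2 / (4 * \<epsilon>) - c\<^sup>2 / (fe (v x))\<^sup>2 + d"
begin

lemma u_cont: "continuous_on {0..L} u" and v_cont: "continuous_on {0..L} v" and w_cont: "continuous_on {0..L} w"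
 by (rule DERIV_continuous_on, erule du) (rule DERIV_continuous_on, erule dv, rule DERIV_continuous_on, erule dw)

lemma dv_at: "x \<in> {0<..<L} ==> (v has_real_derivative w x) (at x)"
 using dv[of x] at_within_Icc_interior[of x 0 L] by auto

lemma du_at: "x \<in> {0<..<L} ==> (u has_real_derivative c / (fe (v x))\<^sup>2) (at x)"
 using du[of x] at_within_Icc_interior[of x 0 L] by auto

lemma fe_continuous: "continuous_on {0..1} fe"
 by (rule DERIV_continuous_on, rule has_field_derivative_at_within, erule fe_deriv)

lemma fe_pos: "0 < t ==> t <= 1 ==> 0 < fe t" using fe_range by blast

definition "H t = (1 - t)\<^sup>2 / (4 * \<epsilon>) - c\<^sup>2 / (fe t)\<^sup>2 + d"
definition "Hd t = 2 * c\<^sup>2 * fe1 t / fe t ^ 3 - (1 - t) / (2 * \<epsilon>)"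

lemma w_sq: "x \<in> {0..L} ==> \<epsilon> * (w x)\<^sup>2 = H (v x)"
 by (simp add: H_def first_integral)

lemma H_deriv: assumes t: "0 < t" "t <= 1" shows "(H has_real_derivative Hd t) (at t)"
proof -
 have fz: "fe t ~= 0" "(fe t)\<^sup>2 ~= 0" using fe_pos[OF t] by auto
 have d2: "((%x. (fe x)\<^sup>2) has_real_derivative 2 * fe t * fe1 t) (at t)"
  by (rule DERIV_cong[OF DERIV_power[OF fe_deriv, of t 2]]) (use t in auto)
 have d3: "((%x. c\<^sup>2 / (fe x)\<^sup>2) has_real_derivative - (c\<^sup>2 * (2 * fe t * fe1 t)) / ((fe t)\<^sup>2 * (fe t)\<^sup>2)) (at t)"
  by (rule DERIV_cong[OF DERIV_divide[OF DERIV_const d2 fz(2)]]) simp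
 have "((%x. 1 - x) has_real_derivative - 1) (at t)"
  by (auto intro!: derivative_eq_intros)
 from DERIV_cdivide[OF DERIV_power[OF this, of 2], of "4 * \<epsilon>"]
 have d4: "((%x. (1 - x)\<^sup>2 / (4 * \<epsilon>)) has_real_derivative - (2 * (1 - t)) / (4 * \<epsilon>)) (at t)" by simp
 have eq: "- (2 * (1 - t)) / (4 * \<epsilon>) - - (c\<^sup>2 * (2 * fe t * fe1 t)) / ((fe t)\<^sup>2 * (fe t)\<^sup>2) = Hd t"
  using fz \<epsilon> by (simp add: Hd_def field_simps power2_eq_square power3_eq_cube)
 show ?thesis unfolding H_def
  by (rule DERIV_cong[OF DERIV_add[OF DERIV_diff[OF d4 d3] DERIV_const]]) (use eq in simp)
qed

lemma H_continuous: "continuous_on {0<..1} H"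
 by (rule DERIV_continuous_on, rule has_field_derivative_at_within, rule H_deriv) auto

lemma dw_H: "x \<in> {0..L} ==> (w has_real_derivative Hd (v x) / (2 * \<epsilon>)) (at x within {0..L})"
 by (rule DERIV_cong[OF dw], simp, use \<epsilon> in \<open>simp add: Hd_def field_simps\<close>)

text \<open>\<open>H'\<close> has the sign of \<open>4\<epsilon>c\<^sup>2q - 1\<close> with \<open>q = fe1/(fe\<^sup>3(1 - t))\<close> nonincreasing: once \<open>H\<close> starts to
decrease, it never increases again.\<close>

lemma H_quasiconcave:
 assumes s: "0 < s" "s < 1" "Hd s <= 0" and t: "s <= t" "t < 1"
 shows "Hd t <= 0"
proof -
 have eq: "Hd r = (1 - r) * (2 * c\<^sup>2 * (fe1 r / (fe r ^ 3 * (1 - r))) - 1 / (2 * \<epsilon>))" if "0 < r" "r < 1" for r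
 proof -
  have "fe r ~= 0" using fe_pos[of r] that by simp
  thus ?thesis using that \<epsilon> by (simp add: Hd_def field_simps)
 qed
 have "2 * c\<^sup>2 * (fe1 s / (fe s ^ 3 * (1 - s))) - 1 / (2 * \<epsilon>) <= 0"
  using s eq[of s] by (simp add: mult_le_0_iff)
 moreover have "2 * c\<^sup>2 * (fe1 t / (fe t ^ 3 * (1 - t))) <= 2 * c\<^sup>2 * (fe1 s / (fe s ^ 3 * (1 - s)))"
  by (rule mult_left_mono[OF fe_q]) (use s t in auto)
 ultimately have "2 * c\<^sup>2 * (fe1 t / (fe t ^ 3 * (1 - t))) - 1 / (2 * \<epsilon>) <= 0" by linarith
 thus ?thesis using eq[of t] s t by (simp add: mult_le_0_iff)
qed

lemma H_decreasing:
 assumes s: "0 < s" "s < 1" "Hd s <= 0" and t: "s <= t" "t <= 1"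
 shows "H t <= H s"
proof (cases "s = t")
 case False
 have "\<exists>l z. s < z & z < t & (H has_real_derivative l) (at z) & H t - H s = (t - s) * l"
 proof (rule MVT)
  show "s < t" using False t by simp
  show "continuous_on {s..t} H" by (rule continuous_on_subset[OF H_continuous]) (use s t in auto)
  show "H differentiable at z" if "s < z" "z < t" for z
   using H_deriv[of z] that s t by (auto simp: real_differentiable_def)
 qed
 then obtain l z where z: "s < z" "z < t" "(H has_real_derivative l) (at z)" "H t - H s = (t - s) * l" by blast
 have "l = Hd z" using DERIV_unique[OF z(3) H_deriv[of z]] z s t by simp
 hence "l <= 0" using H_quasiconcave[OF s, of z] z t by simp
 hence "(t - s) * l <= 0" using False t by (intro mult_nonneg_nonpos) auto
 thus ?thesis using z(4) by simp
qed simp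

text \<open>If the slope vanishes at the boundary, a Gronwall argument forces \<open>v\<close> to be constant.\<close>

lemma slope_zero_imp_constant:
 assumes "w 0 = 0" and x: "x \<in> {0..L}"
 shows "v x = 1"
proof -
 have wb: "\<bar>w y\<bar> <= (1 - v y) / (2 * \<epsilon>)" if y: "y \<in> {0..L}" for y
 proof -
  have f: "0 < fe (v y)" "fe (v y) <= 1" using fe_range[of "v y"] v_pos[OF y] v_le[OF y] by auto
  hence "(fe (v y))\<^sup>2 <= 1" by (simp add: power_le_one)
  hence "c\<^sup>2 <= c\<^sup>2 / (fe (v y))\<^sup>2" using f by (simp add: le_divide_eq mult_left_le)
  hence "\<epsilon> * (w y)\<^sup>2 <= (1 - v y)\<^sup>2 / (4 * \<epsilon>)" using first_integral[OF y] d assms(1) by simp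
  hence "(w y)\<^sup>2 <= ((1 - v y) / (2 * \<epsilon>))\<^sup>2" using \<epsilon> by (simp add: field_simps power2_eq_square)
  thus ?thesis using v_le[OF y] \<epsilon> by (intro power2_le_imp_le[of "\<bar>w y\<bar>"]) auto
 qed
 define z where "z y = (1 - v y) * exp (- y / (2 * \<epsilon>))" for y
 have "z x <= z 0"
 proof (rule DERIV_nonpos_imp_decreasing_open[of 0 x z])
  show "0 <= x" using x by simp
  show "continuous_on {0..x} z" unfolding z_def
   by (intro continuous_intros continuous_on_subset[OF v_cont]) (use x \<epsilon> in auto)
  fix y assume y: "0 < y" "y < x"
  hence yi: "y \<in> {0<..<L}" "y \<in> {0..L}" using x by auto
  have "(z has_real_derivative (1 - v y) * (exp (- y / (2 * \<epsilon>)) * (- 1 / (2 * \<epsilon>))) + (0 - w y) * exp (- y / (2 * \<epsilon>))) (at y)"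
   unfolding z_def
  proof (rule DERIV_mult'[OF DERIV_diff[OF DERIV_const dv_at[OF yi(1)]]])
   have "((%y. - y / (2 * \<epsilon>)) has_real_derivative - 1 / (2 * \<epsilon>)) (at y)"
    by (rule DERIV_cdivide[OF DERIV_minus[OF DERIV_ident]])
   thus "((%y. exp (- y / (2 * \<epsilon>))) has_real_derivative exp (- y / (2 * \<epsilon>)) * (- 1 / (2 * \<epsilon>))) (at y)"
    by (rule DERIV_fun_exp)
  qed
  moreover have "(1 - v y) * (exp (- y / (2 * \<epsilon>)) * (- 1 / (2 * \<epsilon>))) + (0 - w y) * exp (- y / (2 * \<epsilon>)) <= 0"
  proof -
   have "(1 - v y) * (exp (- y / (2 * \<epsilon>)) * (- 1 / (2 * \<epsilon>))) + (0 - w y) * exp (- y / (2 * \<epsilon>))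
    = exp (- y / (2 * \<epsilon>)) * (- w y - (1 - v y) / (2 * \<epsilon>))" by (simp add: algebra_simps)
   moreover have "- w y - (1 - v y) / (2 * \<epsilon>) <= 0" using wb[OF yi(2)] by linarith
   ultimately show ?thesis by (simp add: mult_le_0_iff)
  qed
  ultimately show "\<exists>l. (z has_real_derivative l) (at y) & l <= 0" by blast
 qed
 also have "z 0 = 0" by (simp add: z_def boundary)
 finally have "1 - v x <= 0" by (simp add: z_def mult_le_0_iff not_le[symmetric])
 thus ?thesis using v_le[OF x] by simp
qed

lemma H_nonneg:
 assumes x: "x \<in> {0..L}" and t: "v x <= t" "t <= 1"
 shows "0 <= H t"
proof -
 have "\<exists>y. 0 <= y & y <= x & v y = t"
  by (rule IVT2'[of v x t 0]) (use t x boundary in \<open>auto intro: continuous_on_subset[OF v_cont]\<close>)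
 then obtain y where y: "0 <= y" "y <= x" "v y = t" by blast
 have "\<epsilon> * (w y)\<^sup>2 = H t" using w_sq[of y] y x by simp
 moreover have "0 <= \<epsilon> * (w y)\<^sup>2" using \<epsilon> by simp
 ultimately show ?thesis by simp
qed

end

locale nonconstant = classical +
 assumes w0: "w 0 ~= 0"
begin

lemma H_at_1: "0 < H 1"
 using w_sq[of 0] L \<epsilon> w0 boundary by (metis atLeastAtMost_iff less_eq_real_def mult_pos_pos zero_less_power2)

text \<open>Where the slope vanishes, \<open>H(v) = 0 < H(1)\<close>; by quasi-concavity \<open>H\<close> has to cross zero
increasingly, so each zero of the slope is a strict minimum of \<open>v\<close> with all higher levels
accessible. Two of them cannot coexist.\<close>

lemma zero_slope_iff:
 assumes x0: "x0 \<in> {0..L}" "w x0 = 0"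
 shows "v x0 < 1" "0 < Hd (v x0)" "!!t. v x0 < t ==> t <= 1 ==> 0 < H t"
proof -
 have H0: "H (v x0) = 0" using w_sq[OF x0(1)] x0(2) by simp
 show lt: "v x0 < 1" using H0 H_at_1 v_le[OF x0(1)] by (cases "v x0 = 1") auto
 show H1p: "0 < Hd (v x0)"
 proof (rule ccontr)
  assume "\<not> 0 < Hd (v x0)"
  hence "H 1 <= H (v x0)" using H_decreasing[of "v x0" 1] lt v_pos[OF x0(1)] by simp
  thus False using H0 H_at_1 by simp
 qed
 fix t assume t: "v x0 < t" "t <= 1"
 have nn: "0 <= H r" if "v x0 <= r" "r <= 1" for r using H_nonneg[OF x0(1) that] .
 show "0 < H t"
 proof (rule ccontr)
  assume "\<not> 0 < H t"
  hence Ht: "H t = 0" using nn[of t] t by simp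
  hence t1: "t < 1" using H_at_1 t by (cases "t = 1") auto
  have "Hd t = 0"
  proof (rule DERIV_local_min[OF H_deriv])
   show "0 < t" "t <= 1" using t v_pos[OF x0(1)] by auto
   show "0 < min (t - v x0) (1 - t)" using t t1 by simp
   show "\<forall>y. \<bar>t - y\<bar> < min (t - v x0) (1 - t) --> H t <= H y"
    using nn Ht by (auto simp: abs_if split: if_splits)
  qed
  hence "H 1 <= H t" using H_decreasing[of t 1] t t1 v_pos[OF x0(1)] by simp
  thus False using Ht H_at_1 by simp
 qed
qed

definition "x0 = (SOME x. x \<in> {0..L} & (\<forall>y\<in>{0..L}. v x <= v y))"

lemma x0_min: "x0 \<in> {0..L}" "!!y. y \<in> {0..L} ==> v x0 <= v y"
proof -
 have "\<exists>x. x \<in> {0..L} & (\<forall>y\<in>{0..L}. v x <= v y)"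
  using continuous_attains_inf[OF compact_Icc _ v_cont] L by fastforce
 from someI_ex[OF this] show "x0 \<in> {0..L}" "!!y. y \<in> {0..L} ==> v x0 <= v y" by (auto simp: x0_def)
qed

lemma x0_slope: "x0 \<in> {0<..<L}" "w x0 = 0" "v x0 < 1"
proof -
 have ex: "\<exists>y\<in>{0..L}. v y < 1"
 proof (rule ccontr)
  assume "\<not> ?thesis"
  hence v1: "v y = 1" if "y \<in> {0..L}" for y using v_le[OF that] that by force
  have "(v has_real_derivative w 0) (at 0 within {0..L})" using dv[of 0] L by simp
  moreover have "(v has_real_derivative 0) (at 0 within {0..L})"
   by (rule has_field_derivative_transform_within[OF DERIV_const[of 1] zero_less_one]) (use v1 L in auto)
  ultimately have "w 0 = 0"
   by (intro vector_derivative_unique_within_closed_interval[OF L, of 0 v])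
    (use L in \<open>simp_all add: has_real_derivative_iff_has_vector_derivative\<close>)
  thus False using w0 by simp
 qed
 thus lt: "v x0 < 1" using x0_min(2) by force
 hence "x0 ~= 0" "x0 ~= L" using boundary by auto
 thus xi: "x0 \<in> {0<..<L}" using x0_min(1) by auto
 show "w x0 = 0"
 proof (rule DERIV_local_min[OF dv_at[OF xi]])
  show "0 < min x0 (L - x0)" using xi by simp
  show "\<forall>y. \<bar>x0 - y\<bar> < min x0 (L - x0) --> v x0 <= v y" using x0_min(2) by (auto simp: abs_if split: if_splits)
 qed
qed

lemma zero_slope_unique:
 assumes p: "p \<in> {0..L}" "w p = 0" and q: "q \<in> {0..L}" "w q = 0"
 shows "p = q"
proof -
 have no: False if pq: "p < q" and p: "p \<in> {0..L}" "w p = 0" and q: "q \<in> {0..L}" "w q = 0" for p q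
 proof -
  have vz: "v z = v p" if "z \<in> {0..L}" "w z = 0" for z
  proof -
   have H0: "H (v z) = 0" "H (v p) = 0" using w_sq[OF that(1)] w_sq[OF p(1)] that p by simp_all
   thus ?thesis
    using zero_slope_iff(3)[OF that, of "v p"] zero_slope_iff(3)[OF p, of "v z"] v_le[OF that(1)] v_le[OF p(1)] by force
  qed
  have mem: "x \<in> {0..L}" if "x \<in> {p..q}" for x using that p q by auto
  obtain z where z: "z \<in> {p..q}" "!!x. x \<in> {p..q} ==> v x <= v z"
   using continuous_attains_sup[OF compact_Icc _ continuous_on_subset[OF v_cont], of p q] pq mem by auto
  have vzp: "v z = v p"
  proof (cases "z = p \<or> z = q")
   case True thus ?thesis using vz[OF q] by auto
  next
   case False
   hence zi: "z \<in> {p<..<q}" using z by auto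
   have "w z = 0"
   proof (rule DERIV_local_max[OF dv_at])
    show "z \<in> {0<..<L}" using zi p q by auto
    show "0 < min (z - p) (q - z)" using zi by simp
    show "\<forall>y. \<bar>z - y\<bar> < min (z - p) (q - z) --> v y <= v z" using z(2) by (auto simp: abs_if split: if_splits)
   qed
   thus ?thesis using vz mem[OF z(1)] by simp
  qed
  have ge: "v p <= v x" if "x \<in> {0..L}" for x
   using vz[OF x0_min(1) x0_slope(2)] x0_min(2)[OF that] by simp
  have const: "v x = v p" if "x \<in> {p..q}" for x using ge[OF mem[OF that]] z(2)[OF that] vzp by simp
  have w0: "w x = 0" if "x \<in> {p..q}" for x
  proof -
   have "H (v x) = 0" using const[OF that] w_sq[OF p(1)] p(2) by simp
   thus ?thesis using w_sq[OF mem[OF that]] \<epsilon> by simp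
  qed
  have "(w has_real_derivative Hd (v p) / (2 * \<epsilon>)) (at p within {p..q})"
   by (rule DERIV_subset[OF dw_H[OF p(1)]]) (use p q in auto)
  moreover have "(w has_real_derivative 0) (at p within {p..q})"
   by (rule has_field_derivative_transform_within[OF DERIV_const[of 0] zero_less_one]) (use w0 pq in auto)
  ultimately have "Hd (v p) / (2 * \<epsilon>) = 0" 
   by (intro vector_derivative_unique_within_closed_interval[OF pq, of p w])
    (use pq in \<open>simp_all add: has_real_derivative_iff_has_vector_derivative\<close>)
  thus False using zero_slope_iff(2)[OF p] \<epsilon> by simp
 qed
 show ?thesis using no[of p q] no[of q p] p q by (cases p q rule: linorder_cases) auto
qed

lemma v_mvt:
 assumes x: "0 <= x" "x < y" "y <= L"
 obtains z where "x < z" "z < y" "v y - v x = w z * (y - x)"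
proof -
 have "(v has_derivative (*) (w z)) (at z within {x..y})" if "x <= z" "z <= y" for z
  unfolding has_field_derivative_def[symmetric] by (rule DERIV_subset[OF dv]) (use that x in auto)
 thus ?thesis using mvt_simple[OF x(2), of v "%z. (*) (w z)"] that by auto
qed

lemma w_neg: assumes x: "0 <= x" "x < x0" shows "w x < 0"
proof (rule ccontr)
 assume n: "\<not> w x < 0"
 obtain z where z: "x < z" "z < x0" "v x0 - v x = w z * (x0 - x)" by (rule v_mvt[of x x0]) (use x x0_slope in auto)
 have "w z * (x0 - x) <= 0" using z(3) x0_min(2)[of x] x x0_slope by simp
 hence "w z <= 0" using x by (simp add: mult_le_0_iff)
 hence "\<exists>y\<ge>x. y <= z & w y = 0"
  by (intro IVT2') (use n z x x0_slope in \<open>auto intro: continuous_on_subset[OF w_cont]\<close>)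
 then obtain y where "x <= y" "y <= z" "w y = 0" by blast
 thus False using zero_slope_unique[of y x0] z x x0_slope by auto
qed

lemma w_pos: assumes x: "x0 < x" "x <= L" shows "0 < w x"
proof (rule ccontr)
 assume n: "\<not> 0 < w x"
 obtain z where z: "x0 < z" "z < x" "v x - v x0 = w z * (x - x0)" by (rule v_mvt[of x0 x]) (use x x0_slope in auto)
 have "0 <= w z * (x - x0)" using z(3) x0_min(2)[of x] x x0_slope by simp
 hence "0 <= w z" using x by (simp add: zero_le_mult_iff)
 hence "\<exists>y\<ge>z. y <= x & w y = 0"
  by (intro IVT2') (use n z x x0_slope in \<open>auto intro: continuous_on_subset[OF w_cont]\<close>)
 then obtain y where "z <= y" "y <= x" "w y = 0" by blast
 thus False using zero_slope_unique[of y x0] z x x0_slope by auto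
qed

lemma v_strict:
 shows "0 <= x ==> x < y ==> y <= x0 ==> v y < v x" and "x0 <= x ==> x < y ==> y <= L ==> v x < v y"
proof -
 assume x: "0 <= x" "x < y" "y <= x0"
 obtain z where "x < z" "z < y" "v y - v x = w z * (y - x)" by (rule v_mvt[of x y]) (use x x0_slope in auto)
 thus "v y < v x" using w_neg[of z] x mult_neg_pos[of "w z" "y - x"] by simp
next
 assume x: "x0 <= x" "x < y" "y <= L"
 obtain z where z: "x < z" "z < y" "v y - v x = w z * (y - x)" by (rule v_mvt[of x y]) (use x x0_slope in auto)
 have "0 < w z * (y - x)" by (rule mult_pos_pos) (use w_pos[of z] x z in auto)
 thus "v x < v y" using z by linarith
qed

text \<open>The travel time \<open>- T(t) = \<integral>\<^sub>t\<^sup>1 sqrt (\<epsilon>/H)\<close> between the values \<open>1\<close> and \<open>t\<close> is the same on both sides of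
the minimum; hence the profile is symmetric and the minimum lies in the middle. Freezing \<open>H\<close> beyond
\<open>1\<close> makes \<open>T\<close> differentiable at \<open>1\<close> from both sides.\<close>

definition "T = primitive 1 (%t. sqrt (\<epsilon> / H (min t 1)))"

lemma T_deriv: assumes t: "v x0 < t" "t <= 1" shows "(T has_real_derivative sqrt (\<epsilon> / H t)) (at t)"
proof -
 have "(T has_real_derivative sqrt (\<epsilon> / H (min t 1))) (at t)"
  unfolding T_def
 proof (rule primitive_has_derivative[where S = "{v x0<..}"])
  have "continuous_on {v x0<..} (%t. H (min t 1))"
  proof (rule continuous_on_compose2[OF H_continuous])
   show "(%t. min t 1) ` {v x0<..} \<subseteq> {0<..1}" using v_pos[OF x0_min(1)] by force
  qed (intro continuous_intros)
  moreover have "H (min t 1) ~= 0" if "t \<in> {v x0<..}" for t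
   using zero_slope_iff(3)[OF x0_min(1) x0_slope(2), of "min t 1"] that x0_slope by auto
  ultimately show "continuous_on {v x0<..} (%t. sqrt (\<epsilon> / H (min t 1)))"
   by (intro continuous_intros) auto
 qed (use t x0_slope in auto)
 thus ?thesis using t by (simp add: min_def)
qed

lemma T_1: "T 1 = 0" by (simp add: T_def primitive_def)

lemma sqrt_H: "x \<in> {0..L} ==> sqrt (\<epsilon> / H (v x)) * w x = sgn (w x)" 
proof -
 assume x: "x \<in> {0..L}"
 have "\<epsilon> / H (v x) = 1 / (w x)\<^sup>2" using \<epsilon> by (simp add: w_sq[OF x, symmetric])
 thus ?thesis by (simp add: real_sqrt_divide sgn_if)
qed

lemma T_left: assumes x: "0 <= x" "x < x0" shows "T (v x) = - x"
proof -
 have gt: "v x0 < v y" if "0 <= y" "y <= x" for y using v_strict(1)[of y x0] that x by simp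
 have cT: "continuous_on {v x0<..1} T"
  by (rule DERIV_continuous_on, rule has_field_derivative_at_within, rule T_deriv) auto
 have "((%y. T (v y) + y) has_real_derivative 0) (at y)" if y: "0 < y" "y < x" for y
 proof -
  have yi: "y \<in> {0<..<L}" "y \<in> {0..L}" using y x x0_slope by auto
  have "((%y. T (v y) + y) has_real_derivative sqrt (\<epsilon> / H (v y)) * w y + 1) (at y)"
   by (intro DERIV_add DERIV_chain2[OF T_deriv dv_at] DERIV_ident gt v_le yi) (use y in auto)
  thus ?thesis using sqrt_H[OF yi(2)] w_neg[of y] y x by simp
 qed
 moreover have "continuous_on {0..x} (%y. T (v y) + y)"
  by (intro continuous_intros continuous_on_compose2[OF cT continuous_on_subset[OF v_cont]])
   (use gt v_le x x0_slope in auto)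
 ultimately have "T (v x) + x = T (v 0) + 0"
  using DERIV_isconst_end[of 0 x "%y. T (v y) + y"] x by (cases "x = 0") auto
 thus ?thesis by (simp add: boundary T_1)
qed

lemma T_right: assumes x: "x0 < x" "x <= L" shows "T (v x) = x - L"
proof -
 have gt: "v x0 < v y" if "x <= y" "y <= L" for y using v_strict(2)[of x0 y] that x by simp
 have cT: "continuous_on {v x0<..1} T"
  by (rule DERIV_continuous_on, rule has_field_derivative_at_within, rule T_deriv) auto
 have "((%y. T (v y) - y) has_real_derivative 0) (at y)" if y: "x < y" "y < L" for y
 proof -
  have yi: "y \<in> {0<..<L}" "y \<in> {0..L}" using y x x0_slope by auto
  have "((%y. T (v y) - y) has_real_derivative sqrt (\<epsilon> / H (v y)) * w y - 1) (at y)"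
   by (intro DERIV_diff DERIV_chain2[OF T_deriv dv_at] DERIV_ident gt v_le yi) (use y in auto)
  thus ?thesis using sqrt_H[OF yi(2)] w_pos[of y] y x by simp
 qed
 moreover have "continuous_on {x..L} (%y. T (v y) - y)"
  by (intro continuous_intros continuous_on_compose2[OF cT continuous_on_subset[OF v_cont]])
   (use gt v_le x x0_slope in auto)
 ultimately have "T (v L) - L = T (v x) - x"
  using DERIV_isconst_end[of x L "%y. T (v y) - y"] x by (cases "x = L") auto
 thus ?thesis by (simp add: boundary T_1)
qed

lemma reflect_left: assumes x: "0 <= x" "x < x0" shows "x0 < L - x" "v (L - x) = v x"
proof -
 have gt: "v x0 < v x" using v_strict(1)[of x x0] x by simp
 have "\<exists>y. x0 <= y & y <= L & v y = v x"
  by (rule IVT') (use gt x x0_slope boundary v_le in \<open>auto intro: continuous_on_subset[OF v_cont]\<close>)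
 then obtain y where y: "x0 <= y" "y <= L" "v y = v x" by blast
 hence y0: "x0 < y" using gt by (cases "y = x0") auto
 have "y - L = - x" using T_left[OF x] T_right[OF y0 y(2)] y(3) by simp
 hence "y = L - x" by simp
 thus "x0 < L - x" "v (L - x) = v x" using y y0 by auto
qed

lemma reflect_right: assumes x: "x0 < x" "x <= L" shows "L - x < x0" "v (L - x) = v x"
proof -
 have gt: "v x0 < v x" using v_strict(2)[of x0 x] x by simp
 have "\<exists>y. 0 <= y & y <= x0 & v y = v x"
  by (rule IVT2') (use gt x x0_slope boundary v_le in \<open>auto intro: continuous_on_subset[OF v_cont]\<close>)
 then obtain y where y: "0 <= y" "y <= x0" "v y = v x" by blast
 hence y0: "y < x0" using gt by (cases "y = x0") auto
 have "x - L = - y" using T_left[OF y(1) y0] T_right[OF x] y(3) by simp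
 hence "y = L - x" by simp
 thus "L - x < x0" "v (L - x) = v x" using y y0 by auto
qed

lemma x0_half: "x0 = L / 2"
proof (rule antisym)
 show "x0 <= L / 2"
 proof (rule dense_le_bounded[of 0])
  fix x assume "0 < x" "x < x0"
  thus "x <= L / 2" using reflect_left[of x] by simp
 qed (use x0_slope in simp)
 show "L / 2 <= x0"
 proof (rule dense_ge_bounded[of x0 L])
  fix x assume "x0 < x" "x < L"
  thus "L / 2 <= x" using reflect_right[of x] by simp
 qed (use x0_slope in simp)
qed

lemma v_symmetric_nc: "x \<in> {0..L} ==> v (L - x) = v x"
proof (cases x x0 rule: linorder_cases)
 case equal
 hence "L - x = x" using x0_half by simp
 thus ?thesis by simp
qed (use reflect_left(2)[of x] reflect_right(2)[of x] in auto)

end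

context classical begin

lemma nonconstantI: "w 0 ~= 0 ==> nonconstant fe fe1 \<epsilon> L a u v c d w"
 by (rule nonconstant.intro[OF classical_axioms]) (simp add: nonconstant_axioms_def)

lemma v_symmetric: assumes x: "x \<in> {0..L}" shows "v (L - x) = v x"
proof (cases "w 0 = 0")
 case True thus ?thesis using slope_zero_imp_constant x by simp
next
 case False then interpret nonconstant fe fe1 \<epsilon> L a u v c d w by (rule nonconstantI)
 show ?thesis by (rule v_symmetric_nc[OF x])
qed

lemma u_symmetric: assumes x: "x \<in> {0..L}" shows "u (L - x) = a - u x"
proof -
 have "\<exists>k. \<forall>x\<in>{0..L}. u x + u (L - x) = k"
 proof (rule has_field_derivative_zero_constant)
  fix x assume x: "x \<in> {0..L}"
  have "((%x. u (L - x)) has_real_derivative c / (fe (v (L - x)))\<^sup>2 * (- 1)) (at x within {0..L})"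
  proof (rule DERIV_image_chain[where f = u and g = "%x. L - x", unfolded o_def])
   have "(%x. L - x) ` {0..L} = {0..L}" by (auto intro!: image_eqI[of _ _ "L - _"])
   thus "(u has_real_derivative c / (fe (v (L - x)))\<^sup>2) (at (L - x) within (%x. L - x) ` {0..L})"
    using du[of "L - x"] x by simp
  qed (auto intro!: derivative_eq_intros)
  from DERIV_add[OF du[OF x] this]
  show "((%x. u x + u (L - x)) has_real_derivative 0) (at x within {0..L})" using v_symmetric[OF x] by simp
 qed simp
 hence "u x + u (L - x) = u 0 + u (L - 0)" using x L by (metis atLeastAtMost_iff less_eq_real_def)
 thus ?thesis by (simp add: boundary)
qed

lemma w_nonpos: assumes x: "0 <= x" "x <= L / 2" shows "w x <= 0"
proof (cases "w 0 = 0")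
 case True
 have "H (v x) = H (v 0)" using slope_zero_imp_constant[OF True] x L by simp
 hence "\<epsilon> * (w x)\<^sup>2 = 0" using w_sq[of x] w_sq[of 0] x L True by simp
 thus ?thesis using \<epsilon> by simp
next
 case False then interpret nonconstant fe fe1 \<epsilon> L a u v c d w by (rule nonconstantI)
 have "x = x0 \<or> x < x0" using x0_half x by linarith
 thus ?thesis using w_neg[of x] x0_slope(2) x by fastforce
qed

lemma w_half: "w (L / 2) = 0"
proof (cases "w 0 = 0")
 case True
 have "H (v (L / 2)) = H (v 0)" using slope_zero_imp_constant[OF True] L by simp
 hence "\<epsilon> * (w (L / 2))\<^sup>2 = 0" using w_sq[of "L / 2"] w_sq[of 0] L True by simp
 thus ?thesis using \<epsilon> by simp
next
 case False then interpret nonconstant fe fe1 \<epsilon> L a u v c d w by (rule nonconstantI)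
 show ?thesis using x0_slope x0_half by simp
qed

lemma v_antimono: assumes x: "0 <= x" "x <= y" "y <= L / 2" shows "v y <= v x"
proof (rule DERIV_nonpos_imp_decreasing_open[OF x(2)])
 show "continuous_on {x..y} v" by (rule continuous_on_subset[OF v_cont]) (use x L in auto)
 fix z assume "x < z" "z < y"
 thus "\<exists>l. (v has_real_derivative l) (at z) & l <= 0" using dv_at[of z] w_nonpos[of z] x L by auto
qed

lemma v_min: "x \<in> {0..L} ==> v (L / 2) <= v x"
 using v_antimono[of x "L / 2"] v_antimono[of "L - x" "L / 2"] v_symmetric[of x] by (cases "x <= L / 2") auto

abbreviation "m \<equiv> v (L / 2)"

lemma m_bounds: "0 < m" "m <= 1" using v_pos[of "L / 2"] v_le[of "L / 2"] L by auto

lemma INF_v: "(INF x\<in>{0..L}. v x) = m"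
 by (rule cInf_eq_minimum) (use L v_min in auto)

lemma d_ge: "c\<^sup>2 <= d" using d \<epsilon> by simp

lemma H_nonneg_m: "m <= t ==> t <= 1 ==> 0 <= H t"
 using H_nonneg[of "L / 2"] L by simp

text \<open>On each half of the interval \<open>\<epsilon> v'\<^sup>2 = sqrt (\<epsilon> H(v)) \<bar>v'\<bar>\<close>, and \<open>v\<close> serves as variable of
integration.\<close>

lemma kinetic_energy: "((%x. \<epsilon> * (w x)\<^sup>2) has_integral 2 * integral {m..1} (%t. sqrt (\<epsilon> * H t))) {0..L}"
proof -
 define \<Phi> where "\<Phi> t = integral {m..t} (%t. sqrt (\<epsilon> * H t))" for t
 have cH: "continuous_on {m..1} (%t. sqrt (\<epsilon> * H t))"
  by (intro continuous_intros continuous_on_subset[OF H_continuous]) (use m_bounds in auto)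
 have d\<Phi>: "(\<Phi> has_real_derivative sqrt (\<epsilon> * H t)) (at t within {m..1})" if "t \<in> {m..1}" for t
  unfolding \<Phi>_def by (rule integral_has_real_derivative[OF cH that])
 have dc: "((%x. \<Phi> (v x)) has_real_derivative sqrt (\<epsilon> * H (v x)) * w x) (at x within {0..L})" if x: "x \<in> {0..L}" for x
 proof -
  have vi: "v ` {0..L} \<subseteq> {m..1}" using v_min v_le by auto
  show ?thesis
   by (rule DERIV_image_chain[where f = \<Phi> and g = v, unfolded o_def, OF DERIV_subset[OF d\<Phi> vi] dv[OF x]])
    (use v_min v_le x in auto)
 qed
 have sq: "sqrt (\<epsilon> * H (v x)) = \<epsilon> * \<bar>w x\<bar>" if "x \<in> {0..L}" for x
  using \<epsilon> by (simp add: w_sq[OF that, symmetric] real_sqrt_mult power2_eq_square)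
 have w_ge: "0 <= w x" if "L / 2 <= x" "x <= L" for x
 proof (cases "w 0 = 0")
  case True
  have "H (v x) = H (v 0)" using slope_zero_imp_constant[OF True] that L by simp
  hence "\<epsilon> * (w x)\<^sup>2 = 0" using w_sq[of x] w_sq[of 0] that L True by simp
  thus ?thesis using \<epsilon> by simp
 next
  case False then interpret nonconstant fe fe1 \<epsilon> L a u v c d w by (rule nonconstantI)
  have "x = x0 \<or> x0 < x" using x0_half that by linarith
  thus ?thesis using w_pos[of x] x0_slope(2) that by fastforce
 qed
 have "((%x. \<epsilon> * (w x)\<^sup>2) has_integral (- \<Phi> (v (L / 2)) - (- \<Phi> (v 0)))) {0..L / 2}"
 proof (rule fundamental_theorem_of_calculus)
  fix x assume x: "x \<in> {0..L / 2}"
  have "((%x. - \<Phi> (v x)) has_real_derivative - (sqrt (\<epsilon> * H (v x)) * w x)) (at x within {0..L / 2})"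
   by (rule DERIV_minus[OF DERIV_subset[OF dc]]) (use x L in auto)
  moreover have "- (sqrt (\<epsilon> * H (v x)) * w x) = \<epsilon> * (w x)\<^sup>2"
   using sq[of x] w_nonpos[of x] x L by (simp add: power2_eq_square)
  ultimately show "((%x. - \<Phi> (v x)) has_vector_derivative \<epsilon> * (w x)\<^sup>2) (at x within {0..L / 2})"
   by (simp add: has_real_derivative_iff_has_vector_derivative)
 qed (use L in simp)
 moreover have "((%x. \<epsilon> * (w x)\<^sup>2) has_integral (\<Phi> (v L) - \<Phi> (v (L / 2)))) {L / 2..L}"
 proof (rule fundamental_theorem_of_calculus)
  fix x assume x: "x \<in> {L / 2..L}"
  have "((%x. \<Phi> (v x)) has_real_derivative (sqrt (\<epsilon> * H (v x)) * w x)) (at x within {L / 2..L})"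
   by (rule DERIV_subset[OF dc]) (use x L in auto)
  moreover have "sqrt (\<epsilon> * H (v x)) * w x = \<epsilon> * (w x)\<^sup>2"
   using sq[of x] w_ge[of x] x L by (simp add: power2_eq_square)
  ultimately show "((%x. \<Phi> (v x)) has_vector_derivative \<epsilon> * (w x)\<^sup>2) (at x within {L / 2..L})"
   by (simp add: has_real_derivative_iff_has_vector_derivative)
 qed (use L in simp)
 ultimately have "((%x. \<epsilon> * (w x)\<^sup>2) has_integral ((- \<Phi> (v (L / 2)) - (- \<Phi> (v 0))) + (\<Phi> (v L) - \<Phi> (v (L / 2))))) {0..L}"
  by (rule has_integral_combine[rotated 2]) (use L in auto)
 moreover have "\<Phi> (v (L / 2)) = 0" by (simp add: \<Phi>_def)
 ultimately show ?thesis by (simp add: boundary \<Phi>_def)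
qed

lemma elastic_energy: "((%x. c\<^sup>2 / (fe (v x))\<^sup>2) has_integral c * a) {0..L}"
proof -
 have "((%x. c / (fe (v x))\<^sup>2) has_integral (u L - u 0)) {0..L}"
  by (rule fundamental_theorem_of_calculus) (use L du in \<open>auto simp: has_real_derivative_iff_has_vector_derivative[symmetric]\<close>)
 from has_integral_mult_right[OF this, of c] show ?thesis by (simp add: boundary power2_eq_square)
qed

definition "E x = c\<^sup>2 / (fe (v x))\<^sup>2 + (1 - v x)\<^sup>2 / (4 * \<epsilon>) + \<epsilon> * (w x)\<^sup>2"

lemma E_integral: "(E has_integral 2 * c * a - d * L + 4 * integral {m..1} (%t. sqrt (\<epsilon> * H t))) {0..L}"
proof -
 have "((%x. 2 * (c\<^sup>2 / (fe (v x))\<^sup>2) - d + 2 * (\<epsilon> * (w x)\<^sup>2)) has_integral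
  2 * (c * a) - L * d + 2 * (2 * integral {m..1} (%t. sqrt (\<epsilon> * H t)))) {0..L}"
  using has_integral_const_real[of d 0 L] L
  by (intro has_integral_add has_integral_diff has_integral_mult_right kinetic_energy elastic_energy) simp
 hence "(E has_integral 2 * (c * a) - L * d + 2 * (2 * integral {m..1} (%t. sqrt (\<epsilon> * H t)))) {0..L}"
  by (rule has_integral_eq[rotated]) (simp add: E_def first_integral)
 thus ?thesis by (simp add: algebra_simps)
qed

lemma fracture_energy_le: "integral {0..L} (%x. (1 - v x)\<^sup>2 / (4 * \<epsilon>)) <= integral {0..L} E"
 and elastic_energy_le: "c * a <= integral {0..L} E"
 and d_le: "d * L <= integral {0..L} E"
proof -
 have Ei: "E integrable_on {0..L}" using E_integral by (rule has_integral_integrable)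
 have pi: "(%x. (1 - v x)\<^sup>2 / (4 * \<epsilon>)) integrable_on {0..L}"
  by (intro integrable_continuous_real continuous_intros v_cont) (use \<epsilon> in auto)
 show "integral {0..L} (%x. (1 - v x)\<^sup>2 / (4 * \<epsilon>)) <= integral {0..L} E"
  by (rule integral_le[OF pi Ei]) (use \<epsilon> in \<open>simp add: E_def\<close>)
 have "integral {0..L} (%x. c\<^sup>2 / (fe (v x))\<^sup>2) <= integral {0..L} E"
  by (rule integral_le[OF has_integral_integrable[OF elastic_energy] Ei]) (use \<epsilon> in \<open>simp add: E_def\<close>)
 thus "c * a <= integral {0..L} E" using integral_unique[OF elastic_energy] by simp
 have "integral {0..L} (%x. d) <= integral {0..L} E"
  by (rule integral_le[OF _ Ei]) (use \<epsilon> first_integral in \<open>auto simp: E_def\<close>)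
 thus "d * L <= integral {0..L} E" using L by (simp add: mult.commute)
qed

end

context crit begin

lemma classical:
 obtains c d w where "classical fe fe1 \<epsilon> L a u v c d w"
  "F_eps L fe \<epsilon> u v = ennreal (2 * c * a - d * L + 4 * integral {v (L / 2)..1} (%t. sqrt (\<epsilon> * classical.H fe \<epsilon> c d t)))"
proof -
 obtain c d w where cd: "0 < c" "c\<^sup>2 <= d" "!!x. x \<in> {0..L} ==> 0 < v x"
  "!!x. x \<in> {0..L} ==> (u has_real_derivative c / (fe (v x))\<^sup>2) (at x within {0..L})"
  "!!x. x \<in> {0..L} ==> (v has_real_derivative w x) (at x within {0..L})"
  "!!x. x \<in> {0..L} ==> (w has_real_derivative (c\<^sup>2 * fe1 (v x) / (fe (v x)) ^ 3 + (v x - 1) / (4 * \<epsilon>)) / \<epsilon>) (at x within {0..L})"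
  "!!x. x \<in> {0..L} ==> \<epsilon> * (w x)\<^sup>2 = (1 - v x)\<^sup>2 / (4 * \<epsilon>) - c\<^sup>2 / (fe (v x))\<^sup>2 + d"
  "d = c\<^sup>2 + \<epsilon> * (w 0)\<^sup>2"
  "negligible {x \<in> {0<..<L}. wderiv {0<..<L} u x ~= c / (fe (v x))\<^sup>2}"
  "negligible {x \<in> {0<..<L}. wderiv {0<..<L} v x ~= w x}"
  by (rule classical_solution) (rule that)
 have cl: "classical fe fe1 \<epsilon> L a u v c d w"
 proof (rule classical.intro[OF profile_axioms], rule classical_axioms.intro)
  show "v x <= 1" if "x \<in> {0..L}" for x using v01[OF that] by simp
 qed (assumption | rule \<epsilon> L a cd boundary)+
 interpret C: classical fe fe1 \<epsilon> L a u v c d w by (rule cl)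
 have Ei: "C.E absolutely_integrable_on {0..L}"
  by (rule nonnegative_absolutely_integrable_1[OF has_integral_integrable[OF C.E_integral]])
   (use \<epsilon> in \<open>simp add: C.E_def\<close>)
 hence "C.E absolutely_integrable_on {0<..<L}" by (simp add: absolutely_integrable_on_Icc_iff_Ioo)
 hence int: "integrable (lebesgue_on {0<..<L}) C.E" by (simp add: integrable_lebesgue_on_iff)
 have "F_eps L fe \<epsilon> u v = (\<integral>\<^sup>+x. ennreal ((fe (v x))\<^sup>2 * \<bar>wderiv {0<..<L} u x\<bar>\<^sup>2
    + (1 - v x)\<^sup>2 / (4 * \<epsilon>) + \<epsilon> * \<bar>wderiv {0<..<L} v x\<bar>\<^sup>2) \<partial>lebesgue_on {0<..<L})"
  unfolding F_eps_def using cp v01 by (auto simp: critical_point_def intro!: AE_I2)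
 also have "\<dots> = (\<integral>\<^sup>+x. ennreal (C.E x) \<partial>lebesgue_on {0<..<L})"
 proof (rule nn_integral_cong_AE)
  have n: "negligible ({x \<in> {0<..<L}. wderiv {0<..<L} u x ~= c / (fe (v x))\<^sup>2} \<union> {x \<in> {0<..<L}. wderiv {0<..<L} v x ~= w x})"
   using cd by simp
  show "AE x in lebesgue_on {0<..<L}. ennreal ((fe (v x))\<^sup>2 * \<bar>wderiv {0<..<L} u x\<bar>\<^sup>2
    + (1 - v x)\<^sup>2 / (4 * \<epsilon>) + \<epsilon> * \<bar>wderiv {0<..<L} v x\<bar>\<^sup>2) = ennreal (C.E x)"
  proof (subst AE_lebesgue_on_iff_negligible)
   show "negligible {x \<in> {0<..<L}. \<not> (ennreal ((fe (v x))\<^sup>2 * \<bar>wderiv {0<..<L} u x\<bar>\<^sup>2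
    + (1 - v x)\<^sup>2 / (4 * \<epsilon>) + \<epsilon> * \<bar>wderiv {0<..<L} v x\<bar>\<^sup>2) = ennreal (C.E x))}"
   proof (rule negligible_subset[OF n], rule subsetI, rule ccontr)
    fix x assume x: "x \<in> {x \<in> {0<..<L}. \<not> (ennreal ((fe (v x))\<^sup>2 * \<bar>wderiv {0<..<L} u x\<bar>\<^sup>2
     + (1 - v x)\<^sup>2 / (4 * \<epsilon>) + \<epsilon> * \<bar>wderiv {0<..<L} v x\<bar>\<^sup>2) = ennreal (C.E x))}"
     "x \<notin> {x \<in> {0<..<L}. wderiv {0<..<L} u x ~= c / (fe (v x))\<^sup>2} \<union> {x \<in> {0<..<L}. wderiv {0<..<L} v x ~= w x}"
    hence xe: "wderiv {0<..<L} u x = c / (fe (v x))\<^sup>2" "wderiv {0<..<L} v x = w x" by auto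
    have "fe (v x) ~= 0" using C.fe_pos[of "v x"] C.v_pos[of x] C.v_le[of x] x by auto
    hence "(fe (v x))\<^sup>2 * (c / (fe (v x))\<^sup>2)\<^sup>2 = c\<^sup>2 / (fe (v x))\<^sup>2" by (simp add: field_simps power2_eq_square)
    thus False using x(1) by (simp add: xe C.E_def)
   qed
  qed simp
 qed
 also have "\<dots> = ennreal (\<integral>x. C.E x \<partial>lebesgue_on {0<..<L})"
  by (rule nn_integral_eq_integral[OF int]) (use \<epsilon> in \<open>auto simp: C.E_def intro!: AE_I2\<close>)
 also have "(\<integral>x. C.E x \<partial>lebesgue_on {0<..<L}) = integral {0<..<L} C.E"
  by (rule lebesgue_integral_eq_integral[OF int]) simp
 also have "\<dots> = integral {0..L} C.E" by (simp add: integral_open_interval_real)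
 finally show ?thesis using that[OF cl] integral_unique[OF C.E_integral] by simp
qed

end

section \<open>The truncated degradation functions\<close>

lemma has_real_derivative_glue:
 fixes h :: "real => real"
 assumes l: "(p has_real_derivative D) (at t within A)" and r: "(q has_real_derivative D) (at t within B)"
  and A: "e1 < t" "{e1..t} \<subseteq> A" "!!x. e1 <= x ==> x <= t ==> h x = p x"
  and B: "t < e2" "{t..e2} \<subseteq> B" "!!x. t <= x ==> x <= e2 ==> h x = q x"
 shows "(h has_real_derivative D) (at t)"
proof -
 have 1: "(h has_real_derivative D) (at t within {e1..t})"
  by (rule has_field_derivative_transform_within[OF DERIV_subset[OF l A(2)] zero_less_one]) (use A in auto)
 have 2: "(h has_real_derivative D) (at t within {t..e2})"
  by (rule has_field_derivative_transform_within[OF DERIV_subset[OF r B(2)] zero_less_one]) (use B in auto)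
 have "(h has_real_derivative D) (at t within {e1..t} \<union> {t..e2})"
  using 1 2 by (simp add: has_field_derivative_iff Lim_within_Un)
 moreover have "{e1..t} \<union> {t..e2} = {e1..e2}" using A B by auto
 moreover have "at t within {e1..e2} = at t" by (rule at_within_Icc_interior) (use A B in auto)
 ultimately show ?thesis by simp
qed

locale trunc = degr +
 fixes \<epsilon> s :: real and \<psi> :: "real => real"
 assumes \<epsilon>: "0 < \<epsilon>" and s: "s \<in> {0<..<1}" and tp: "trunc_profile f \<epsilon> s \<psi>"
begin

definition "fe = f_trunc f \<epsilon> s \<psi>"
definition "\<psi>1 = deriv_in {0..1} \<psi>"
definition "fe1 t = (if t <= s then sqrt \<epsilon> * f1 t else \<psi>1 t)"

lemma tpD: "!!t. t \<in> {0..1} ==> \<psi> t \<in> {0..1}" "C2_on {0..1} \<psi>" "mono_on {0..1} \<psi>" "\<psi> 1 = 1"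
  "\<psi> s = sqrt \<epsilon> * f s" "\<psi>1 s = sqrt \<epsilon> * f1 s" "antimono_on {s..<1} (%t. \<psi>1 t / (1 - t))"
 using tp unfolding trunc_profile_def \<psi>1_def f1_def by blast+

lemma \<psi>_C1: "!!t. t \<in> {0..1} ==> (\<psi> has_real_derivative \<psi>1 t) (at t within {0..1})" "continuous_on {0..1} \<psi>1"
proof -
 obtain h1 h2 where h: "\<forall>x\<in>{0..1}. (\<psi> has_real_derivative h1 x) (at x within {0..1})"
   "\<forall>x\<in>{0..1}. (h1 has_real_derivative h2 x) (at x within {0..1})"
  using tpD(2) unfolding C2_on_def by blast
 have eq: "\<psi>1 t = h1 t" if "t \<in> {0..1}" for t
 proof -
  have nb: "at t within {0..1} ~= bot" using that by (simp add: trivial_limit_within islimpt_Icc)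
  show ?thesis unfolding \<psi>1_def
   by (rule vector_derivative_within[OF nb]) (use h(1) that in \<open>simp add: has_real_derivative_iff_has_vector_derivative\<close>)
 qed
 thus "!!t. t \<in> {0..1} ==> (\<psi> has_real_derivative \<psi>1 t) (at t within {0..1})" using h(1) by simp
 have "continuous_on {0..1} h1" using h(2) by (meson DERIV_continuous_on)
 thus "continuous_on {0..1} \<psi>1" using eq by (subst continuous_on_cong[OF refl, of _ _ h1]) auto
qed

lemma sqrt_\<epsilon>: "0 < sqrt \<epsilon>" using \<epsilon> by simp

text \<open>The hypothesis on \<open>\<psi>'/(1 - t)\<close> forces the derivative of the truncation to vanish linearly at
\<open>1\<close>, so the extension by \<open>1\<close> is continuously differentiable.\<close>

lemma \<psi>1_bounds: assumes t: "s <= t" "t < 1" shows "0 <= \<psi>1 t" "\<psi>1 t <= (1 - t) * (\<psi>1 s / (1 - s))"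
proof -
 have "(\<psi> has_real_derivative \<psi>1 t) (at t)" using \<psi>_C1(1)[of t] at_within_Icc_interior[of t 0 1] t s by auto
 note d = this
 show "0 <= \<psi>1 t"
 proof (rule ccontr)
  assume "\<not> 0 <= \<psi>1 t"
  then obtain e where e: "0 < e" "!!h. 0 < h ==> h < e ==> \<psi> (t + h) < \<psi> t"
   using DERIV_neg_dec_right[OF d] by force
  define h where "h = min e (1 - t) / 2"
  have "h <= e / 2" "h <= (1 - t) / 2" "0 < h" using e t by (auto simp: h_def)
  hence h: "0 < h" "h < e" "t + h <= 1" using e t by (auto simp: field_simps)
  have "\<psi> t <= \<psi> (t + h)" by (rule mono_onD[OF tpD(3)]) (use h t s in auto)
  thus False using e(2)[OF h(1,2)] by simp
 qed
 have "\<psi>1 t / (1 - t) <= \<psi>1 s / (1 - s)"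
  using tpD(7) t s unfolding monotone_on_def by simp
 thus "\<psi>1 t <= (1 - t) * (\<psi>1 s / (1 - s))" using t by (simp add: divide_le_eq mult.commute)
qed

lemma \<psi>1_1: "\<psi>1 1 = 0"
proof -
 have ne: "at (1::real) within {s..<1} ~= bot"
  using s by (simp add: trivial_limit_within)
 have lim: "(\<psi>1 \<longlongrightarrow> \<psi>1 1) (at 1 within {s..<1})"
 proof (rule tendsto_within_subset)
  show "(\<psi>1 \<longlongrightarrow> \<psi>1 1) (at 1 within {0..1})" using \<psi>_C1(2) by (simp add: continuous_on_def)
 qed (use s in auto)
 have up: "((%t. (1 - t) * (\<psi>1 s / (1 - s))) \<longlongrightarrow> (1 - 1) * (\<psi>1 s / (1 - s))) (at 1 within {s..<1})"
  by (intro tendsto_intros)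
 have ev: "\<forall>\<^sub>F t in at 1 within {s..<1}. s <= t & t < 1" by (simp add: eventually_at_filter)
 have "\<psi>1 1 <= (1 - 1) * (\<psi>1 s / (1 - s))"
  by (rule tendsto_le[OF ne up lim]) (rule eventually_mono[OF ev], rule \<psi>1_bounds(2), auto)
 moreover have "0 <= \<psi>1 1"
  by (rule tendsto_lowerbound[OF lim _ ne]) (rule eventually_mono[OF ev], rule \<psi>1_bounds(1), auto)
 ultimately show ?thesis by simp
qed

lemma fe_low: "0 <= t ==> t <= s ==> fe t = sqrt \<epsilon> * f t"
 by (simp add: fe_def f_trunc_def)

lemma fe_high: "s <= t ==> t <= 1 ==> fe t = \<psi> t"
 using s tpD(5) by (cases "t = s") (auto simp: fe_def f_trunc_def)

lemma fe1_high: "s <= t ==> fe1 t = \<psi>1 t"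
 using tpD(6) by (cases "t = s") (auto simp: fe1_def)

lemma f_mono: "0 <= x ==> x <= y ==> y < 1 ==> f x <= f y"
proof (rule DERIV_nonneg_imp_increasing_open[of x y f])
 assume xy: "0 <= x" "x <= y" "y < 1"
 show "continuous_on {x..y} f" by (rule continuous_on_subset[OF f_continuous]) (use xy in auto)
 fix z assume "x < z" "z < y"
 hence "z \<in> {0<..<1}" using xy by simp
 thus "\<exists>l. (f has_real_derivative l) (at z) & 0 <= l" using f_deriv[of z] f1_pos[of z] by (auto intro: less_imp_le)
qed

lemma fe_high_bounds: "s <= t ==> t <= 1 ==> sqrt \<epsilon> * f s <= fe t & fe t <= 1"
 using mono_onD[OF tpD(3), of s t] tpD(1)[of t] tpD(5) s by (auto simp: fe_high)

lemma fs_le: "sqrt \<epsilon> * f s <= 1" using fe_high_bounds[of s] s fe_low[of s] by simp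

sublocale profile fe fe1
proof
 show "fe 0 = 0" using fe_low[of 0] s f_zero by simp
 show "fe 1 = 1" using fe_high[of 1] s tpD(4) by simp
 show "0 < fe t & fe t <= 1" if t: "0 < t" "t <= 1" for t
 proof (cases "t <= s")
  case True
  have "sqrt \<epsilon> * f t <= sqrt \<epsilon> * f s" by (rule mult_left_mono[OF f_mono]) (use True t s \<epsilon> in auto)
  hence "sqrt \<epsilon> * f t <= 1" using fs_le by linarith
  thus ?thesis using fe_low[of t] True t s f_pos[of t] sqrt_\<epsilon> fs_le by simp
 next
  case False
  have "0 < sqrt \<epsilon> * f s" using f_pos[OF s] sqrt_\<epsilon> by simp
  thus ?thesis using fe_high_bounds[of t] False t by auto
 qed
 show "continuous_on {0..1} fe1"
 proof -
  have "continuous_on ({0..s} \<union> {s..1}) (%t. if t <= s then sqrt \<epsilon> * f1 t else \<psi>1 t)"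
  proof (rule continuous_on_cases)
   show "continuous_on {0..s} (%t. sqrt \<epsilon> * f1 t)"
    by (intro continuous_intros continuous_on_subset[OF f1_continuous]) (use s in auto)
   show "continuous_on {s..1} \<psi>1" by (rule continuous_on_subset[OF \<psi>_C1(2)]) (use s in auto)
  qed (use tpD(6) in auto)
  moreover have "{0..s} \<union> {s..1} = {0..1}" using s by auto
  ultimately show ?thesis by (simp add: fe1_def[abs_def])
 qed
 show "(fe has_real_derivative fe1 t) (at t)" if t: "t \<in> {0..1}" for t
 proof -
  have df: "((%x. sqrt \<epsilon> * f x) has_real_derivative sqrt \<epsilon> * f1 t) (at t within {0..<1})" if "t < 1"
   by (rule DERIV_cmult[OF f_deriv_within]) (use t that in simp)
  consider "t = 0" | "0 < t" "t < s" | "t = s" | "s < t" "t < 1" | "t = 1" using t by fastforce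
  thus ?thesis
  proof cases
   case 1
   have "((%x. sqrt \<epsilon> * f1 0 * x) has_real_derivative sqrt \<epsilon> * f1 0) (at t within UNIV)"
    using DERIV_cmult_Id by simp
   moreover have "((%x. sqrt \<epsilon> * f x) has_real_derivative sqrt \<epsilon> * f1 0) (at t within {0..<1})" using df 1 by simp
   ultimately have "(fe has_real_derivative sqrt \<epsilon> * f1 0) (at t)"
    by (rule has_real_derivative_glue[where ?e1.0 = "-1" and ?e2.0 = s])
     (use 1 s f_zero in \<open>auto simp: fe_def f_trunc_def f1_def\<close>)
   thus ?thesis using 1 s by (simp add: fe1_def)
  next
   case 2
   hence tt: "t < 1" using s by simp
   show ?thesis unfolding fe1_def
    by (rule has_real_derivative_glue[where ?e1.0 = 0 and ?e2.0 = s, OF DERIV_cong[OF df[OF tt]] DERIV_cong[OF df[OF tt]]])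
     (use 2 s fe_low in auto)
  next
   case 3
   hence tt: "t < 1" using s by simp
   show ?thesis
    by (rule has_real_derivative_glue[where ?e1.0 = 0 and ?e2.0 = 1, OF DERIV_cong[OF df[OF tt]] DERIV_cong[OF \<psi>_C1(1)[OF t]]])
     (use 3 s fe_low fe_high tpD(6) in \<open>auto simp: fe1_def\<close>)
  next
   case 4
   show ?thesis
    by (rule has_real_derivative_glue[where ?e1.0 = s and ?e2.0 = 1, OF DERIV_cong[OF \<psi>_C1(1)[OF t]] DERIV_cong[OF \<psi>_C1(1)[OF t]]])
     (use 4 s fe_high in \<open>auto simp: fe1_def\<close>)
  next
   case 5
   have "((%x. 1) has_real_derivative fe1 t) (at t within UNIV)"
    using \<psi>1_1 5 s by (simp add: fe1_def)
   show ?thesis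
    by (rule has_real_derivative_glue[where ?e1.0 = s and ?e2.0 = 2, OF DERIV_cong[OF \<psi>_C1(1)[OF t]] \<open>((%x. 1) has_real_derivative fe1 t) (at t within UNIV)\<close>])
     (use 5 s fe_high tpD(4) in \<open>auto simp: fe1_def fe_def f_trunc_def\<close>)
  qed
 qed
 show "fe1 t / (fe t ^ 3 * (1 - t)) <= fe1 x / (fe x ^ 3 * (1 - x))" if xt: "0 < x" "x <= t" "t < 1" for x t
 proof -
  have low: "fe1 t / (fe t ^ 3 * (1 - t)) <= fe1 x / (fe x ^ 3 * (1 - x))" if "0 < x" "x <= t" "t <= s" for x t
  proof -
   have e: "sqrt \<epsilon> * f1 y / ((sqrt \<epsilon> * f y) ^ 3 * (1 - y)) = 1 / \<epsilon> * (f1 y / (f y ^ 3 * (1 - y)))" for y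
   proof -
    have "sqrt \<epsilon> * f1 y / ((sqrt \<epsilon> * f y) ^ 3 * (1 - y)) = (sqrt \<epsilon> / sqrt \<epsilon>) * (f1 y / ((sqrt \<epsilon> * sqrt \<epsilon>) * (f y ^ 3 * (1 - y))))"
     by (simp add: power3_eq_cube mult_ac)
    thus ?thesis using \<epsilon> by simp
   qed
   have "1 / \<epsilon> * (f1 t / (f t ^ 3 * (1 - t))) <= 1 / \<epsilon> * (f1 x / (f x ^ 3 * (1 - x)))"
    by (rule mult_left_mono[OF q_antimono]) (use that s \<epsilon> in auto)
   thus ?thesis using that s by (simp only: fe_low fe1_def e if_True order_trans[OF that(2,3)] that(3) less_imp_le[OF that(1)] order_trans[OF less_imp_le[OF that(1)] that(2)])
  qed
  have high: "fe1 t / (fe t ^ 3 * (1 - t)) <= fe1 x / (fe x ^ 3 * (1 - x))" if "s <= x" "x <= t" "t < 1" for x t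
  proof -
   have "\<psi>1 t / (1 - t) <= \<psi>1 x / (1 - x)" using tpD(7) that s unfolding monotone_on_def by simp
   note le = this
   have mono: "\<psi> x <= \<psi> t" by (rule mono_onD[OF tpD(3)]) (use that s in auto)
   have px: "0 < \<psi> x"
   proof -
    have "0 < sqrt \<epsilon> * f s" using f_pos[OF s] sqrt_\<epsilon> by simp
    thus ?thesis using fe_high_bounds[of x] fe_high[of x] that by auto
   qed
   have "0 <= \<psi>1 x / (1 - x)" using \<psi>1_bounds(1)[of x] that by simp
   moreover have "0 < \<psi> x ^ 3" "\<psi> x ^ 3 <= \<psi> t ^ 3" using px mono by (auto intro: power_mono)
   ultimately have "\<psi>1 t / (1 - t) / \<psi> t ^ 3 <= \<psi>1 x / (1 - x) / \<psi> x ^ 3"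
    by (intro frac_le[OF _ le])
   thus ?thesis using that by (simp add: fe_high fe1_high mult.commute)
  qed
  consider "t <= s" | "s <= x" | "x <= s" "s <= t" by linarith
  thus ?thesis
  proof cases
   case 3
   thus ?thesis using low[of x s] high[of s t] xt by linarith
  qed (use low high xt in auto)
 qed
qed

end

context classical begin

lemma strict_left:
 assumes m1: "v (L / 2) < 1" and x: "0 <= x" "x < L / 2"
 shows "v (L / 2) < v x" "w x < 0"
proof -
 have "w 0 ~= 0" using slope_zero_imp_constant[of "L / 2"] m1 L by auto
 then interpret nonconstant fe fe1 \<epsilon> L a u v c d w by (rule nonconstantI)
 show "v (L / 2) < v x" "w x < 0" using v_strict(1)[of x "L / 2"] w_neg[of x] x0_half x by auto
qed

lemma level_reached:
 assumes x: "0 <= x" "x <= y" "y <= L / 2" and t: "v y <= t" "t <= v x"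
 obtains z where "x <= z" "z <= y" "v z = t"
 using IVT2'[of v y t x] t x L continuous_on_subset[OF v_cont, of "{x..y}"] that by auto

lemma u_increment_ge:
 assumes x: "0 <= x" "x <= y" "y <= L"
 shows "c * (y - x) <= u y - u x"
proof -
 have "u x - c * x <= u y - c * y"
 proof (rule DERIV_nonneg_imp_increasing_open[of x y "%z. u z - c * z", OF x(2)])
  show "continuous_on {x..y} (%z. u z - c * z)"
   by (intro continuous_intros continuous_on_subset[OF u_cont]) (use x in auto)
  fix z assume z: "x < z" "z < y"
  hence zi: "z \<in> {0<..<L}" "z \<in> {0..L}" using x by auto
  have f: "0 < fe (v z)" "fe (v z) <= 1" using fe_range[of "v z"] v_pos[OF zi(2)] v_le[OF zi(2)] by auto
  hence "(fe (v z))\<^sup>2 <= 1" by (simp add: power_le_one)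
  hence "c <= c / (fe (v z))\<^sup>2" using f c by (simp add: le_divide_eq mult_left_le)
  moreover have "((%z. u z - c * z) has_real_derivative c / (fe (v z))\<^sup>2 - c) (at z)"
   by (rule DERIV_diff[OF du_at[OF zi(1)] DERIV_cmult_Id])
  ultimately show "\<exists>l. ((%z. u z - c * z) has_real_derivative l) (at z) & 0 <= l" by force
 qed
 thus ?thesis by (simp add: algebra_simps)
qed

lemma u_mono: "0 <= x ==> x <= y ==> y <= L ==> u x <= u y"
proof -
 assume x: "0 <= x" "x <= y" "y <= L"
 have "0 <= c * (y - x)" using c x by simp
 thus ?thesis using u_increment_ge[OF x] by simp
qed

lemma u_bounds: "x \<in> {0..L} ==> 0 <= u x & u x <= a"
 using u_mono[of 0 x] u_mono[of x L] boundary by simp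

lemma u_half: "u (L / 2) = a / 2"
 using u_symmetric[of "L / 2"] L by simp

text \<open>By monotonicity \<open>1 - v \<ge> 1 - v(x)\<close> on \<open>[x, L/2]\<close>, and the integral of \<open>(1 - v)\<^sup>2/(4\<epsilon>)\<close> is
bounded by the energy.\<close>

lemma v_near_1:
 assumes x: "0 <= x" "x <= L / 2"
 shows "(1 - v x)\<^sup>2 * (L / 2 - x) <= 4 * \<epsilon> * integral {0..L} E"
proof -
 have pi: "(%x. (1 - v x)\<^sup>2 / (4 * \<epsilon>)) integrable_on {0..L}"
  by (intro integrable_continuous_real continuous_intros v_cont) (use \<epsilon> in auto)
 have pi': "(%x. (1 - v x)\<^sup>2 / (4 * \<epsilon>)) integrable_on {x..L / 2}"
  by (rule integrable_subinterval_real[OF pi]) (use x L in auto)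
 have "integral {x..L / 2} (%_. (1 - v x)\<^sup>2 / (4 * \<epsilon>)) <= integral {x..L / 2} (%x. (1 - v x)\<^sup>2 / (4 * \<epsilon>))"
 proof (rule integral_le[OF _ pi'])
  fix y assume y: "y \<in> {x..L / 2}"
  have "(1 - v x)\<^sup>2 <= (1 - v y)\<^sup>2"
   by (rule power_mono) (use v_antimono[of x y] v_le[of x] x y L in auto)
  thus "(1 - v x)\<^sup>2 / (4 * \<epsilon>) <= (1 - v y)\<^sup>2 / (4 * \<epsilon>)" using \<epsilon> by (simp add: divide_right_mono)
 qed (rule integrable_const_ivl)
 also have "\<dots> <= integral {0..L} (%x. (1 - v x)\<^sup>2 / (4 * \<epsilon>))"
  by (rule integral_subset_le[OF _ pi' pi]) (use x L \<epsilon> in auto)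
 also have "\<dots> <= integral {0..L} E" by (rule fracture_energy_le)
 finally have "(L / 2 - x) * ((1 - v x)\<^sup>2 / (4 * \<epsilon>)) <= integral {0..L} E" using x by simp
 thus ?thesis using \<epsilon> by (simp add: field_simps)
qed

lemma H_upper: "0 < t ==> t <= 1 ==> \<epsilon> * H t <= (1 - t)\<^sup>2 / 4 + \<epsilon> * d"
 using \<epsilon> by (simp add: H_def field_simps)

lemma d_pos: "0 < d" using less_le_trans[OF zero_less_power[OF c, of 2] d_ge] .

text \<open>The first integral, integrated over \<open>[0, x]\<close>: the elastic term gives \<open>c u(x)\<close> and the kinetic
one is an integral over levels above \<open>v(x)\<close>, small when \<open>v(x)\<close> is close to \<open>1\<close>.\<close>

lemma d_upper:
 assumes x: "0 <= x" "x <= L / 2"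
 shows "d * x <= c * u x + (1 + \<epsilon> * d) * (1 - v x)"
proof -
 define P where "P z = c * u z + (1 + \<epsilon> * d) * (1 - v z) - d * z" for z
 have "P 0 <= P x"
 proof (rule DERIV_nonneg_imp_increasing_open[of 0 x P, OF x(1)])
  show "continuous_on {0..x} P" unfolding P_def
   by (intro continuous_intros continuous_on_subset[OF u_cont] continuous_on_subset[OF v_cont]) (use x L in auto)
  fix z assume z: "0 < z" "z < x"
  hence zi: "z \<in> {0<..<L}" "z \<in> {0..L}" using x L by auto
  have D: "(P has_real_derivative c * (c / (fe (v z))\<^sup>2) + (1 + \<epsilon> * d) * (0 - w z) - d) (at z)"
   unfolding P_def
   by (rule DERIV_diff[OF DERIV_add[OF DERIV_cmult[OF du_at[OF zi(1)]] DERIV_cmult[OF DERIV_diff[OF DERIV_const dv_at[OF zi(1)]]]] DERIV_cmult_Id])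
  have wn: "w z <= 0" using w_nonpos[of z] z x by simp
  have ed: "0 < \<epsilon> * d" using \<epsilon> d_pos by simp
  have "(\<epsilon> * - w z)\<^sup>2 = \<epsilon> * H (v z)" using w_sq[OF zi(2), symmetric] by (simp add: power2_eq_square)
  also have "\<dots> <= (1 - v z)\<^sup>2 / 4 + \<epsilon> * d" using H_upper v_pos v_le zi(2) by blast
  also have "\<dots> <= 1 / 4 + \<epsilon> * d" using v_pos[OF zi(2)] v_le[OF zi(2)] by (simp add: power_le_one)
  also have "\<dots> <= (1 + \<epsilon> * d)\<^sup>2" using ed by (simp add: power2_sum)
  finally have "\<epsilon> * - w z <= 1 + \<epsilon> * d" by (rule power2_le_imp_le) (use ed in simp)
  hence "\<epsilon> * - w z * - w z <= (1 + \<epsilon> * d) * - w z" by (rule mult_right_mono) (use wn in simp)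
  hence 1: "\<epsilon> * (w z)\<^sup>2 <= (1 + \<epsilon> * d) * (0 - w z)" by (simp add: power2_eq_square)
  have "0 <= (1 - v z)\<^sup>2 / (4 * \<epsilon>)" using \<epsilon> by simp
  hence "0 <= c * (c / (fe (v z))\<^sup>2) + (1 + \<epsilon> * d) * (0 - w z) - d"
   using first_integral[OF zi(2)] 1 by (simp add: power2_eq_square)
  thus "\<exists>l. (P has_real_derivative l) (at z) & 0 <= l" using D by blast
 qed
 thus ?thesis by (simp add: P_def boundary)
qed

end

section \<open>Estimates for a single critical point\<close>

context degr begin

lemma RR_continuous: "0 < C ==> C < \<sigma> ==> continuous_on {0..pi / 2} (RR C)"
 unfolding RR_def[abs_def] by (rule indefinite_integral_continuous_1) (simp add: gr_integrable)

lemma RR_th_continuous: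
 assumes C: "0 < C" "C < \<sigma>" "C <= k t" and t: "0 <= t"
 shows "continuous_on {t..1} (%x. RR C (th C x))"
proof (rule continuous_on_compose2[OF RR_continuous[OF C(1,2)] th_continuous[OF C(1,3) t]])
 show "th C ` {t..1} \<subseteq> {0..pi / 2}"
  using th_bounds[OF C(1)] k_mono[of t] C t by (fastforce intro: less_imp_le)
qed

lemma RR_increment_antimono_C:
 assumes C: "0 < C" "C <= C'" "C' < \<sigma>" and ab: "0 <= a" "a <= b" "b <= pi / 2"
 shows "RR C' b - RR C' a <= RR C b - RR C a"
proof -
 have C0: "0 < C'" "C < \<sigma>" using C by auto
 have "integral {a..b} (gr C') <= integral {a..b} (gr C)"
  by (rule integral_le_open) (use C C0 ab in \<open>auto intro!: gr_integrable gr_antimono_C\<close>)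
 thus ?thesis using RR_increment[of C' a b] RR_increment[of C a b] C C0 ab by simp
qed

end

locale trunc_crit = trunc \<sigma> f \<epsilon> s \<psi> +
 classical "trunc.fe f \<epsilon> s \<psi>" "trunc.fe1 f \<epsilon> s \<psi>" \<epsilon> L a u v c d w
 for \<sigma> f \<epsilon> s \<psi> L a u v c d w
begin

lemma fe_sq: "0 <= t ==> t <= s ==> (fe t)\<^sup>2 = \<epsilon> * (f t)\<^sup>2"
 using \<epsilon> by (simp add: fe_low power_mult_distrib)

lemma f_k: "t < 1 ==> f t = k t / (1 - t)"
 by (simp add: k_def)

lemma H_low:
 assumes t: "0 < t" "t <= s"
 shows "4 * (\<epsilon> * H t) = (1 - t)\<^sup>2 * (1 - (2 * c / k t)\<^sup>2) + 4 * \<epsilon> * d"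
proof -
 have t1: "t < 1" using t s by simp
 have kt: "0 < k t" using k_pos[of t] t t1 by simp
 have fz: "f t ~= 0" using f_pos[of t] t t1 by simp
 have H: "H t = (1 - t)\<^sup>2 / (4 * \<epsilon>) - c\<^sup>2 / (\<epsilon> * (f t)\<^sup>2) + d"
  using t by (simp add: H_def fe_sq)
 have "4 * (\<epsilon> * H t) = (1 - t)\<^sup>2 - (2 * c)\<^sup>2 / (f t)\<^sup>2 + 4 * \<epsilon> * d"
  unfolding H using \<epsilon> fz by (simp add: field_simps)
 also have "(2 * c)\<^sup>2 / (f t)\<^sup>2 = (1 - t)\<^sup>2 * (2 * c / k t)\<^sup>2"
  using t1 by (simp add: f_k power_divide power_mult_distrib)
 finally show ?thesis by (simp add: algebra_simps)
qed

lemma w_low: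
 assumes x: "x \<in> {0..L}" "v x <= s"
 shows "(2 * \<epsilon> * w x)\<^sup>2 = (1 - v x)\<^sup>2 * (1 - (2 * c / k (v x))\<^sup>2) + 4 * \<epsilon> * d"
proof -
 have "(2 * \<epsilon> * w x)\<^sup>2 = 4 * (\<epsilon> * (\<epsilon> * (w x)\<^sup>2))" by (simp add: power2_eq_square)
 thus ?thesis using H_low[OF v_pos[OF x(1)] x(2)] w_sq[OF x(1)] by simp
qed

text \<open>The first integral at the minimum of \<open>v\<close>, written in terms of \<open>k\<close>.\<close>

lemma flux_eq:
 assumes m: "m <= s"
 shows "(2 * c)\<^sup>2 = (k m)\<^sup>2 * (1 + 4 * \<epsilon> * d / (1 - m)\<^sup>2)"
proof -
 have m1: "0 < m" "m < 1" using m s m_bounds by auto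
 have km: "0 < k m" using k_pos[of m] m1 by simp
 have "0 = (1 - m)\<^sup>2 * (1 - (2 * c / k m)\<^sup>2) + 4 * \<epsilon> * d" using w_low[of "L / 2"] w_half L m by simp
 hence "(2 * c / k m)\<^sup>2 = 1 + 4 * \<epsilon> * d / (1 - m)\<^sup>2" using m1 by (simp add: field_simps)
 thus ?thesis using km by (simp add: power_divide field_simps)
qed

text \<open>The sign of this difference decides whether \<open>u + RR C (th C v)\<close> increases or decreases along the
orbit: its two terms are the squares of the speeds of \<open>u\<close> and of \<open>RR C (th C v)\<close>, up to a common factor.\<close>

lemma speed_balance:
 assumes x: "x \<in> {0..L}" "v x <= s"
 shows "(2 * c)\<^sup>2 * (1 - v x)\<^sup>2 * (1 - (C / k (v x))\<^sup>2) - C\<^sup>2 * (2 * \<epsilon> * w x)\<^sup>2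
  = (1 - v x)\<^sup>2 * ((2 * c)\<^sup>2 - C\<^sup>2) - C\<^sup>2 * (4 * \<epsilon> * d)"
 unfolding w_low[OF x] by (simp add: power_divide algebra_simps)

lemma u_RR_deriv:
 assumes x: "x \<in> {0<..<L}" "v x <= s" and C: "0 < C" "C < k (v x)"
 defines "q \<equiv> sqrt (1 - (C / k (v x))\<^sup>2)"
 shows "((%z. u z + RR C (th C (v z))) has_real_derivative
  (1 - v x) / (2 * \<epsilon> * (k (v x))\<^sup>2 * q) * (2 * c * (1 - v x) * q + C * (2 * \<epsilon> * w x))) (at x)" "0 < q"
proof -
 have xi: "x \<in> {0..L}" using x by auto
 have t: "v x \<in> {0<..<1}" using v_pos[OF xi] x s by auto
 have kt: "0 < k (v x)" using k_pos[of "v x"] t by simp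
 have "C / k (v x) < 1" "0 < C / k (v x)" using C kt by auto
 hence "(C / k (v x))\<^sup>2 < 1" by (simp add: power_less_one_iff abs_square_less_1)
 thus q: "0 < q" by (simp add: q_def)
 have "(u has_real_derivative c / (fe (v x))\<^sup>2) (at x)" by (rule du_at[OF x(1)])
 moreover have "c / (fe (v x))\<^sup>2 = c * (1 - v x)\<^sup>2 / (\<epsilon> * (k (v x))\<^sup>2)"
  using t x by (simp add: fe_sq f_k power_divide)
 ultimately have 1: "(u has_real_derivative c * (1 - v x)\<^sup>2 / (\<epsilon> * (k (v x))\<^sup>2)) (at x)" by simp
 have 2: "((%z. RR C (th C (v z))) has_real_derivative C * (1 - v x) / ((k (v x))\<^sup>2 * q) * w x) (at x)"
  unfolding q_def by (rule DERIV_chain2[OF RR_th_deriv[OF C t] dv_at[OF x(1)]])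
 have "c * (1 - v x)\<^sup>2 / (\<epsilon> * (k (v x))\<^sup>2) + C * (1 - v x) / ((k (v x))\<^sup>2 * q) * w x
  = (1 - v x) / (2 * \<epsilon> * (k (v x))\<^sup>2 * q) * (2 * c * (1 - v x) * q + C * (2 * \<epsilon> * w x))"
  using q kt \<epsilon> by (simp add: field_simps power2_eq_square)
 thus "((%z. u z + RR C (th C (v z))) has_real_derivative
  (1 - v x) / (2 * \<epsilon> * (k (v x))\<^sup>2 * q) * (2 * c * (1 - v x) * q + C * (2 * \<epsilon> * w x))) (at x)"
  using DERIV_add[OF 1 2] by simp
qed

lemma u_RR_continuous:
 assumes C: "0 < C" "C < \<sigma>" "C <= k m" and x: "0 <= x" "y <= L"
 shows "continuous_on {x..y} (%z. u z + RR C (th C (v z)))"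
proof -
 have "continuous_on {0..L} (%z. RR C (th C (v z)))"
  by (rule continuous_on_compose2[OF RR_th_continuous[OF C] v_cont]) (use m_bounds v_min v_le in auto)
 thus ?thesis
  by (intro continuous_on_add) (use x u_cont in \<open>auto intro: continuous_on_subset\<close>)
qed

text \<open>With \<open>C = k(m)\<close> the orbit is faster than the geodesic (its level contains the extra \<open>4\<epsilon>d\<close>), so
\<open>u + RR(C, th C v)\<close> does not increase on the left half.\<close>

lemma u_increment_le_RR:
 assumes x: "0 <= x" "x <= y" "y <= L / 2" and vx: "v x <= s"
 shows "u y - u x <= RR (k m) (th (k m) (v x)) - RR (k m) (th (k m) (v y))"
proof -
 have ms: "m <= s" using v_min[of x] vx x L by auto
 have m1: "0 < m" "m < 1" using ms s m_bounds by auto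
 have km: "0 < k m" "k m < \<sigma>" using k_pos[of m] k_less_\<sigma>[of m] m1 by auto
 have "u y + RR (k m) (th (k m) (v y)) <= u x + RR (k m) (th (k m) (v x))"
 proof (rule DERIV_nonpos_imp_decreasing_open[of x y "%z. u z + RR (k m) (th (k m) (v z))", OF x(2)])
  show "continuous_on {x..y} (%z. u z + RR (k m) (th (k m) (v z)))"
   by (rule u_RR_continuous) (use km x L in auto)
  fix z assume z: "x < z" "z < y"
  hence zi: "z \<in> {0<..<L}" "z \<in> {0..L}" using x L by auto
  have mz: "m < v z" "w z < 0" using strict_left[of z] m1 z x by auto
  have vz: "v z <= s" using v_antimono[of x z] vx x z by simp
  have v1: "v z < 1" using vz s by simp
  have kz: "k m < k (v z)" using k_strict_mono[of m "v z"] mz v1 m1 by simp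
  note D = u_RR_deriv[OF zi(1) vz km(1) kz]
  define q where "q = sqrt (1 - (k m / k (v z))\<^sup>2)"
  have q: "0 < q" "q\<^sup>2 = 1 - (k m / k (v z))\<^sup>2" using D(2) by (auto simp: q_def)
  have ed: "0 <= 4 * \<epsilon> * d" using \<epsilon> d_pos by simp
  have "(1 - v z)\<^sup>2 <= (1 - m)\<^sup>2" by (rule power_mono) (use mz v1 in auto)
  hence r: "(1 - v z)\<^sup>2 / (1 - m)\<^sup>2 <= 1" using m1 by simp
  have "(2 * c * (1 - v z) * q)\<^sup>2 - (k m * (2 * \<epsilon> * - w z))\<^sup>2
   = (1 - v z)\<^sup>2 * ((2 * c)\<^sup>2 - (k m)\<^sup>2) - (k m)\<^sup>2 * (4 * \<epsilon> * d)"
   using speed_balance[OF zi(2) vz, of "k m"] by (simp add: power_mult_distrib q(2))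
  also have "\<dots> = (k m)\<^sup>2 * (4 * \<epsilon> * d) * ((1 - v z)\<^sup>2 / (1 - m)\<^sup>2 - 1)"
   unfolding flux_eq[OF ms] by (simp add: algebra_simps)
  also have "\<dots> <= 0" by (rule mult_nonneg_nonpos) (use r ed in auto)
  finally have "(2 * c * (1 - v z) * q)\<^sup>2 <= (k m * (2 * \<epsilon> * - w z))\<^sup>2" by simp
  hence "2 * c * (1 - v z) * q <= k m * (2 * \<epsilon> * - w z)"
   by (rule power2_le_imp_le) (intro mult_nonneg_nonneg, use km \<epsilon> mz in auto)
  moreover have "k m * (2 * \<epsilon> * - w z) = - (k m * (2 * \<epsilon> * w z))" by simp
  ultimately have "2 * c * (1 - v z) * q + k m * (2 * \<epsilon> * w z) <= 0" by linarith
  hence "(1 - v z) / (2 * \<epsilon> * (k (v z))\<^sup>2 * q) * (2 * c * (1 - v z) * q + k m * (2 * \<epsilon> * w z)) <= 0"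
   by (rule mult_nonneg_nonpos[rotated]) (use v1 \<epsilon> q in auto)
  thus "\<exists>l. ((%z. u z + RR (k m) (th (k m) (v z))) has_real_derivative l) (at z) & l <= 0"
   using D(1) unfolding q_def by blast
 qed
 thus ?thesis by simp
qed

text \<open>The constant \<open>C\<close> is defined by \<open>C\<^sup>2 4\<epsilon>d = ((2c)\<^sup>2 - C\<^sup>2)(1 - t)\<^sup>2\<close>, so that the difference in
\<open>speed_balance\<close> is nonnegative at all levels \<open>v \<le> t\<close>.\<close>

lemma u_increment_ge_RR:
 assumes y: "0 <= y" "y <= L / 2" "v y = t" and t: "m < t" "t <= s"
 defines "C \<equiv> 2 * c / sqrt (1 + 4 * \<epsilon> * d / (1 - t)\<^sup>2)"
 shows "RR C (th C t) - RR C (th C m) <= u (L / 2) - u y" "0 < C" "C <= k m"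
proof -
 have ms: "m <= s" using t by simp
 have m1: "0 < m" "m < 1" "t < 1" using t s m_bounds by auto
 have km: "0 < k m" "k m < \<sigma>" using k_pos[of m] k_less_\<sigma>[of m] m1 by auto
 have ed: "0 < 4 * \<epsilon> * d" using \<epsilon> d_pos by simp
 define B2 where "B2 = 1 + 4 * \<epsilon> * d / (1 - t)\<^sup>2"
 have B2: "1 < B2" using ed m1 by (simp add: B2_def)
 have C: "C = 2 * c / sqrt B2" by (simp add: C_def B2_def)
 show C0: "0 < C" using B2 c by (simp add: C)
 have CB: "(2 * c)\<^sup>2 = C\<^sup>2 * B2" using B2 by (simp add: C power_divide)
 have "(1 - t)\<^sup>2 <= (1 - m)\<^sup>2" by (rule power_mono) (use t m1 in auto)
 hence "4 * \<epsilon> * d / (1 - m)\<^sup>2 <= 4 * \<epsilon> * d / (1 - t)\<^sup>2"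
  by (rule divide_left_mono) (use ed m1 in auto)
 hence "(k m)\<^sup>2 * (1 + 4 * \<epsilon> * d / (1 - m)\<^sup>2) <= (k m)\<^sup>2 * B2" by (intro mult_left_mono) (auto simp: B2_def)
 hence "C\<^sup>2 * B2 <= (k m)\<^sup>2 * B2" using CB flux_eq[OF ms] by simp
 hence "C\<^sup>2 <= (k m)\<^sup>2" using B2 by simp
 thus Ckm: "C <= k m" by (rule power2_le_imp_le) (use km in simp)
 have Cs: "C < \<sigma>" using Ckm km by simp
 have "u y + RR C (th C (v y)) <= u (L / 2) + RR C (th C (v (L / 2)))"
 proof (rule DERIV_nonneg_imp_increasing_open[of y "L / 2" "%z. u z + RR C (th C (v z))", OF y(2)])
  show "continuous_on {y..L / 2} (%z. u z + RR C (th C (v z)))"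
   by (rule u_RR_continuous) (use C0 Cs Ckm y L in auto)
  fix z assume z: "y < z" "z < L / 2"
  hence zi: "z \<in> {0<..<L}" "z \<in> {0..L}" using y L by auto
  have mz: "m < v z" "w z < 0" using strict_left[of z] m1 z y by auto
  have vt: "v z <= t" using v_antimono[of y z] y z by simp
  have vz: "v z <= s" "v z < 1" using vt t m1 by auto
  have kz: "C < k (v z)" using k_strict_mono[of m "v z"] mz vz m1 Ckm by simp
  note D = u_RR_deriv[OF zi(1) vz(1) C0 kz]
  define q where "q = sqrt (1 - (C / k (v z))\<^sup>2)"
  have q: "0 < q" "q\<^sup>2 = 1 - (C / k (v z))\<^sup>2" using D(2) by (auto simp: q_def)
  have "(1 - t)\<^sup>2 <= (1 - v z)\<^sup>2" by (rule power_mono) (use vt m1 in auto)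
  hence r: "1 <= (1 - v z)\<^sup>2 / (1 - t)\<^sup>2" using m1 by simp
  have "(2 * c * (1 - v z) * q)\<^sup>2 - (C * (2 * \<epsilon> * - w z))\<^sup>2
   = (1 - v z)\<^sup>2 * ((2 * c)\<^sup>2 - C\<^sup>2) - C\<^sup>2 * (4 * \<epsilon> * d)"
   using speed_balance[OF zi(2) vz(1), of C] by (simp add: power_mult_distrib q(2))
  also have "\<dots> = C\<^sup>2 * (4 * \<epsilon> * d) * ((1 - v z)\<^sup>2 / (1 - t)\<^sup>2 - 1)"
   unfolding CB B2_def by (simp add: algebra_simps)
  also have "\<dots> \<ge> 0" by (rule mult_nonneg_nonneg) (use r ed in auto)
  finally have "(C * (2 * \<epsilon> * - w z))\<^sup>2 <= (2 * c * (1 - v z) * q)\<^sup>2" by simp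
  hence "C * (2 * \<epsilon> * - w z) <= 2 * c * (1 - v z) * q"
   by (rule power2_le_imp_le) (use c vz q in simp)
  moreover have "C * (2 * \<epsilon> * - w z) = - (C * (2 * \<epsilon> * w z))" by simp
  ultimately have "0 <= 2 * c * (1 - v z) * q + C * (2 * \<epsilon> * w z)" by linarith
  hence "0 <= (1 - v z) / (2 * \<epsilon> * (k (v z))\<^sup>2 * q) * (2 * c * (1 - v z) * q + C * (2 * \<epsilon> * w z))"
   by (rule mult_nonneg_nonneg[rotated]) (use vz \<epsilon> q in auto)
  thus "\<exists>l. ((%z. u z + RR C (th C (v z))) has_real_derivative l) (at z) & 0 <= l"
   using D(1) unfolding q_def by blast
 qed
 thus "RR C (th C t) - RR C (th C m) <= u (L / 2) - u y" using y(3) by simp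
qed

text \<open>A bound for the speed of \<open>u\<close> where the truncation is active; it is asymptotically the flux \<open>c\<close>.\<close>

definition "slope = c / (\<epsilon> * (f s)\<^sup>2)"

lemma u_increment_le_slope:
 assumes x: "0 <= x" "x <= y" "y <= L / 2" and vy: "s <= v y"
 shows "u y - u x <= slope * (y - x)"
proof -
 have "u y - slope * y <= u x - slope * x"
 proof (rule DERIV_nonpos_imp_decreasing_open[of x y "%z. u z - slope * z", OF x(2)])
  show "continuous_on {x..y} (%z. u z - slope * z)"
   by (intro continuous_intros continuous_on_subset[OF u_cont]) (use x L in auto)
  fix z assume z: "x < z" "z < y"
  hence zi: "z \<in> {0<..<L}" "z \<in> {0..L}" using x L by auto
  have "s <= v z" using v_antimono[of z y] vy x z by simp
  hence "sqrt \<epsilon> * f s <= fe (v z)" using fe_high_bounds v_le[OF zi(2)] by blast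
  moreover have "0 < sqrt \<epsilon> * f s" using f_pos[OF s] \<epsilon> by simp
  ultimately have "(sqrt \<epsilon> * f s)\<^sup>2 <= (fe (v z))\<^sup>2" "0 < (sqrt \<epsilon> * f s)\<^sup>2" by (auto intro: power_mono)
  hence "c / (fe (v z))\<^sup>2 <= c / (sqrt \<epsilon> * f s)\<^sup>2" using c by (intro divide_left_mono mult_pos_pos) auto
  also have "\<dots> = slope" using \<epsilon> by (simp add: slope_def power_mult_distrib)
  finally have "c / (fe (v z))\<^sup>2 - slope <= 0" by simp
  moreover have "((%z. u z - slope * z) has_real_derivative c / (fe (v z))\<^sup>2 - slope) (at z)"
   by (rule DERIV_diff[OF du_at[OF zi(1)] DERIV_cmult_Id])
  ultimately show "\<exists>l. ((%z. u z - slope * z) has_real_derivative l) (at z) & l <= 0" by blast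
 qed
 thus ?thesis by (simp add: algebra_simps)
qed

lemma slope_pos: "0 < slope" using c \<epsilon> f_pos[OF s] by (simp add: slope_def)

text \<open>The orbit spends its time either above the threshold \<open>s\<close>, where the slope bounds the speed, or
below, where the geodesic comparison bounds the displacement by half an opening.\<close>

lemma u_core_le:
 assumes x: "0 <= x" "x <= L / 2" and C: "m < 1 ==> C <= k m" "0 < C" "C < \<sigma>"
 shows "u (L / 2) - u x <= slope * (L / 2 - x) + S C / 2"
proof -
 have core: "u (L / 2) - u y <= S C / 2" if y: "0 <= y" "y <= L / 2" "v y <= s" for y
 proof -
  have m1: "0 < m" "m < 1" using v_min[of y] y s L m_bounds by auto
  have km: "0 < k m" "k m < \<sigma>" using k_pos[of m] k_less_\<sigma>[of m] m1 by auto
  have kv: "k m <= k (v y)" using k_mono[of m "v y"] v_min[of y] v_le[of y] y m1 L by simp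
  have "u (L / 2) - u y <= RR (k m) (th (k m) (v y)) - RR (k m) (th (k m) m)"
   by (rule u_increment_le_RR) (use y in auto)
  also have "\<dots> = RR (k m) (th (k m) (v y))" using km by simp
  also have "\<dots> <= RR (k m) (pi / 2)"
   using th_bounds[OF km(1) kv] by (intro RR_mono) (use km in auto)
  also have "\<dots> = S (k m) / 2" by (simp add: S_def)
  also have "\<dots> <= S C / 2" using S_antimono[of C "k m"] C m1 km by simp
  finally show ?thesis .
 qed
 have S0: "0 <= S C" using S_pos[OF C(2,3)] by simp
 have sl: "0 <= slope * (L / 2 - x)" using slope_pos x by simp
 consider "v x <= s" | "s <= m" | "m <= s" "s <= v x" by linarith
 thus ?thesis
 proof cases
  case 1 thus ?thesis using core[of x] x sl by simp
 next
  case 2 thus ?thesis using u_increment_le_slope[of x "L / 2"] x S0 by simp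
 next
  case 3
  obtain y where y: "x <= y" "y <= L / 2" "v y = s" by (rule level_reached[of x "L / 2" s]) (use x 3 in auto)
  have "u (L / 2) - u y <= S C / 2" using core[of y] x y by simp
  moreover have "u y - u x <= slope * (y - x)" using u_increment_le_slope[of x y] x y by simp
  moreover have "slope * (y - x) <= slope * (L / 2 - x)" using slope_pos y by simp
  ultimately show ?thesis by simp
 qed
qed

text \<open>Far from the well \<open>v\<close> is close to \<open>1\<close>, so the angles between the levels \<open>v(x)\<close> and \<open>s\<close> are all
close to each other and the geodesic part of the displacement is small. The modulus of
continuity of \<open>arccos\<close> enters as the hypothesis on \<open>\<delta>\<close>.\<close>

lemma u_tail_le:
 assumes x: "0 <= x" "x <= L / 2" and vx: "1 / 2 <= v x"
  and \<delta>: "0 <= \<delta>" "!!p q. 0 <= p ==> p <= q ==> q <= 1 ==> q - p <= 1 - k (v x) / \<sigma> ==> arccos p - arccos q <= \<delta>"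
 shows "u x <= slope * x + \<rho> (1 / 2) * \<delta>"
proof (cases "s <= v x")
 case True
 have "0 <= \<rho> (1 / 2) * \<delta>" using \<rho>_pos[of "1 / 2"] \<delta>(1) by simp
 thus ?thesis using u_increment_le_slope[of 0 x] x True boundary by simp
next
 case False
 hence vs: "v x <= s" by simp
 have m1: "0 < m" "m < 1" using v_min[of x] x vs s L m_bounds by auto
 have mv: "m <= v x" using v_min[of x] x L by simp
 have km: "0 < k m" "k m < \<sigma>" using k_pos[of m] k_less_\<sigma>[of m] m1 by auto
 have v1: "v x < 1" using vs s by simp
 have kv: "k m <= k (v x)" "k (v x) <= k s" using k_mono[of m "v x"] k_mono[of "v x" s] mv vs v1 m1 s by auto
 have ks: "k s < \<sigma>" using k_less_\<sigma>[of s] s by simp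
 obtain y where y: "0 <= y" "y <= x" "v y = s"
  by (rule level_reached[of 0 x s]) (use x vs s boundary in auto)
 define p where "p = th (k m) (v x)"
 define q where "q = th (k m) s"
 have pq: "0 <= p" "q < pi / 2" "p <= q"
 proof -
  show "0 <= p" using th_bounds[OF km(1) kv(1)] by (simp add: p_def)
  show "q < pi / 2" using th_bounds[OF km(1), of s] kv by (simp add: q_def)
  have "k m / k s <= k m / k (v x)" using kv km by (intro divide_left_mono) auto
  thus "p <= q" unfolding p_def q_def th_def
   using quot_k_bounds[OF km(1), of s] quot_k_bounds[OF km(1), of "v x"] kv by (intro arccos_le_arccos) auto
 qed
 have "u x - u y <= RR (k m) q - RR (k m) p"
  using u_increment_le_RR[of y x] y x s by (simp add: p_def q_def)
 also have "\<dots> <= \<rho> (1 / 2) * (q - p)"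
 proof (rule RR_increment_le[OF km pq(1,3)])
  fix \<theta> assume th: "p < \<theta>" "\<theta> < q"
  have "gr (k m) \<theta> <= gr (k m) p" by (rule gr_antimono) (use km pq th in auto)
  also have "\<dots> = \<rho> (v x)" unfolding p_def by (rule gr_th) (use km kv vx v1 in auto)
  also have "\<dots> <= \<rho> (1 / 2)" by (rule \<rho>_antimono) (use vx v1 in auto)
  finally show "gr (k m) \<theta> <= \<rho> (1 / 2)" .
 qed (use pq in simp)
 also have "\<dots> <= \<rho> (1 / 2) * \<delta>"
 proof (rule mult_left_mono)
  have kv0: "0 < k (v x)" "0 < k s" using km kv by auto
  have "arccos (k m / k s) - arccos (k m / k (v x)) <= \<delta>"
  proof (rule \<delta>(2))
   show "0 <= k m / k s" using km kv0 by simp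
   show "k m / k s <= k m / k (v x)" using kv km by (intro divide_left_mono) auto
   show "k m / k (v x) <= 1" using kv kv0 by simp
   have "k m / k (v x) - k m / k s = k m / k (v x) * (1 - k (v x) / k s)" using kv0 by (simp add: field_simps)
   also have "\<dots> <= 1 * (1 - k (v x) / k s)"
    by (rule mult_right_mono) (use kv kv0 in auto)
   also have "\<dots> <= 1 - k (v x) / \<sigma>" using kv0 ks by (simp add: frac_le)
   finally show "k m / k (v x) - k m / k s <= 1 - k (v x) / \<sigma>" .
  qed
  thus "q - p <= \<delta>" by (simp add: p_def q_def th_def)
  show "0 <= \<rho> (1 / 2)" using \<rho>_pos[of "1 / 2"] by simp
 qed
 finally have 1: "u x - u y <= \<rho> (1 / 2) * \<delta>" .
 have "u y - u 0 <= slope * (y - 0)" using u_increment_le_slope[of 0 y] x y by simp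
 moreover have "slope * y <= slope * x" using slope_pos y by simp
 ultimately show ?thesis using 1 boundary by simp
qed

text \<open>The comparison constant \<open>C\<close> is replaced by a fixed larger \<open>C1\<close>, for which the opening is
smaller; the level \<open>t\<close> is so high that the angles of the geodesic of \<open>C1\<close> are exhausted. The
correction term is the initial angle, since \<open>C\<close> is slightly smaller than \<open>k(m)\<close>.\<close>

lemma u_core_ge:
 assumes x: "0 <= x" "x <= L / 2" and t: "m < t" "t <= s" "t <= v x"
 defines "C \<equiv> 2 * c / sqrt (1 + 4 * \<epsilon> * d / (1 - t)\<^sup>2)"
 assumes C1: "C <= C1" "C1 < \<sigma>" "C / k t <= C1 / \<sigma>"
 shows "S C1 / 2 - r C1 * arccos (C / k m) <= u (L / 2) - u x"
proof -
 obtain y where y: "x <= y" "y <= L / 2" "v y = t"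
  by (rule level_reached[of x "L / 2" t]) (use x t in auto)
 have "0 <= y" using x y by simp
 note lo = u_increment_ge_RR[OF this y(2,3) t(1,2), folded C_def]
 have C0: "0 < C1" using lo C1 by simp
 have t1: "t < 1" "0 < m" using t s m_bounds by auto
 have kt: "k m <= k t" "k t <= \<sigma>" using k_mono[of m t] k_mono[of t 1] t t1 by auto
 have km: "0 < k m" using lo by simp
 note T = th_bounds[OF lo(2,3)] th_bounds[OF lo(2) order_trans[OF lo(3) kt(1)]]
 have qb: "0 <= C / k t" "C / k t <= C / k m" "C / k m <= 1" using lo kt km by (auto intro: divide_left_mono)
 have th_le: "th C m <= th C t" unfolding th_def by (rule arccos_le_arccos) (use qb in auto)
 have "\<Theta> C1 <= th C t" unfolding th_def \<Theta>_def
  by (rule arccos_le_arccos) (use qb C1 \<sigma>_pos in \<open>auto simp: divide_le_eq\<close>)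
 hence 1: "RR C1 (\<Theta> C1) <= RR C1 (th C t)"
  using \<Theta>_bounds[OF C0 C1(2)] T by (intro RR_mono) (use C0 C1 in auto)
 have "RR C1 (th C m) - RR C1 0 <= r C1 * (th C m - 0)"
  by (rule RR_increment_le) (use C0 C1 T gr_bounds[of _ C1] in auto)
 hence 2: "RR C1 (th C m) <= r C1 * arccos (C / k m)" by (simp add: th_def)
 have "RR C1 (th C t) - RR C1 (th C m) <= RR C (th C t) - RR C (th C m)"
  by (rule RR_increment_antimono_C) (use lo C1 T th_le in auto)
 also have "\<dots> <= u (L / 2) - u y" by (rule lo(1))
 also have "\<dots> <= u (L / 2) - u x" using u_mono[of x y] x y L by simp
 finally show ?thesis using 1 2 S_eq[OF C0 C1(2)] by simp
qed

end

section \<open>Limits of sequences of critical points\<close>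

text \<open>A sequence of critical points with \<open>\<epsilon> \<rightarrow> 0\<close> and bounded energy along which the flux, the level
and the minimum converge.\<close>

locale crit_seq = degr +
 fixes \<epsilon> s :: "nat => real" and \<psi> :: "nat => real => real" and L :: real and an :: "nat => real"
  and u v :: "nat => real => real" and c d :: "nat => real" and w :: "nat => real => real"
  and a c0 d0 m0 M :: real
 assumes crit: "!!n. trunc_crit \<sigma> f (\<epsilon> n) (s n) (\<psi> n) L (an n) (u n) (v n) (c n) (d n) (w n)"
  and \<epsilon>_lim: "\<epsilon> ----> 0" and s_lim: "s ----> 1" and fs_lim: "(%n. sqrt (\<epsilon> n) * f (s n)) ----> 1"
  and a_lim: "an ----> a" and a0: "0 < a" and c_lim: "c ----> c0" and d_lim: "d ----> d0"
  and m_lim: "(%n. v n (L / 2)) ----> m0"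
  and bound: "!!n. 2 * c n * an n - d n * L + 4 * integral {v n (L / 2)..1}
   (%t. sqrt (\<epsilon> n * classical.H (trunc.fe f (\<epsilon> n) (s n) (\<psi> n)) (\<epsilon> n) (c n) (d n) t)) <= M"
begin

interpretation tc: trunc_crit \<sigma> f "\<epsilon> n" "s n" "\<psi> n" L "an n" "u n" "v n" "c n" "d n" "w n" for n
 by (rule crit)

definition "energy n = 2 * c n * an n - d n * L + 4 * integral {v n (L / 2)..1}
   (%t. sqrt (\<epsilon> n * classical.H (trunc.fe f (\<epsilon> n) (s n) (\<psi> n)) (\<epsilon> n) (c n) (d n) t))"

lemma E_le: "integral {0..L} (tc.E n) <= M"
 using integral_unique[OF tc.E_integral] bound by simp

lemma L_pos: "0 < L" by (rule tc.L)

lemma v_lim_left: assumes x: "0 <= x" "x < L / 2" shows "(%n. v n x) ----> 1"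
proof -
 have "(%n. (1 - v n x)\<^sup>2) ----> 0"
 proof (rule tendsto_sandwich[where f = "%_. 0" and h = "%n. 4 * \<epsilon> n * (M / (L / 2 - x))"])
  show "\<forall>\<^sub>F n in sequentially. (1 - v n x)\<^sup>2 <= 4 * \<epsilon> n * (M / (L / 2 - x))"
  proof (rule always_eventually, rule allI)
   fix n
   have "(1 - v n x)\<^sup>2 * (L / 2 - x) <= 4 * \<epsilon> n * integral {0..L} (tc.E n)"
    by (rule tc.v_near_1) (use x in auto)
   also have "\<dots> <= 4 * \<epsilon> n * M" by (rule mult_left_mono[OF E_le]) (use tc.\<epsilon>[of n] in simp)
   finally show "(1 - v n x)\<^sup>2 <= 4 * \<epsilon> n * (M / (L / 2 - x))" using x by (simp add: pos_le_divide_eq)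
  qed
  have "(%n. 4 * \<epsilon> n * (M / (L / 2 - x))) ----> 4 * 0 * (M / (L / 2 - x))" by (intro tendsto_intros \<epsilon>_lim)
  thus "(%n. 4 * \<epsilon> n * (M / (L / 2 - x))) ----> 0" by simp
 qed auto
 hence "(%n. sqrt ((1 - v n x)\<^sup>2)) ----> sqrt 0" by (rule tendsto_real_sqrt)
 hence "(%n. \<bar>1 - v n x\<bar>) ----> 0" by simp
 hence "(%n. 1 - v n x) ----> 0" by (rule tendsto_rabs_zero_cancel)
 hence "(%n. 1 - (1 - v n x)) ----> 1 - 0" by (intro tendsto_intros)
 thus ?thesis by simp
qed

lemma v_lim: assumes x: "x \<in> {0..L}" "x ~= L / 2" shows "(%n. v n x) ----> 1"
proof (cases "x < L / 2")
 case True thus ?thesis using v_lim_left[of x] x by simp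
next
 case False
 hence "(%n. v n (L - x)) ----> 1" using x by (intro v_lim_left) auto
 thus ?thesis using tc.v_symmetric[OF x(1)] by simp
qed

lemma slope_lim: "tc.slope ----> c0"
proof -
 have "(%n. c n / (sqrt (\<epsilon> n) * f (s n))\<^sup>2) ----> c0 / 1\<^sup>2"
  by (intro tendsto_intros c_lim fs_lim) simp
 moreover have "c n / (sqrt (\<epsilon> n) * f (s n))\<^sup>2 = tc.slope n" for n
  using tc.\<epsilon>[of n] by (simp add: tc.slope_def power_mult_distrib)
 ultimately show ?thesis by simp
qed

text \<open>From below the speed of \<open>u\<close> is at least \<open>c\<close>; from above the tail estimate applies, whose slope
tends to \<open>c0\<close> and whose error is controlled by the uniform continuity of \<open>arccos\<close>.\<close>

lemma u_lim_left: assumes x: "0 <= x" "x < L / 2" shows "(%n. u n x) ----> c0 * x"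
proof (rule order_tendstoI)
 fix y assume "y < c0 * x"
 moreover have "(%n. c n * x) ----> c0 * x" by (intro tendsto_intros c_lim)
 ultimately have "\<forall>\<^sub>F n in sequentially. y < c n * x" by (rule order_tendstoD[rotated])
 thus "\<forall>\<^sub>F n in sequentially. y < u n x"
 proof eventually_elim
  case (elim n)
  show ?case using tc.u_increment_ge[of 0 x n] tc.boundary(1)[of n] x elim L_pos by simp
 qed
next
 fix y assume y: "c0 * x < y"
 have \<rho>0: "0 < \<rho> (1 / 2)" by (rule \<rho>_pos) simp
 define e where "e = (y - c0 * x) / (2 * \<rho> (1 / 2))"
 have e: "0 < e" using y \<rho>0 by (simp add: e_def)
 have "uniformly_continuous_on {-1..1} arccos"
  by (rule compact_uniformly_continuous[OF continuous_on_arccos']) simp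
 then obtain \<eta> where \<eta>: "0 < \<eta>" "!!p q. p \<in> {-1..1} ==> q \<in> {-1..1} ==> dist p q < \<eta> ==> dist (arccos p) (arccos q) < e"
  unfolding uniformly_continuous_on_def using e by metis
 have "(%n. k (v n x)) ----> k 1"
  by (rule continuous_on_tendsto_compose[OF k_continuous v_lim_left[OF x]])
   (use x L_pos tc.v_pos[of x] tc.v_le[of x] in \<open>auto intro!: always_eventually less_imp_le\<close>)
 hence "(%n. 1 - k (v n x) / \<sigma>) ----> 1 - \<sigma> / \<sigma>" using \<sigma>_pos by (intro tendsto_intros) auto
 hence 1: "\<forall>\<^sub>F n in sequentially. 1 - k (v n x) / \<sigma> < \<eta>" using \<eta>(1) \<sigma>_pos by (intro order_tendstoD) auto
 have 2: "\<forall>\<^sub>F n in sequentially. 1 / 2 < v n x" by (rule order_tendstoD(1)[OF v_lim_left[OF x]]) simp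
 have "(%n. tc.slope n * x + \<rho> (1 / 2) * e) ----> c0 * x + \<rho> (1 / 2) * e" by (intro tendsto_intros slope_lim)
 moreover have "c0 * x + \<rho> (1 / 2) * e < y"
 proof -
  have "\<rho> (1 / 2) * e = (y - c0 * x) / 2" using \<rho>0 by (simp add: e_def)
  moreover have "z + (y - z) / 2 < y" if "z < y" for z :: real using that by (simp add: field_simps)
  ultimately show ?thesis using y by simp
 qed
 ultimately have 3: "\<forall>\<^sub>F n in sequentially. tc.slope n * x + \<rho> (1 / 2) * e < y" by (rule order_tendstoD)
 show "\<forall>\<^sub>F n in sequentially. u n x < y"
  using 1 2 3
 proof eventually_elim
  case (elim n)
  have "u n x <= tc.slope n * x + \<rho> (1 / 2) * e"
  proof (rule tc.u_tail_le)
   fix p q :: real assume pq: "0 <= p" "p <= q" "q <= 1" "q - p <= 1 - k (v n x) / \<sigma>"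
   have "dist (arccos p) (arccos q) < e"
    by (rule \<eta>(2)) (use pq elim in \<open>auto simp: dist_real_def\<close>)
   thus "arccos p - arccos q <= e" by (simp add: dist_real_def)
  qed (use x e elim in auto)
  thus ?case using elim by simp
 qed
qed

definition "j = a - c0 * L"

lemma u_lim: assumes x: "x \<in> {0<..<L}" "x ~= L / 2" shows "(%n. u n x) ----> affine_jump L c0 j x"
proof (cases "x < L / 2")
 case True thus ?thesis using u_lim_left[of x] x by (simp add: affine_jump_def)
next
 case False
 hence "(%n. u n (L - x)) ----> c0 * (L - x)" using x by (intro u_lim_left) auto
 hence "(%n. an n - u n (L - x)) ----> a - c0 * (L - x)" by (intro tendsto_intros a_lim)
 moreover have "an n - u n (L - x) = u n x" for n using tc.u_symmetric[of x n] x by simp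
 moreover have "a - c0 * (L - x) = affine_jump L c0 j x" using x False by (simp add: affine_jump_def j_def algebra_simps)
 ultimately show ?thesis by simp
qed

lemma c0_nonneg: "0 <= c0"
 by (rule LIMSEQ_le_const[OF c_lim]) (use tc.c in \<open>auto intro: less_imp_le\<close>)

lemma j_nonneg: "0 <= j"
proof -
 have "c0 * L <= a"
 proof (rule LIMSEQ_le)
  show "(%n. c n * L) ----> c0 * L" by (intro tendsto_intros c_lim)
  show "\<exists>N. \<forall>n\<ge>N. c n * L <= an n"
   using tc.u_increment_ge[of 0 L] tc.boundary L_pos by simp
 qed (rule a_lim)
 thus ?thesis by (simp add: j_def)
qed

lemma m_bounds: "m0 \<in> {0..1}"
 using LIMSEQ_le_const[OF m_lim, of 0] LIMSEQ_le_const2[OF m_lim, of 1] tc.m_bounds by (auto intro: less_imp_le)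

lemma \<epsilon>d_lim: "(%n. 4 * \<epsilon> n * d n) ----> 0"
 using tendsto_mult[OF tendsto_mult[OF tendsto_const[of 4] \<epsilon>_lim] d_lim] by simp

lemma m_lt_s: assumes "m0 < 1" shows "\<forall>\<^sub>F n in sequentially. v n (L / 2) < s n"
proof -
 have "\<forall>\<^sub>F n in sequentially. v n (L / 2) < (1 + m0) / 2" by (rule order_tendstoD(2)[OF m_lim]) (use assms in simp)
 moreover have "\<forall>\<^sub>F n in sequentially. (1 + m0) / 2 < s n" by (rule order_tendstoD(1)[OF s_lim]) (use assms in simp)
 ultimately show ?thesis by eventually_elim simp
qed

lemma km_lim: "(%n. k (v n (L / 2))) ----> k m0"
 by (rule continuous_on_tendsto_compose[OF k_continuous m_lim m_bounds])
  (use tc.m_bounds in \<open>auto intro!: always_eventually less_imp_le\<close>)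

lemma flux_limit: assumes m0: "m0 < 1" shows "2 * c0 = k m0"
proof -
 have "(%n. (k (v n (L / 2)))\<^sup>2 * (1 + 4 * \<epsilon> n * d n / (1 - v n (L / 2))\<^sup>2)) ----> (k m0)\<^sup>2 * (1 + 0 / (1 - m0)\<^sup>2)"
  using m0 by (intro tendsto_intros km_lim \<epsilon>d_lim m_lim) auto
 moreover have "\<forall>\<^sub>F n in sequentially. (k (v n (L / 2)))\<^sup>2 * (1 + 4 * \<epsilon> n * d n / (1 - v n (L / 2))\<^sup>2) = (2 * c n)\<^sup>2"
  using m_lt_s[OF m0] by eventually_elim (rule tc.flux_eq[symmetric], simp)
 ultimately have "(%n. (2 * c n)\<^sup>2) ----> (k m0)\<^sup>2" by (simp add: filterlim_cong)
 moreover have "(%n. (2 * c n)\<^sup>2) ----> (2 * c0)\<^sup>2" by (intro tendsto_intros c_lim)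
 ultimately have "(2 * c0)\<^sup>2 = (k m0)\<^sup>2" by (rule LIMSEQ_unique[rotated])
 thus ?thesis by (rule power2_eq_imp_eq) (use c0_nonneg k_nonneg[of m0] m_bounds in auto)
qed

lemma an_le: assumes C: "v n (L / 2) < 1 ==> C <= k (v n (L / 2))" "0 < C" "C < \<sigma>"
 shows "an n <= tc.slope n * L + S C"
 using tc.u_core_le[of 0 n C] C L_pos tc.boundary(1)[of n] tc.u_half[of n] by simp

lemma j_upper:
 assumes C: "!!n. v n (L / 2) < 1 ==> Cn n <= k (v n (L / 2))" "!!n. 0 < Cn n" "!!n. Cn n < \<sigma>"
  and lim: "(%n. S (Cn n)) ----> l"
 shows "j <= l"
proof -
 have "a <= c0 * L + l"
  by (rule LIMSEQ_le[OF a_lim, of "%n. tc.slope n * L + S (Cn n)"])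
   (use an_le[OF C] in \<open>auto intro!: tendsto_intros slope_lim lim\<close>)
 thus ?thesis by (simp add: j_def)
qed

text \<open>If the minimum tends to \<open>1\<close>, so does \<open>k(m)/\<sigma>\<close>, and the openings \<open>S(k(m))\<close> vanish.\<close>

lemma no_jump: assumes m0: "m0 = 1" shows "j = 0"
proof -
 define Cn where "Cn n = min (k (v n (L / 2))) (\<sigma> * (1 - 1 / (real n + 2)))" for n
 have "(%n. 1 / (real n + 2)) ----> 0" by real_asymp
 hence "Cn ----> min (k m0) (\<sigma> * (1 - 0))"
  unfolding Cn_def[abs_def] by (intro tendsto_intros km_lim)
 hence lim: "Cn ----> \<sigma>" using m0 by simp
 have pos: "0 < Cn n" for n using tc.m_bounds[of n] k_pos[of "v n (L / 2)"] \<sigma>_pos by (simp add: Cn_def)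
 have lt: "Cn n < \<sigma>" for n using \<sigma>_pos by (simp add: Cn_def min_less_iff_disj)
 have "j <= 0" by (rule j_upper[OF _ pos lt S_tendsto_0[OF lim pos lt]]) (simp add: Cn_def)
 thus ?thesis using j_nonneg by simp
qed

lemma j_upper_inner: assumes m0: "0 < m0" "m0 < 1" shows "j <= S (k m0)"
proof -
 have K: "0 < k m0" "k m0 < \<sigma>" using k_pos[of m0] k_less_\<sigma>[of m0] m0 by auto
 define Cn where "Cn n = min (k (v n (L / 2))) ((k m0 + \<sigma>) / 2)" for n
 have "Cn ----> min (k m0) ((k m0 + \<sigma>) / 2)"
  unfolding Cn_def[abs_def] by (intro tendsto_intros km_lim) simp
 hence lim: "Cn ----> k m0" using K by (simp add: min_def)
 have pos: "0 < Cn n" for n using tc.m_bounds[of n] k_pos[of "v n (L / 2)"] K by (simp add: Cn_def)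
 have lt: "Cn n < \<sigma>" for n using K by (simp add: Cn_def min_less_iff_disj)
 show ?thesis by (rule j_upper[OF _ pos lt S_seq_continuous[OF lim K]]) (simp add: Cn_def)
qed

text \<open>Choosing the level \<open>t\<close> with \<open>k(m0)/k(t) < C1/\<sigma>\<close> makes the core estimate applicable for late
indices, and the angular correction \<open>arccos (C/k(m))\<close> tends to \<open>arccos 1 = 0\<close>.\<close>

lemma j_lower:
 assumes m0: "m0 < 1" and C1: "k m0 < C1" "C1 < \<sigma>"
 shows "S C1 <= j"
proof -
 have km0: "0 <= k m0" using k_nonneg[of m0] m_bounds by simp
 have C10: "0 < C1" using km0 C1 by simp
 define K where "K = k m0 * \<sigma> / C1"
 have K: "k m0 <= K" "K < \<sigma>" "0 <= K"
 proof -
  have "k m0 * C1 <= k m0 * \<sigma>" using km0 C1 by (intro mult_left_mono) auto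
  thus "k m0 <= K" using C10 by (simp add: K_def pos_le_divide_eq)
  have "k m0 * \<sigma> < C1 * \<sigma>" using C1 \<sigma>_pos by simp
  thus "K < \<sigma>" using C10 by (simp add: K_def pos_divide_less_eq mult.commute)
  show "0 <= K" using km0 C10 \<sigma>_pos by (simp add: K_def)
 qed
 \<comment> \<open>Any level with \<open>K < k t < \<sigma>\<close> would do.\<close>
 define t where "t = \<kappa> ((K + \<sigma>) / 2)"
 have y: "0 < (K + \<sigma>) / 2" "(K + \<sigma>) / 2 < \<sigma>" using K by auto
 have t: "t \<in> {0<..<1}" unfolding t_def by (rule \<kappa>_inner[OF y])
 have kt: "k t = (K + \<sigma>) / 2" unfolding t_def by (rule k_\<kappa>) (use y in simp)
 hence Kt: "K < k t" using K by simp
 have mt: "m0 < t"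
 proof (rule ccontr)
  assume "\<not> m0 < t"
  hence "k t <= k m0" using k_mono[of t m0] t m0 by simp
  thus False using Kt K by simp
 qed
 define C where "C n = 2 * c n / sqrt (1 + 4 * \<epsilon> n * d n / (1 - t)\<^sup>2)" for n
 have B: "(%n. sqrt (1 + 4 * \<epsilon> n * d n / (1 - t)\<^sup>2)) ----> sqrt (1 + 0 / (1 - t)\<^sup>2)"
  by (intro tendsto_intros \<epsilon>d_lim) (use t in auto)
 have "C ----> 2 * c0 / sqrt (1 + 0 / (1 - t)\<^sup>2)"
  unfolding C_def[abs_def] by (intro tendsto_intros c_lim B) simp
 hence C_lim: "C ----> k m0" using flux_limit[OF m0] by simp
 have kt0: "0 < k t" using Kt K by simp
 have e1: "\<forall>\<^sub>F n in sequentially. C n < C1" by (rule order_tendstoD(2)[OF C_lim C1(1)])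
 have "k m0 / k t < C1 / \<sigma>"
 proof -
  have "k m0 * \<sigma> < k t * C1" using Kt C10 by (simp add: K_def pos_divide_less_eq)
  thus ?thesis using kt0 \<sigma>_pos by (simp add: divide_less_eq less_divide_eq mult.commute)
 qed
 moreover have "(%n. C n / k t) ----> k m0 / k t" by (intro tendsto_intros C_lim) (use kt0 in simp)
 ultimately have e2: "\<forall>\<^sub>F n in sequentially. C n / k t < C1 / \<sigma>" by (rule order_tendstoD(2)[rotated])
 have e3: "\<forall>\<^sub>F n in sequentially. v n (L / 2) < t" by (rule order_tendstoD(2)[OF m_lim mt])
 have e4: "\<forall>\<^sub>F n in sequentially. t < s n" by (rule order_tendstoD(1)[OF s_lim]) (use t in simp)
 define R where "R n = sqrt (1 + 4 * \<epsilon> n * d n / (1 - v n (L / 2))\<^sup>2) / sqrt (1 + 4 * \<epsilon> n * d n / (1 - t)\<^sup>2)" for n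
 have "R ----> sqrt (1 + 0 / (1 - m0)\<^sup>2) / sqrt (1 + 0 / (1 - t)\<^sup>2)"
  unfolding R_def[abs_def] by (intro tendsto_intros B \<epsilon>d_lim m_lim) (use m0 in auto)
 hence R_lim: "R ----> 1" by simp
 have R_eq: "C n / k (v n (L / 2)) = R n & R n \<in> {-1..1}" if n: "v n (L / 2) < t" "t < s n" for n
 proof -
  have mb: "0 < v n (L / 2)" "v n (L / 2) < 1" using tc.m_bounds[of n] n t by auto
  have km: "0 < k (v n (L / 2))" using k_pos mb by simp
  have ed: "0 < 4 * \<epsilon> n * d n" using tc.\<epsilon>[of n] tc.d_pos[of n] by simp
  have "(2 * c n)\<^sup>2 = (k (v n (L / 2)))\<^sup>2 * (1 + 4 * \<epsilon> n * d n / (1 - v n (L / 2))\<^sup>2)"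
   by (rule tc.flux_eq) (use n in simp)
  hence "sqrt ((2 * c n)\<^sup>2) = sqrt ((k (v n (L / 2)))\<^sup>2 * (1 + 4 * \<epsilon> n * d n / (1 - v n (L / 2))\<^sup>2))" by simp
  hence 1: "2 * c n = k (v n (L / 2)) * sqrt (1 + 4 * \<epsilon> n * d n / (1 - v n (L / 2))\<^sup>2)"
   using km tc.c[of n] by (simp add: real_sqrt_mult)
  have 2: "C n / k (v n (L / 2)) = R n" using km unfolding C_def R_def 1 by simp
  have "(1 - t)\<^sup>2 <= (1 - v n (L / 2))\<^sup>2" by (rule power_mono) (use n t in auto)
  hence "4 * \<epsilon> n * d n / (1 - v n (L / 2))\<^sup>2 <= 4 * \<epsilon> n * d n / (1 - t)\<^sup>2"
   by (rule divide_left_mono) (use ed t mb in auto)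
  moreover have "0 < 1 + 4 * \<epsilon> n * d n / (1 - t)\<^sup>2" using ed t by (intro add_pos_nonneg) auto
  ultimately have "R n <= 1" by (simp add: R_def pos_divide_le_eq)
  moreover have "0 <= R n" using ed by (auto simp: R_def intro!: divide_nonneg_nonneg)
  ultimately show ?thesis using 2 by simp
 qed
 have "(%n. arccos (max (- 1) (min 1 (R n)))) ----> arccos (max (- 1) (min 1 1))"
  by (rule continuous_on_tendsto_compose[OF continuous_on_arccos'])
   (use tendsto_max[OF tendsto_const[of "- 1"] tendsto_min[OF tendsto_const[of 1] R_lim]] in auto)
 hence acos: "(%n. arccos (max (- 1) (min 1 (R n)))) ----> 0" by simp
 have half: "S C1 / 2 <= a / 2 - c0 * x" if x: "0 <= x" "x < L / 2" for x
 proof (rule tendsto_le[OF sequentially_bot])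
  show "(%n. an n / 2 - u n x) ----> a / 2 - c0 * x" by (intro tendsto_intros a_lim u_lim_left x) simp
  have "(%n. S C1 / 2 - r C1 * arccos (max (- 1) (min 1 (R n)))) ----> S C1 / 2 - r C1 * 0" by (intro tendsto_intros acos)
  thus "(%n. S C1 / 2 - r C1 * arccos (max (- 1) (min 1 (R n)))) ----> S C1 / 2" by simp
  have e5: "\<forall>\<^sub>F n in sequentially. t < v n x" by (rule order_tendstoD(1)[OF v_lim_left[OF x]]) (use t in simp)
  show "\<forall>\<^sub>F n in sequentially. S C1 / 2 - r C1 * arccos (max (- 1) (min 1 (R n))) <= an n / 2 - u n x"
   using e1 e2 e3 e4 e5
  proof eventually_elim
   case (elim n)
   have "S C1 / 2 - r C1 * arccos (C n / k (v n (L / 2))) <= u n (L / 2) - u n x"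
    unfolding C_def by (rule tc.u_core_ge) (use x elim C1 in \<open>auto simp: C_def\<close>)
   moreover have "C n / k (v n (L / 2)) = max (- 1) (min 1 (R n))" using R_eq[OF elim(3,4)] by simp
   ultimately show ?case using tc.u_half[of n] by simp
  qed
 qed
 have "S C1 / 2 <= a / 2 - c0 * (L / 2)"
 proof (rule tendsto_lowerbound[where F = "at_left (L / 2)" and f = "%x. a / 2 - c0 * x"])
  show "((%x. a / 2 - c0 * x) \<longlongrightarrow> a / 2 - c0 * (L / 2)) (at_left (L / 2))" by (intro tendsto_intros)
  have "\<forall>\<^sub>F x in at_left (L / 2). x \<in> {0<..<L / 2}" by (rule eventually_at_left_real) (use L_pos in simp)
  thus "\<forall>\<^sub>F x in at_left (L / 2). S C1 / 2 <= a / 2 - c0 * x" by eventually_elim (rule half, auto)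
 qed simp
 thus ?thesis by (simp add: j_def field_simps)
qed

theorem inner_jump: assumes m0: "0 < m0" "m0 < 1" shows "j = S (k m0)"
proof (rule antisym[OF j_upper_inner[OF m0]])
 have K: "0 < k m0" "k m0 < \<sigma>" using k_pos[of m0] k_less_\<sigma>[of m0] m0 by auto
 define C where "C n = k m0 + (\<sigma> - k m0) * (1 / (real n + 2))" for n
 have "(%n. 1 / (real n + 2)) ----> 0" by real_asymp
 hence "C ----> k m0 + (\<sigma> - k m0) * 0" unfolding C_def[abs_def] by (intro tendsto_intros)
 hence lim: "C ----> k m0" by simp
 show "S (k m0) <= j"
 proof (rule LIMSEQ_le_const2[OF S_seq_continuous[OF lim K]], intro exI allI impI)
  fix n
  have "(\<sigma> - k m0) * (1 / (real n + 2)) < (\<sigma> - k m0) * 1" by (rule mult_strict_left_mono) (use K in auto)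
  thus "S (C n) <= j" using K by (intro j_lower[OF m0(2)]) (auto simp: C_def)
 qed
qed

text \<open>The openings \<open>S\<close> of \<open>k(m) \<rightarrow> 0\<close> converge to \<open>a\<close>: they are at most \<open>j = a\<close> by \<open>j_lower\<close>, and they
nearly exhaust the boundary values by \<open>an_le\<close>. So the openings have the finite supremum \<open>a\<close>.\<close>

theorem full_fracture: assumes m0: "m0 = 0" shows "c0 = 0" "j = a" "s_frac f = ereal a" "g_coh f a = 1"
proof -
 show c: "c0 = 0" using flux_limit m0 by simp
 show ja: "j = a" unfolding j_def using c by simp
 \<comment> \<open>The bound \<open>\<sigma>/2\<close> takes care of the indices with constant \<open>v n\<close>, for which \<open>k = \<sigma>\<close>.\<close>
 define Cn where "Cn n = min (k (v n (L / 2))) (\<sigma> / 2)" for n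
 have "Cn ----> min (k m0) (\<sigma> / 2)" unfolding Cn_def[abs_def] by (intro tendsto_intros km_lim) simp
 hence lim: "Cn ----> 0" using m0 \<sigma>_pos by (simp add: min_def)
 have pos: "0 < Cn n" for n using tc.m_bounds[of n] k_pos[of "v n (L / 2)"] \<sigma>_pos by (simp add: Cn_def)
 have lt: "Cn n < \<sigma>" for n using \<sigma>_pos by (simp add: Cn_def min_less_iff_disj)
 have le: "S C <= a" if "0 < C" "C < \<sigma>" for C using j_lower[of C] that m0 ja by simp
 have "(%n. S (Cn n)) ----> a"
 proof (rule tendsto_sandwich[where f = "%n. an n - tc.slope n * L" and h = "%_. a"])
  have "(%n. an n - tc.slope n * L) ----> a - c0 * L" by (intro tendsto_intros a_lim slope_lim)
  thus "(%n. an n - tc.slope n * L) ----> a" using c by simp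
  show "\<forall>\<^sub>F n in sequentially. an n - tc.slope n * L <= S (Cn n)"
  proof (rule always_eventually, rule allI)
   fix n
   have "an n <= tc.slope n * L + S (Cn n)" by (rule an_le[OF _ pos lt]) (simp add: Cn_def)
   thus "an n - tc.slope n * L <= S (Cn n)" by simp
  qed
 qed (use le[OF pos lt] in auto)
 from fracture_case[OF pos lt lim this le] show "s_frac f = ereal a" "g_coh f a = 1" by auto
qed

text \<open>At the point \<open>L/4\<close> the inequality \<open>d_upper\<close> becomes \<open>d0 x \<le> c0\<^sup>2 x\<close> in the limit, since \<open>v \<rightarrow> 1\<close>
there.\<close>

lemma d0_eq: "d0 = c0\<^sup>2"
proof (rule antisym)
 show "c0\<^sup>2 <= d0"
  by (rule LIMSEQ_le[of "%n. (c n)\<^sup>2", OF _ d_lim]) (use tc.d_ge in \<open>auto intro!: tendsto_intros c_lim\<close>)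
 define x where "x = L / 4"
 have x: "0 <= x" "x < L / 2" "0 < x" using L_pos by (auto simp: x_def)
 have "d0 * x <= c0 * (c0 * x) + (1 + 0 * d0) * (1 - 1)"
 proof (rule LIMSEQ_le)
  show "(%n. d n * x) ----> d0 * x" by (intro tendsto_intros d_lim)
  show "(%n. c n * u n x + (1 + \<epsilon> n * d n) * (1 - v n x)) ----> c0 * (c0 * x) + (1 + 0 * d0) * (1 - 1)"
   by (intro tendsto_intros c_lim u_lim_left v_lim_left \<epsilon>_lim d_lim x)
  show "\<exists>N. \<forall>n\<ge>N. d n * x <= c n * u n x + (1 + \<epsilon> n * d n) * (1 - v n x)"
   using tc.d_upper[of x] x by simp
 qed
 thus "d0 <= c0\<^sup>2" using x by (simp add: power2_eq_square mult.assoc[symmetric])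
qed

definition "surface = (if m0 = 1 then 0 else if m0 = 0 then 1 else KK (k m0))"

lemma surface_integral:
 "((%t. (1 - t) / 2 * sqrt (1 - (k m0 / k t)\<^sup>2)) has_integral surface / 4) {m0..1}"
proof -
 consider "m0 = 0" | "0 < m0" "m0 < 1" | "m0 = 1" using m_bounds by fastforce
 thus ?thesis
 proof cases
  case 1
  have "((%t. (1 - t) / 2) has_integral (- (1 - 1)\<^sup>2 / 4 - (- (1 - 0)\<^sup>2 / 4))) {0..1::real}"
  proof (rule fundamental_theorem_of_calculus)
   fix x :: real assume "x \<in> {0..1}"
   have "((%t. - (1 - t)\<^sup>2 / 4) has_real_derivative (1 - x) / 2) (at x within {0..1})"
    by (auto intro!: derivative_eq_intros simp: field_simps)
   thus "((%t. - (1 - t)\<^sup>2 / 4) has_vector_derivative (1 - x) / 2) (at x within {0..1})"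
    by (simp add: has_real_derivative_iff_has_vector_derivative)
  qed simp
  moreover have "surface = 1" unfolding surface_def using 1 by simp
  ultimately show ?thesis using 1 by simp
 next
  case 2
  from has_integral_divide[OF KK_integral[of m0], of 4]
  have "((%t. 2 * (1 - t) * sqrt (1 - (k m0 / k t)\<^sup>2) / 4) has_integral KK (k m0) / 4) {m0..1}" using 2 by simp
  hence "((%t. (1 - t) / 2 * sqrt (1 - (k m0 / k t)\<^sup>2)) has_integral KK (k m0) / 4) {m0..1}"
   by (rule has_integral_eq[rotated]) simp
  thus ?thesis using 2 by (simp add: surface_def)
 next
  case 3
  hence "surface = 0" unfolding surface_def by simp
  thus ?thesis using 3 by (simp add: has_integral_refl)
 qed
qed

text \<open>Dominated convergence: by \<open>H_upper\<close> the integrands are uniformly bounded, and at a fixed level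
the truncation is eventually inactive. The finitely many levels in \<open>Z\<close> are excluded from the
pointwise limit.\<close>

lemma kinetic_limit:
 "(%n. integral {v n (L / 2)..1} (%t. sqrt (\<epsilon> n * tc.H n t))) ----> surface / 4"
proof -
 define Z where "Z = {0, m0, 1}"
 define F where "F n t = (if t \<in> Z then 0 else if t \<in> {v n (L / 2)..1} then sqrt (\<epsilon> n * tc.H n t) else 0)" for n t
 define G where "G t = (if t \<in> Z then 0 else if t \<in> {m0..1} then (1 - t) / 2 * sqrt (1 - (k m0 / k t)\<^sup>2) else 0)" for t
 have Z: "finite Z" by (simp add: Z_def)
 have Fi: "(F n has_integral integral {v n (L / 2)..1} (%t. sqrt (\<epsilon> n * tc.H n t))) {0..1}" for n
 proof -
  have "continuous_on {v n (L / 2)..1} (%t. sqrt (\<epsilon> n * tc.H n t))"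
   by (intro continuous_intros continuous_on_subset[OF tc.H_continuous]) (use tc.m_bounds[of n] in auto)
  hence "((%t. sqrt (\<epsilon> n * tc.H n t)) has_integral integral {v n (L / 2)..1} (%t. sqrt (\<epsilon> n * tc.H n t))) {v n (L / 2)..1}"
   by (intro integrable_integral integrable_continuous_real)
  hence "((%t. if t \<in> {v n (L / 2)..1} then sqrt (\<epsilon> n * tc.H n t) else 0) has_integral
    integral {v n (L / 2)..1} (%t. sqrt (\<epsilon> n * tc.H n t))) {0..1}"
   by (subst has_integral_restrict) (use tc.m_bounds[of n] in auto)
  thus ?thesis
   by (rule has_integral_spike_finite[OF Z, rotated]) (simp add: F_def)
 qed
 have Gi: "(G has_integral surface / 4) {0..1}"
 proof -
  have "((%t. if t \<in> {m0..1} then (1 - t) / 2 * sqrt (1 - (k m0 / k t)\<^sup>2) else 0) has_integral surface / 4) {0..1}"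
   by (subst has_integral_restrict) (use m_bounds surface_integral in auto)
  thus ?thesis
   by (rule has_integral_spike_finite[OF Z, rotated]) (simp add: G_def)
 qed
 obtain B where B: "!!n. \<bar>4 * \<epsilon> n * d n\<bar> <= B"
  using convergent_imp_Bseq[of "%n. 4 * \<epsilon> n * d n"] \<epsilon>d_lim by (auto simp: convergent_def Bseq_def)
 have bnd: "norm (F n t) <= sqrt (1 + B)" if t: "t \<in> {0..1}" for n t
 proof -
  have B0: "0 <= B" using B[of 0] by simp
  show ?thesis
  proof (cases "t \<in> Z \<or> t \<notin> {v n (L / 2)..1}")
   case True thus ?thesis using B0 by (auto simp: F_def)
  next
   case False
   hence tt: "0 < t" "t <= 1" "v n (L / 2) <= t" using tc.m_bounds[of n] by auto
   have "\<epsilon> n * tc.H n t <= (1 - t)\<^sup>2 / 4 + \<epsilon> n * d n" by (rule tc.H_upper[OF tt(1,2)])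
   moreover have "(1 - t)\<^sup>2 <= 1" using tt by (simp add: power_le_one)
   moreover have "\<epsilon> n * d n <= B"
   proof -
    have "0 < \<epsilon> n * d n" using tc.\<epsilon>[of n] tc.d_pos[of n] by simp
    moreover have "4 * (\<epsilon> n * d n) <= B" using B[of n] by (simp add: mult.assoc)
    ultimately show ?thesis by linarith
   qed
   ultimately have "\<epsilon> n * tc.H n t <= 1 + B" by simp
   moreover have "0 <= \<epsilon> n * tc.H n t" using tc.H_nonneg_m[OF tt(3,2)] tc.\<epsilon>[of n] by simp
   ultimately show ?thesis using False by (simp add: F_def)
  qed
 qed
 have pt: "(%n. F n t) ----> G t" if t: "t \<in> {0..1}" for t
 proof (cases "t \<in> Z")
  case True thus ?thesis by (simp add: F_def G_def)
 next
  case False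
  hence tt: "0 < t" "t < 1" "t ~= m0" using t by (auto simp: Z_def)
  show ?thesis
  proof (cases "t < m0")
   case True
   have "\<forall>\<^sub>F n in sequentially. t < v n (L / 2)" by (rule order_tendstoD(1)[OF m_lim True])
   hence "\<forall>\<^sub>F n in sequentially. F n t = 0" by eventually_elim (simp add: F_def)
   thus ?thesis using True by (simp add: G_def tendsto_eventually)
  next
   case False2: False
   hence mt: "m0 < t" "m0 < 1" using tt by auto
   have kt: "0 < k t" using k_pos tt by simp
   have e: "\<forall>\<^sub>F n in sequentially. v n (L / 2) < t" by (rule order_tendstoD(2)[OF m_lim mt(1)])
   have e': "\<forall>\<^sub>F n in sequentially. t < s n" by (rule order_tendstoD(1)[OF s_lim tt(2)])
   have "\<forall>\<^sub>F n in sequentially. sqrt (((1 - t)\<^sup>2 * (1 - (2 * c n / k t)\<^sup>2) + 4 * \<epsilon> n * d n) / 4) = F n t"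
    using e e'
   proof eventually_elim
    case (elim n)
    have "\<epsilon> n * tc.H n t = ((1 - t)\<^sup>2 * (1 - (2 * c n / k t)\<^sup>2) + 4 * \<epsilon> n * d n) / 4"
     using tc.H_low[OF tt(1), of n] elim by simp
    thus ?case using elim tt False by (simp add: F_def)
   qed
   moreover have "(%n. sqrt (((1 - t)\<^sup>2 * (1 - (2 * c n / k t)\<^sup>2) + 4 * \<epsilon> n * d n) / 4))
    ----> sqrt (((1 - t)\<^sup>2 * (1 - (2 * c0 / k t)\<^sup>2) + 0) / 4)"
    using kt by (intro tendsto_intros c_lim \<epsilon>d_lim) auto
   moreover have "sqrt (((1 - t)\<^sup>2 * (1 - (2 * c0 / k t)\<^sup>2) + 0) / 4) = G t"
    using tt mt False flux_limit[OF mt(2)] by (simp add: G_def real_sqrt_mult real_sqrt_divide)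
   ultimately show ?thesis by (simp add: filterlim_cong)
  qed
 qed
 have "(%n. integral {0..1} (F n)) ----> integral {0..1} G"
  by (rule dominated_convergence(2)[where h = "%_. sqrt (1 + B)"]) (use Fi bnd pt in \<open>auto intro: has_integral_integrable\<close>)
 thus ?thesis using integral_unique[OF Fi] integral_unique[OF Gi] by simp
qed

theorem energy_limit: "energy ----> 2 * c0 * a - c0\<^sup>2 * L + surface"
proof -
 have "(%n. 2 * c n * an n - d n * L + 4 * integral {v n (L / 2)..1} (%t. sqrt (\<epsilon> n * tc.H n t)))
  ----> 2 * c0 * a - d0 * L + 4 * (surface / 4)"
  by (intro tendsto_intros c_lim a_lim d_lim kinetic_limit)
 thus ?thesis by (simp add: d0_eq energy_def[abs_def])
qed

lemma continuous_measurable: "continuous_on {0..L} h ==> h \<in> borel_measurable (lebesgue_on {0<..<L})"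
 by (rule continuous_imp_measurable_on_sets_lebesgue) (auto intro: continuous_on_subset)

lemma L1_limit:
 assumes h: "!!n. continuous_on {0..L} (h n)" and b: "!!n x. x \<in> {0..L} ==> \<bar>h n x\<bar> <= B"
  and h0: "h0 \<in> borel_measurable (lebesgue_on {0<..<L})"
  and lim: "!!x. x \<in> {0<..<L} ==> x ~= L / 2 ==> (%n. h n x) ----> h0 x"
 shows "L1_tendsto L h h0"
proof -
 have n: "negligible {L / 2}" by simp
 have "(%n. \<integral>\<^sup>+x. ennreal (norm (h0 x - h n x)) \<partial>lebesgue_on {0<..<L}) ----> 0"
 proof (rule nn_integral_dominated_convergence_norm[where w = "%_. B"])
  show "h n \<in> borel_measurable (lebesgue_on {0<..<L})" for n by (rule continuous_measurable[OF h])
  show "AE x in lebesgue_on {0<..<L}. norm (h n x) <= B" for n using b by (intro AE_I2) auto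
  show "AE x in lebesgue_on {0<..<L}. (%n. h n x) ----> h0 x"
  proof (subst AE_lebesgue_on_iff_negligible)
   have "{x \<in> {0<..<L}. \<not> (%n. h n x) ----> h0 x} \<subseteq> {L / 2}" using lim by blast
   thus "negligible {x \<in> {0<..<L}. \<not> (%n. h n x) ----> h0 x}" by (rule negligible_subset[OF n])
  qed simp
  have "emeasure (lebesgue_on {0<..<L}) {0<..<L} < \<infinity>" using L_pos by (simp add: emeasure_restrict_space)
  thus "(\<integral>\<^sup>+ x. ennreal B \<partial>lebesgue_on {0<..<L}) < \<infinity>" by (simp add: ennreal_mult_less_top)
 qed (simp_all add: h0)
 thus ?thesis by (simp add: L1_tendsto_def abs_minus_commute)
qed

theorem v_L1: "L1_tendsto L v (%_. 1)"
proof (rule L1_limit[where B = 1])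
 show "\<bar>v n x\<bar> <= 1" if "x \<in> {0..L}" for n x using tc.v_pos[OF that, of n] tc.v_le[OF that, of n] by simp
qed (use tc.v_cont v_lim in auto)

theorem u_L1: "L1_tendsto L u (affine_jump L c0 j)"
proof -
 obtain B where B: "!!n. \<bar>an n\<bar> <= B"
  using convergent_imp_Bseq[of an] a_lim by (auto simp: convergent_def Bseq_def)
 interpret J: one_jump L c0 j by unfold_locales (use L_pos c0_nonneg j_nonneg in auto)
 show ?thesis
 proof (rule L1_limit[where B = B])
  show "\<bar>u n x\<bar> <= B" if "x \<in> {0..L}" for n x using tc.u_bounds[OF that, of n] B[of n] by simp
  show "affine_jump L c0 j \<in> borel_measurable (lebesgue_on {0<..<L})" using J.u0_integrable by simp
 qed (use tc.u_cont u_lim in auto)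
qed

end

section \<open>Compactness and convergence of critical points\<close>

text \<open>Finiteness of the energy supplies the bounds \<open>0 \<le> v \<le> 1\<close>.\<close>

lemma critical_point_data:
 assumes tr: "trunc \<sigma> f \<epsilon> s \<psi>" and L: "0 < L" and a: "0 < a"
  and cp: "critical_point L (f_trunc f \<epsilon> s \<psi>) \<epsilon> a u v"
  and fin: "F_eps L (f_trunc f \<epsilon> s \<psi>) \<epsilon> u v < \<infinity>"
 obtains c d w where "trunc_crit \<sigma> f \<epsilon> s \<psi> L a u v c d w"
  "F_eps L (f_trunc f \<epsilon> s \<psi>) \<epsilon> u v = ennreal (2 * c * a - d * L + 4 * integral {v (L / 2)..1}
   (%t. sqrt (\<epsilon> * classical.H (trunc.fe f \<epsilon> s \<psi>) \<epsilon> c d t)))"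
proof -
 interpret T: trunc \<sigma> f \<epsilon> s \<psi> by (rule tr)
 have ae: "AE x in lebesgue_on {0<..<L}. 0 <= v x & v x <= 1"
  using fin by (simp add: F_eps_def split: if_splits)
 have vc: "continuous_on {0..L} v" and vb: "v 0 = 1" "v L = 1" using cp by (auto simp: critical_point_def)
 have v01: "v x \<in> {0..1}" if x: "x \<in> {0..L}" for x
 proof (cases "x = 0 \<or> x = L")
  case False
  have "negligible {x \<in> {0<..<L}. \<not> (0 <= v x & v x <= 1)}"
   using ae by (subst (asm) AE_lebesgue_on_iff_negligible) auto
  hence n: "negligible {x \<in> {0<..<L}. v x ~= max 0 (min 1 (v x))}"
   by (rule negligible_subset) auto
  have c: "continuous_on {0<..<L} v" by (rule continuous_on_subset[OF vc]) auto
  have "v x = max 0 (min 1 (v x))"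
   by (rule continuous_ae_eq_imp_eq[OF _ c _ n]) (use False x c in \<open>auto intro!: continuous_intros\<close>)
  moreover have "max 0 (min 1 (v x)) \<in> {0..1}" by auto
  ultimately show ?thesis by simp
 qed (use vb in auto)
 interpret C: crit T.fe T.fe1 \<epsilon> L a u v
  by (intro crit.intro[OF T.profile_axioms] crit_axioms.intro) (use T.\<epsilon> L a cp v01 in \<open>simp_all add: T.fe_def\<close>)
 obtain c d w where "classical T.fe T.fe1 \<epsilon> L a u v c d w"
  "F_eps L T.fe \<epsilon> u v = ennreal (2 * c * a - d * L + 4 * integral {v (L / 2)..1}
   (%t. sqrt (\<epsilon> * classical.H T.fe \<epsilon> c d t)))" by (rule C.classical) (rule that)
 thus ?thesis using that[of c d w] trunc_crit.intro[OF tr] by (simp add: T.fe_def)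
qed

lemma convergent_subsequence_triple:
 fixes x y z :: "nat => real"
 assumes "!!n. x n \<in> {a1..b1}" "!!n. y n \<in> {a2..b2}" "!!n. z n \<in> {a3..b3}"
 obtains r l1 l2 l3 where "strict_mono (r :: nat => nat)" "(%n. x (r n)) ----> l1" "(%n. y (r n)) ----> l2" "(%n. z (r n)) ----> l3"
proof -
 have "seq_compact ({a1..b1} \<times> {a2..b2} \<times> {a3..b3})"
  unfolding compact_eq_seq_compact_metric[symmetric] by (intro compact_Times compact_Icc)
 moreover have "\<forall>n. (x n, y n, z n) \<in> {a1..b1} \<times> {a2..b2} \<times> {a3..b3}" using assms by simp
 ultimately obtain l r where r: "strict_mono r" "((%n. (x n, y n, z n)) \<circ> r) ----> l"
  by (rule seq_compactE)
 have l: "(%n. (x (r n), y (r n), z (r n))) ----> l" using r(2) by (simp add: o_def)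
 show ?thesis
  using that[OF r(1)] tendsto_fst[OF l] tendsto_fst[OF tendsto_snd[OF l]] tendsto_snd[OF tendsto_snd[OF l]] by simp
qed

text \<open>The boundary values \<open>a\<^sub>\<epsilon>\<close> are positive only for small \<open>\<epsilon>\<close>, so the family is first restricted to
a sequence where this holds. The energy bound controls \<open>c\<close> and \<open>d\<close>, and the minimum lies in \<open>[0,
1]\<close>, so compactness yields convergent data.\<close>

theorem theorem1p7:
  fixes L \<sigma>c a \<epsilon>0 :: real
    and f s a\<epsilon> :: "real \<Rightarrow> real"
    and \<psi> u v :: "real \<Rightarrow> real \<Rightarrow> real"
  defines "f\<epsilon> \<equiv> (\<lambda>\<epsilon>. f_trunc f \<epsilon> (s \<epsilon>) (\<psi> \<epsilon>))"
  assumes "0 < L" and "0 < \<sigma>c" and "degradation \<sigma>c f"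
    and "0 < \<epsilon>0"
    and "\<forall>\<epsilon>\<in>{0<..<\<epsilon>0}. s \<epsilon> \<in> {0<..<1}"
    and "antimono_on {0<..<\<epsilon>0} s" and "(s \<longlongrightarrow> 1) (at_right 0)"
    and "((\<lambda>\<epsilon>. sqrt \<epsilon> * f (s \<epsilon>)) \<longlongrightarrow> 1) (at_right 0)"
    and "\<forall>\<epsilon>\<in>{0<..<\<epsilon>0}. trunc_profile f \<epsilon> (s \<epsilon>) (\<psi> \<epsilon>)"
    and "\<forall>\<epsilon>\<in>{0<..<\<epsilon>0}. critical_point L (f\<epsilon> \<epsilon>) \<epsilon> (a\<epsilon> \<epsilon>) (u \<epsilon>) (v \<epsilon>)"
    and "(a\<epsilon> \<longlongrightarrow> a) (at_right 0)" and "0 < a"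
    and "(SUP \<epsilon>\<in>{0<..<\<epsilon>0}. F_eps L (f\<epsilon> \<epsilon>) \<epsilon> (u \<epsilon>) (v \<epsilon>)) < \<infinity>"
  shows "\<exists>(\<epsilon>k :: nat \<Rightarrow> real) (u0 :: real \<Rightarrow> real) (m0 :: real).
      (\<forall>k. \<epsilon>k k \<in> {0<..<\<epsilon>0}) \<and> \<epsilon>k \<longlonglongrightarrow> 0 \<and>
      L1_tendsto L (\<lambda>k. u (\<epsilon>k k)) u0 \<and> L1_tendsto L (\<lambda>k. v (\<epsilon>k k)) (\<lambda>_. 1) \<and>
      SBV L u0 \<and> D_var L u0 {0<..<L} = a \<and>
      (\<lambda>k. INF x\<in>{0..L}. v (\<epsilon>k k) x) \<longlonglongrightarrow> m0 \<and>
      (m0 = 1 \<longrightarrow> (\<forall>x\<in>{0<..<L}. u0 x = a / L * x)) \<and>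
      (m0 \<in> {0<..<1} \<longrightarrow>
        (let c0 = 1 / 2 * f m0 * (1 - m0) in
          (\<forall>x\<in>{0<..<L}. u0 x = c0 * x + (a - c0 * L) * indicator {L / 2<..<L} x) \<and>
          c0 \<in> {0<..<\<sigma>c / 2} \<and>
          a - c0 * L = jump L a u0 (L / 2) \<and>
          0 < jump L a u0 (L / 2) \<and> ereal (jump L a u0 (L / 2)) < s_frac f \<and>
          (g_coh f has_real_derivative 2 * c0) (at (jump L a u0 (L / 2))))) \<and>
      (m0 = 0 \<longrightarrow>
        \<bar>s_frac f\<bar> \<noteq> \<infinity> \<and>
        (\<forall>x\<in>{0<..<L}. u0 x = a * indicator {L / 2<..<L} x) \<and>
        a = jump L a u0 (L / 2) \<and> ereal (jump L a u0 (L / 2)) = s_frac f) \<and>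
      (m0 < 1 \<or> (m0 = 1 \<and> a / L \<le> \<sigma>c / 2) \<longrightarrow>
        (\<lambda>k. F_eps L (f\<epsilon> (\<epsilon>k k)) (\<epsilon>k k) (u (\<epsilon>k k)) (v (\<epsilon>k k)))
          \<longlonglongrightarrow> F_lim L \<sigma>c f a u0 (\<lambda>_. 1)) \<and>
      (m0 = 1 \<and> a / L > \<sigma>c / 2 \<longrightarrow>
        \<not> (\<lambda>k. F_eps L (f\<epsilon> (\<epsilon>k k)) (\<epsilon>k k) (u (\<epsilon>k k)) (v (\<epsilon>k k)))
          \<longlonglongrightarrow> F_lim L \<sigma>c f a u0 (\<lambda>_. 1))"
proof -
 note fe_def = assms(1) and L = assms(2) and \<sigma> = assms(3) and deg = assms(4) and \<epsilon>0 = assms(5) and s01 = assms(6)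
  and s_lim = assms(8) and fs_lim = assms(9) and tp = assms(10) and cp = assms(11) and a_lim = assms(12)
  and a0 = assms(13) and fin = assms(14)
 interpret D: degr \<sigma>c f by unfold_locales (rule \<sigma> deg)+
 define F where "F \<epsilon> = F_eps L (f\<epsilon> \<epsilon>) \<epsilon> (u \<epsilon>) (v \<epsilon>)" for \<epsilon>
 have F_top: "(SUP \<epsilon>\<in>{0<..<\<epsilon>0}. F \<epsilon>) < top" using fin by (simp add: F_def)
 define M where "M = enn2real (SUP \<epsilon>\<in>{0<..<\<epsilon>0}. F \<epsilon>)"
 have M0: "0 <= M" by (simp add: M_def)
 have F_le: "F \<epsilon> <= ennreal M" if "\<epsilon> \<in> {0<..<\<epsilon>0}" for \<epsilon>
  unfolding M_def ennreal_enn2real[OF F_top] by (rule SUP_upper[OF that])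
 obtain \<epsilon>1 where \<epsilon>1: "0 < \<epsilon>1" "!!\<epsilon>. 0 < \<epsilon> ==> \<epsilon> < \<epsilon>1 ==> 0 < a\<epsilon> \<epsilon>"
  using order_tendstoD(1)[OF a_lim a0] unfolding eventually_at_right_field by blast
 define e where "e n = min \<epsilon>0 \<epsilon>1 / (real n + 2)" for n :: nat
 have e0: "0 < e n" "e n < \<epsilon>0" "e n < \<epsilon>1" for n
 proof -
  have m: "0 < min \<epsilon>0 \<epsilon>1" using \<epsilon>0 \<epsilon>1 by simp
  thus "0 < e n" by (simp add: e_def)
  have "min \<epsilon>0 \<epsilon>1 * 1 < min \<epsilon>0 \<epsilon>1 * (real n + 2)" by (rule mult_strict_left_mono[OF _ m]) simp
  hence "e n < min \<epsilon>0 \<epsilon>1" unfolding e_def by (subst pos_divide_less_eq) auto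
  thus "e n < \<epsilon>0" "e n < \<epsilon>1" by auto
 qed
 have e_in: "e n \<in> {0<..<\<epsilon>0}" for n using e0 by simp
 have e_lim: "e ----> 0" unfolding e_def by real_asymp
 have tr: "trunc \<sigma>c f (e n) (s (e n)) (\<psi> (e n))" for n
  by (intro trunc.intro D.degr_axioms trunc_axioms.intro) (use e0 e_in s01 tp in auto)
 have "\<exists>c d w. trunc_crit \<sigma>c f (e n) (s (e n)) (\<psi> (e n)) L (a\<epsilon> (e n)) (u (e n)) (v (e n)) c d w &
  F (e n) = ennreal (2 * c * a\<epsilon> (e n) - d * L + 4 * integral {v (e n) (L / 2)..1}
   (%t. sqrt (e n * classical.H (trunc.fe f (e n) (s (e n)) (\<psi> (e n))) (e n) c d t)))" for n
 proof -
  have "F (e n) < \<infinity>" using F_le[OF e_in] by (rule le_less_trans) simp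
  hence fin': "F_eps L (f_trunc f (e n) (s (e n)) (\<psi> (e n))) (e n) (u (e n)) (v (e n)) < \<infinity>"
   by (simp add: F_def fe_def)
  have cp': "critical_point L (f_trunc f (e n) (s (e n)) (\<psi> (e n))) (e n) (a\<epsilon> (e n)) (u (e n)) (v (e n))"
   using cp e_in[of n] by (simp add: fe_def)
  show ?thesis
   by (rule critical_point_data[OF tr L \<epsilon>1(2)[OF e0(1,3)] cp' fin']) (auto simp: F_def fe_def)
 qed
 then obtain c d w where crit: "!!n. trunc_crit \<sigma>c f (e n) (s (e n)) (\<psi> (e n)) L (a\<epsilon> (e n)) (u (e n)) (v (e n)) (c n) (d n) (w n)"
  and F_eq: "!!n. F (e n) = ennreal (2 * c n * a\<epsilon> (e n) - d n * L + 4 * integral {v (e n) (L / 2)..1}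
   (%t. sqrt (e n * classical.H (trunc.fe f (e n) (s (e n)) (\<psi> (e n))) (e n) (c n) (d n) t)))"
  by metis
 interpret tc: trunc_crit \<sigma>c f "e n" "s (e n)" "\<psi> (e n)" L "a\<epsilon> (e n)" "u (e n)" "v (e n)" "c n" "d n" "w n" for n
  by (rule crit)
 have bound: "2 * c n * a\<epsilon> (e n) - d n * L + 4 * integral {v (e n) (L / 2)..1}
   (%t. sqrt (e n * classical.H (trunc.fe f (e n) (s (e n)) (\<psi> (e n))) (e n) (c n) (d n) t)) <= M" for n
  using F_le[OF e_in, of n] M0 unfolding F_eq by (simp add: ennreal_le_iff)
 have e_right: "filterlim e (at_right 0) sequentially"
  unfolding filterlim_at using e_lim e0 by (auto intro!: always_eventually simp: less_imp_neq[symmetric])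
 have an_lim: "(%n. a\<epsilon> (e n)) ----> a" by (rule filterlim_compose[OF a_lim e_right])
 obtain A where A: "!!n. \<bar>a\<epsilon> (e n)\<bar> <= A"
  using convergent_imp_Bseq[of "%n. a\<epsilon> (e n)"] an_lim by (auto simp: convergent_def Bseq_def)
 have c_bd: "c n \<in> {0..A / L}" for n
 proof -
  have "c n * L <= a\<epsilon> (e n)" using tc.u_increment_ge[of 0 L n] tc.boundary L by simp
  hence "c n * L <= A" using A[of n] by simp
  thus ?thesis using tc.c[of n] L by (simp add: pos_le_divide_eq)
 qed
 have d_bd: "d n \<in> {0..M / L}" for n
 proof -
  have "d n * L <= M" by (rule order_trans[OF tc.d_le]) (use integral_unique[OF tc.E_integral[of n]] bound[of n] in simp)
  thus ?thesis using tc.d_pos[of n] L by (simp add: pos_le_divide_eq)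
 qed
 have m_bd: "v (e n) (L / 2) \<in> {0..1}" for n using tc.m_bounds[of n] by simp
 obtain r c0 d0 m0 where r: "strict_mono r" and lims: "(%n. c (r n)) ----> c0" "(%n. d (r n)) ----> d0"
  "(%n. v (e (r n)) (L / 2)) ----> m0"
  by (rule convergent_subsequence_triple[of c 0 "A / L" d 0 "M / L" "%n. v (e n) (L / 2)" 0 1, OF c_bd d_bd m_bd])
 define \<epsilon>k where "\<epsilon>k n = e (r n)" for n
 have sub: "(%n. X (r n)) ----> l" if "X ----> l" for X and l :: real
  using LIMSEQ_subseq_LIMSEQ[OF that r] by (simp add: o_def)
 interpret Q: crit_seq \<sigma>c f \<epsilon>k "%n. s (\<epsilon>k n)" "%n. \<psi> (\<epsilon>k n)" L "%n. a\<epsilon> (\<epsilon>k n)" "%n. u (\<epsilon>k n)" "%n. v (\<epsilon>k n)"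
  "%n. c (r n)" "%n. d (r n)" "%n. w (r n)" a c0 d0 m0 M
 proof (rule crit_seq.intro[OF D.degr_axioms], rule crit_seq_axioms.intro, goal_cases)
  case 1 show ?case unfolding \<epsilon>k_def by (rule crit)
 next
  case 2 show ?case unfolding \<epsilon>k_def by (rule sub[OF e_lim])
 next
  case 3 show ?case unfolding \<epsilon>k_def by (rule sub[OF filterlim_compose[OF s_lim e_right]])
 next
  case 4 show ?case unfolding \<epsilon>k_def by (rule sub[OF filterlim_compose[OF fs_lim e_right]])
 next
  case 5 show ?case unfolding \<epsilon>k_def by (rule sub[OF an_lim])
 next
  case 6 show ?case by (rule a0)
 next
  case 10 show ?case unfolding \<epsilon>k_def by (rule bound)
 qed (use lims in \<open>simp_all add: \<epsilon>k_def\<close>)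
 define u0 where "u0 = affine_jump L c0 Q.j"
 interpret J: one_jump L c0 Q.j by unfold_locales (rule L Q.c0_nonneg Q.j_nonneg)+
 have a_eq: "a = c0 * L + Q.j" by (simp add: Q.j_def)
 have jump: "jump L a u0 (L / 2) = Q.j" unfolding u0_def by (rule J.jump_u0)
 have F_k: "F_eps L (f\<epsilon> (\<epsilon>k n)) (\<epsilon>k n) (u (\<epsilon>k n)) (v (\<epsilon>k n)) = ennreal (Q.energy n)" for n
  unfolding Q.energy_def F_eq[of "r n", unfolded F_def, folded \<epsilon>k_def] ..
 have F_limit: "(%n. F_eps L (f\<epsilon> (\<epsilon>k n)) (\<epsilon>k n) (u (\<epsilon>k n)) (v (\<epsilon>k n))) ----> ennreal (2 * c0 * a - c0\<^sup>2 * L + Q.surface)"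
  unfolding F_k by (rule tendsto_ennrealI[OF Q.energy_limit])
 have F_l: "F_lim L \<sigma>c f a u0 (%_. 1) = ennreal (L * phi_bulk \<sigma>c c0) + (if Q.j = 0 then 0 else ennreal (g_coh f Q.j))"
  unfolding u0_def using J.F_lim_u0[OF \<sigma>, of f] a_eq by simp
 have phi: "phi_bulk \<sigma>c c0 = c0\<^sup>2" if "c0 <= \<sigma>c / 2" using that Q.c0_nonneg by (simp add: phi_bulk_def)
 have inner: "c0 = 1 / 2 * f m0 * (1 - m0)" "0 < 2 * c0" "2 * c0 < \<sigma>c" "Q.j = D.S (2 * c0)" if m: "0 < m0" "m0 < 1"
  using Q.flux_limit[OF m(2)] Q.inner_jump[OF m] D.k_pos[of m0] D.k_less_\<sigma>[of m0] m by (auto simp: D.k_def mult.commute)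
 have c0_one: "c0 = a / L" "Q.j = 0" if "m0 = 1" using Q.no_jump[OF that] a_eq L by auto
 have convergence: "ennreal (2 * c0 * a - c0\<^sup>2 * L + Q.surface) = F_lim L \<sigma>c f a u0 (%_. 1)"
  if hyp: "m0 < 1 \<or> (m0 = 1 & a / L <= \<sigma>c / 2)"
 proof -
  consider "m0 = 0" | "0 < m0" "m0 < 1" | "m0 = 1" "a / L <= \<sigma>c / 2" using Q.m_bounds hyp by fastforce
  thus ?thesis
  proof cases
   case 1
   note ff = Q.full_fracture[OF 1]
   have "Q.surface = 1" using 1 unfolding Q.surface_def by simp
   thus ?thesis using ff(1,2,4) phi \<sigma> a0 unfolding F_l by simp
  next
   case 2
   note i = inner[OF 2]
   have j: "0 < Q.j" using D.S_pos[OF i(2,3)] i(4) by simp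
   have g: "g_coh f Q.j = 2 * c0 * Q.j + D.KK (2 * c0)" using D.g_eq[OF i(2,3)] i(4) by simp
   have "Q.surface = D.KK (2 * c0)" using 2 Q.flux_limit unfolding Q.surface_def by simp
   moreover have "2 * c0 * a - c0\<^sup>2 * L = L * c0\<^sup>2 + 2 * c0 * Q.j"
    by (subst a_eq) (simp add: algebra_simps power2_eq_square)
   ultimately have e: "2 * c0 * a - c0\<^sup>2 * L + Q.surface = L * c0\<^sup>2 + g_coh f Q.j" using g by linarith
   have "0 <= g_coh f Q.j" by (simp add: g_coh_def)
   hence "ennreal (L * c0\<^sup>2 + g_coh f Q.j) = ennreal (L * c0\<^sup>2) + ennreal (g_coh f Q.j)"
    by (intro ennreal_plus) (use L in auto)
   thus ?thesis unfolding F_l e using j phi i(3) by simp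
  next
   case 3
   have "Q.surface = 0" using 3 unfolding Q.surface_def by simp
   moreover have "2 * c0 * a - c0\<^sup>2 * L = L * c0\<^sup>2"
    using a_eq c0_one(2)[OF 3(1)] by (simp add: algebra_simps power2_eq_square)
   ultimately show ?thesis unfolding F_l using c0_one[OF 3(1)] 3 phi by simp
  qed
 qed
 have no_convergence: "\<not> (%k. F_eps L (f\<epsilon> (\<epsilon>k k)) (\<epsilon>k k) (u (\<epsilon>k k)) (v (\<epsilon>k k))) ----> F_lim L \<sigma>c f a u0 (%_. 1)"
  if m: "m0 = 1" and big: "a / L > \<sigma>c / 2"
 proof
  assume "(%k. F_eps L (f\<epsilon> (\<epsilon>k k)) (\<epsilon>k k) (u (\<epsilon>k k)) (v (\<epsilon>k k))) ----> F_lim L \<sigma>c f a u0 (%_. 1)"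
  from LIMSEQ_unique[OF F_limit this]
  have eq: "ennreal (2 * c0 * a - c0\<^sup>2 * L + Q.surface) = ennreal (L * phi_bulk \<sigma>c c0)"
   unfolding F_l using c0_one(2)[OF m] by simp
  have "Q.surface = 0" using m unfolding Q.surface_def by simp
  moreover have "2 * c0 * a - c0\<^sup>2 * L = L * c0\<^sup>2"
   using a_eq c0_one(2)[OF m] by (simp add: algebra_simps power2_eq_square)
  moreover have c: "\<sigma>c / 2 < c0" using c0_one(1)[OF m] big by simp
  hence ph: "phi_bulk \<sigma>c c0 = \<sigma>c * c0 - \<sigma>c\<^sup>2 / 4" using \<sigma> by (simp add: phi_bulk_def)
  moreover have "0 <= \<sigma>c * c0 - \<sigma>c\<^sup>2 / 4"
  proof -
   have "\<sigma>c * (\<sigma>c / 2) <= \<sigma>c * c0" using c \<sigma> by (intro mult_left_mono) auto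
   moreover have "0 <= \<sigma>c\<^sup>2" "\<sigma>c * (\<sigma>c / 2) = \<sigma>c\<^sup>2 / 2" by (simp_all add: power2_eq_square)
   ultimately show ?thesis by linarith
  qed
  moreover have "2 * c0 * a - c0\<^sup>2 * L + Q.surface = L * c0\<^sup>2" using calculation(1,2) by linarith
  ultimately have "ennreal (L * c0\<^sup>2) = ennreal (L * (\<sigma>c * c0 - \<sigma>c\<^sup>2 / 4))" "0 <= \<sigma>c * c0 - \<sigma>c\<^sup>2 / 4"
   using eq by metis+
  hence "L * c0\<^sup>2 = L * (\<sigma>c * c0 - \<sigma>c\<^sup>2 / 4)" using L by (subst (asm) ennreal_inj) auto
  hence "(c0 - \<sigma>c / 2)\<^sup>2 = 0" using L by (simp add: power2_diff power_divide)
  thus False using c by simp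
 qed
 have INF: "(INF x\<in>{0..L}. v (\<epsilon>k n) x) = v (\<epsilon>k n) (L / 2)" for n unfolding \<epsilon>k_def by (rule tc.INF_v)
 show ?thesis
 proof (intro exI[of _ \<epsilon>k] exI[of _ u0] exI[of _ m0] conjI impI allI)
  show "\<epsilon>k n \<in> {0<..<\<epsilon>0}" for n unfolding \<epsilon>k_def by (rule e_in)
  show "\<epsilon>k ----> 0" by (rule Q.\<epsilon>_lim)
  show "L1_tendsto L (%k. u (\<epsilon>k k)) u0" unfolding u0_def by (rule Q.u_L1)
  show "L1_tendsto L (%k. v (\<epsilon>k k)) (%_. 1)" by (rule Q.v_L1)
  show "SBV L u0" unfolding u0_def by (rule J.SBV_u0)
  show "D_var L u0 {0<..<L} = a" unfolding u0_def J.D_var_u0 using a_eq by simp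
  show "(%k. INF x\<in>{0..L}. v (\<epsilon>k k) x) ----> m0" unfolding INF by (rule Q.m_lim)
  show "\<forall>x\<in>{0<..<L}. u0 x = a / L * x" if "m0 = 1" using c0_one[OF that] by (simp add: u0_def affine_jump_def)
  show "let c0 = 1 / 2 * f m0 * (1 - m0) in
     (\<forall>x\<in>{0<..<L}. u0 x = c0 * x + (a - c0 * L) * indicator {L / 2<..<L} x) &
     c0 \<in> {0<..<\<sigma>c / 2} &
     a - c0 * L = jump L a u0 (L / 2) &
     0 < jump L a u0 (L / 2) & ereal (jump L a u0 (L / 2)) < s_frac f &
     (g_coh f has_real_derivative 2 * c0) (at (jump L a u0 (L / 2)))" if "m0 \<in> {0<..<1}"
  proof -
   have m: "0 < m0" "m0 < 1" using that by auto
   note i = inner[OF m]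
   show ?thesis
    unfolding Let_def i(1)[symmetric] jump
   proof (intro conjI ballI)
    show "u0 x = c0 * x + (a - c0 * L) * indicator {L / 2<..<L} x" for x
     by (simp only: u0_def affine_jump_def Q.j_def)
    show "c0 \<in> {0<..<\<sigma>c / 2}" using i(2,3) by simp
    show "a - c0 * L = Q.j" by (simp only: Q.j_def)
    show "0 < Q.j" "ereal Q.j < s_frac f" "(g_coh f has_real_derivative 2 * c0) (at Q.j)"
     unfolding i(4) by (rule D.S_pos[OF i(2,3)] D.S_less_s_frac[OF i(2,3)] D.g_derivative[OF i(2,3)])+
   qed
  qed
  show "\<bar>s_frac f\<bar> ~= \<infinity>" "\<forall>x\<in>{0<..<L}. u0 x = a * indicator {L / 2<..<L} x"
   "a = jump L a u0 (L / 2)" "ereal (jump L a u0 (L / 2)) = s_frac f" if "m0 = 0"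
   unfolding jump using Q.full_fracture[OF that] by (simp_all add: u0_def affine_jump_def)
  show "(%k. F_eps L (f\<epsilon> (\<epsilon>k k)) (\<epsilon>k k) (u (\<epsilon>k k)) (v (\<epsilon>k k))) ----> F_lim L \<sigma>c f a u0 (%_. 1)"
   if "m0 < 1 \<or> (m0 = 1 & a / L <= \<sigma>c / 2)"
   using F_limit unfolding convergence[OF that] .
  show "\<not> (%k. F_eps L (f\<epsilon> (\<epsilon>k k)) (\<epsilon>k k) (u (\<epsilon>k k)) (v (\<epsilon>k k))) ----> F_lim L \<sigma>c f a u0 (%_. 1)"
   if "m0 = 1 & a / L > \<sigma>c / 2"
   using no_convergence that by blast
 qed
qed

end
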